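(* Let $G$ be a one-parameter metabelian nilpotent Lie group of dimension $n$, let $\Gamma$ be a discrete uniform subgroup of $G$, and let $M,\ (X_1,\dots,X_n),\ p,\ \mathcal V,\ \mathcal W,\ \Sigma,\ \tau,\ \rho,\ \mathscr H_\rho$ be as defined in the context. The operator $\mathbf U$ defined for all $\xi\in\mathcal C(G/\Gamma)$ and $g\in G$ by $$\mathbf U(\xi)(l)(g)=\begin{cases}\displaystyle\int_{M/M\cap\Gamma}\xi(gm)\,\chi_l(m)\,d\dot m & \text{if } l\in\Sigma,\\[2mm] \displaystyle\int_{G/\Gamma}\xi(gm)\,\chi_l(m)\,d\dot m & \text{if } l\in\mathcal V,\end{cases}$$ is an isometric linear operator (with respect to the norm of $\mathbf L^2(G/\Gamma)$) having values in the Hilbert space $\mathscr H_\rho$ of $\rho$, and it can be extended to $\mathbf L^2(G/\Gamma)$ to an intertwining operator of $\tau$ and $\rho$.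
   Context: A one-parameter metabelian nilpotent Lie group is a connected, simply connected nilpotent Lie group $G$ whose Lie algebra $\mathfrak g$ is nonabelian and has an abelian ideal of codimension one. A discrete subgroup $\Gamma\subset G$ is uniform if $G/\Gamma$ is compact. $\mathfrak g$ is given the rational structure $\mathfrak g_{\mathbb Q}=\mathbb Q\text{-span}\{\log\Gamma\}$; a subspace $\mathfrak h\subset\mathfrak g$ is rational if $\mathfrak h=\mathbb R\text{-span}(\mathfrak h\cap\mathfrak g_{\mathbb Q})$. Fix $M=\exp(\mathfrak m)$, where $\mathfrak m$ is a rational abelian ideal of $\mathfrak g$ of codimension one, and a basis $(X_1,\dots,X_n)$ of $\mathfrak g$ such that: $\mathbb R\text{-span}\{X_1,\dots,X_i\}$ is an ideal for every $i$ (strong Malcev basis); $\Gamma=\exp(\mathbb ZX_1)\cdots\exp(\mathbb ZX_n)$ (strongly based on $\Gamma$); $[\mathfrak g,\mathfrak g]=\mathbb R\text{-span}\{X_1,\dots,X_p\}$ and $\mathfrak m=\mathbb R\text{-span}\{X_1,\dots,X_{n-1}\}$. Let $(X_1^*,\dots,X_n^* )$ be the dual basis of $\mathfrak g^*$, and view $\mathfrak m^*\subset\mathfrak g^*$ as the span of $X_1^*,\dots,X_{n-1}^*$. Put $\mathcal V=\mathbb ZX_{p+1}^*+\cdots+\mathbb ZX_n^*$ and $\mathcal W=\{l\in\mathbb ZX_1^*+\cdots+\mathbb ZX_{n-1}^*:\ l|_{[\mathfrak g,\mathfrak g]}\neq0\}$. For $l\in\mathfrak m^*$, $g\in G$ let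 $\mathrm{Ad}_0^*g\,l=(\mathrm{Ad}^*g\,l)|_{\mathfrak m}$, where $\mathrm{Ad}^*$ is the coadjoint action. The set $\mathcal W$ is invariant under $\mathrm{Ad}^*_0\Gamma$; $\Sigma$ denotes a crosssection (set of representatives) for the $\Gamma$-orbits in $\mathcal W$ under this action. Characters: $\chi_l(\exp X)=e^{2i\pi\langle l,X\rangle}$, for $X\in\mathfrak m$ if $l\in\Sigma$ (a character of $M$), and for $X\in\mathfrak g$ if $l\in\mathcal V$ (a character of $G$). $\tau=\mathrm{Ind}_\Gamma^G1$ is the quasi-regular representation on $\mathbf L^2(G/\Gamma)$ (for the $G$-invariant probability measure): $(\tau(a)f)(g)=f(a^{-1}g)$. $\mathcal C(G/\Gamma)$ is the space of complex continuous functions $\xi$ on $G$ with $\xi(g\gamma)=\xi(g)$ for $g\in G,\gamma\in\Gamma$. For a closed subgroup $H$ and a unitary character $\chi$ of $H$, $\mathrm{Ind}_H^G\chi$ acts by left translations $(F\mapsto F(g^{-1}\,\cdot))$ on the completion of the space of continuous $F:G\to\mathbb C$ with compact support modulo $H$ and $F(gh)=\chi(h)^{-1}F(g)$, for the norm $\left(\int_{G/H}|F|^2\right)^{1/2}$. Put $\rho=\bigoplus_{l\in\Sigma}\mathrm{Ind}_M^G\chi_l\oplus\bigoplus_{l\in\mathcal V}\chi_l$ (Hilbert direct sum), acting on $\mathscr H_\rho$; an element of $\mathscr H_\rho$ is a family $K=(K(l))_{l\in\Sigma\cup\mathcal V}$, where for $l\in\mathcal V$ the one-dimensional space of $\chi_l$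 is realized as the functions $F$ on $G$ with $F(gx)=\chi_l(x)^{-1}F(g)$ for all $g,x\in G$, with norm $|F(e)|$ ($G$ acting by left translations). The measures on $M/M\cap\Gamma$ and $G/\Gamma$ are the invariant probability measures, and the measure on $G/M$ is the invariant measure $\int_{G/M}\varphi=\int_{\mathbb R}\varphi(\exp(tX_n)M)\,dt$. *)

theory Defs
  imports "HOL-Analysis.Analysis" "HOL-Algebra.Left_Coset"
begin

primrec Ck_on :: "nat \<Rightarrow> 'a::euclidean_space set \<Rightarrow> ('a \<Rightarrow> 'b::euclidean_space) \<Rightarrow> bool" where
  "Ck_on 0 S f \<longleftrightarrow> continuous_on S f"
| "Ck_on (Suc k) S f \<longleftrightarrow>
     f differentiable_on S \<and> (\<forall>v. Ck_on k S (\<lambda>x. frechet_derivative f (at x) v))"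

definition smooth_on :: "'a::euclidean_space set \<Rightarrow> ('a \<Rightarrow> 'b::euclidean_space) \<Rightarrow> bool" where
  "smooth_on S f \<longleftrightarrow> open S \<and> (\<forall>k. Ck_on k S f)"

text \<open>A chart is a domain together with a coordinate map; values of the map outside the
  domain are irrelevant. The model space is an arbitrary Euclidean space, so the dimension
  of the manifold is its \<open>DIM\<close>.\<close>

type_synonym ('g, 'a) chart = "'g set \<times> ('g \<Rightarrow> 'a)"

abbreviation chart_inv :: "('g, 'a) chart \<Rightarrow> 'a \<Rightarrow> 'g" where
  "chart_inv \<kappa> \<equiv> inv_into (fst \<kappa>) (snd \<kappa>)"

abbreviation chart_range :: "('g, 'a) chart \<Rightarrow> 'a set" where
  "chart_range \<kappa> \<equiv> snd \<kappa> ` fst \<kappa>"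

definition smooth_atlas :: "('g::topological_space, 'a::euclidean_space) chart set \<Rightarrow> bool" where
  "smooth_atlas \<A> \<longleftrightarrow>
     (\<Union>\<kappa>\<in>\<A>. fst \<kappa>) = UNIV \<and>
     (\<forall>\<kappa>\<in>\<A>. open (fst \<kappa>) \<and> open (chart_range \<kappa>) \<and>
        homeomorphism (fst \<kappa>) (chart_range \<kappa>) (snd \<kappa>) (chart_inv \<kappa>)) \<and>
     (\<forall>\<kappa>\<in>\<A>. \<forall>\<kappa>'\<in>\<A>.
        smooth_on (snd \<kappa> ` (fst \<kappa> \<inter> fst \<kappa>')) (\<lambda>x. snd \<kappa>' (chart_inv \<kappa> x)))"

text \<open>The underlying set of the Lie group is the whole (arbitrary) type. As \<open>smooth_on\<close> includes
  openness of the set, the last two clauses also express continuity of the group operations.\<close>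

definition lie_group ::
  "'g::{t2_space,second_countable_topology} monoid \<Rightarrow> ('g, 'a::euclidean_space) chart set \<Rightarrow> bool" where
  "lie_group G \<A> \<longleftrightarrow>
     group G \<and> carrier G = UNIV \<and> smooth_atlas \<A> \<and>
     (\<forall>\<kappa>1\<in>\<A>. \<forall>\<kappa>2\<in>\<A>. \<forall>\<kappa>3\<in>\<A>.
        smooth_on {(x, y). x \<in> chart_range \<kappa>1 \<and> y \<in> chart_range \<kappa>2 \<and>
                     chart_inv \<kappa>1 x \<otimes>\<^bsub>G\<^esub> chart_inv \<kappa>2 y \<in> fst \<kappa>3}
          (\<lambda>(x, y). snd \<kappa>3 (chart_inv \<kappa>1 x \<otimes>\<^bsub>G\<^esub> chart_inv \<kappa>2 y))) \<and>
     (\<forall>\<kappa>1\<in>\<A>. \<forall>\<kappa>2\<in>\<A>.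
        smooth_on {x \<in> chart_range \<kappa>1. inv\<^bsub>G\<^esub> (chart_inv \<kappa>1 x) \<in> fst \<kappa>2}
          (\<lambda>x. snd \<kappa>2 (inv\<^bsub>G\<^esub> (chart_inv \<kappa>1 x))))"

text \<open>The Lie algebra is the tangent space at the identity, identified with the model space
  by the differential of a chart \<open>\<kappa>\<close> around the identity. In it, \<open>Ad g\<close> is the differential at the
  identity of conjugation by \<open>g\<close>, and the bracket is \<open>[X, Y] = (d Ad)(X) Y\<close>, where \<open>d Ad\<close> is the
  differential of \<open>Ad\<close> at the identity.\<close>

definition identity_chart ::
  "'g monoid \<Rightarrow> ('g, 'a) chart set \<Rightarrow> ('g, 'a) chart \<Rightarrow> bool" where
  "identity_chart G \<A> \<kappa> \<longleftrightarrow> \<kappa> \<in> \<A> \<and> \<one>\<^bsub>G\<^esub> \<in> fst \<kappa>"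

definition Ad :: "'g monoid \<Rightarrow> ('g, 'a::euclidean_space) chart \<Rightarrow> 'g \<Rightarrow> 'a \<Rightarrow> 'a" where
  "Ad G \<kappa> g X = frechet_derivative
     (\<lambda>x. snd \<kappa> (g \<otimes>\<^bsub>G\<^esub> chart_inv \<kappa> x \<otimes>\<^bsub>G\<^esub> inv\<^bsub>G\<^esub> g)) (at (snd \<kappa> \<one>\<^bsub>G\<^esub>)) X"

definition lie_bracket :: "'g monoid \<Rightarrow> ('g, 'a::euclidean_space) chart \<Rightarrow> 'a \<Rightarrow> 'a \<Rightarrow> 'a" where
  "lie_bracket G \<kappa> X Y = frechet_derivative
     (\<lambda>x. Ad G \<kappa> (chart_inv \<kappa> x) Y) (at (snd \<kappa> \<one>\<^bsub>G\<^esub>)) X"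

text \<open>The exponential map: for every \<open>X\<close>, the curve \<open>t \<mapsto> exp (t X)\<close> is the one-parameter subgroup
  with initial velocity \<open>X\<close>. This determines \<open>exp\<close> uniquely. Continuity is required because
  \<open>snd \<kappa>\<close> is unspecified outside the chart domain.\<close>

definition exponential_map ::
  "'g::topological_space monoid \<Rightarrow> ('g, 'a::euclidean_space) chart \<Rightarrow> ('a \<Rightarrow> 'g) \<Rightarrow> bool" where
  "exponential_map G \<kappa> expo \<longleftrightarrow>
     (\<forall>X. (\<forall>s t. expo ((s + t) *\<^sub>R X) = expo (s *\<^sub>R X) \<otimes>\<^bsub>G\<^esub> expo (t *\<^sub>R X)) \<and>
          continuous_on UNIV (\<lambda>t::real. expo (t *\<^sub>R X)) \<and>
          ((\<lambda>t. snd \<kappa> (expo (t *\<^sub>R X))) has_vector_derivative X) (at 0))"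

abbreviation log_map :: "('a \<Rightarrow> 'g) \<Rightarrow> 'g \<Rightarrow> 'a" where
  "log_map expo \<equiv> inv_into UNIV expo"

definition lie_ideal :: "('a::real_vector \<Rightarrow> 'a \<Rightarrow> 'a) \<Rightarrow> 'a set \<Rightarrow> bool" where
  "lie_ideal br \<hh> \<longleftrightarrow> subspace \<hh> \<and> (\<forall>X. \<forall>Y\<in>\<hh>. br X Y \<in> \<hh>)"

definition abelian_subalgebra :: "('a::real_vector \<Rightarrow> 'a \<Rightarrow> 'a) \<Rightarrow> 'a set \<Rightarrow> bool" where
  "abelian_subalgebra br \<hh> \<longleftrightarrow> subspace \<hh> \<and> (\<forall>X\<in>\<hh>. \<forall>Y\<in>\<hh>. br X Y = 0)"

definition codim_one_abelian_ideal :: "('a::euclidean_space \<Rightarrow> 'a \<Rightarrow> 'a) \<Rightarrow> 'a set \<Rightarrow> bool" where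
  "codim_one_abelian_ideal br \<hh> \<longleftrightarrow>
     lie_ideal br \<hh> \<and> abelian_subalgebra br \<hh> \<and> dim \<hh> + 1 = DIM('a)"

definition derived_algebra :: "('a::real_vector \<Rightarrow> 'a \<Rightarrow> 'a) \<Rightarrow> 'a set" where
  "derived_algebra br = span {br X Y | X Y. True}"

primrec lower_central :: "('a::real_vector \<Rightarrow> 'a \<Rightarrow> 'a) \<Rightarrow> nat \<Rightarrow> 'a set" where
  "lower_central br 0 = UNIV"
| "lower_central br (Suc k) = span {br X Y | X Y. Y \<in> lower_central br k}"

definition nilpotent_algebra :: "('a::real_vector \<Rightarrow> 'a \<Rightarrow> 'a) \<Rightarrow> bool" where
  "nilpotent_algebra br \<longleftrightarrow> (\<exists>k. lower_central br k = {0})"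

definition one_parameter_metabelian_nilpotent ::
  "'g::{t2_space,second_countable_topology} monoid \<Rightarrow> ('g, 'a::euclidean_space) chart set
     \<Rightarrow> ('g, 'a) chart \<Rightarrow> bool" where
  "one_parameter_metabelian_nilpotent G \<A> \<kappa> \<longleftrightarrow>
     lie_group G \<A> \<and> identity_chart G \<A> \<kappa> \<and>
     connected (UNIV :: 'g set) \<and> simply_connected (UNIV :: 'g set) \<and>
     nilpotent_algebra (lie_bracket G \<kappa>) \<and>
     (\<exists>X Y. lie_bracket G \<kappa> X Y \<noteq> 0) \<and>
     (\<exists>\<hh>. codim_one_abelian_ideal (lie_bracket G \<kappa>) \<hh>)"

definition rational_span :: "'a::real_vector set \<Rightarrow> 'a set" where
  "rational_span S = module.span (\<lambda>(q::rat) v. real_of_rat q *\<^sub>R v) S"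

definition rational_subspace :: "('a::real_vector \<Rightarrow> 'g) \<Rightarrow> 'g set \<Rightarrow> 'a set \<Rightarrow> bool" where
  "rational_subspace expo \<Gamma> \<hh> \<longleftrightarrow>
     \<hh> = span (\<hh> \<inter> rational_span (log_map expo ` \<Gamma>))"

text \<open>Bases are families \<open>X 1, \<dots>, X n\<close> with \<open>n = DIM('a)\<close>; other values of \<open>X\<close> are irrelevant.\<close>

definition strong_malcev_basis ::
  "('a::euclidean_space \<Rightarrow> 'a \<Rightarrow> 'a) \<Rightarrow> (nat \<Rightarrow> 'a) \<Rightarrow> bool" where
  "strong_malcev_basis br X \<longleftrightarrow>
     inj_on X {1..DIM('a)} \<and> independent (X ` {1..DIM('a)}) \<and> span (X ` {1..DIM('a)}) = UNIV \<and>
     (\<forall>i\<in>{1..DIM('a)}. lie_ideal br (span (X ` {1..i})))"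

definition strongly_based_on ::
  "'g monoid \<Rightarrow> ('a::euclidean_space \<Rightarrow> 'g) \<Rightarrow> (nat \<Rightarrow> 'a) \<Rightarrow> 'g set \<Rightarrow> bool" where
  "strongly_based_on G expo X \<Gamma> \<longleftrightarrow>
     \<Gamma> = {foldr (\<lambda>i g. expo (of_int (k i) *\<^sub>R X i) \<otimes>\<^bsub>G\<^esub> g) [1..<Suc DIM('a)] \<one>\<^bsub>G\<^esub>
            | k :: nat \<Rightarrow> int. True}"

definition dual_vec :: "(nat \<Rightarrow> 'a::euclidean_space) \<Rightarrow> nat \<Rightarrow> 'a \<Rightarrow> real" where
  "dual_vec X i v = representation (X ` {1..DIM('a)}) v (X i)"

definition V_lattice :: "(nat \<Rightarrow> 'a::euclidean_space) \<Rightarrow> nat \<Rightarrow> ('a \<Rightarrow> real) set" where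
  "V_lattice X p =
     {(\<lambda>v. \<Sum>i = Suc p..DIM('a). of_int (c i) * dual_vec X i v) | c :: nat \<Rightarrow> int. True}"

definition W_lattice ::
  "('a::euclidean_space \<Rightarrow> 'a \<Rightarrow> 'a) \<Rightarrow> (nat \<Rightarrow> 'a) \<Rightarrow> ('a \<Rightarrow> real) set" where
  "W_lattice br X =
     {l. (\<exists>c :: nat \<Rightarrow> int. l = (\<lambda>v. \<Sum>i = 1..<DIM('a). of_int (c i) * dual_vec X i v)) \<and>
         (\<exists>v\<in>derived_algebra br. l v \<noteq> 0)}"

definition coAd ::
  "'g monoid \<Rightarrow> ('g, 'a::euclidean_space) chart \<Rightarrow> 'g \<Rightarrow> ('a \<Rightarrow> real) \<Rightarrow> 'a \<Rightarrow> real" where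
  "coAd G \<kappa> g l = (\<lambda>v. l (Ad G \<kappa> (inv\<^bsub>G\<^esub> g) v))"

text \<open>Restriction to the span of \<open>X 1, \<dots>, X (n - 1)\<close>, viewed again as a functional on the whole
  Lie algebra (vanishing on \<open>X n\<close>).\<close>

definition coAd0 ::
  "'g monoid \<Rightarrow> ('g, 'a::euclidean_space) chart \<Rightarrow> (nat \<Rightarrow> 'a) \<Rightarrow> 'g \<Rightarrow> ('a \<Rightarrow> real) \<Rightarrow> 'a \<Rightarrow> real" where
  "coAd0 G \<kappa> X g l = (\<lambda>v. \<Sum>i = 1..<DIM('a). coAd G \<kappa> g l (X i) * dual_vec X i v)"

definition cross_section ::
  "'g set \<Rightarrow> ('g \<Rightarrow> 'l \<Rightarrow> 'l) \<Rightarrow> 'l set \<Rightarrow> 'l set \<Rightarrow> bool" where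
  "cross_section \<Gamma> act W \<Sigma> \<longleftrightarrow>
     \<Sigma> \<subseteq> W \<and> (\<forall>l\<in>W. \<exists>!s. s \<in> \<Sigma> \<and> (\<exists>\<gamma>\<in>\<Gamma>. s = act \<gamma> l))"

definition character :: "('a \<Rightarrow> 'g) \<Rightarrow> ('a \<Rightarrow> real) \<Rightarrow> 'g \<Rightarrow> complex" where
  "character expo l g = exp (2 * \<i> * of_real pi * of_real (l (log_map expo g)))"

text \<open>The space of left cosets \<open>G/H\<close> of a subgroup, with the quotient topology; the group may be a
  subgroup \<open>G\<lparr>carrier := K\<rparr>\<close>, whose topology is the subspace topology.\<close>

definition coset_topology :: "'g::topological_space monoid \<Rightarrow> 'g set \<Rightarrow> 'g set topology" where
  "coset_topology G H = topology (\<lambda>S. S \<subseteq> lcosets\<^bsub>G\<^esub> H \<and>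
     openin (top_of_set (carrier G)) {g \<in> carrier G. g <#\<^bsub>G\<^esub> H \<in> S})"

lemma openin_coset_topology:
  "openin (coset_topology G H) S \<longleftrightarrow> S \<subseteq> lcosets\<^bsub>G\<^esub> H \<and>
     openin (top_of_set (carrier G)) {g \<in> carrier G. g <#\<^bsub>G\<^esub> H \<in> S}"
proof -
  have "istopology (\<lambda>S. S \<subseteq> lcosets\<^bsub>G\<^esub> H \<and>
     openin (top_of_set (carrier G)) {g \<in> carrier G. g <#\<^bsub>G\<^esub> H \<in> S})"
    unfolding istopology_def
  proof (intro conjI allI impI)
    fix S T
    assume "S \<subseteq> lcosets\<^bsub>G\<^esub> H \<and> openin (top_of_set (carrier G)) {g \<in> carrier G. g <#\<^bsub>G\<^esub> H \<in> S}"
      and "T \<subseteq> lcosets\<^bsub>G\<^esub> H \<and> openin (top_of_set (carrier G)) {g \<in> carrier G. g <#\<^bsub>G\<^esub> H \<in> T}"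
    moreover have "{g \<in> carrier G. g <#\<^bsub>G\<^esub> H \<in> S \<inter> T} =
        {g \<in> carrier G. g <#\<^bsub>G\<^esub> H \<in> S} \<inter> {g \<in> carrier G. g <#\<^bsub>G\<^esub> H \<in> T}"
      by auto
    ultimately show "openin (top_of_set (carrier G)) {g \<in> carrier G. g <#\<^bsub>G\<^esub> H \<in> S \<inter> T}"
      and "S \<inter> T \<subseteq> lcosets\<^bsub>G\<^esub> H"
      by auto
  next
    fix \<K>
    assume *: "\<forall>S\<in>\<K>. S \<subseteq> lcosets\<^bsub>G\<^esub> H \<and>
      openin (top_of_set (carrier G)) {g \<in> carrier G. g <#\<^bsub>G\<^esub> H \<in> S}"
    then show "\<Union>\<K> \<subseteq> lcosets\<^bsub>G\<^esub> H"
      by auto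
    have "{g \<in> carrier G. g <#\<^bsub>G\<^esub> H \<in> \<Union>\<K>} = (\<Union>S\<in>\<K>. {g \<in> carrier G. g <#\<^bsub>G\<^esub> H \<in> S})"
      by auto
    with * show "openin (top_of_set (carrier G)) {g \<in> carrier G. g <#\<^bsub>G\<^esub> H \<in> \<Union>\<K>}"
      by auto
  qed
  then show ?thesis
    unfolding coset_topology_def by (simp add: topology_inverse')
qed

definition coset_borel :: "'g::topological_space monoid \<Rightarrow> 'g set \<Rightarrow> 'g set measure" where
  "coset_borel G H = sigma (lcosets\<^bsub>G\<^esub> H) {S. openin (coset_topology G H) S}"

definition invariant_probability ::
  "'g::topological_space monoid \<Rightarrow> 'g set \<Rightarrow> 'g set measure \<Rightarrow> bool" where
  "invariant_probability G H \<mu> \<longleftrightarrow>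
     sets \<mu> = sets (coset_borel G H) \<and> emeasure \<mu> (space \<mu>) = 1 \<and>
     (\<forall>a\<in>carrier G. \<forall>S\<in>sets \<mu>. emeasure \<mu> ((\<lambda>c. a <#\<^bsub>G\<^esub> c) ` S) = emeasure \<mu> S)"

definition uniform_subgroup :: "'g::topological_space monoid \<Rightarrow> 'g set \<Rightarrow> bool" where
  "uniform_subgroup G \<Gamma> \<longleftrightarrow>
     subgroup \<Gamma> G \<and> discrete \<Gamma> \<and> compact_space (coset_topology G \<Gamma>)"

text \<open>Functions on \<open>G/H\<close> are written as right \<open>H\<close>-invariant functions \<open>f\<close> on \<open>G\<close>; the following is the
  corresponding function of cosets.\<close>

definition on_cosets :: "('g \<Rightarrow> 'b) \<Rightarrow> 'g set \<Rightarrow> 'b" where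
  "on_cosets f c = f (SOME g. g \<in> c)"

text \<open>The squared norm \<open>\<integral>|f|\<^sup>2\<close> over \<open>G/H\<close>, with value \<open>\<infinity>\<close> allowed; here only \<open>|f|\<close> has to be
  right \<open>H\<close>-invariant.\<close>

definition sq_norm :: "'g set measure \<Rightarrow> ('g \<Rightarrow> complex) \<Rightarrow> ennreal" where
  "sq_norm \<mu> f = (\<integral>\<^sup>+ c. ennreal (on_cosets (\<lambda>g. (cmod (f g))\<^sup>2) c) \<partial>\<mu>)"

definition line_measure ::
  "'g::topological_space monoid \<Rightarrow> ('a::real_vector \<Rightarrow> 'g) \<Rightarrow> 'g set \<Rightarrow> 'a \<Rightarrow> 'g set measure" where
  "line_measure G expo M X =
     distr lborel (coset_borel G M) (\<lambda>t. expo (t *\<^sub>R X) <#\<^bsub>G\<^esub> M)"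

text \<open>Elements of the Hilbert spaces below are given by representatives, i.e. two functions \<open>f, f'\<close> are
  the same element iff the (squared) norm of \<open>f - f'\<close> vanishes.\<close>

definition left_translate :: "'g monoid \<Rightarrow> 'g \<Rightarrow> ('g \<Rightarrow> complex) \<Rightarrow> 'g \<Rightarrow> complex" where
  "left_translate G a f = (\<lambda>g. f (inv\<^bsub>G\<^esub> a \<otimes>\<^bsub>G\<^esub> g))"

definition cont_coset_functions ::
  "'g::topological_space monoid \<Rightarrow> 'g set \<Rightarrow> ('g \<Rightarrow> complex) set" where
  "cont_coset_functions G \<Gamma> =
     {\<xi>. continuous_on UNIV \<xi> \<and> (\<forall>g. \<forall>\<gamma>\<in>\<Gamma>. \<xi> (g \<otimes>\<^bsub>G\<^esub> \<gamma>) = \<xi> g)}"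

definition L2_coset_functions ::
  "'g monoid \<Rightarrow> 'g set \<Rightarrow> 'g set measure \<Rightarrow> ('g \<Rightarrow> complex) set" where
  "L2_coset_functions G \<Gamma> \<mu> =
     {f. (\<forall>g. \<forall>\<gamma>\<in>\<Gamma>. f (g \<otimes>\<^bsub>G\<^esub> \<gamma>) = f g) \<and>
         on_cosets f \<in> borel_measurable \<mu> \<and> sq_norm \<mu> f < \<infinity>}"

definition covariant :: "'g monoid \<Rightarrow> 'g set \<Rightarrow> ('g \<Rightarrow> complex) \<Rightarrow> ('g \<Rightarrow> complex) \<Rightarrow> bool" where
  "covariant G H \<psi> F \<longleftrightarrow> (\<forall>g. \<forall>h\<in>H. F (g \<otimes>\<^bsub>G\<^esub> h) = inverse (\<psi> h) * F g)"

definition ind_core ::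
  "'g::topological_space monoid \<Rightarrow> 'g set \<Rightarrow> ('g \<Rightarrow> complex) \<Rightarrow> ('g \<Rightarrow> complex) set" where
  "ind_core G H \<psi> =
     {F. continuous_on UNIV F \<and> covariant G H \<psi> F \<and>
         (\<exists>C. compact C \<and> {g. F g \<noteq> 0} \<subseteq> C <#>\<^bsub>G\<^esub> H)}"

text \<open>The completion of \<open>ind_core\<close> is realized as its closure among the Borel covariant functions,
  for the norm of square integration over \<open>G/H\<close>.\<close>

definition ind_space ::
  "'g::topological_space monoid \<Rightarrow> 'g set \<Rightarrow> ('g \<Rightarrow> complex) \<Rightarrow> 'g set measure \<Rightarrow> ('g \<Rightarrow> complex) set" where
  "ind_space G H \<psi> \<nu> =
     {F \<in> borel_measurable borel. covariant G H \<psi> F \<and>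
        (\<exists>\<Phi> :: nat \<Rightarrow> 'g \<Rightarrow> complex. (\<forall>k. \<Phi> k \<in> ind_core G H \<psi>) \<and>
           (\<lambda>k. sq_norm \<nu> (\<lambda>g. F g - \<Phi> k g)) \<longlonglongrightarrow> 0)}"

definition char_space :: "'g monoid \<Rightarrow> ('g \<Rightarrow> complex) \<Rightarrow> ('g \<Rightarrow> complex) set" where
  "char_space G \<psi> = {F. covariant G (carrier G) \<psi> F}"

text \<open>Hilbert direct sum over \<open>\<Sigma> \<union> V\<close>; the values of a family outside \<open>\<Sigma> \<union> V\<close> are irrelevant.\<close>

definition rho_sq_norm ::
  "'g monoid \<Rightarrow> 'g set measure \<Rightarrow> 'l set \<Rightarrow> 'l set \<Rightarrow> ('l \<Rightarrow> 'g \<Rightarrow> complex) \<Rightarrow> ennreal" where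
  "rho_sq_norm G \<nu> \<Sigma> V K =
     (\<Sum>\<^sub>\<infinity>l\<in>\<Sigma>. sq_norm \<nu> (K l)) + (\<Sum>\<^sub>\<infinity>l\<in>V. ennreal ((cmod (K l \<one>\<^bsub>G\<^esub>))\<^sup>2))"

definition rho_space ::
  "'g::topological_space monoid \<Rightarrow> ('a \<Rightarrow> 'g) \<Rightarrow> 'g set \<Rightarrow> 'g set measure
     \<Rightarrow> ('a \<Rightarrow> real) set \<Rightarrow> ('a \<Rightarrow> real) set \<Rightarrow> (('a \<Rightarrow> real) \<Rightarrow> 'g \<Rightarrow> complex) set" where
  "rho_space G expo M \<nu> \<Sigma> V =
     {K. (\<forall>l\<in>\<Sigma>. K l \<in> ind_space G M (character expo l) \<nu>) \<and>
         (\<forall>l\<in>V. K l \<in> char_space G (character expo l)) \<and>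
         rho_sq_norm G \<nu> \<Sigma> V K < \<infinity>}"

text \<open>As elements are given by representatives, linearity and the intertwining relation hold up to
  families of norm zero.\<close>

definition intertwining_operator ::
  "'g::topological_space monoid \<Rightarrow> ('a \<Rightarrow> 'g) \<Rightarrow> 'g set \<Rightarrow> 'g set \<Rightarrow> 'g set measure \<Rightarrow> 'g set measure
     \<Rightarrow> ('a \<Rightarrow> real) set \<Rightarrow> ('a \<Rightarrow> real) set
     \<Rightarrow> (('g \<Rightarrow> complex) \<Rightarrow> ('a \<Rightarrow> real) \<Rightarrow> 'g \<Rightarrow> complex) \<Rightarrow> bool" where
  "intertwining_operator G expo \<Gamma> M \<mu> \<nu> \<Sigma> V T \<longleftrightarrow>
     (\<forall>f\<in>L2_coset_functions G \<Gamma> \<mu>. T f \<in> rho_space G expo M \<nu> \<Sigma> V) \<and>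
     (\<forall>f\<in>L2_coset_functions G \<Gamma> \<mu>. \<forall>h\<in>L2_coset_functions G \<Gamma> \<mu>. \<forall>a b.
        rho_sq_norm G \<nu> \<Sigma> V
          (\<lambda>l g. T (\<lambda>x. a * f x + b * h x) l g - (a * T f l g + b * T h l g)) = 0) \<and>
     (\<exists>B::real. \<forall>f\<in>L2_coset_functions G \<Gamma> \<mu>.
        rho_sq_norm G \<nu> \<Sigma> V (T f) \<le> ennreal B * sq_norm \<mu> f) \<and>
     (\<forall>a\<in>carrier G. \<forall>f\<in>L2_coset_functions G \<Gamma> \<mu>.
        rho_sq_norm G \<nu> \<Sigma> V
          (\<lambda>l g. T (left_translate G a f) l g - left_translate G a (T f l) g) = 0)"

definition U_op ::
  "'g monoid \<Rightarrow> ('a \<Rightarrow> 'g) \<Rightarrow> 'g set measure \<Rightarrow> 'g set measure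
     \<Rightarrow> ('a \<Rightarrow> real) set \<Rightarrow> ('a \<Rightarrow> real) set
     \<Rightarrow> ('g \<Rightarrow> complex) \<Rightarrow> ('a \<Rightarrow> real) \<Rightarrow> 'g \<Rightarrow> complex" where
  "U_op G expo \<mu>M \<mu> \<Sigma> V \<xi> l g =
     (if l \<in> \<Sigma> then \<integral>c. on_cosets (\<lambda>m. \<xi> (g \<otimes>\<^bsub>G\<^esub> m) * character expo l m) c \<partial>\<mu>M
      else if l \<in> V then \<integral>c. on_cosets (\<lambda>m. \<xi> (g \<otimes>\<^bsub>G\<^esub> m) * character expo l m) c \<partial>\<mu>
      else 0)"

end

theory Submission
  imports Defs
begin

text \<open>
  In the coordinates \<open>E\<close> the group is \<open>M \<rtimes> exp (\<real> X\<^sub>n)\<close> and \<open>\<Gamma>\<close> consists of the integer vectors. For continuous \<open>\<xi>\<close> and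
  fixed \<open>t\<close>, Parseval's identity on the torus \<open>M / (M \<inter> \<Gamma>)\<close> applied to \<open>m \<mapsto> \<xi> (exp (t X\<^sub>n) m)\<close>, integrated over
  \<open>t \<in> [0, 1)\<close>, expresses \<open>\<parallel>\<xi>\<parallel>\<^sup>2\<close> as a sum of \<open>\<integral> \<bar>\<xi>\<^sub>l t\<bar>\<^sup>2\<close> over all integral functionals \<open>l\<close> on the ideal, where
  \<open>\<xi>\<^sub>l t\<close> is the \<open>l\<close>-th Fourier coefficient. If \<open>l\<close> does not vanish on the derived algebra, \<open>\<Gamma>\<close> acts on \<open>l\<close> through
  \<open>\<int>\<close> without stabilizer and moving \<open>l\<close> by \<open>k\<close> amounts to shifting \<open>t\<close> by \<open>k\<close>; so the terms of one orbit fill up the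
  integral over the real line, which is the norm in the induced representation. If \<open>l\<close> vanishes there,
  \<open>\<xi>\<^sub>l\<close> is 1-periodic, and Parseval's identity on the circle turns its term into the contributions of
  the characters of \<open>G\<close> extending \<open>l\<close>. Hence the operator is isometric on continuous functions, and it
  extends by their density in \<open>L\<^sup>2(G / \<Gamma>)\<close>.
\<close>

section \<open>Calculus in charts and Lie groups\<close>

text \<open>The group is given only by an atlas, \<open>expo\<close> only through its one-parameter
  subgroups, and the two probability measures only by their invariance, so every explicit formula
  has to be derived from these. The coordinates \<open>E\<close> put the factor from the ideal to
  the left of exp (t X_n); in them the product is governed by the single polynomial operator group
  \<open>Af\<close>. Simple connectedness enters through the injectivity of \<open>E\<close>. The
  disintegration of the measure on G / \<Gamma> comes from averaging continuous functions, and the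
  invariance of the torus measure under the automorphisms induced by exp (k X_n) from evaluating it
  on characters. Elements of the target space are functions that must be covariant at every point,
  whereas L2 limits exist only almost everywhere; this forces the explicit pointwise limit
  \<open>limf\<close> in the extension. All norms are squared and take values in the extended
  nonnegative reals, so the triangle inequality takes the form |a + b|^2 \<le> 2 |a|^2 + 2 |b|^2;
  this is where the factors 4 and 16 in front of norms come from.\<close>

lemma smooth_on_differentiable:
  assumes "smooth_on S f" "x \<in> S"
  shows "f differentiable (at x)"
proof -
  have "open S" "Ck_on 1 S f"
    using assms unfolding smooth_on_def by auto
  then have "f differentiable_on S" by simp
  then show ?thesis
    using \<open>open S\<close> assms(2) by (metis at_within_open differentiable_on_def)
qed

lemma smooth_on_frechet_derivative:
  assumes "smooth_on S f"
  shows "smooth_on S (\<lambda>x. frechet_derivative f (at x) v)"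
  unfolding smooth_on_def
proof (intro conjI allI)
  show "open S" using assms by (simp add: smooth_on_def)
  fix k
  have "Ck_on (Suc k) S f" using assms by (simp add: smooth_on_def)
  then show "Ck_on k S (\<lambda>x. frechet_derivative f (at x) v)" by simp
qed

lemma smooth_on_continuous: "smooth_on S f \<Longrightarrow> continuous_on S f"
  unfolding smooth_on_def by (metis Ck_on.simps(1))

text \<open>The derivatives in the basis directions are continuous, hence bounded on a closed ball;
  the sum of these bounds dominates the operator norm, and the mean value inequality on the convex
  ball finishes. This is the Lipschitz condition behind the uniqueness of one-parameter
  subgroups.\<close>

lemma smooth_on_locally_lipschitz:
  fixes f :: "'a::euclidean_space \<Rightarrow> 'b::euclidean_space"
  assumes f: "smooth_on S f" and a: "a \<in> S"
  obtains e L where "e > 0" "ball a e \<subseteq> S"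
    "\<And>x y. x \<in> ball a e \<Longrightarrow> y \<in> ball a e \<Longrightarrow> norm (f x - f y) \<le> L * norm (x - y)"
proof -
  have "open S" using f by (simp add: smooth_on_def)
  then obtain e where e: "e > 0" "cball a e \<subseteq> S"
    using a open_contains_cball by blast
  have "\<exists>B. \<forall>x\<in>cball a e. norm (frechet_derivative f (at x) b) \<le> B" for b
  proof -
    have "continuous_on (cball a e) (\<lambda>x. frechet_derivative f (at x) b)"
      using smooth_on_continuous[OF smooth_on_frechet_derivative[OF f]] e(2)
      by (rule continuous_on_subset)
    then have "bounded ((\<lambda>x. frechet_derivative f (at x) b) ` cball a e)"
      by (intro compact_imp_bounded compact_continuous_image) auto
    then show ?thesis by (auto simp: bounded_iff)
  qed
  then obtain B where B: "\<And>b x. x \<in> cball a e \<Longrightarrow> norm (frechet_derivative f (at x) b) \<le> B b"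
    by metis
  define L where "L = (\<Sum>b\<in>Basis. B b)"
  have on: "onorm (frechet_derivative f (at x)) \<le> L" if x: "x \<in> ball a e" for x
  proof (rule onorm_le)
    fix v :: 'a
    have "(f has_derivative frechet_derivative f (at x)) (at x)"
      using smooth_on_differentiable[OF f, of x] x subsetD[OF e(2), of x] frechet_derivative_works
      by (metis mem_ball mem_cball less_imp_le)
    then have lin: "linear (frechet_derivative f (at x))"
      by (simp add: has_derivative_linear)
    have "frechet_derivative f (at x) v = frechet_derivative f (at x) (\<Sum>b\<in>Basis. (v \<bullet> b) *\<^sub>R b)"
      by (simp add: euclidean_representation)
    also have "\<dots> = (\<Sum>b\<in>Basis. (v \<bullet> b) *\<^sub>R frechet_derivative f (at x) b)"
      using lin by (simp add: linear_sum linear_cmul)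
    finally have "norm (frechet_derivative f (at x) v)
      \<le> (\<Sum>b\<in>Basis. norm ((v \<bullet> b) *\<^sub>R frechet_derivative f (at x) b))"
      by (metis norm_sum)
    also have "\<dots> \<le> (\<Sum>b\<in>Basis. norm v * B b)"
      using B[of x] x by (intro sum_mono) (auto intro!: mult_mono Basis_le_norm)
    finally show "norm (frechet_derivative f (at x) v) \<le> L * norm v"
      by (simp add: L_def sum_distrib_left mult.commute)
  qed
  have "norm (f x - f y) \<le> L * norm (x - y)" if "x \<in> ball a e" "y \<in> ball a e" for x y
  proof (rule differentiable_bound[OF convex_ball _ on that])
    fix z assume "z \<in> ball a e"
    then show "(f has_derivative frechet_derivative f (at z)) (at z within ball a e)"
      using smooth_on_differentiable[OF f, of z] subsetD[OF e(2), of z] frechet_derivative_works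
      by (metis mem_ball mem_cball less_imp_le has_derivative_at_withinI)
  qed
  moreover have "ball a e \<subseteq> S" using e by (metis ball_subset_cball order_trans)
  ultimately show ?thesis using that e(1) by blast
qed

text \<open>Chart maps are unspecified outside their domains, so the group identities hold in
  coordinates only near the base point; this lemma carries derivatives across such local
  identities.\<close>

lemma has_derivative_eventually_eq:
  assumes "(f has_derivative f') (at x)" "\<forall>\<^sub>F y in at x. f y = g y" "f x = g x"
  shows "(g has_derivative f') (at x)"
proof -
  obtain S where "open S" "x \<in> S" "\<forall>y\<in>S. y \<noteq> x \<longrightarrow> f y = g y"
    using assms(2) unfolding eventually_at_topological by auto
  then show ?thesis
    using assms(3) by (intro has_derivative_transform_within_open[OF assms(1)]) auto
qed

lemma has_vector_derivative_shift:
  assumes "((\<lambda>h. f (t + h)) has_vector_derivative D) (at (0::real))"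
  shows "(f has_vector_derivative D) (at t)"
proof -
  have "((\<lambda>s. s - t) has_vector_derivative 1) (at t)"
    by (auto intro!: derivative_eq_intros)
  then have "(((\<lambda>h. f (t + h)) \<circ> (\<lambda>s. s - t)) has_vector_derivative 1 *\<^sub>R D) (at t)"
    by (rule vector_diff_chain_at) (use assms in simp)
  then show ?thesis by (simp add: o_def)
qed

section \<open>Continuity of the group operations and the adjoint representation in one
  chart\<close>

locale lie_chart =
  fixes G :: "'g::{t2_space,second_countable_topology} monoid" (structure)
    and \<A> :: "('g, 'a::euclidean_space) chart set"
    and \<kappa> :: "('g, 'a) chart"
  assumes lie: "lie_group G \<A>" and idc: "identity_chart G \<A> \<kappa>"
begin

lemma grp: "group G" and carr [simp]: "carrier G = UNIV" and atlas: "smooth_atlas \<A>"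
  using lie by (auto simp: lie_group_def)

lemma mult_assoc: "x \<otimes> y \<otimes> z = x \<otimes> (y \<otimes> z)"
  using grp by (metis UNIV_I carr group.is_monoid monoid.m_assoc)

lemma one_mult [simp]: "\<one> \<otimes> x = x" "x \<otimes> \<one> = x"
  using grp by (metis UNIV_I carr group.is_monoid monoid.l_one, metis UNIV_I carr group.is_monoid monoid.r_one)

lemma inv_mult [simp]: "inv x \<otimes> x = \<one>" "x \<otimes> inv x = \<one>"
  using grp by (metis UNIV_I carr group.l_inv, metis UNIV_I carr group.r_inv)

lemma inv_mult' [simp]: "inv x \<otimes> (x \<otimes> y) = y" "x \<otimes> (inv x \<otimes> y) = y"
  by (metis inv_mult(1) mult_assoc one_mult(1), metis inv_mult(2) mult_assoc one_mult(1))

lemma inv_inv' [simp]: "inv (inv x) = x"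
  using grp by (metis UNIV_I carr group.inv_inv)

lemma inv_prod: "inv (x \<otimes> y) = inv y \<otimes> inv x"
  using grp by (metis UNIV_I carr group.inv_mult_group)

lemma inv_one' [simp]: "inv \<one> = \<one>"
  by (metis inv_mult(2) one_mult(1))

lemma mult_cancel: "x \<otimes> y = x \<otimes> z \<longleftrightarrow> y = z" "y \<otimes> x = z \<otimes> x \<longleftrightarrow> y = z"
  by (metis inv_mult'(1), metis inv_mult(2) mult_assoc one_mult(2))

lemma inv_eqI: "x \<otimes> y = \<one> \<Longrightarrow> inv x = y"
  by (metis inv_mult(2) mult_cancel(1))

lemma chart_ex: "\<exists>\<kappa>'\<in>\<A>. g \<in> fst \<kappa>'"
  using atlas unfolding smooth_atlas_def by auto

lemma chart_facts:
  assumes "\<kappa>' \<in> \<A>"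
  shows "open (fst \<kappa>')" "open (chart_range \<kappa>')"
    "continuous_on (fst \<kappa>') (snd \<kappa>')" "continuous_on (chart_range \<kappa>') (chart_inv \<kappa>')"
    "\<And>g. g \<in> fst \<kappa>' \<Longrightarrow> chart_inv \<kappa>' (snd \<kappa>' g) = g"
    "\<And>x. x \<in> chart_range \<kappa>' \<Longrightarrow> snd \<kappa>' (chart_inv \<kappa>' x) = x"
    "\<And>x. x \<in> chart_range \<kappa>' \<Longrightarrow> chart_inv \<kappa>' x \<in> fst \<kappa>'"
proof -
  have *: "open (fst \<kappa>') \<and> open (chart_range \<kappa>') \<and>
        homeomorphism (fst \<kappa>') (chart_range \<kappa>') (snd \<kappa>') (chart_inv \<kappa>')"
    using atlas assms unfolding smooth_atlas_def by blast
  then show "open (fst \<kappa>')" "open (chart_range \<kappa>')"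
    "continuous_on (fst \<kappa>') (snd \<kappa>')" "continuous_on (chart_range \<kappa>') (chart_inv \<kappa>')"
    "\<And>g. g \<in> fst \<kappa>' \<Longrightarrow> chart_inv \<kappa>' (snd \<kappa>' g) = g"
    "\<And>x. x \<in> chart_range \<kappa>' \<Longrightarrow> snd \<kappa>' (chart_inv \<kappa>' x) = x"
    "\<And>x. x \<in> chart_range \<kappa>' \<Longrightarrow> chart_inv \<kappa>' x \<in> fst \<kappa>'"
    unfolding homeomorphism_def by (auto intro: inv_into_into)
qed

lemma smooth_mult:
  assumes "\<kappa>1 \<in> \<A>" "\<kappa>2 \<in> \<A>" "\<kappa>3 \<in> \<A>"
  shows "smooth_on {(x, y). x \<in> chart_range \<kappa>1 \<and> y \<in> chart_range \<kappa>2 \<and>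
                     chart_inv \<kappa>1 x \<otimes> chart_inv \<kappa>2 y \<in> fst \<kappa>3}
          (\<lambda>(x, y). snd \<kappa>3 (chart_inv \<kappa>1 x \<otimes> chart_inv \<kappa>2 y))"
  using lie assms unfolding lie_group_def by blast

lemma smooth_inv:
  assumes "\<kappa>1 \<in> \<A>" "\<kappa>2 \<in> \<A>"
  shows "smooth_on {x \<in> chart_range \<kappa>1. inv (chart_inv \<kappa>1 x) \<in> fst \<kappa>2}
          (\<lambda>x. snd \<kappa>2 (inv (chart_inv \<kappa>1 x)))"
  using lie assms unfolding lie_group_def by blast

text \<open>Locally the product is the inverse of a third chart applied to the smooth coordinate
  expression of multiplication. The pairs where this expression is valid form an open set because
  \<open>smooth_on\<close> includes openness of its domain.\<close>

lemma continuous_mult_UNIV: "continuous_on UNIV (\<lambda>(g, h). g \<otimes> h)"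
proof (rule continuous_at_imp_continuous_on, intro ballI)
  fix z :: "'g \<times> 'g"
  obtain g h where z: "z = (g, h)" by fastforce
  obtain \<kappa>1 \<kappa>2 \<kappa>3 where k: "\<kappa>1 \<in> \<A>" "\<kappa>2 \<in> \<A>" "\<kappa>3 \<in> \<A>"
    and m: "g \<in> fst \<kappa>1" "h \<in> fst \<kappa>2" "g \<otimes> h \<in> fst \<kappa>3"
    using chart_ex by metis
  define S where "S = {(x, y). x \<in> chart_range \<kappa>1 \<and> y \<in> chart_range \<kappa>2 \<and>
                     chart_inv \<kappa>1 x \<otimes> chart_inv \<kappa>2 y \<in> fst \<kappa>3}"
  define f where "f = (\<lambda>(x, y). snd \<kappa>3 (chart_inv \<kappa>1 x \<otimes> chart_inv \<kappa>2 y))"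
  have sm: "smooth_on S f" unfolding S_def f_def by (rule smooth_mult[OF k])
  then have "open S" by (simp add: smooth_on_def)
  define c where "c = (\<lambda>(a, b). (snd \<kappa>1 a, snd \<kappa>2 b))"
  have cc: "continuous_on (fst \<kappa>1 \<times> fst \<kappa>2) c"
    unfolding c_def case_prod_beta
    by (intro continuous_on_Pair continuous_on_compose2[OF chart_facts(3)[OF k(1)]]
        continuous_on_compose2[OF chart_facts(3)[OF k(2)]] continuous_on_fst continuous_on_snd continuous_on_id) auto
  define U where "U = (fst \<kappa>1 \<times> fst \<kappa>2) \<inter> c -` S"
  have "open U"
    unfolding U_def using cc \<open>open S\<close> chart_facts(1)[OF k(1)] chart_facts(1)[OF k(2)]
    by (metis continuous_on_open_vimage open_Times inf_commute)
  have zU: "z \<in> U"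
    unfolding U_def z c_def S_def using m by (simp add: chart_facts(5)[OF k(1)] chart_facts(5)[OF k(2)])
  have "continuous_on U (\<lambda>w. chart_inv \<kappa>3 (f (c w)))"
  proof (rule continuous_on_compose2[OF chart_facts(4)[OF k(3)]])
    show "continuous_on U (\<lambda>w. f (c w))"
      by (rule continuous_on_compose2[OF smooth_on_continuous[OF sm]
           continuous_on_subset[OF cc]]) (auto simp: U_def)
    show "(\<lambda>w. f (c w)) ` U \<subseteq> chart_range \<kappa>3"
      by (auto simp: U_def f_def S_def)
  qed
  moreover have "chart_inv \<kappa>3 (f (c w)) = (\<lambda>(g, h). g \<otimes> h) w" if "w \<in> U" for w
  proof -
    obtain a b where w: "w = (a, b)" by fastforce
    have *: "a \<in> fst \<kappa>1" "b \<in> fst \<kappa>2"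
      "chart_inv \<kappa>1 (snd \<kappa>1 a) \<otimes> chart_inv \<kappa>2 (snd \<kappa>2 b) \<in> fst \<kappa>3"
      using that by (simp_all add: U_def S_def c_def w)
    then have "a \<otimes> b \<in> fst \<kappa>3"
      by (simp add: chart_facts(5)[OF k(1)] chart_facts(5)[OF k(2)])
    then show ?thesis
      by (simp add: w f_def c_def * chart_facts(5)[OF k(1)] chart_facts(5)[OF k(2)] chart_facts(5)[OF k(3)])
  qed
  ultimately have "continuous_on U (\<lambda>(g, h). g \<otimes> h)"
    by (simp cong: continuous_on_cong)
  then show "isCont (\<lambda>(g, h). g \<otimes> h) z"
    using \<open>open U\<close> zU continuous_on_eq_continuous_at by blast
qed

lemma continuous_inv_UNIV: "continuous_on UNIV (\<lambda>g. inv g)"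
proof (rule continuous_at_imp_continuous_on, intro ballI)
  fix g :: 'g
  obtain \<kappa>1 \<kappa>2 where k: "\<kappa>1 \<in> \<A>" "\<kappa>2 \<in> \<A>"
    and m: "g \<in> fst \<kappa>1" "inv g \<in> fst \<kappa>2"
    using chart_ex by metis
  define S where "S = {x \<in> chart_range \<kappa>1. inv (chart_inv \<kappa>1 x) \<in> fst \<kappa>2}"
  define f where "f = (\<lambda>x. snd \<kappa>2 (inv (chart_inv \<kappa>1 x)))"
  have sm: "smooth_on S f" unfolding S_def f_def by (rule smooth_inv[OF k])
  then have "open S" by (simp add: smooth_on_def)
  define U where "U = fst \<kappa>1 \<inter> snd \<kappa>1 -` S"
  have "open U"
    unfolding U_def using chart_facts(3)[OF k(1)] \<open>open S\<close> chart_facts(1)[OF k(1)]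
    by (metis continuous_on_open_vimage inf_commute)
  have zU: "g \<in> U"
    unfolding U_def S_def using m by (simp add: chart_facts(5)[OF k(1)])
  have "continuous_on U (\<lambda>w. chart_inv \<kappa>2 (f (snd \<kappa>1 w)))"
  proof (rule continuous_on_compose2[OF chart_facts(4)[OF k(2)]])
    show "continuous_on U (\<lambda>w. f (snd \<kappa>1 w))"
      by (rule continuous_on_compose2[OF smooth_on_continuous[OF sm]
           continuous_on_subset[OF chart_facts(3)[OF k(1)]]]) (auto simp: U_def)
    show "(\<lambda>w. f (snd \<kappa>1 w)) ` U \<subseteq> chart_range \<kappa>2"
      by (auto simp: U_def f_def S_def)
  qed
  moreover have "chart_inv \<kappa>2 (f (snd \<kappa>1 w)) = inv w" if "w \<in> U" for w
  proof -
    have *: "w \<in> fst \<kappa>1" "inv (chart_inv \<kappa>1 (snd \<kappa>1 w)) \<in> fst \<kappa>2"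
      using that by (simp_all add: U_def S_def)
    then show ?thesis
      by (simp add: f_def chart_facts(5)[OF k(1)] chart_facts(5)[OF k(2)])
  qed
  ultimately have "continuous_on U (\<lambda>g. inv g)"
    by (simp cong: continuous_on_cong)
  then show "isCont (\<lambda>g. inv g) g"
    using \<open>open U\<close> zU continuous_on_eq_continuous_at by blast
qed

lemma continuous_on_mult [continuous_intros]:
  fixes f h :: "'b::topological_space \<Rightarrow> 'g"
  shows "continuous_on S f \<Longrightarrow> continuous_on S h \<Longrightarrow> continuous_on S (\<lambda>x. f x \<otimes> h x)"
  using continuous_on_compose2[OF continuous_mult_UNIV continuous_on_Pair, of S f h] by auto

lemma continuous_on_inverse [continuous_intros]:
  fixes f :: "'b::topological_space \<Rightarrow> 'g"
  shows "continuous_on S f \<Longrightarrow> continuous_on S (\<lambda>x. inv (f x))"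
  using continuous_on_compose2[OF continuous_inv_UNIV, of S f] by auto

definition "\<phi> = snd \<kappa>"
definition "\<psi> = chart_inv \<kappa>"
definition "D = fst \<kappa>"
definition "R = chart_range \<kappa>"
text \<open>The chart is not assumed to be centred at 0, so all derivatives defining the Lie algebra
  are taken at this point.\<close>

definition "e0 = \<phi> \<one>"

lemma kA: "\<kappa> \<in> \<A>" and one_D [simp]: "\<one> \<in> D"
  using idc by (auto simp: identity_chart_def D_def)

lemma chart:
  shows open_D: "open D" and open_R: "open R"
    and cont_\<phi>: "continuous_on D \<phi>" and cont_\<psi>: "continuous_on R \<psi>"
    and \<psi>\<phi>: "\<And>g. g \<in> D \<Longrightarrow> \<psi> (\<phi> g) = g"
    and \<phi>\<psi>: "\<And>x. x \<in> R \<Longrightarrow> \<phi> (\<psi> x) = x"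
    and \<psi>_in: "\<And>x. x \<in> R \<Longrightarrow> \<psi> x \<in> D"
    and \<phi>_in: "\<And>g. g \<in> D \<Longrightarrow> \<phi> g \<in> R"
  using chart_facts[OF kA] unfolding \<phi>_def \<psi>_def D_def R_def by auto

lemma e0_R [simp]: "e0 \<in> R" and \<psi>_e0 [simp]: "\<psi> e0 = \<one>"
  unfolding e0_def by (auto simp: \<phi>_in \<psi>\<phi>)

definition "conjc g x = \<phi> (g \<otimes> \<psi> x \<otimes> inv g)"

lemma Ad_eq: "Ad G \<kappa> g = frechet_derivative (conjc g) (at e0)"
  unfolding Ad_def conjc_def \<phi>_def \<psi>_def e0_def by auto

lemma lmul_differentiable:
  assumes "\<kappa>2 \<in> \<A>" "\<kappa>3 \<in> \<A>" "h \<in> fst \<kappa>2" "g \<otimes> h \<in> fst \<kappa>3"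
  shows "(\<lambda>x. snd \<kappa>3 (g \<otimes> chart_inv \<kappa>2 x)) differentiable (at (snd \<kappa>2 h))"
proof -
  obtain \<kappa>1 where k: "\<kappa>1 \<in> \<A>" "g \<in> fst \<kappa>1" using chart_ex by metis
  have "(\<lambda>(x, y). snd \<kappa>3 (chart_inv \<kappa>1 x \<otimes> chart_inv \<kappa>2 y)) differentiable
      (at (snd \<kappa>1 g, snd \<kappa>2 h))"
    using smooth_on_differentiable[OF smooth_mult[OF k(1) assms(1,2)]]
      k assms by (simp add: chart_facts(5)[OF k(1)] chart_facts(5)[OF assms(1)])
  moreover have "(\<lambda>y. (snd \<kappa>1 g, y)) differentiable (at (snd \<kappa>2 h))"
    by (auto simp: differentiable_def intro!: exI derivative_eq_intros)
  ultimately have "(\<lambda>(x, y). snd \<kappa>3 (chart_inv \<kappa>1 x \<otimes> chart_inv \<kappa>2 y)) \<circ> (\<lambda>y. (snd \<kappa>1 g, y))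
     differentiable (at (snd \<kappa>2 h))"
    by (intro differentiable_chain_at) auto
  then show ?thesis
    using k by (simp add: o_def chart_facts(5)[OF k(1)])
qed

lemma rmul_differentiable:
  assumes "\<kappa>2 \<in> \<A>" "\<kappa>3 \<in> \<A>" "h \<in> fst \<kappa>2" "h \<otimes> g \<in> fst \<kappa>3"
  shows "(\<lambda>x. snd \<kappa>3 (chart_inv \<kappa>2 x \<otimes> g)) differentiable (at (snd \<kappa>2 h))"
proof -
  obtain \<kappa>1 where k: "\<kappa>1 \<in> \<A>" "g \<in> fst \<kappa>1" using chart_ex by metis
  have "(\<lambda>(x, y). snd \<kappa>3 (chart_inv \<kappa>2 x \<otimes> chart_inv \<kappa>1 y)) differentiable
      (at (snd \<kappa>2 h, snd \<kappa>1 g))"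
    using smooth_on_differentiable[OF smooth_mult[OF assms(1) k(1) assms(2)]]
      k assms by (simp add: chart_facts(5)[OF k(1)] chart_facts(5)[OF assms(1)])
  moreover have "(\<lambda>y. (y, snd \<kappa>1 g)) differentiable (at (snd \<kappa>2 h))"
    by (auto simp: differentiable_def intro!: exI derivative_eq_intros)
  ultimately have "(\<lambda>(x, y). snd \<kappa>3 (chart_inv \<kappa>2 x \<otimes> chart_inv \<kappa>1 y)) \<circ> (\<lambda>y. (y, snd \<kappa>1 g))
     differentiable (at (snd \<kappa>2 h))"
    by (intro differentiable_chain_at) auto
  then show ?thesis
    using k by (simp add: o_def chart_facts(5)[OF k(1)])
qed

lemma conjc_e0 [simp]: "conjc g e0 = e0"
  by (simp add: conjc_def e0_def[symmetric])

lemma eventually_\<psi>: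
  assumes "open U" "g \<otimes> h \<in> U"
  shows "\<forall>\<^sub>F x in at e0. g \<otimes> \<psi> x \<otimes> h \<in> U" 
proof -
  have c: "continuous_on R (\<lambda>x. g \<otimes> \<psi> x \<otimes> h)"
    by (intro continuous_intros cont_\<psi>)
  have "open (R \<inter> (\<lambda>x. g \<otimes> \<psi> x \<otimes> h) -` U)"
    using c assms(1) open_R by (metis continuous_on_open_vimage inf_commute)
  moreover have "e0 \<in> R \<inter> (\<lambda>x. g \<otimes> \<psi> x \<otimes> h) -` U" using assms by simp
  ultimately show ?thesis
    by (metis (mono_tags, lifting) IntD2 eventually_at_topological vimageD)
qed

text \<open>For \<open>g\<close> far from the identity the intermediate product
  \<open>g \<otimes> \<psi> x\<close> leaves the chart. Conjugation is therefore factored through a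
  second chart around \<open>g\<close>: a left translation into it followed by a right translation
  back.\<close>

lemma conjc_differentiable: "conjc g differentiable (at e0)"
proof -
  obtain \<kappa>3 where k: "\<kappa>3 \<in> \<A>" "g \<in> fst \<kappa>3" using chart_ex by metis
  have 1: "(\<lambda>x. snd \<kappa>3 (g \<otimes> \<psi> x)) differentiable (at e0)"
    using lmul_differentiable[OF kA k(1), of \<one> g] k(2) one_D
    unfolding \<psi>_def e0_def \<phi>_def D_def by auto
  have 2: "(\<lambda>y. \<phi> (chart_inv \<kappa>3 y \<otimes> inv g)) differentiable (at (snd \<kappa>3 (g \<otimes> \<psi> e0)))"
    using rmul_differentiable[OF k(1) kA k(2), of "inv g"] one_D
    unfolding \<phi>_def D_def by simp
  have 3: "((\<lambda>y. \<phi> (chart_inv \<kappa>3 y \<otimes> inv g)) \<circ> (\<lambda>x. snd \<kappa>3 (g \<otimes> \<psi> x))) differentiable (at e0)"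
    using 1 2 by (rule differentiable_chain_at)
  then obtain f' where f': "(((\<lambda>y. \<phi> (chart_inv \<kappa>3 y \<otimes> inv g)) \<circ> (\<lambda>x. snd \<kappa>3 (g \<otimes> \<psi> x))) has_derivative f') (at e0)"
    by (auto simp: differentiable_def)
  have "\<forall>\<^sub>F x in at e0. g \<otimes> \<psi> x \<otimes> \<one> \<in> fst \<kappa>3"
    using k chart_facts(1)[OF k(1)] by (intro eventually_\<psi>) auto
  then have "\<forall>\<^sub>F x in at e0. ((\<lambda>y. \<phi> (chart_inv \<kappa>3 y \<otimes> inv g)) \<circ> (\<lambda>x. snd \<kappa>3 (g \<otimes> \<psi> x))) x = conjc g x"
    by eventually_elim (simp add: conjc_def chart_facts(5)[OF k(1)])
  then have "(conjc g has_derivative f') (at e0)"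
    using k by (intro has_derivative_eventually_eq[OF f'])
      (simp_all add: conjc_def chart_facts(5)[OF k(1)])
  then show ?thesis by (auto simp: differentiable_def)
qed

lemma conjc_has_derivative: "(conjc g has_derivative Ad G \<kappa> g) (at e0)"
  using conjc_differentiable frechet_derivative_works unfolding Ad_eq by blast

lemma linear_Ad: "linear (Ad G \<kappa> g)"
  using conjc_has_derivative has_derivative_linear by blast

lemma Ad_mult: "Ad G \<kappa> (g \<otimes> h) = Ad G \<kappa> g \<circ> Ad G \<kappa> h"
proof -
  have 1: "((conjc g \<circ> conjc h) has_derivative (Ad G \<kappa> g \<circ> Ad G \<kappa> h)) (at e0)"
    by (rule diff_chain_at) (auto simp: conjc_has_derivative)
  have "\<forall>\<^sub>F x in at e0. h \<otimes> \<psi> x \<otimes> inv h \<in> D"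
    by (rule eventually_\<psi>) (auto simp: open_D)
  then have "\<forall>\<^sub>F x in at e0. (conjc g \<circ> conjc h) x = conjc (g \<otimes> h) x"
    by eventually_elim (auto simp: conjc_def \<psi>\<phi> mult_assoc inv_prod)
  then have "(conjc (g \<otimes> h) has_derivative (Ad G \<kappa> g \<circ> Ad G \<kappa> h)) (at e0)"
    using has_derivative_eventually_eq[OF 1] by auto
  then show ?thesis
    using conjc_has_derivative has_derivative_unique by blast
qed

lemma Ad_one: "Ad G \<kappa> \<one> = (\<lambda>x. x)"
proof -
  have "\<forall>\<^sub>F x in at e0. x = conjc \<one> x"
    using eventually_at_in_open'[OF open_R e0_R]
    by eventually_elim (auto simp: conjc_def \<phi>\<psi>)
  then have "(conjc \<one> has_derivative (\<lambda>x. x)) (at e0)"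
    by (rule has_derivative_eventually_eq[OF has_derivative_ident]) simp
  then show ?thesis
    using conjc_has_derivative has_derivative_unique by blast
qed

lemma eventually_in_D:
  fixes c :: "real \<Rightarrow> 'g"
  assumes "continuous_on UNIV c" "c t \<in> D"
  shows "\<forall>\<^sub>F x in at t. c x \<in> D"
proof -
  have "open (c -` D)"
    using assms(1) open_D by (auto simp: continuous_on_open_vimage[OF open_UNIV])
  then have "\<forall>\<^sub>F x in at t. x \<in> c -` D"
    by (rule eventually_at_in_open') (simp add: assms(2))
  then show ?thesis by simp
qed

subsection \<open>One-parameter subgroups\<close>

text \<open>The velocity is prescribed only at time 0; the homomorphism property carries it to all
  other times, as \<open>one_par_ode\<close> shows.\<close>

definition one_par :: "(real \<Rightarrow> 'g) \<Rightarrow> 'a \<Rightarrow> bool" where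
  "one_par c Y \<longleftrightarrow> (\<forall>s t. c (s + t) = c s \<otimes> c t) \<and> continuous_on UNIV c \<and>
     ((\<lambda>t. \<phi> (c t)) has_vector_derivative Y) (at 0)"

lemma one_par_0: "one_par c Y \<Longrightarrow> c 0 = \<one>"
  unfolding one_par_def by (metis add_0 mult_cancel(1) one_mult(2))

lemma one_par_minus: "one_par c Y \<Longrightarrow> c (- t) = inv (c t)"
  using one_par_0 inv_eqI unfolding one_par_def by (metis add.right_inverse)

definition "mulc = (\<lambda>(x, y). \<phi> (\<psi> x \<otimes> \<psi> y))"
definition "\<Omega> = {(x, y). x \<in> R \<and> y \<in> R \<and> \<psi> x \<otimes> \<psi> y \<in> D}"

lemma smooth_mulc: "smooth_on \<Omega> mulc"
  using smooth_mult[OF kA kA kA] unfolding \<Omega>_def mulc_def R_def \<psi>_def \<phi>_def D_def .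

definition "dm p = frechet_derivative mulc (at p)"

lemma dm: "p \<in> \<Omega> \<Longrightarrow> (mulc has_derivative dm p) (at p)"
  unfolding dm_def using smooth_on_differentiable[OF smooth_mulc] frechet_derivative_works by blast

lemma linear_dm: "p \<in> \<Omega> \<Longrightarrow> linear (dm p)"
  using dm has_derivative_linear by blast

lemma smooth_dm: "smooth_on \<Omega> (\<lambda>p. dm p v)"
  unfolding dm_def by (rule smooth_on_frechet_derivative[OF smooth_mulc])

text \<open>The left invariant vector field with value \<open>Y\<close> at the identity, in chart
  coordinates.\<close>

definition "lfield Y x = dm (x, e0) (0, Y)"

lemma e0_\<Omega>: "x \<in> R \<Longrightarrow> (x, e0) \<in> \<Omega>" "x \<in> R \<Longrightarrow> (e0, x) \<in> \<Omega>"
  by (auto simp: \<Omega>_def \<psi>_in)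

text \<open>With one argument frozen at the identity, multiplication is the identity map near
  \<open>e0\<close>; this gives both partial derivatives, and linearity adds them.\<close>

lemma dm_e0: "dm (e0, e0) (a, b) = a + b"
proof -
  have ev: "\<forall>\<^sub>F x in at e0. x \<in> R"
    using eventually_at_in_open'[OF open_R e0_R] .
  have "((mulc \<circ> (\<lambda>x. (x, e0))) has_derivative (dm (e0, e0) \<circ> (\<lambda>v. (v, 0)))) (at e0)"
    by (intro diff_chain_at) (auto intro!: derivative_eq_intros dm e0_\<Omega>)
  moreover have "\<forall>\<^sub>F x in at e0. (mulc \<circ> (\<lambda>x. (x, e0))) x = x"
    using ev by eventually_elim (auto simp: mulc_def \<phi>\<psi>)
  ultimately have "((\<lambda>x. x) has_derivative (dm (e0, e0) \<circ> (\<lambda>v. (v, 0)))) (at e0)"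
    by (rule has_derivative_eventually_eq) (simp add: mulc_def e0_def[symmetric])
  then have 1: "dm (e0, e0) \<circ> (\<lambda>v. (v, 0)) = (\<lambda>x. x)"
    using has_derivative_ident has_derivative_unique by blast
  have "((mulc \<circ> (\<lambda>x. (e0, x))) has_derivative (dm (e0, e0) \<circ> (\<lambda>v. (0, v)))) (at e0)"
    by (intro diff_chain_at) (auto intro!: derivative_eq_intros dm e0_\<Omega>)
  moreover have "\<forall>\<^sub>F x in at e0. (mulc \<circ> (\<lambda>x. (e0, x))) x = x"
    using ev by eventually_elim (auto simp: mulc_def \<phi>\<psi>)
  ultimately have "((\<lambda>x. x) has_derivative (dm (e0, e0) \<circ> (\<lambda>v. (0, v)))) (at e0)"
    by (rule has_derivative_eventually_eq) (simp add: mulc_def e0_def[symmetric])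
  then have 2: "dm (e0, e0) \<circ> (\<lambda>v. (0, v)) = (\<lambda>x. x)"
    using has_derivative_ident has_derivative_unique by blast
  have "dm (e0, e0) ((a, 0) + (0, b)) = dm (e0, e0) (a, 0) + dm (e0, e0) (0, b)"
    by (rule linear_add[OF linear_dm]) (simp add: e0_\<Omega>)
  then show ?thesis using fun_cong[OF 1, of a] fun_cong[OF 2, of b] by simp
qed

lemma curve_mult_derivative:
  assumes a: "((\<lambda>t. \<phi> (a t)) has_vector_derivative a') (at t)" "continuous_on UNIV a" "a t \<in> D"
    and b: "((\<lambda>t. \<phi> (b t)) has_vector_derivative b') (at t)" "continuous_on UNIV b" "b t \<in> D"
    and ab: "a t \<otimes> b t \<in> D"
  shows "((\<lambda>t. \<phi> (a t \<otimes> b t)) has_vector_derivative dm (\<phi> (a t), \<phi> (b t)) (a', b')) (at t)"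
proof -
  have in\<Omega>: "(\<phi> (a t), \<phi> (b t)) \<in> \<Omega>"
    using a b ab by (auto simp: \<Omega>_def \<phi>_in \<psi>\<phi>)
  have "((mulc \<circ> (\<lambda>t. (\<phi> (a t), \<phi> (b t)))) has_derivative
      (dm (\<phi> (a t), \<phi> (b t)) \<circ> (\<lambda>h. (h *\<^sub>R a', h *\<^sub>R b')))) (at t)"
    using a(1) b(1) dm[OF in\<Omega>] unfolding has_vector_derivative_def
    by (intro diff_chain_at has_derivative_Pair) auto
  moreover have "\<forall>\<^sub>F x in at t. (mulc \<circ> (\<lambda>t. (\<phi> (a t), \<phi> (b t)))) x = \<phi> (a x \<otimes> b x)"
  proof -
    have "\<forall>\<^sub>F x in at t. a x \<in> D" "\<forall>\<^sub>F x in at t. b x \<in> D"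
      using a b by (auto intro!: eventually_in_D)
    then show ?thesis by eventually_elim (auto simp: mulc_def \<psi>\<phi>)
  qed
  ultimately have "((\<lambda>t. \<phi> (a t \<otimes> b t)) has_derivative
      (dm (\<phi> (a t), \<phi> (b t)) \<circ> (\<lambda>h. (h *\<^sub>R a', h *\<^sub>R b')))) (at t)"
    by (rule has_derivative_eventually_eq) (use a b in \<open>auto simp: mulc_def \<psi>\<phi>\<close>)
  moreover have "(dm (\<phi> (a t), \<phi> (b t)) \<circ> (\<lambda>h. (h *\<^sub>R a', h *\<^sub>R b')))
      = (\<lambda>h. h *\<^sub>R dm (\<phi> (a t), \<phi> (b t)) (a', b'))"
    using linear_cmul[OF linear_dm[OF in\<Omega>], of _ "(a', b')"] by (auto simp: o_def)
  ultimately show ?thesis unfolding has_vector_derivative_def by simp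
qed

text \<open>Since c (t + h) = c t c h, the velocity at time t is the velocity at 0 moved by left
  translation: one-parameter subgroups are integral curves of left invariant fields.\<close>

lemma one_par_ode:
  assumes c: "one_par c Y" and t: "c t \<in> D"
  shows "((\<lambda>t. \<phi> (c t)) has_vector_derivative lfield Y (\<phi> (c t))) (at t)"
proof -
  have c0: "c 0 = \<one>" using c by (rule one_par_0)
  have "((\<lambda>h. \<phi> (c t \<otimes> c h)) has_vector_derivative dm (\<phi> (c t), \<phi> (c 0)) (0, Y)) (at 0)"
    using c t c0 unfolding one_par_def
    by (intro curve_mult_derivative) (auto intro!: derivative_eq_intros continuous_intros)
  then have "((\<lambda>h. \<phi> (c (t + h))) has_vector_derivative lfield Y (\<phi> (c t))) (at 0)"
    using c c0 unfolding one_par_def lfield_def e0_def by simp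
  then show ?thesis by (rule has_vector_derivative_shift)
qed

text \<open>Two integral curves of the same Lipschitz field with the same starting point. On a short
  interval the maximal distance between them is at most half of itself.\<close>

lemma one_par_unique_local:
  assumes c: "one_par c Y" and d: "one_par d Y"
  shows "\<exists>\<delta>>0. \<forall>t\<in>{0..\<delta>}. c t = d t"
proof -
  define V where "V = (\<lambda>p. dm p (0, Y))"
  obtain e L where e: "e > 0" "ball (e0, e0) e \<subseteq> \<Omega>"
    and L: "\<And>p q. p \<in> ball (e0, e0) e \<Longrightarrow> q \<in> ball (e0, e0) e \<Longrightarrow> norm (V p - V q) \<le> L * norm (p - q)"
    using smooth_on_locally_lipschitz[OF smooth_dm, of "(e0, e0)" "(0, Y)"] e0_\<Omega>(1)[OF e0_R]
    unfolding V_def by metis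
  have Lf: "norm (lfield Y x - lfield Y y) \<le> L * norm (x - y)" if "x \<in> ball e0 e" "y \<in> ball e0 e" for x y
    using L[of "(x, e0)" "(y, e0)"] that by (auto simp: V_def lfield_def dist_Pair_Pair norm_Pair)
  have near: "\<exists>\<delta>>0. \<forall>t. \<bar>t\<bar> \<le> \<delta> \<longrightarrow> f t \<in> D \<and> \<phi> (f t) \<in> ball e0 e" if f: "one_par f Y" for f
  proof -
    have "open (D \<inter> \<phi> -` ball e0 e)"
      using cont_\<phi> open_D by (metis continuous_on_open_vimage inf_commute open_ball)
    then have "open (f -` (D \<inter> \<phi> -` ball e0 e))"
      using f unfolding one_par_def by (auto simp: continuous_on_open_vimage[OF open_UNIV])
    moreover have "0 \<in> f -` (D \<inter> \<phi> -` ball e0 e)"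
      using one_par_0[OF f] e by (auto simp: e0_def)
    ultimately obtain r where r: "r > 0" "cball 0 r \<subseteq> f -` (D \<inter> \<phi> -` ball e0 e)"
      using open_contains_cball by blast
    show ?thesis
    proof (intro exI[of _ r] conjI allI impI)
      fix t :: real assume "\<bar>t\<bar> \<le> r"
      then have "t \<in> cball 0 r" by simp
      then show "f t \<in> D" "\<phi> (f t) \<in> ball e0 e" using r by auto
    qed (use r in auto)
  qed
  obtain r1 where r1: "r1 > 0" "\<And>t. \<bar>t\<bar> \<le> r1 \<Longrightarrow> c t \<in> D \<and> \<phi> (c t) \<in> ball e0 e"
    using near[OF c] by blast
  obtain r2 where r2: "r2 > 0" "\<And>t. \<bar>t\<bar> \<le> r2 \<Longrightarrow> d t \<in> D \<and> \<phi> (d t) \<in> ball e0 e"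
    using near[OF d] by blast
  \<comment> \<open>The third bound yields \<open>\<delta> * \<bar>L\<bar> \<le> 1/2\<close>, which
    is the factor one half in the final estimate; adding 1 to \<open>\<bar>L\<bar>\<close> keeps the
    denominator positive.\<close>
  define \<delta> where "\<delta> = min (min r1 r2) (1 / (2 * (\<bar>L\<bar> + 1)))"
  have \<delta>: "\<delta> > 0" "\<delta> \<le> r1" "\<delta> \<le> r2" "\<delta> * \<bar>L\<bar> \<le> 1/2"
  proof -
    show "\<delta> > 0" "\<delta> \<le> r1" "\<delta> \<le> r2" using r1 r2 by (auto simp: \<delta>_def)
    have "\<delta> * (\<bar>L\<bar> + 1) \<le> 1 / (2 * (\<bar>L\<bar> + 1)) * (\<bar>L\<bar> + 1)"
      by (intro mult_right_mono) (auto simp: \<delta>_def)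
    also have "1 / (2 * (\<bar>L\<bar> + 1)) * (\<bar>L\<bar> + 1) = 1/2" by (simp add: field_simps)
    finally have "\<delta> * (\<bar>L\<bar> + 1) \<le> 1/2" .
    then show "\<delta> * \<bar>L\<bar> \<le> 1/2" using \<open>\<delta> > 0\<close> by (simp add: distrib_left)
  qed
  define u where "u t = \<phi> (c t) - \<phi> (d t)" for t
  have du: "(u has_vector_derivative (lfield Y (\<phi> (c t)) - lfield Y (\<phi> (d t)))) (at t)"
    if "t \<in> {0..\<delta>}" for t
    unfolding u_def using that \<delta> r1 r2
    by (intro has_vector_derivative_diff one_par_ode c d) auto
  have "continuous_on {0..\<delta>} u"
    using du by (intro continuous_at_imp_continuous_on ballI has_vector_derivative_continuous) auto
  then have "continuous_on {0..\<delta>} (\<lambda>t. norm (u t))" by (intro continuous_intros)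
  then obtain s where s: "s \<in> {0..\<delta>}" "\<And>t. t \<in> {0..\<delta>} \<Longrightarrow> norm (u t) \<le> norm (u s)"
    using continuous_attains_sup[of "{0..\<delta>}" "\<lambda>t. norm (u t)"] \<delta> by auto
  have "norm (u s - u 0) \<le> (\<bar>L\<bar> * norm (u s)) * norm (s - 0)"
  proof (rule differentiable_bound[where f' = "\<lambda>t h. h *\<^sub>R (lfield Y (\<phi> (c t)) - lfield Y (\<phi> (d t)))" and S = "{0..\<delta>}"])
    fix t assume t: "t \<in> {0..\<delta>}"
    show "(u has_derivative (\<lambda>h. h *\<^sub>R (lfield Y (\<phi> (c t)) - lfield Y (\<phi> (d t))))) (at t within {0..\<delta>})"
      using du[OF t] unfolding has_vector_derivative_def by (rule has_derivative_at_withinI)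
    have "norm (lfield Y (\<phi> (c t)) - lfield Y (\<phi> (d t))) \<le> L * norm (u t)"
      unfolding u_def using r1 r2 t \<delta> by (intro Lf) auto
    also have "\<dots> \<le> \<bar>L\<bar> * norm (u s)"
      using s(2)[OF t] by (intro mult_mono) auto
    finally have *: "norm (lfield Y (\<phi> (c t)) - lfield Y (\<phi> (d t))) \<le> \<bar>L\<bar> * norm (u s)" .
    show "onorm (\<lambda>h. h *\<^sub>R (lfield Y (\<phi> (c t)) - lfield Y (\<phi> (d t)))) \<le> \<bar>L\<bar> * norm (u s)"
    proof (rule onorm_le)
      fix x :: real
      show "norm (x *\<^sub>R (lfield Y (\<phi> (c t)) - lfield Y (\<phi> (d t)))) \<le> \<bar>L\<bar> * norm (u s) * norm x"
        using mult_right_mono[OF *, of "\<bar>x\<bar>"] by (simp add: mult.commute)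
    qed
  qed (use s \<delta> in auto)
  also have "\<dots> \<le> (\<bar>L\<bar> * norm (u s)) * \<delta>"
    using s by (intro mult_left_mono) auto
  also have "\<dots> = (\<delta> * \<bar>L\<bar>) * norm (u s)" by (simp add: ac_simps)
  also have "\<dots> \<le> (1/2) * norm (u s)" using \<delta> by (intro mult_right_mono) auto
  finally have "norm (u s) \<le> 0"
    using one_par_0[OF c] one_par_0[OF d] by (simp add: u_def)
  then have "u t = 0" if "t \<in> {0..\<delta>}" for t using s(2)[OF that] by auto
  then have "c t = d t" if "t \<in> {0..\<delta>}" for t
    using that r1(2)[of t] r2(2)[of t] \<delta> unfolding u_def
    by (metis \<psi>\<phi> abs_of_nonneg atLeastAtMost_iff order_trans right_minus_eq)
  then show ?thesis using \<delta> by blast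
qed

text \<open>Agreement near 0 doubles its range at each step, because the value at t is the square of
  the value at t/2.\<close>

lemma one_par_unique:
  assumes c: "one_par c Y" and d: "one_par d Y"
  shows "c t = d t"
proof -
  obtain \<delta> where \<delta>: "\<delta> > 0" "\<And>t. t \<in> {0..\<delta>} \<Longrightarrow> c t = d t"
    using one_par_unique_local[OF assms] by blast
  have small: "c t = d t" if "\<bar>t\<bar> \<le> \<delta>" for t
  proof (cases "t \<ge> 0")
    case False
    then have "c (- t) = d (- t)" using that \<delta> by auto
    then show ?thesis using one_par_minus[OF c, of "-t"] one_par_minus[OF d, of "-t"] by simp
  qed (use that \<delta> in auto)
  have *: "\<forall>t. \<bar>t\<bar> \<le> 2 ^ k * \<delta> \<longrightarrow> c t = d t" for k
  proof (induction k)
    case (Suc k)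
    show ?case
    proof (intro allI impI)
      fix t assume "\<bar>t\<bar> \<le> 2 ^ Suc k * \<delta>"
      then have "c (t/2) = d (t/2)" using Suc by auto
      then show "c t = d t" using c d unfolding one_par_def by (metis field_sum_of_halves)
    qed
  qed (use small in auto)
  obtain k where "\<bar>t\<bar> / \<delta> < 2 ^ k" using real_arch_pow[of 2 "\<bar>t\<bar> / \<delta>"] by auto
  then have "\<bar>t\<bar> \<le> 2 ^ k * \<delta>" using \<delta>(1) by (simp add: field_simps)
  then show ?thesis using * by blast
qed

lemma Ad_curve:
  assumes c: "((\<lambda>t. \<phi> (c t)) has_vector_derivative Y) (at 0)" "continuous_on UNIV c" "c 0 = \<one>"
  shows "((\<lambda>t. \<phi> (g \<otimes> c t \<otimes> inv g)) has_vector_derivative Ad G \<kappa> g Y) (at 0)"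
proof -
  have "((conjc g \<circ> (\<lambda>t. \<phi> (c t))) has_derivative (Ad G \<kappa> g \<circ> (\<lambda>h. h *\<^sub>R Y))) (at 0)"
    using c conjc_has_derivative[of g] unfolding has_vector_derivative_def
    by (intro diff_chain_at) (auto simp: e0_def)
  moreover have "\<forall>\<^sub>F x in at 0. (conjc g \<circ> (\<lambda>t. \<phi> (c t))) x = \<phi> (g \<otimes> c x \<otimes> inv g)"
  proof -
    have "\<forall>\<^sub>F x in at 0. c x \<in> D" using c by (auto intro!: eventually_in_D)
    then show ?thesis by eventually_elim (auto simp: conjc_def \<psi>\<phi>)
  qed
  ultimately have "((\<lambda>t. \<phi> (g \<otimes> c t \<otimes> inv g)) has_derivative (Ad G \<kappa> g \<circ> (\<lambda>h. h *\<^sub>R Y))) (at 0)"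
    by (rule has_derivative_eventually_eq) (use c in \<open>auto simp: conjc_def \<psi>\<phi>\<close>)
  then show ?thesis
    unfolding has_vector_derivative_def using linear_cmul[OF linear_Ad] by (simp add: o_def)
qed

lemma one_par_conj:
  assumes "one_par c Y"
  shows "one_par (\<lambda>t. g \<otimes> c t \<otimes> inv g) (Ad G \<kappa> g Y)"
  using assms Ad_curve[of c Y g] one_par_0[OF assms] unfolding one_par_def
  by (auto intro!: continuous_intros simp: mult_assoc)

subsection \<open>The bracket as the derivative of the adjoint action\<close>

definition "invc x = \<phi> (inv (\<psi> x))"

lemma invc_differentiable: "invc differentiable (at e0)"
proof -
  have "smooth_on {x \<in> R. inv (\<psi> x) \<in> D} invc"
    using smooth_inv[OF kA kA] unfolding R_def \<psi>_def \<phi>_def D_def invc_def .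
  then show ?thesis by (rule smooth_on_differentiable) auto
qed

text \<open>Near the identity the whole conjugation x y x^-1 stays inside one chart, so it is
  \<open>mulc\<close> applied twice. The chain rule then exhibits the dependence of
  \<open>Ad\<close> on x through the derivative \<open>dm\<close>, which is smooth in its base
  point.\<close>

lemma Ad_formula:
  assumes x: "x \<in> R" "inv (\<psi> x) \<in> D"
  shows "Ad G \<kappa> (\<psi> x) Y = dm (x, invc x) (lfield Y x, 0)"
proof -
  have 1: "(x, e0) \<in> \<Omega>" using x by (simp add: e0_\<Omega>)
  have 2: "(x, invc x) \<in> \<Omega>" using x by (simp add: \<Omega>_def invc_def \<phi>_in \<psi>\<phi>)
  have m0: "mulc (x, e0) = x" using x by (simp add: mulc_def \<phi>\<psi>)
  have d1: "((mulc \<circ> (\<lambda>y. (x, y))) has_derivative (dm (x, e0) \<circ> (\<lambda>v. (0, v)))) (at e0)"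
    using dm[OF 1] by (intro diff_chain_at) (auto intro!: derivative_eq_intros)
  have "((mulc \<circ> (\<lambda>y. ((mulc \<circ> (\<lambda>y. (x, y))) y, invc x))) has_derivative
      (dm (x, invc x) \<circ> (\<lambda>v. ((dm (x, e0) \<circ> (\<lambda>v. (0, v))) v, 0)))) (at e0)"
  proof (rule diff_chain_at)
    show "((\<lambda>y. ((mulc \<circ> (\<lambda>y. (x, y))) y, invc x)) has_derivative
      (\<lambda>v. ((dm (x, e0) \<circ> (\<lambda>v. (0, v))) v, 0))) (at e0)"
      by (intro has_derivative_Pair d1) simp
    show "(mulc has_derivative dm (x, invc x)) (at ((mulc \<circ> (\<lambda>y. (x, y))) e0, invc x))"
      using dm[OF 2] by (simp add: m0)
  qed
  moreover have "\<forall>\<^sub>F y in at e0. (mulc \<circ> (\<lambda>y. ((mulc \<circ> (\<lambda>y. (x, y))) y, invc x))) y = conjc (\<psi> x) y"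
  proof -
    have "\<forall>\<^sub>F y in at e0. \<psi> x \<otimes> \<psi> y \<otimes> \<one> \<in> D"
      using x by (intro eventually_\<psi>) (auto simp: open_D \<psi>_in)
    then show ?thesis by eventually_elim (use x in \<open>auto simp: mulc_def conjc_def invc_def \<psi>\<phi>\<close>)
  qed
  ultimately have "(conjc (\<psi> x) has_derivative
      (dm (x, invc x) \<circ> (\<lambda>v. ((dm (x, e0) \<circ> (\<lambda>v. (0, v))) v, 0)))) (at e0)"
    by (rule has_derivative_eventually_eq)
      (use x in \<open>auto simp: m0\<close>, simp add: mulc_def invc_def \<psi>\<phi> e0_def[symmetric])
  then have "Ad G \<kappa> (\<psi> x) = dm (x, invc x) \<circ> (\<lambda>v. ((dm (x, e0) \<circ> (\<lambda>v. (0, v))) v, 0))"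
    using conjc_has_derivative has_derivative_unique by blast
  then show ?thesis by (simp add: lfield_def)
qed

lemma Ad_differentiable: "(\<lambda>x. Ad G \<kappa> (\<psi> x) Y) differentiable (at e0)"
proof -
  obtain invc' where invc': "(invc has_derivative invc') (at e0)"
    using invc_differentiable by (auto simp: differentiable_def)
  have 2: "(e0, invc e0) \<in> \<Omega>" by (simp add: \<Omega>_def invc_def \<phi>_in \<psi>\<phi>)
  have dmd: "(\<lambda>x. dm (x, invc x) v) differentiable (at e0)" for v
  proof -
    have "((\<lambda>p. dm p v) \<circ> (\<lambda>x. (x, invc x))) differentiable (at e0)"
    proof (rule differentiable_chain_at)
      show "(\<lambda>x. (x, invc x)) differentiable (at e0)"
        by (rule differentiableI[OF has_derivative_Pair[OF has_derivative_ident invc']])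
      show "(\<lambda>p. dm p v) differentiable (at (e0, invc e0))"
        by (rule smooth_on_differentiable[OF smooth_dm 2])
    qed
    then show ?thesis by (simp add: o_def)
  qed
  have lfd: "lfield Y differentiable (at e0)"
  proof -
    have "((\<lambda>p. dm p (0, Y)) \<circ> (\<lambda>x. (x, e0))) differentiable (at e0)"
    proof (rule differentiable_chain_at)
      show "(\<lambda>x. (x, e0)) differentiable (at e0)"
        by (auto simp: differentiable_def intro!: exI derivative_eq_intros)
      show "(\<lambda>p. dm p (0, Y)) differentiable (at (e0, e0))"
        by (rule smooth_on_differentiable[OF smooth_dm e0_\<Omega>(1)]) simp
    qed
    then show ?thesis by (simp add: o_def lfield_def[abs_def])
  qed
  \<comment> \<open>The vector fed to \<open>dm\<close> also varies with x. Expanding it in the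
    basis leaves only products of scalar functions with \<open>dm\<close> at fixed vectors, whose
    differentiability is known.\<close>
  have "(\<lambda>x. \<Sum>b\<in>Basis. (lfield Y x \<bullet> b) *\<^sub>R dm (x, invc x) (b, 0)) differentiable (at e0)"
    using lfd dmd by (intro differentiable_sum differentiable_scaleR differentiable_inner) auto
  then obtain f' where f': "((\<lambda>x. \<Sum>b\<in>Basis. (lfield Y x \<bullet> b) *\<^sub>R dm (x, invc x) (b, 0)) has_derivative f') (at e0)"
    by (auto simp: differentiable_def)
  have eq: "(\<Sum>b\<in>Basis. (lfield Y x \<bullet> b) *\<^sub>R dm (x, invc x) (b, 0)) = Ad G \<kappa> (\<psi> x) Y"
    if x: "x \<in> R" "inv (\<psi> x) \<in> D" for x
  proof -
    have "(x, invc x) \<in> \<Omega>" using x by (simp add: \<Omega>_def invc_def \<phi>_in \<psi>\<phi>)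
    then have lin: "linear (\<lambda>v. dm (x, invc x) (v, 0))"
      using linear_compose[OF linearI[of "\<lambda>v. (v, 0)"] linear_dm] by (simp add: o_def)
    have "dm (x, invc x) (lfield Y x, 0) = (\<lambda>v. dm (x, invc x) (v, 0)) (\<Sum>b\<in>Basis. (lfield Y x \<bullet> b) *\<^sub>R b)"
      by (simp add: euclidean_representation)
    also have "\<dots> = (\<Sum>b\<in>Basis. (lfield Y x \<bullet> b) *\<^sub>R dm (x, invc x) (b, 0))"
      by (simp only: linear_sum[OF lin] linear_cmul[OF lin])
    finally show ?thesis using Ad_formula[OF x] by simp
  qed
  have "continuous_on R (\<lambda>x. inv (\<psi> x))" by (intro continuous_intros cont_\<psi>)
  then have "open (R \<inter> (\<lambda>x. inv (\<psi> x)) -` D)"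
    using open_D open_R by (metis continuous_on_open_vimage inf_commute)
  then have "\<forall>\<^sub>F x in at e0. x \<in> R \<inter> (\<lambda>x. inv (\<psi> x)) -` D"
    by (rule eventually_at_in_open') simp
  then have "\<forall>\<^sub>F x in at e0. (\<Sum>b\<in>Basis. (lfield Y x \<bullet> b) *\<^sub>R dm (x, invc x) (b, 0)) = Ad G \<kappa> (\<psi> x) Y"
    by eventually_elim (use eq in auto)
  then have "((\<lambda>x. Ad G \<kappa> (\<psi> x) Y) has_derivative f') (at e0)"
    by (rule has_derivative_eventually_eq[OF f']) (simp add: eq)
  then show ?thesis by (auto simp: differentiable_def)
qed

abbreviation br :: "'a \<Rightarrow> 'a \<Rightarrow> 'a" where "br \<equiv> lie_bracket G \<kappa>"

lemma Ad_has_derivative: "((\<lambda>x. Ad G \<kappa> (\<psi> x) Y) has_derivative (\<lambda>X. br X Y)) (at e0)"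
  using Ad_differentiable[of Y] unfolding frechet_derivative_works lie_bracket_def \<psi>_def e0_def \<phi>_def by simp

lemma linear_br_left: "linear (\<lambda>X. br X Y)"
  using Ad_has_derivative has_derivative_linear by blast

lemma linear_br_right: "linear (br X)"
proof (rule linearI)
  fix Y Z
  have "((\<lambda>x. Ad G \<kappa> (\<psi> x) Y + Ad G \<kappa> (\<psi> x) Z) has_derivative (\<lambda>X. br X Y + br X Z)) (at e0)"
    by (intro derivative_intros Ad_has_derivative)
  then have "(\<lambda>X. br X Y + br X Z) = (\<lambda>X. br X (Y + Z))"
    using has_derivative_unique[OF Ad_has_derivative[of "Y + Z"]] by (simp add: linear_add[OF linear_Ad])
  then show "br X (Y + Z) = br X Y + br X Z" by metis
next
  fix r Y
  have "((\<lambda>x. r *\<^sub>R Ad G \<kappa> (\<psi> x) Y) has_derivative (\<lambda>X. r *\<^sub>R br X Y)) (at e0)"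
    by (intro derivative_intros Ad_has_derivative)
  then have "(\<lambda>X. r *\<^sub>R br X Y) = (\<lambda>X. br X (r *\<^sub>R Y))"
    using has_derivative_unique[OF Ad_has_derivative[of "r *\<^sub>R Y"]] by (simp add: linear_cmul[OF linear_Ad])
  then show "br X (r *\<^sub>R Y) = r *\<^sub>R br X Y" by metis
qed

text \<open>At time 0 this is the definition of the bracket combined with the chain rule;
  multiplicativity of \<open>Ad\<close> moves it to time t.\<close>

lemma Ad_one_par_derivative:
  assumes c: "one_par c X"
  shows "((\<lambda>t. Ad G \<kappa> (c t) Y) has_vector_derivative Ad G \<kappa> (c t) (br X Y)) (at t)"
proof -
  have c': "((\<lambda>t. \<phi> (c t)) has_vector_derivative X) (at 0)" "continuous_on UNIV c"
    using c by (auto simp: one_par_def)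
  have c0: "c 0 = \<one>" using c by (rule one_par_0)
  have "(((\<lambda>x. Ad G \<kappa> (\<psi> x) Y) \<circ> (\<lambda>t. \<phi> (c t))) has_derivative ((\<lambda>X. br X Y) \<circ> (\<lambda>h. h *\<^sub>R X))) (at 0)"
    using c' Ad_has_derivative unfolding has_vector_derivative_def
    by (intro diff_chain_at) (auto simp: c0 e0_def[symmetric])
  moreover have "\<forall>\<^sub>F x in at 0. ((\<lambda>x. Ad G \<kappa> (\<psi> x) Y) \<circ> (\<lambda>t. \<phi> (c t))) x = Ad G \<kappa> (c x) Y"
  proof -
    have "\<forall>\<^sub>F x in at 0. c x \<in> D" using c' c0 by (auto intro!: eventually_in_D)
    then show ?thesis by eventually_elim (auto simp: \<psi>\<phi>)
  qed
  ultimately have "((\<lambda>h. Ad G \<kappa> (c h) Y) has_derivative ((\<lambda>X. br X Y) \<circ> (\<lambda>h. h *\<^sub>R X))) (at 0)"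
    by (rule has_derivative_eventually_eq) (simp add: c0 \<psi>\<phi>)
  then have "((\<lambda>h. Ad G \<kappa> (c h) Y) has_vector_derivative br X Y) (at 0)"
    unfolding has_vector_derivative_def using linear_cmul[OF linear_br_left] by (simp add: o_def)
  then have "((\<lambda>h. Ad G \<kappa> (c t) (Ad G \<kappa> (c h) Y)) has_vector_derivative Ad G \<kappa> (c t) (br X Y)) (at 0)"
    by (rule bounded_linear.has_vector_derivative[OF linear_Ad[unfolded linear_conv_bounded_linear]])
  then have "((\<lambda>h. Ad G \<kappa> (c (t + h)) Y) has_vector_derivative Ad G \<kappa> (c t) (br X Y)) (at 0)"
    using c by (simp add: one_par_def Ad_mult)
  then show ?thesis by (rule has_vector_derivative_shift)
qed

end

text \<open>The diagonal is compact and disjoint from the closed set where f leaves V, hence at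
  positive distance from it. It provides one step size valid for all stages of a homotopy at
  once.\<close>

lemma close_pairs_in_open:
  fixes f :: "real \<times> real \<times> real \<Rightarrow> 'b::topological_space"
  assumes cont: "continuous_on ({0..1} \<times> {0..1} \<times> {0..1}) f" and V: "open V"
    and diag: "\<And>s a. s \<in> {0..1} \<Longrightarrow> a \<in> {0..1} \<Longrightarrow> f (s, a, a) \<in> V"
  shows "\<exists>d>0. \<forall>s\<in>{0..1}. \<forall>a\<in>{0..1}. \<forall>b\<in>{0..1}. \<bar>a - b\<bar> < d \<longrightarrow> f (s, a, b) \<in> V"
proof -
  define K :: "(real \<times> real \<times> real) set" where "K = {0..1} \<times> {0..1} \<times> {0..1}"
  have K: "compact K" unfolding K_def by (intro compact_Times compact_Icc)
  have C: "closed (K \<inter> f -` (- V))"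
    using cont V compact_imp_closed[OF K] unfolding K_def
    by (intro continuous_closed_preimage) auto
  define \<Delta> :: "(real \<times> real \<times> real) set" where "\<Delta> = (\<lambda>(s, a). (s, a, a)) ` ({0..1} \<times> {0..1})"
  have D: "compact \<Delta>"
    unfolding \<Delta>_def case_prod_beta
    by (intro compact_continuous_image continuous_intros compact_Times compact_Icc)
  have "\<Delta> \<inter> (K \<inter> f -` (- V)) = {}" using diag by (auto simp: \<Delta>_def)
  then obtain d where d: "d > 0" "\<And>x y. x \<in> \<Delta> \<Longrightarrow> y \<in> K \<inter> f -` (- V) \<Longrightarrow> d \<le> dist x y"
    using separate_compact_closed[OF D C] by blast
  show ?thesis
  proof (intro exI[of _ d] conjI ballI impI)
    fix s a b :: real assume H: "s \<in> {0..1}" "a \<in> {0..1}" "b \<in> {0..1}" "\<bar>a - b\<bar> < d"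
    show "f (s, a, b) \<in> V"
    proof (rule ccontr)
      assume "f (s, a, b) \<notin> V"
      then have "(s, a, b) \<in> K \<inter> f -` (- V)" using H by (auto simp: K_def)
      moreover have "(s, a, a) \<in> \<Delta>" unfolding \<Delta>_def using H by (auto intro!: image_eqI[of _ _ "(s, a)"])
      ultimately have "d \<le> dist (s, a, a) (s, a, b)" using d(2) by blast
      then show False using H by (simp add: dist_Pair_Pair dist_real_def)
    qed
  qed (rule d(1))
qed

section \<open>The exponential map: the adjoint series and products of commuting
  exponentials\<close>

locale lie_exp = lie_chart G \<A> \<kappa>
  for G :: "'g::{t2_space,second_countable_topology} monoid" (structure)
    and \<A> :: "('g, 'a::euclidean_space) chart set" and \<kappa> +
  fixes expo :: "'a \<Rightarrow> 'g"
  assumes expm: "exponential_map G \<kappa> expo"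
begin

lemma expo_one_par: "one_par (\<lambda>t. expo (t *\<^sub>R Y)) Y"
  using expm unfolding exponential_map_def one_par_def \<phi>_def by blast

lemma one_par_expo: "one_par c Y \<Longrightarrow> c t = expo (t *\<^sub>R Y)"
  using one_par_unique expo_one_par by blast

lemma expo_0 [simp]: "expo 0 = \<one>"
  using one_par_0[OF expo_one_par, of 0] by simp

lemma expo_add_scale: "expo ((s + t) *\<^sub>R Y) = expo (s *\<^sub>R Y) \<otimes> expo (t *\<^sub>R Y)"
  using expo_one_par[of Y] unfolding one_par_def by blast

lemma expo_conj: "expo (Ad G \<kappa> g Y) = g \<otimes> expo Y \<otimes> inv g"
  using one_par_expo[OF one_par_conj[OF expo_one_par[of Y]], of g 1] by simp

lemma one_par_tangent_unique: "one_par c Y \<Longrightarrow> one_par c Z \<Longrightarrow> Y = Z"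
  unfolding one_par_def by (meson vector_derivative_unique_at)

text \<open>Conjugation by exp (t Y) fixes every exp (s Y), and a one-parameter subgroup determines
  its tangent vector.\<close>

lemma Ad_expo_self: "Ad G \<kappa> (expo (t *\<^sub>R Y)) Y = Y"
proof -
  have "expo (t *\<^sub>R Y) \<otimes> expo (s *\<^sub>R Y) \<otimes> inv (expo (t *\<^sub>R Y)) = expo (s *\<^sub>R Y)" for s
    by (metis add.commute expo_add_scale inv_mult(2) mult_assoc one_mult(2))
  then have "one_par (\<lambda>s. expo (s *\<^sub>R Y)) (Ad G \<kappa> (expo (t *\<^sub>R Y)) Y)"
    using one_par_conj[OF expo_one_par[of Y], of "expo (t *\<^sub>R Y)"] by simp
  then show ?thesis using one_par_tangent_unique expo_one_par by blast
qed

lemma br_self: "br Y Y = 0"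
proof -
  have "((\<lambda>t::real. Y) has_vector_derivative br Y Y) (at 0)"
    using Ad_one_par_derivative[OF expo_one_par[of Y], of Y 0] by (simp add: Ad_expo_self Ad_one)
  moreover have "((\<lambda>t::real. Y) has_vector_derivative 0) (at 0)" by (rule has_vector_derivative_const)
  ultimately show ?thesis by (rule vector_derivative_unique_at)
qed

lemma br_antisym: "br Y Z = - br Z Y"
proof -
  have "br (Y + Z) (Y + Z) = br Y Y + br Y Z + (br Z Y + br Z Z)"
    by (simp add: linear_add[OF linear_br_left] linear_add[OF linear_br_right])
  then show ?thesis by (simp add: br_self eq_neg_iff_add_eq_0)
qed

text \<open>The terminating series of exp (t ad Y). Differentiating in t raises j by one on both
  sides, so descending induction on j shows that the two sides have equal derivatives; they agree at
  t = 0.\<close>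

lemma Ad_expo_power:
  assumes k: "(br Y ^^ k) Z = 0" and j: "j \<le> k"
  shows "Ad G \<kappa> (expo (t *\<^sub>R Y)) ((br Y ^^ j) Z) = (\<Sum>i<k - j. (t ^ i / fact i) *\<^sub>R (br Y ^^ (i + j)) Z)"
  using j
proof (induction "k - j" arbitrary: j t)
  case 0
  then have "j = k" by linarith
  then show ?case by (simp only: k linear_0[OF linear_Ad] diff_self_eq_0 lessThan_0 sum.empty)
next
  case (Suc m)
  then have m: "m = k - Suc j" "Suc j \<le> k" "k - j = Suc m" by auto
  define F where "F t = Ad G \<kappa> (expo (t *\<^sub>R Y)) ((br Y ^^ j) Z)" for t
  define Q where "Q t = (\<Sum>i<k - j. (t ^ i / fact i) *\<^sub>R (br Y ^^ (i + j)) Z)" for t :: real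
  have "((\<lambda>t. F t - Q t) has_vector_derivative 0) (at t within UNIV)" for t
  proof -
    have "(F has_vector_derivative Ad G \<kappa> (expo (t *\<^sub>R Y)) (br Y ((br Y ^^ j) Z))) (at t)"
      unfolding F_def by (rule Ad_one_par_derivative[OF expo_one_par])
    also have "br Y ((br Y ^^ j) Z) = (br Y ^^ Suc j) Z" by simp
    also have "Ad G \<kappa> (expo (t *\<^sub>R Y)) ((br Y ^^ Suc j) Z) = (\<Sum>i<m. (t ^ i / fact i) *\<^sub>R (br Y ^^ (i + Suc j)) Z)"
      using Suc.hyps(1)[OF m(1,2)] m by simp
    finally have 1: "(F has_vector_derivative (\<Sum>i<m. (t ^ i / fact i) *\<^sub>R (br Y ^^ (i + Suc j)) Z)) (at t)" .
    have "Q = (\<lambda>t. (br Y ^^ j) Z + (\<Sum>i<m. (t ^ Suc i / fact (Suc i)) *\<^sub>R (br Y ^^ (Suc i + j)) Z))"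
      unfolding Q_def m(3) by (subst sum.lessThan_Suc_shift) simp
    moreover have "((\<lambda>t. (t ^ Suc i / fact (Suc i)) *\<^sub>R W) has_vector_derivative (t ^ i / fact i) *\<^sub>R W) (at t)"
      for i and W :: 'a
    proof -
      have "((\<lambda>t. t ^ Suc i / fact (Suc i)) has_real_derivative (real (Suc i) * t ^ i / fact (Suc i))) (at t)"
        by (auto intro!: derivative_eq_intros simp del: power_Suc fact_Suc)
      also have "real (Suc i) * t ^ i / fact (Suc i) = t ^ i / fact i"
        by (simp add: fact_Suc field_simps del: of_nat_Suc)
      finally have "((\<lambda>t. (t ^ Suc i / fact (Suc i)) *\<^sub>R W) has_vector_derivative
          (t ^ Suc i / fact (Suc i)) *\<^sub>R 0 + (t ^ i / fact i) *\<^sub>R W) (at t)"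
        by (intro has_vector_derivative_scaleR has_vector_derivative_const)
      then show ?thesis by simp
    qed
    then have "((\<lambda>t. (br Y ^^ j) Z + (\<Sum>i<m. (t ^ Suc i / fact (Suc i)) *\<^sub>R (br Y ^^ (Suc i + j)) Z))
      has_vector_derivative 0 + (\<Sum>i<m. (t ^ i / fact i) *\<^sub>R (br Y ^^ (Suc i + j)) Z)) (at t)"
      by (intro has_vector_derivative_add has_vector_derivative_const has_vector_derivative_sum)
    ultimately have "(Q has_vector_derivative (\<Sum>i<m. (t ^ i / fact i) *\<^sub>R (br Y ^^ (i + Suc j)) Z)) (at t)"
      by simp
    from has_vector_derivative_diff[OF 1 this] show ?thesis by simp
  qed
  then obtain c where c: "\<And>t. F t - Q t = c"
    using has_vector_derivative_zero_constant[of UNIV "\<lambda>t. F t - Q t"] by auto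
  have "F 0 = (br Y ^^ j) Z" by (simp add: F_def Ad_one)
  moreover have "Q 0 = (br Y ^^ j) Z"
    unfolding Q_def m(3) by (subst sum.lessThan_Suc_shift) simp
  ultimately have "c = 0" using c[of 0] by simp
  then show ?case using c[of t] by (simp add: F_def Q_def)
qed

lemma Ad_expo_commuting: "br Y Z = 0 \<Longrightarrow> Ad G \<kappa> (expo (t *\<^sub>R Y)) Z = Z"
  using Ad_expo_power[of 1 Y Z 0 t] by simp

text \<open>A vanishing bracket makes the two one-parameter groups commute, so their product is
  again a one-parameter subgroup. Its velocity is Y + Z by \<open>dm_e0\<close>, and uniqueness
  identifies it.\<close>

lemma expo_add:
  assumes "br Y Z = 0"
  shows "expo (Y + Z) = expo Y \<otimes> expo Z"
proof -
  have com: "expo (s *\<^sub>R Y) \<otimes> expo (t *\<^sub>R Z) = expo (t *\<^sub>R Z) \<otimes> expo (s *\<^sub>R Y)" for s t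
  proof -
    have "expo (t *\<^sub>R Z) = expo (Ad G \<kappa> (expo (s *\<^sub>R Y)) (t *\<^sub>R Z))"
      by (simp add: linear_cmul[OF linear_Ad] Ad_expo_commuting[OF assms])
    then show ?thesis unfolding expo_conj by (metis inv_mult(1) mult_assoc one_mult(2))
  qed
  have "one_par (\<lambda>t. expo (t *\<^sub>R Y) \<otimes> expo (t *\<^sub>R Z)) (Y + Z)"
    unfolding one_par_def
  proof (intro conjI allI)
    fix s t
    show "expo ((s + t) *\<^sub>R Y) \<otimes> expo ((s + t) *\<^sub>R Z) =
       expo (s *\<^sub>R Y) \<otimes> expo (s *\<^sub>R Z) \<otimes> (expo (t *\<^sub>R Y) \<otimes> expo (t *\<^sub>R Z))"
      unfolding expo_add_scale by (metis com mult_assoc)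
  next
    show "continuous_on UNIV (\<lambda>t. expo (t *\<^sub>R Y) \<otimes> expo (t *\<^sub>R Z))"
      using expo_one_par unfolding one_par_def by (intro continuous_intros) auto
    have "((\<lambda>t. \<phi> (expo (t *\<^sub>R Y) \<otimes> expo (t *\<^sub>R Z))) has_vector_derivative
       dm (\<phi> (expo (0 *\<^sub>R Y)), \<phi> (expo (0 *\<^sub>R Z))) (Y, Z)) (at 0)"
      using expo_one_par unfolding one_par_def by (intro curve_mult_derivative) auto
    then show "((\<lambda>t. \<phi> (expo (t *\<^sub>R Y) \<otimes> expo (t *\<^sub>R Z))) has_vector_derivative Y + Z) (at 0)"
      by (simp add: e0_def[symmetric] dm_e0)
  qed
  from one_par_expo[OF this, of 1] show ?thesis by simp
qed

lemma product_has_derivative_0: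
  fixes a b :: "'b::real_normed_vector \<Rightarrow> 'g"
  assumes a: "((\<lambda>t. \<phi> (a t)) has_derivative a') (at 0)" "continuous_on UNIV a" "a 0 = \<one>"
    and b: "((\<lambda>t. \<phi> (b t)) has_derivative b') (at 0)" "continuous_on UNIV b" "b 0 = \<one>"
  shows "((\<lambda>t. \<phi> (a t \<otimes> b t)) has_derivative (\<lambda>h. a' h + b' h)) (at 0)"
proof -
  have "((mulc \<circ> (\<lambda>t. (\<phi> (a t), \<phi> (b t)))) has_derivative
      (dm (e0, e0) \<circ> (\<lambda>h. (a' h, b' h)))) (at 0)"
  proof (rule diff_chain_at)
    show "((\<lambda>t. (\<phi> (a t), \<phi> (b t))) has_derivative (\<lambda>h. (a' h, b' h))) (at 0)"
      by (intro has_derivative_Pair a b)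
    show "(mulc has_derivative dm (e0, e0)) (at (\<phi> (a 0), \<phi> (b 0)))"
      using dm[OF e0_\<Omega>(1)[OF e0_R]] a b by (simp add: e0_def)
  qed
  moreover have "\<forall>\<^sub>F x in at 0. (mulc \<circ> (\<lambda>t. (\<phi> (a t), \<phi> (b t)))) x = \<phi> (a x \<otimes> b x)"
  proof -
    have ev: "\<forall>\<^sub>F x in at 0. f x \<in> D" if "continuous_on UNIV f" "f 0 = \<one>" for f :: "'b \<Rightarrow> 'g"
    proof -
      have "open (f -` D)"
        using that(1) open_D by (auto simp: continuous_on_open_vimage[OF open_UNIV])
      then have "\<forall>\<^sub>F x in at 0. x \<in> f -` D"
        by (rule eventually_at_in_open') (simp add: that(2))
      then show ?thesis by simp
    qed
    from ev[OF a(2,3)] ev[OF b(2,3)] show ?thesis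
      by eventually_elim (auto simp: mulc_def \<psi>\<phi>)
  qed
  ultimately have "((\<lambda>t. \<phi> (a t \<otimes> b t)) has_derivative
      (dm (e0, e0) \<circ> (\<lambda>h. (a' h, b' h)))) (at 0)"
    by (rule has_derivative_eventually_eq) (use a b in \<open>auto simp: mulc_def \<psi>\<phi>\<close>)
  then show ?thesis by (simp add: o_def dm_e0)
qed

lemma open_left_translate: "open U \<Longrightarrow> open ((\<lambda>g. a \<otimes> g) ` U)"
proof -
  assume U: "open U"
  have "(\<lambda>g. a \<otimes> g) ` U = (\<lambda>g. inv a \<otimes> g) -` U"
    by (auto intro!: image_eqI[of _ _ "inv a \<otimes> _"])
  moreover have "continuous_on UNIV (\<lambda>g. inv a \<otimes> g)" by (intro continuous_intros)
  ultimately show ?thesis using U by (simp add: continuous_on_open_vimage[OF open_UNIV])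
qed

end

section \<open>Malcev coordinates of the second kind\<close>

locale malcev = lie_exp G \<A> \<kappa> expo
  for G :: "'g::{t2_space,second_countable_topology} monoid" (structure)
    and \<A> :: "('g, 'a::euclidean_space) chart set" and \<kappa> and expo +
  fixes \<mm> :: "'a set" and X :: "nat \<Rightarrow> 'a" and n :: nat
  assumes n_dim: "n = DIM('a)" and nilp: "nilpotent_algebra (lie_bracket G \<kappa>)"
    and malcev_basis: "strong_malcev_basis (lie_bracket G \<kappa>) X"
    and mm_ideal: "codim_one_abelian_ideal (lie_bracket G \<kappa>) \<mm>"
    and mm_span: "\<mm> = span (X ` {1..n - 1})"
    and conn: "connected (UNIV :: 'g set)" and sconn: "simply_connected (UNIV :: 'g set)"
begin

abbreviation "co \<equiv> dual_vec X"

lemma n_pos: "n \<ge> 1" using DIM_positive[where 'a='a] n_dim by linarith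

lemma basis: "inj_on X {1..n}" "independent (X ` {1..n})" "span (X ` {1..n}) = UNIV"
  "\<And>i. i \<in> {1..n} \<Longrightarrow> lie_ideal br (span (X ` {1..i}))"
  using malcev_basis unfolding strong_malcev_basis_def n_dim by auto

lemma linear_co: "linear (co i)"
  unfolding dual_vec_def n_dim[symmetric]
  by (rule linearI) (simp_all add: representation_add representation_scale basis del: One_nat_def)

lemma co_X: "i \<in> {1..n} \<Longrightarrow> j \<in> {1..n} \<Longrightarrow> co i (X j) = (if i = j then 1 else 0)"
  unfolding dual_vec_def n_dim[symmetric]
  using representation_basis[OF basis(2), of "X j"] basis(1) by (auto dest: inj_onD)

lemma co_expand: "(\<Sum>i\<in>{1..n}. co i v *\<^sub>R X i) = v"
proof -
  have "(\<Sum>b\<in>X ` {1..n}. representation (X ` {1..n}) v b *\<^sub>R b) = v"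
    by (rule sum_representation_eq) (simp_all add: basis del: One_nat_def)
  then show ?thesis
    unfolding sum.reindex[OF basis(1)] by (simp add: dual_vec_def n_dim[symmetric])
qed

lemma co_sum: "i \<in> {1..n} \<Longrightarrow> S \<subseteq> {1..n} \<Longrightarrow> co i (\<Sum>j\<in>S. c j *\<^sub>R X j) = (if i \<in> S then c i else 0)"
proof -
  assume i: "i \<in> {1..n}" and S: "S \<subseteq> {1..n}"
  have "finite S" using S finite_subset by blast
  have "co i (\<Sum>j\<in>S. c j *\<^sub>R X j) = (\<Sum>j\<in>S. c j * co i (X j))"
    by (simp add: linear_sum[OF linear_co] linear_cmul[OF linear_co])
  also have "\<dots> = (\<Sum>j\<in>S. if j = i then c i else 0)"
    using i S by (intro sum.cong) (auto simp: co_X)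
  finally show ?thesis using \<open>finite S\<close> by simp
qed

lemma continuous_co [continuous_intros]: "continuous_on S f \<Longrightarrow> continuous_on S (\<lambda>x. co i (f x))"
  by (rule bounded_linear.continuous_on[OF linear_co[unfolded linear_conv_bounded_linear]])

definition "\<tau> v = co n v"
definition "\<pi> v = v - \<tau> v *\<^sub>R X n"

lemma linear_\<tau>: "linear \<tau>" unfolding \<tau>_def[abs_def] by (rule linear_co)
lemma \<tau>_simps [simp]: "\<tau> (v + w) = \<tau> v + \<tau> w" "\<tau> (v - w) = \<tau> v - \<tau> w" "\<tau> (r *\<^sub>R v) = r * \<tau> v"
   "\<tau> 0 = 0" "\<tau> (- v) = - \<tau> v" "\<tau> (X n) = 1"
  using linear_add[OF linear_\<tau>] linear_diff[OF linear_\<tau>] linear_cmul[OF linear_\<tau>] linear_0[OF linear_\<tau>]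
    linear_neg[OF linear_\<tau>] co_X[of n n] n_pos by (auto simp: \<tau>_def)
lemma \<pi>_simps [simp]: "\<pi> (v + w) = \<pi> v + \<pi> w" "\<pi> (r *\<^sub>R v) = r *\<^sub>R \<pi> v" "\<pi> 0 = 0" "\<pi> (X n) = 0" "\<tau> (\<pi> v) = 0"
  by (auto simp: \<pi>_def algebra_simps)
lemma \<pi>_\<tau>: "v = \<pi> v + \<tau> v *\<^sub>R X n" by (simp add: \<pi>_def)
lemma continuous_\<tau> [continuous_intros]: "continuous_on S f \<Longrightarrow> continuous_on S (\<lambda>x. \<tau> (f x))"
  unfolding \<tau>_def by (intro continuous_intros)

lemma \<pi>_sum: "\<pi> v = (\<Sum>i\<in>{1..n - 1}. co i v *\<^sub>R X i)"
proof -
  have "{1..n} = insert n {1..n - 1}" using n_pos by auto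
  then have "v = co n v *\<^sub>R X n + (\<Sum>i\<in>{1..n - 1}. co i v *\<^sub>R X i)"
    using co_expand[of v] n_pos by simp
  then show ?thesis by (simp only: \<pi>_def \<tau>_def) (metis add_diff_cancel_left')
qed

lemma mm_iff: "v \<in> \<mm> \<longleftrightarrow> \<tau> v = 0"
proof
  assume "v \<in> \<mm>"
  moreover have "span (X ` {1..n - 1}) \<subseteq> {v. \<tau> v = 0}"
  proof (rule span_minimal)
    show "X ` {1..n - 1} \<subseteq> {v. \<tau> v = 0}" using n_pos by (auto simp: \<tau>_def co_X)
    show "subspace {v. \<tau> v = 0}" by (auto simp: subspace_def)
  qed
  ultimately show "\<tau> v = 0" using mm_span by auto
next
  assume "\<tau> v = 0"
  then have "v = (\<Sum>i\<in>{1..n - 1}. co i v *\<^sub>R X i)" using \<pi>_sum[of v] by (simp add: \<pi>_def)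
  moreover have "(\<Sum>i\<in>{1..n - 1}. co i v *\<^sub>R X i) \<in> span (X ` {1..n - 1})"
    by (intro span_sum span_scale span_base) auto
  ultimately show "v \<in> \<mm>" using mm_span by simp
qed

lemma mm_abelian: "\<tau> v = 0 \<Longrightarrow> \<tau> w = 0 \<Longrightarrow> br v w = 0"
  using mm_ideal unfolding codim_one_abelian_ideal_def abelian_subalgebra_def by (simp add: mm_iff)

lemma mm_is_ideal: "\<tau> w = 0 \<Longrightarrow> \<tau> (br v w) = 0"
  using mm_ideal unfolding codim_one_abelian_ideal_def lie_ideal_def by (simp add: mm_iff)

text \<open>Because the ideal is abelian, this one nilpotent operator determines the whole
  bracket.\<close>

definition "ad = br (X n)"

lemma linear_ad: "linear ad" unfolding ad_def by (rule linear_br_right)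

lemma ad_Xn [simp]: "ad (X n) = 0" by (simp add: ad_def br_self)

lemma \<tau>_ad [simp]: "\<tau> (ad v) = 0"
proof -
  have "ad v = ad (\<pi> v)"
    by (subst \<pi>_\<tau>[of v]) (simp add: linear_add[OF linear_ad] linear_cmul[OF linear_ad])
  then show ?thesis using mm_is_ideal[of "\<pi> v"] by (simp add: ad_def)
qed

lemma ad_pow_lower_central: "(ad ^^ k) v \<in> lower_central br k"
  by (induction k) (auto simp: ad_def intro!: span_base)

definition "nil = (SOME k. lower_central br k = {0})"

lemma ad_nil [simp]: "(ad ^^ nil) v = 0"
proof -
  have "lower_central br nil = {0}"
    using nilp unfolding nilpotent_algebra_def nil_def by (rule someI_ex)
  then show ?thesis using ad_pow_lower_central[of nil v] by auto
qed

lemma linear_ad_pow: "linear (ad ^^ k)"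
proof (induction k)
  case (Suc k)
  have "linear (ad \<circ> (ad ^^ k))" by (rule linear_compose[OF Suc linear_ad])
  then show ?case by (simp add: o_def)
qed (simp add: linear_id[unfolded id_def])

lemma ad_nil_ge: "k \<ge> nil \<Longrightarrow> (ad ^^ k) v = 0"
proof -
  assume "k \<ge> nil"
  then have "(ad ^^ k) v = (ad ^^ (k - nil)) ((ad ^^ nil) v)"
    by (metis comp_apply funpow_add le_add_diff_inverse2)
  then show ?thesis by (simp add: linear_0[OF linear_ad_pow])
qed

definition "Af t v = Ad G \<kappa> (expo (t *\<^sub>R X n)) v"

lemma Af_eq: "Af t v = (\<Sum>i<nil. (t ^ i / fact i) *\<^sub>R (ad ^^ i) v)"
  using Ad_expo_power[of nil "X n" v 0 t] ad_nil[of v] unfolding Af_def ad_def by simp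

lemma linear_Af: "linear (Af t)" unfolding Af_def by (rule linear_Ad)

lemma Af_simps [simp]: "Af t (v + w) = Af t v + Af t w" "Af t (v - w) = Af t v - Af t w"
  "Af t (r *\<^sub>R v) = r *\<^sub>R Af t v" "Af t 0 = 0" "Af t (- v) = - Af t v"
  using linear_add[OF linear_Af] linear_diff[OF linear_Af] linear_cmul[OF linear_Af]
    linear_0[OF linear_Af] linear_neg[OF linear_Af] by auto

lemma Af_add: "Af (s + t) v = Af s (Af t v)"
  unfolding Af_def by (simp add: expo_add_scale Ad_mult)

lemma Af_0 [simp]: "Af 0 v = v" unfolding Af_def by (simp add: Ad_one)

lemma Af_inverse [simp]: "Af t (Af (- t) v) = v" "Af (- t) (Af t v) = v"
  using Af_add[of t "-t"] Af_add[of "-t" t] by simp_all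

lemma Af_Xn [simp]: "Af t (X n) = X n" unfolding Af_def by (rule Ad_expo_self)

lemma nil_pos: "nil > 0"
proof (rule ccontr)
  assume "\<not> nil > 0"
  then have "X n = 0" using ad_nil[of "X n"] by simp
  then show False using \<tau>_simps(6) \<tau>_simps(4) by simp
qed

lemma \<tau>_Af [simp]: "\<tau> (Af t v) = \<tau> v"
proof -
  have "Af t v = Af t (\<pi> v) + \<tau> v *\<^sub>R X n"
    by (subst \<pi>_\<tau>[of v]) simp
  moreover have "\<tau> (Af t w) = 0" if "\<tau> w = 0" for w
  proof -
    have "\<tau> ((ad ^^ i) w) = 0" for i using that by (induction i) auto
    then show ?thesis unfolding Af_eq linear_sum[OF linear_\<tau>] by simp
  qed
  ultimately show ?thesis by simp
qed

lemma \<pi>_Af: "\<pi> (Af t v) = Af t (\<pi> v)" by (simp add: \<pi>_def)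

lemma continuous_Af [continuous_intros]:
  assumes "continuous_on S f" "continuous_on S g"
  shows "continuous_on S (\<lambda>x. Af (f x) (g x))"
proof -
  have "continuous_on S (\<lambda>x. (ad ^^ i) (g x))" for i
    by (rule bounded_linear.continuous_on[OF linear_ad_pow[unfolded linear_conv_bounded_linear] assms(2)])
  then show ?thesis unfolding Af_eq by (intro continuous_intros assms) auto
qed

text \<open>The group law and the inverse in the coordinates \<open>E\<close> below: in \<open>G = M \<rtimes> exp (\<real> X\<^sub>n)\<close> only the action of the
  second factor on the abelian ideal enters.\<close>

definition "star v w = v + Af (\<tau> v) w"
definition "starinv v = - Af (- \<tau> v) v"

lemma star_simps [simp]: "star v 0 = v" "star 0 v = v" "star v (starinv v) = 0" "star (starinv v) v = 0"
  "\<tau> (star v w) = \<tau> v + \<tau> w" "\<tau> (starinv v) = - \<tau> v"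
  by (auto simp: star_def starinv_def)

lemma star_assoc: "star (star u v) w = star u (star v w)"
  by (simp add: star_def Af_add algebra_simps)

lemma star_cancel [simp]: "star (starinv v) (star v w) = w" "star v (star (starinv v) w) = w"
  by (simp_all add: star_assoc[symmetric])

lemma starinv_star: "star (starinv v) w = Af (- \<tau> v) (w - v)"
  by (simp add: star_def starinv_def)

lemma continuous_star [continuous_intros]:
  assumes "continuous_on S f" "continuous_on S g"
  shows "continuous_on S (\<lambda>x. star (f x) (g x))"
  unfolding star_def by (intro continuous_intros assms)

lemma continuous_starinv [continuous_intros]:
  assumes "continuous_on S f"
  shows "continuous_on S (\<lambda>x. starinv (f x))"
  unfolding starinv_def by (intro continuous_intros assms)

definition "E v = expo (\<pi> v) \<otimes> expo (\<tau> v *\<^sub>R X n)"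

lemma expo_mm: "\<tau> v = 0 \<Longrightarrow> \<tau> w = 0 \<Longrightarrow> expo (v + w) = expo v \<otimes> expo w"
  by (rule expo_add) (rule mm_abelian)

text \<open>Moving exp (\<tau> v X_n) to the right past exp (\<pi> w) conjugates the latter, which
  applies \<open>Af (\<tau> v)\<close> to its logarithm; the remaining factors add up inside the
  abelian ideal and along X_n.\<close>

lemma E_mult: "E v \<otimes> E w = E (star v w)"
proof -
  let ?g = "expo (\<tau> v *\<^sub>R X n)"
  have "?g \<otimes> expo (\<pi> w) = expo (Af (\<tau> v) (\<pi> w)) \<otimes> ?g"
    unfolding Af_def expo_conj by (simp add: mult_assoc)
  then have "E v \<otimes> E w = expo (\<pi> v) \<otimes> expo (Af (\<tau> v) (\<pi> w)) \<otimes> (?g \<otimes> expo (\<tau> w *\<^sub>R X n))"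
    unfolding E_def by (metis mult_assoc)
  also have "\<dots> = E (star v w)"
    unfolding E_def by (simp add: star_def expo_mm[symmetric] expo_add_scale[symmetric] \<pi>_Af)
  finally show ?thesis .
qed

lemma E_0 [simp]: "E 0 = \<one>" by (simp add: E_def)

lemma E_inv: "inv (E v) = E (starinv v)"
  by (rule inv_eqI) (simp add: E_mult)

lemma E_mm: "\<tau> v = 0 \<Longrightarrow> E v = expo v" by (simp add: E_def \<pi>_def)
lemma E_Xn: "E (t *\<^sub>R X n) = expo (t *\<^sub>R X n)" by (simp add: E_def)

lemma expo_co:
  "continuous_on UNIV (\<lambda>v. expo (co i v *\<^sub>R Y))"
  "((\<lambda>v. \<phi> (expo (co i v *\<^sub>R Y))) has_derivative (\<lambda>h. co i h *\<^sub>R Y)) (at 0)"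
proof -
  have o: "continuous_on UNIV (\<lambda>t. expo (t *\<^sub>R Y))"
    "((\<lambda>t. \<phi> (expo (t *\<^sub>R Y))) has_derivative (\<lambda>h. h *\<^sub>R Y)) (at 0)"
    using expo_one_par[of Y] unfolding one_par_def has_vector_derivative_def by auto
  show "continuous_on UNIV (\<lambda>v. expo (co i v *\<^sub>R Y))"
    by (rule continuous_on_compose2[OF o(1)]) (auto intro!: continuous_intros)
  have "((\<lambda>t. \<phi> (expo (t *\<^sub>R Y))) \<circ> co i has_derivative (\<lambda>h. h *\<^sub>R Y) \<circ> co i) (at 0)"
    using o(2) linear_imp_has_derivative[OF linear_co]
    by (intro diff_chain_at) (auto simp: linear_0[OF linear_co])
  then show "((\<lambda>v. \<phi> (expo (co i v *\<^sub>R Y))) has_derivative (\<lambda>h. co i h *\<^sub>R Y)) (at 0)"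
    by (simp add: o_def)
qed

text \<open>The definition of \<open>expo\<close> gives continuity and derivatives only along single
  lines. In the abelian ideal the exponential of a sum is a product of such lines, so both
  properties are assembled one basis vector at a time.\<close>

lemma expo_partial_sum:
  assumes "k \<le> n - 1"
  shows "continuous_on UNIV (\<lambda>v. expo (\<Sum>i\<in>{1..k}. co i v *\<^sub>R X i)) \<and>
    ((\<lambda>v. \<phi> (expo (\<Sum>i\<in>{1..k}. co i v *\<^sub>R X i))) has_derivative (\<lambda>h. \<Sum>i\<in>{1..k}. co i h *\<^sub>R X i)) (at 0)"
  using assms
proof (induction k)
  case (Suc k)
  have \<tau>X: "\<tau> (X i) = 0" if "i \<in> {1..n - 1}" for i 
  proof -
    have "i \<in> {1..n}" "n \<in> {1..n}" "n \<noteq> i" using that n_pos by auto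
    then show ?thesis by (simp add: \<tau>_def co_X)
  qed
  have "\<tau> (\<Sum>i\<in>{1..k}. co i v *\<^sub>R X i) = 0" for v
    using Suc.prems by (auto simp: linear_sum[OF linear_\<tau>] \<tau>X intro!: sum.neutral)
  then have eq: "expo (\<Sum>i\<in>{1..Suc k}. co i v *\<^sub>R X i)
     = expo (\<Sum>i\<in>{1..k}. co i v *\<^sub>R X i) \<otimes> expo (co (Suc k) v *\<^sub>R X (Suc k))" for v
    using \<tau>X[of "Suc k"] Suc.prems by (simp add: expo_mm)
  have IH: "continuous_on UNIV (\<lambda>v. expo (\<Sum>i\<in>{1..k}. co i v *\<^sub>R X i))"
    "((\<lambda>v. \<phi> (expo (\<Sum>i\<in>{1..k}. co i v *\<^sub>R X i))) has_derivative (\<lambda>h. \<Sum>i\<in>{1..k}. co i h *\<^sub>R X i)) (at 0)"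
    using Suc by auto
  have "((\<lambda>v. \<phi> (expo (\<Sum>i\<in>{1..k}. co i v *\<^sub>R X i) \<otimes> expo (co (Suc k) v *\<^sub>R X (Suc k)))) has_derivative
     (\<lambda>h. (\<Sum>i\<in>{1..k}. co i h *\<^sub>R X i) + co (Suc k) h *\<^sub>R X (Suc k))) (at 0)"
    by (rule product_has_derivative_0[OF IH(2,1) _ expo_co(2,1)]) (simp_all add: linear_0[OF linear_co])
  then show ?case
    unfolding eq using IH(1) expo_co(1) by (auto intro!: continuous_intros)
qed simp

lemma continuous_E: "continuous_on UNIV E"
  and E_derivative: "((\<lambda>v. \<phi> (E v)) has_derivative (\<lambda>h. h)) (at 0)"
proof -
  have *: "continuous_on UNIV (\<lambda>v. expo (\<pi> v))" "((\<lambda>v. \<phi> (expo (\<pi> v))) has_derivative \<pi>) (at 0)"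
    using expo_partial_sum[of "n - 1"] unfolding \<pi>_sum[symmetric] by auto
  show "continuous_on UNIV E"
    unfolding E_def[abs_def] \<tau>_def using * expo_co(1) by (intro continuous_intros)
  have "((\<lambda>v. \<phi> (E v)) has_derivative (\<lambda>h. \<pi> h + co n h *\<^sub>R X n)) (at 0)"
    unfolding E_def \<tau>_def
    by (rule product_has_derivative_0[OF *(2,1) _ expo_co(2,1)]) (simp_all add: linear_0[OF linear_co])
  then show "((\<lambda>v. \<phi> (E v)) has_derivative (\<lambda>h. h)) (at 0)"
    by (simp add: \<pi>_def \<tau>_def)
qed

section \<open>Bijectivity of the coordinate map: open subgroup, local injectivity, lifting of
  homotopies\<close>

lemma E_nbhd_one:
  assumes "open U" "0 \<in> U"
  shows "\<exists>W. open W \<and> \<one> \<in> W \<and> W \<subseteq> E ` U"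
proof -
  define S where "S = E -` D"
  have S: "open S" "0 \<in> S"
    using continuous_E open_D by (auto simp: S_def continuous_on_open_vimage[OF open_UNIV])
  have cf: "continuous_on S (\<lambda>v. \<phi> (E v))"
    by (rule continuous_on_compose2[OF cont_\<phi> continuous_on_subset[OF continuous_E]]) (auto simp: S_def)
  \<comment> \<open>The derivative is known at 0 alone; for a continuous map with an invertible
    derivative at one point the image of a neighbourhood still has the image point in its
    interior.\<close>
  have "\<phi> (E 0) \<in> interior ((\<lambda>v. \<phi> (E v)) ` (U \<inter> S))"
    by (rule sussmann_open_mapping[OF S(1) cf S(2) E_derivative bounded_linear_ident])
      (use assms S in \<open>auto simp: o_def id_def interior_open open_Int\<close>)
  define J where "J = interior ((\<lambda>v. \<phi> (E v)) ` (U \<inter> S))"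
  have "open (D \<inter> \<phi> -` J)"
    using cont_\<phi> open_D unfolding J_def by (metis continuous_on_open_vimage inf_commute open_interior)
  moreover have "\<one> \<in> D \<inter> \<phi> -` J" using \<open>\<phi> (E 0) \<in> _\<close> by (simp add: J_def)
  moreover have "D \<inter> \<phi> -` J \<subseteq> E ` U"
  proof
    fix g assume g: "g \<in> D \<inter> \<phi> -` J"
    then obtain v where "v \<in> U" "v \<in> S" "\<phi> g = \<phi> (E v)"
      using interior_subset unfolding J_def by blast
    then have "g = E v" using g \<psi>\<phi> unfolding S_def by (metis IntD1 vimageE)
    then show "g \<in> E ` U" using \<open>v \<in> U\<close> by blast
  qed
  ultimately show ?thesis by blast
qed

text \<open>Homogeneity: \<open>star v\<close> moves the claim at \<open>E v\<close> to the
  identity.\<close>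

lemma E_open:
  assumes "open U"
  shows "open (E ` U)"
proof (rule Topological_Spaces.openI)
  fix g assume "g \<in> E ` U"
  then obtain v where v: "v \<in> U" "g = E v" by blast
  have c: "continuous_on UNIV (star v)" by (intro continuous_intros)
  then have "open (star v -` U)" "0 \<in> star v -` U"
    using assms v by (auto simp: continuous_on_open_vimage[OF open_UNIV])
  then obtain W where W: "open W" "\<one> \<in> W" "W \<subseteq> E ` (star v -` U)" using E_nbhd_one by blast
  show "\<exists>T. open T \<and> g \<in> T \<and> T \<subseteq> E ` U"
  proof (intro exI conjI)
    show "open ((\<lambda>h. g \<otimes> h) ` W)" by (rule open_left_translate[OF W(1)])
    show "g \<in> (\<lambda>h. g \<otimes> h) ` W" using W(2) by (auto intro!: image_eqI[of _ _ "\<one>"])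
    show "(\<lambda>h. g \<otimes> h) ` W \<subseteq> E ` U" using W(3) v by (auto simp: E_mult)
  qed
qed

text \<open>The range is an open subgroup, so its complement is a union of open cosets;
  connectedness leaves no complement.\<close>

lemma E_surj: "range E = UNIV"
proof -
  have o: "open (range E)" by (simp add: E_open)
  have "open (- range E)"
  proof (rule Topological_Spaces.openI)
    fix g assume g: "g \<in> - range E"
    have "h \<notin> range E" if hg: "h \<in> (\<lambda>h. g \<otimes> h) ` range E" for h
    proof
      assume "h \<in> range E"
      then obtain v where "h = E v" by blast
      moreover obtain w where "h = g \<otimes> E w" using hg by blast
      ultimately have "g = E v \<otimes> inv (E w)" by (metis inv_mult(2) mult_assoc one_mult(2))
      then show False using g by (simp add: E_inv E_mult)
    qed
    moreover have "g \<in> (\<lambda>h. g \<otimes> h) ` range E" by (metis E_0 image_iff one_mult(2) rangeI)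
    ultimately show "\<exists>T. open T \<and> g \<in> T \<and> T \<subseteq> - range E"
      using open_left_translate[OF o, of g] by blast
  qed
  then have "closed (range E)" by (simp add: closed_def)
  moreover have "\<forall>T::'g set. open T \<and> closed T \<longrightarrow> T = {} \<or> T = UNIV"
    using conn unfolding connected_clopen by simp
  ultimately show ?thesis using o by blast
qed

text \<open>The derivative at 0 is the identity, so near 0 a kernel element v satisfies norm v \<le>
  norm v / 2.\<close>

lemma E_locally_injective: "\<exists>\<delta>>0. \<forall>v. E v = \<one> \<and> norm v < \<delta> \<longrightarrow> v = 0"
proof -
  obtain \<delta> where d: "\<delta> > 0" "\<And>y. norm (y - 0) < \<delta> \<Longrightarrow> norm (\<phi> (E y) - \<phi> (E 0) - (y - 0)) \<le> 1/2 * norm (y - 0)"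
    using E_derivative unfolding has_derivative_at_alt by (metis half_gt_zero zero_less_one)
  have "v = 0" if "E v = \<one>" "norm v < \<delta>" for v
  proof -
    have "norm v \<le> 1/2 * norm v" using d(2)[of v] that by simp
    then show ?thesis by simp
  qed
  then show ?thesis using d by blast
qed

text \<open>For kernel elements v and w the quotient \<open>star (starinv v) w\<close> is a kernel
  element too, and it is a linear image of w - v; the bound of that linear map converts the
  isolation radius at 0 into one at v.\<close>

lemma kernel_isolated:
  assumes "E v = \<one>"
  shows "\<exists>e>0. \<forall>w. E w = \<one> \<and> w \<noteq> v \<longrightarrow> e \<le> norm (w - v)"
proof -
  obtain \<delta> where \<delta>: "\<delta> > 0" "\<And>v. E v = \<one> \<Longrightarrow> norm v < \<delta> \<Longrightarrow> v = 0" using E_locally_injective by blast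
  have bl: "bounded_linear (Af (- \<tau> v))" by (rule linear_Af[unfolded linear_conv_bounded_linear])
  obtain B where B: "B > 0" "\<And>w. norm (Af (- \<tau> v) w) \<le> norm w * B"
    using bounded_linear.pos_bounded[OF bl] by blast
  have "\<delta> / B \<le> norm (w - v)" if w: "E w = \<one>" "w \<noteq> v" for w
  proof (rule ccontr)
    assume "\<not> \<delta> / B \<le> norm (w - v)"
    then have "norm (w - v) * B < \<delta>" using B(1) by (simp add: field_simps)
    then have "norm (star (starinv v) w) < \<delta>" unfolding starinv_star using B(2) le_less_trans by blast
    moreover have "E (star (starinv v) w) = \<one>"
      by (simp add: E_mult[symmetric] E_inv[symmetric] assms w)
    ultimately have "star (starinv v) w = 0" using \<delta> by blast
    then have "star v (star (starinv v) w) = star v 0" by (simp only:)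
    then show False using w by simp
  qed
  then show ?thesis using \<delta> B by (intro exI[of _ "\<delta> / B"]) auto
qed

text \<open>On a small ball all quotients \<open>star (starinv v) w\<close> stay within the
  isolation radius, so \<open>E\<close> is injective there. On a compact ball its inverse is
  continuous, and the open mapping property gives a neighbourhood of the identity inside the
  image.\<close>

lemma local_section:
  obtains r V \<sigma> where "r > 0" "open V" "\<one> \<in> V" "continuous_on V \<sigma>"
    "\<And>g. g \<in> V \<Longrightarrow> E (\<sigma> g) = g" "\<And>v. norm v < r \<Longrightarrow> \<sigma> (E v) = v"
proof -
  obtain \<delta> where \<delta>: "\<delta> > 0" "\<And>v. E v = \<one> \<Longrightarrow> norm v < \<delta> \<Longrightarrow> v = 0" using E_locally_injective by blast
  have c: "continuous_on UNIV (\<lambda>(v, w). star (starinv v) w)"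
    unfolding case_prod_beta by (intro continuous_intros)
  then have "open ((\<lambda>(v, w). star (starinv v) w) -` ball 0 \<delta>)"
    by (auto simp: continuous_on_open_vimage[OF open_UNIV])
  moreover have "(0, 0) \<in> (\<lambda>(v, w). star (starinv v) w) -` ball 0 \<delta>"
    using \<delta> by (simp add: starinv_def)
  ultimately obtain A B where AB: "open A" "open B" "0 \<in> A" "0 \<in> B" 
    "A \<times> B \<subseteq> (\<lambda>(v, w). star (starinv v) w) -` ball 0 \<delta>"
    by (metis open_prod_elim mem_Sigma_iff)
  obtain r where r: "r > 0" "cball 0 r \<subseteq> A \<inter> B"
    using AB open_contains_cball[of "A \<inter> B"] by blast
  have small: "norm (star (starinv v) w) < \<delta>" if "v \<in> cball 0 r" "w \<in> cball 0 r" for v w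
    using AB(5) r that by (auto simp: subset_iff)
  have inj: "inj_on E (cball 0 r)"
  proof (rule inj_onI)
    fix v w assume vw: "v \<in> cball 0 r" "w \<in> cball 0 r" "E v = E w"
    have "E (star (starinv v) w) = \<one>"
      by (simp add: E_mult[symmetric] E_inv[symmetric] vw)
    then have "star (starinv v) w = 0" using \<delta> small vw by blast
    then have "star v (star (starinv v) w) = star v 0" by (simp only:)
    then show "v = w" by simp
  qed
  define \<sigma> where "\<sigma> = inv_into (cball 0 r) E"
  have \<sigma>: "\<sigma> (E v) = v" if "v \<in> cball 0 r" for v
    unfolding \<sigma>_def using inj that by simp
  have c\<sigma>: "continuous_on (E ` cball 0 r) \<sigma>"
    by (rule continuous_on_inv[OF continuous_on_subset[OF continuous_E] compact_cball])
       (use \<sigma> in auto)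
  obtain V where V: "open V" "\<one> \<in> V" "V \<subseteq> E ` ball 0 r"
    using E_nbhd_one[of "ball 0 r"] r by auto
  show thesis
  proof (rule that[of r V \<sigma>])
    show "continuous_on V \<sigma>" by (rule continuous_on_subset[OF c\<sigma>]) (use V in \<open>auto intro: less_imp_le\<close>)
    show "E (\<sigma> g) = g" if gV: "g \<in> V" for g
    proof -
      obtain v where "g = E v" "v \<in> ball 0 r" using subsetD[OF V(3) gV] by blast
      then show ?thesis using \<sigma>[of v] by simp
    qed
  qed (use r V \<sigma> in auto)
qed

text \<open>A loop \<open>t \<mapsto> E (t k)\<close> with \<open>E k = \<one>\<close> is null homotopic. Lifting the homotopy through \<open>E\<close> as a
  product of small steps, the endpoints of the lifts form a path in the discrete kernel from \<open>k\<close> to \<open>0\<close>.\<close>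

lemma E_kernel:
  assumes k: "E k = \<one>"
  shows "k = 0"
proof -
  obtain r V \<sigma> where rV: "r > 0" "open V" "\<one> \<in> V" "continuous_on V \<sigma>"
    "\<And>g. g \<in> V \<Longrightarrow> E (\<sigma> g) = g" "\<And>v. norm v < r \<Longrightarrow> \<sigma> (E v) = v"
    using local_section by metis
  define p where "p t = E (t *\<^sub>R k)" for t :: real
  have "path p" unfolding path_def p_def
    by (intro continuous_on_compose2[OF continuous_E]) (auto intro!: continuous_intros)
  then have "homotopic_loops UNIV p (\<lambda>t. \<one>)"
    using sconn k unfolding simply_connected_def
    by (auto simp: pathfinish_def pathstart_def p_def path_def intro!: continuous_intros)
  then obtain h where h: "continuous_on ({0..1::real} \<times> {0..1}) h"
    and h0: "\<And>x. x \<in> {0..1} \<Longrightarrow> h (0, x) = p x" and h1: "\<And>x. x \<in> {0..1} \<Longrightarrow> h (1, x) = \<one>"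
    and hl: "\<And>t. t \<in> {0..1} \<Longrightarrow> pathfinish (h \<circ> Pair t) = pathstart (h \<circ> Pair t)"
    unfolding homotopic_loops by auto
  have hl': "h (t, 1) = h (t, 0)" if "t \<in> {0..1}" for t
    using hl[OF that] by (simp add: pathfinish_def pathstart_def)
  \<comment> \<open>The increment of the loop at stage s between the times a and b. It is the
    identity for a = b, so for close times it lies in V, where the local section lifts it.\<close>
  define f where "f = (\<lambda>(s, a, b). inv (h (s, a)) \<otimes> h (s, b))"
  have hc: "continuous_on S (\<lambda>x. h (u x, w x))"
    if "continuous_on S u" "continuous_on S w" "\<And>x. x \<in> S \<Longrightarrow> u x \<in> {0..1} \<and> w x \<in> {0..1}"
    for S :: "'z::topological_space set" and u w
    by (rule continuous_on_compose2[OF h continuous_on_Pair[OF that(1,2)]]) (use that in auto)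
  have "continuous_on ({0..1} \<times> {0..1} \<times> {0..1}) f"
    unfolding f_def case_prod_beta by (intro continuous_intros hc) auto
  then obtain d1 where d1: "d1 > 0" "\<And>s a b. s \<in> {0..1} \<Longrightarrow> a \<in> {0..1} \<Longrightarrow> b \<in> {0..1} \<Longrightarrow> \<bar>a - b\<bar> < d1 \<Longrightarrow> f (s, a, b) \<in> V"
    using close_pairs_in_open[of f V] rV(2,3) by (auto simp: f_def)
  \<comment> \<open>The same increments for the straight path t k in coordinates. Keeping them
    shorter than r ensures that the section returns exactly these vectors at stage 0.\<close>
  define f2 where "f2 = (\<lambda>(s::real, a, b). star (starinv (a *\<^sub>R k)) (b *\<^sub>R k))"
  have "continuous_on ({0..1} \<times> {0..1} \<times> {0..1}) f2"
    unfolding f2_def case_prod_beta by (intro continuous_intros)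
  then obtain d2 where d2: "d2 > 0" "\<And>s a b. s \<in> {0..1} \<Longrightarrow> a \<in> {0..1} \<Longrightarrow> b \<in> {0..1} \<Longrightarrow> \<bar>a - b\<bar> < d2 \<Longrightarrow> f2 (s, a, b) \<in> ball 0 r"
    using close_pairs_in_open[of f2 "ball 0 r"] rV(1) by (auto simp: f2_def)
  obtain N :: nat where N: "N > 0" "1 / N < min d1 d2"
    using d1 d2 real_arch_inverse[of "min d1 d2"] by (auto simp: inverse_eq_divide)
  have step: "real i / N \<in> {0..1}" "real (Suc i) / N \<in> {0..1}" "\<bar>real i / N - real (Suc i) / N\<bar> < min d1 d2"
    if "i < N" for i
  proof -
    have "real i / N - real (Suc i) / N = - (1 / N)" using N by (simp add: field_simps)
    then show "\<bar>real i / N - real (Suc i) / N\<bar> < min d1 d2" using N by simp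
  qed (use that N in \<open>auto simp: field_simps\<close>)
  define st where "st i s = f (s, real i / N, real (Suc i) / N)" for i s
  have stV: "st i s \<in> V" if "i < N" "s \<in> {0..1}" for i s
    unfolding st_def using step[OF that(1)] that by (intro d1) auto
  define H where "H = rec_nat (\<lambda>s. 0) (\<lambda>i P s. star (P s) (\<sigma> (st i s)))"
  have H0: "H 0 s = 0" and HS: "H (Suc i) s = star (H i s) (\<sigma> (st i s))" for i s
    by (simp_all add: H_def)
  have Hcont: "i \<le> N \<Longrightarrow> continuous_on {0..1} (H i)" for i
  proof (induction i)
    case 0 then show ?case by (simp add: H0[abs_def] continuous_on_const cong: continuous_on_cong)
  next
    case (Suc i)
    have "continuous_on {0..1} (st i)"
      unfolding st_def f_def using step[of i] Suc.prems by (auto intro!: continuous_intros hc)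
    then have "continuous_on {0..1} (\<lambda>s. \<sigma> (st i s))"
      by (rule continuous_on_compose2[OF rV(4)]) (use stV Suc.prems in auto)
    moreover have "continuous_on {0..1} (H i)" using Suc by simp
    ultimately have "continuous_on {0..1} (\<lambda>s. star (H i s) (\<sigma> (st i s)))" by (intro continuous_intros)
    then show ?case by (simp add: HS[abs_def] cong: continuous_on_cong)
  qed
  have HE: "i \<le> N \<Longrightarrow> s \<in> {0..1} \<Longrightarrow> E (H i s) = inv (h (s, 0)) \<otimes> h (s, real i / N)" for i s
  proof (induction i)
    case (Suc i)
    then have "E (H (Suc i) s) = inv (h (s, 0)) \<otimes> h (s, real i / N) \<otimes> st i s"
      using rV(5) stV by (simp add: HS E_mult[symmetric])
    then show ?case by (simp add: st_def f_def mult_assoc del: of_nat_Suc)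
  qed (simp add: H0)
  \<comment> \<open>Each stage of the homotopy is a closed loop, so the endpoint of its lift lies in
    the kernel.\<close>
  have HN: "E (H N s) = \<one>" if "s \<in> {0..1}" for s
    using HE[of N s] that N by (simp add: hl')
  have Hs0: "i \<le> N \<Longrightarrow> H i 0 = (real i / N) *\<^sub>R k" for i
  proof (induction i)
    case (Suc i)
    let ?a = "real i / N" and ?b = "real (Suc i) / N"
    have ab: "?a \<in> {0..1}" "?b \<in> {0..1}" "\<bar>?a - ?b\<bar> < d2" using step[of i] Suc.prems by auto
    have "st i 0 = inv (E (?a *\<^sub>R k)) \<otimes> E (?b *\<^sub>R k)"
      using ab by (simp add: st_def f_def h0 p_def del: of_nat_Suc)
    also have "\<dots> = E (f2 (0, ?a, ?b))" by (simp add: E_inv E_mult f2_def)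
    finally have "\<sigma> (st i 0) = f2 (0, ?a, ?b)"
      using d2(2)[of 0 ?a ?b] ab rV(6) by (simp del: of_nat_Suc)
    then show ?case using Suc by (simp add: HS f2_def del: of_nat_Suc)
  qed (simp add: H0)
  have Hs1: "i \<le> N \<Longrightarrow> H i 1 = 0" for i
  proof (induction i)
    case (Suc i)
    have "\<sigma> \<one> = 0" using rV(6)[of 0] rV(1) by simp
    then show ?case using Suc step[of i] by (simp add: HS st_def f_def h1 del: of_nat_Suc)
  qed (simp add: H0)
  have "H N 0 = H N 1"
  proof -
    have "continuous_on {0..1} (H N)" using Hcont by simp
    have "\<forall>b\<in>Basis. H N 0 \<bullet> b = H N 1 \<bullet> b"
    proof (rule ccontr)
      assume "\<not> ?thesis"
      then have ne: "H N 0 \<noteq> H N 1" by auto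
      \<comment> \<open>The endpoint of the lift is continuous in the stage and takes isolated
        values; its level set is therefore open as well as closed in the unit interval.\<close>
      define S0 where "S0 = {s\<in>{0..1}. H N s = H N 0}"
      have cl: "closedin (top_of_set {0..1}) S0"
        unfolding S0_def using \<open>continuous_on {0..1} (H N)\<close> by (rule continuous_closedin_preimage_constant)
      have op: "openin (top_of_set {0..1}) S0"
      proof -
        obtain e where e: "e > 0" "\<And>w. E w = \<one> \<Longrightarrow> w \<noteq> H N 0 \<Longrightarrow> e \<le> norm (w - H N 0)"
          using kernel_isolated[OF HN[of 0]] by auto
        have "S0 = {0..1} \<inter> H N -` ball (H N 0) e"
          using e HN by (force simp: S0_def dist_norm norm_minus_commute)
        then show ?thesis
          using \<open>continuous_on {0..1} (H N)\<close> by (auto intro: continuous_openin_preimage_gen)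
      qed
      have "connected {0..1::real}" by (rule connected_Icc)
      then have "S0 = {} \<or> S0 = {0..1}" using cl op connected_clopen by blast
      moreover have "0 \<in> S0" by (simp add: S0_def)
      ultimately have "1 \<in> S0" by auto
      then show False using ne by (simp add: S0_def)
    qed
    then show ?thesis by (simp add: euclidean_eq_iff[of "H N 0"])
  qed
  then show ?thesis using Hs0[of N] Hs1[of N] N by simp
qed

lemma E_inj: "inj E"
proof (rule injI)
  fix v w assume "E v = E w"
  then have "E (star (starinv v) w) = \<one>" by (simp add: E_mult[symmetric] E_inv[symmetric])
  then have "star (starinv v) w = 0" by (rule E_kernel)
  then have "star v (star (starinv v) w) = star v 0" by (simp only:)
  then show "v = w" by simp
qed

definition "L = inv_into UNIV E"

lemma L_E [simp]: "L (E v) = v" and E_L [simp]: "E (L g) = g"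
  unfolding L_def using E_inj E_surj by (simp_all add: surj_f_inv_f)

lemma continuous_L: "continuous_on UNIV L"
  unfolding continuous_on_open_vimage[OF open_UNIV]
proof (intro allI impI)
  fix B :: "'a set" assume "open B"
  moreover have "L -` B = E ` B" by (auto intro: image_eqI[of _ _ "L _"])
  ultimately show "open (L -` B \<inter> UNIV)" using E_open by simp
qed

lemma L_mult: "L (g \<otimes> h) = star (L g) (L h)"
  by (metis E_L E_mult L_E)

lemma continuous_on_E [continuous_intros]:
  "continuous_on S f \<Longrightarrow> continuous_on S (\<lambda>x. E (f x))"
  using continuous_on_compose2[OF continuous_E] by blast

lemma continuous_on_L [continuous_intros]:
  "continuous_on S f \<Longrightarrow> continuous_on S (\<lambda>x. L (f x))"
  using continuous_on_compose2[OF continuous_L] by blast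

subsection \<open>The logarithm in these coordinates\<close>

text \<open>The finite series of (exp (t ad) - 1) / (t ad), that is, the mean of
  \<open>Af (s t)\<close> over s in [0, 1]. It converts coordinates of the first kind into those of
  the second.\<close>

definition "Bf t v = (\<Sum>i<nil. (t ^ i / fact (Suc i)) *\<^sub>R (ad ^^ i) v)"

lemma linear_Bf: "linear (Bf t)"
  unfolding Bf_def[abs_def]
  by (rule linearI) (simp_all add: linear_add[OF linear_ad_pow] linear_cmul[OF linear_ad_pow]
      scaleR_right_distrib sum.distrib scaleR_sum_right mult.commute)

lemma \<tau>_Bf: "\<tau> (Bf t v) = \<tau> v"
proof -
  obtain m where m: "nil = Suc m" using nil_pos gr0_conv_Suc by blast
  show ?thesis
    unfolding Bf_def m by (subst sum.lessThan_Suc_shift) (simp add: linear_sum[OF linear_\<tau>])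
qed

text \<open>\<open>Bf t\<close> is the identity plus terms that raise the power of
  \<open>ad\<close>. Applying the last power of \<open>ad\<close> that does not kill v leaves only
  the term with i = 0.\<close>

lemma Bf_inj: "inj (Bf t)"
  unfolding linear_injective_0[OF linear_Bf]
proof (intro allI impI)
  fix v assume B: "Bf t v = 0"
  show "v = 0"
  proof (rule ccontr)
    assume "v \<noteq> 0"
    define k where "k = (LEAST k. (ad ^^ k) v = 0)"
    have k: "(ad ^^ k) v = 0" unfolding k_def by (rule LeastI[of _ nil]) simp
    have "k \<noteq> 0" using k \<open>v \<noteq> 0\<close> by (metis funpow_0)
    then obtain m where m: "k = Suc m" using not0_implies_Suc by blast
    then have "(ad ^^ m) v \<noteq> 0" using not_less_Least[of m "\<lambda>k. (ad ^^ k) v = 0"] k_def by simp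
    have "0 = (ad ^^ m) (Bf t v)" by (simp add: B linear_0[OF linear_ad_pow])
    also have "\<dots> = (\<Sum>i<nil. (t ^ i / fact (Suc i)) *\<^sub>R (ad ^^ m) ((ad ^^ i) v))"
      unfolding Bf_def by (simp add: linear_sum[OF linear_ad_pow] linear_cmul[OF linear_ad_pow])
    also have "\<dots> = (\<Sum>i<nil. if i = 0 then (ad ^^ m) v else 0)"
    proof (rule sum.cong[OF refl])
      fix i
      show "(t ^ i / fact (Suc i)) *\<^sub>R (ad ^^ m) ((ad ^^ i) v) = (if i = 0 then (ad ^^ m) v else 0)"
      proof (cases "i = 0")
        case False
        then obtain j where j: "i = Suc j" using not0_implies_Suc by blast
        have "(ad ^^ m) ((ad ^^ i) v) = (ad ^^ (j + k)) v"
        proof -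
          have "m + i = j + k" using j m by simp
          then show ?thesis by (metis comp_apply funpow_add)
        qed
        also have "\<dots> = (ad ^^ j) ((ad ^^ k) v)" by (simp add: funpow_add)
        finally show ?thesis using False by (simp add: k linear_0[OF linear_ad_pow])
      qed simp
    qed
    also have "\<dots> = (ad ^^ m) v" using nil_pos by simp
    finally show False using \<open>(ad ^^ m) v \<noteq> 0\<close> by simp
  qed
qed

text \<open>The curve on the right, scaled by s, is shown to be a one-parameter subgroup with
  velocity Y. The point is the cocycle identity \<open>bhom\<close>, which matches the group law
  \<open>star\<close>.\<close>

lemma expo_eq_E: "expo Y = E (Bf (\<tau> Y) (\<pi> Y) + \<tau> Y *\<^sub>R X n)"
proof -
  define t where "t = \<tau> Y"
  define m where "m = \<pi> Y"
  \<comment> \<open>The integral of \<open>Af (r * t) m\<close> over r from 0 to s.\<close>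
  define b where "b s = s *\<^sub>R Bf (s * t) m" for s
  have b_eq: "b s = (\<Sum>i<nil. (s ^ Suc i * (t ^ i / fact (Suc i))) *\<^sub>R (ad ^^ i) m)" for s
    unfolding b_def Bf_def by (simp add: scaleR_sum_right power_mult_distrib mult_ac del: fact_Suc)
  have b': "(b has_vector_derivative Af (s * t) m) (at s)" for s
  proof -
    have d: "((\<lambda>s. (s ^ Suc i * (t ^ i / fact (Suc i))) *\<^sub>R W) has_vector_derivative ((s * t) ^ i / fact i) *\<^sub>R W) (at s)"
      for i and W :: 'a
    proof -
      have "((\<lambda>s. s ^ Suc i * (t ^ i / fact (Suc i))) has_real_derivative (real (Suc i) * s ^ i * (t ^ i / fact (Suc i)))) (at s)"
        by (auto intro!: derivative_eq_intros simp del: power_Suc fact_Suc)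
      also have "real (Suc i) * s ^ i * (t ^ i / fact (Suc i)) = (s * t) ^ i / fact i"
        by (simp add: fact_Suc field_simps power_mult_distrib del: of_nat_Suc)
      finally have "((\<lambda>s. (s ^ Suc i * (t ^ i / fact (Suc i))) *\<^sub>R W) has_vector_derivative
          (s ^ Suc i * (t ^ i / fact (Suc i))) *\<^sub>R 0 + ((s * t) ^ i / fact i) *\<^sub>R W) (at s)"
        by (intro has_vector_derivative_scaleR has_vector_derivative_const)
      then show ?thesis by simp
    qed
    show ?thesis unfolding b_eq[abs_def] Af_eq by (intro has_vector_derivative_sum d)
  qed
  have bhom: "b (s + u) = b s + Af (s * t) (b u)" for s u
  proof -
    \<comment> \<open>As a function of u the defect has derivative zero, because \<open>Af\<close>
      is a one-parameter group of operators, and it vanishes at u = 0.\<close>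
    define F where "F u = b (s + u) - (b s + Af (s * t) (b u))" for u
    have "(F has_vector_derivative 0) (at u within UNIV)" for u
    proof -
      have "((\<lambda>u. s + u) has_vector_derivative 1) (at u)" by (auto intro!: derivative_eq_intros)
      then have "((b \<circ> (\<lambda>u. s + u)) has_vector_derivative 1 *\<^sub>R Af ((s + u) * t) m) (at u)"
        by (rule vector_diff_chain_at) (rule b')
      moreover have "((\<lambda>u. Af (s * t) (b u)) has_vector_derivative Af (s * t) (Af (u * t) m)) (at u)"
        by (rule bounded_linear.has_vector_derivative[OF linear_Af[unfolded linear_conv_bounded_linear] b'])
      ultimately have "((\<lambda>u. (b \<circ> (\<lambda>u. s + u)) u - (b s + Af (s * t) (b u))) has_vector_derivative
          (1 *\<^sub>R Af ((s + u) * t) m - (0 + Af (s * t) (Af (u * t) m)))) (at u)"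
        by (intro has_vector_derivative_diff has_vector_derivative_add has_vector_derivative_const)
      then show ?thesis unfolding F_def by (simp add: o_def Af_add[symmetric] distrib_right)
    qed
    then obtain c where c: "\<And>u. F u = c" using has_vector_derivative_zero_constant[of UNIV F] by auto
    have "F 0 = 0" by (simp add: F_def b_def)
    then show ?thesis using c[of 0] c[of u] by (simp add: F_def)
  qed
  have \<tau>b: "\<tau> (b s) = 0" for s by (simp add: b_def \<tau>_Bf m_def)
  have "one_par (\<lambda>s. E (b s + (s * t) *\<^sub>R X n)) Y"
    unfolding one_par_def
  proof (intro conjI allI)
    fix s u
    show "E (b (s + u) + ((s + u) * t) *\<^sub>R X n) = E (b s + (s * t) *\<^sub>R X n) \<otimes> E (b u + (u * t) *\<^sub>R X n)"
      unfolding E_mult star_def by (simp add: bhom \<tau>b algebra_simps)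
  next
    have "continuous_on UNIV b"
      using b' by (intro continuous_at_imp_continuous_on ballI has_vector_derivative_continuous) auto
    then show "continuous_on UNIV (\<lambda>s. E (b s + (s * t) *\<^sub>R X n))" by (intro continuous_intros)
    have "((\<lambda>s. s * t) has_real_derivative t) (at 0)" by (auto intro!: derivative_eq_intros)
    then have "((\<lambda>s. b s + (s * t) *\<^sub>R X n) has_vector_derivative (Af (0 * t) m + ((0 * t) *\<^sub>R 0 + t *\<^sub>R X n))) (at 0)"
      by (intro has_vector_derivative_add b' has_vector_derivative_scaleR has_vector_derivative_const)
    then have "((\<lambda>s. b s + (s * t) *\<^sub>R X n) has_vector_derivative Y) (at 0)"
      using \<pi>_\<tau>[of Y] by (simp add: m_def t_def)
    then have "(((\<lambda>v. \<phi> (E v)) \<circ> (\<lambda>s. b s + (s * t) *\<^sub>R X n)) has_derivative ((\<lambda>h. h) \<circ> (\<lambda>h. h *\<^sub>R Y))) (at 0)"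
      unfolding has_vector_derivative_def using E_derivative
      by (intro diff_chain_at) (auto simp: b_def)
    then show "((\<lambda>s. \<phi> (E (b s + (s * t) *\<^sub>R X n))) has_vector_derivative Y) (at 0)"
      unfolding has_vector_derivative_def by (simp add: o_def)
  qed
  from one_par_expo[OF this, of 1] show ?thesis by (simp add: b_def t_def m_def)
qed

lemma expo_inj: "inj expo"
proof (rule injI)
  fix Y Z assume "expo Y = expo Z"
  then have "E (Bf (\<tau> Y) (\<pi> Y) + \<tau> Y *\<^sub>R X n) = E (Bf (\<tau> Z) (\<pi> Z) + \<tau> Z *\<^sub>R X n)"
    by (simp only: expo_eq_E[symmetric])
  then have *: "Bf (\<tau> Y) (\<pi> Y) + \<tau> Y *\<^sub>R X n = Bf (\<tau> Z) (\<pi> Z) + \<tau> Z *\<^sub>R X n"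
    by (rule injD[OF E_inj])
  have \<tau>: "\<tau> Y = \<tau> Z" using arg_cong[OF *, of \<tau>] by (simp add: \<tau>_Bf)
  then have "Bf (\<tau> Y) (\<pi> Y) = Bf (\<tau> Y) (\<pi> Z)" using * by simp
  then have "\<pi> Y = \<pi> Z" by (rule injD[OF Bf_inj])
  then show "Y = Z" using \<tau> \<pi>_\<tau>[of Y] \<pi>_\<tau>[of Z] by simp
qed

lemma expo_surj: "surj expo"
  unfolding surj_def
proof
  fix g
  have "surj (Bf (\<tau> (L g)))" by (rule linear_injective_imp_surjective[OF linear_Bf Bf_inj]) simp
  then obtain v where v: "Bf (\<tau> (L g)) v = \<pi> (L g)" by (metis surjD)
  then have "\<tau> v = 0" using \<tau>_Bf[of "\<tau> (L g)" v] by simp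
  then have "\<tau> (v + \<tau> (L g) *\<^sub>R X n) = \<tau> (L g)" "\<pi> (v + \<tau> (L g) *\<^sub>R X n) = v"
    by (simp_all add: \<pi>_def)
  then have "expo (v + \<tau> (L g) *\<^sub>R X n) = E (Bf (\<tau> (L g)) v + \<tau> (L g) *\<^sub>R X n)"
    using expo_eq_E[of "v + \<tau> (L g) *\<^sub>R X n"] by simp
  also have "\<dots> = g" unfolding v using \<pi>_\<tau>[of "L g"] by simp
  finally show "\<exists>Y. g = expo Y" by (intro exI) (rule sym)
qed

lemma log_expo [simp]: "log_map expo (expo Y) = Y"
  using expo_inj by simp

lemma log_mm: "\<tau> v = 0 \<Longrightarrow> log_map expo (E v) = v"
  using log_expo[of v] by (simp add: E_mm)

text \<open>\<open>Bf t v\<close> and v differ by elements of the range of \<open>ad\<close>, which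
  such a functional does not see. Hence the characters of the whole group, defined through the
  logarithm, can be evaluated in the coordinates \<open>L\<close>.\<close>

lemma log_functional:
  assumes l: "linear l" and lad: "\<And>v. l (ad v) = (0::real)"
  shows "l (log_map expo g) = l (L g)"
proof -
  obtain Y where Y: "g = expo Y" using expo_surj by (metis surjD)
  obtain m where m: "nil = Suc m" using nil_pos gr0_conv_Suc by blast
  have "l (Bf t v) = l v" for t v
    unfolding Bf_def m by (subst sum.lessThan_Suc_shift) (simp add: linear_add[OF l] linear_sum[OF l] linear_cmul[OF l] lad)
  then have "l (L g) = l (\<pi> Y + \<tau> Y *\<^sub>R X n)"
    unfolding Y by (subst expo_eq_E) (simp add: linear_add[OF l])
  then show ?thesis using Y \<pi>_\<tau>[of Y] by simp
qed

text \<open>The factor of \<open>E w\<close> from the ideal acts trivially on the abelian ideal, so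
  only the coordinate along X_n matters; this reduces the coadjoint action of \<Gamma> to an action
  of the integers.\<close>

lemma Ad_mm: "\<tau> v = 0 \<Longrightarrow> Ad G \<kappa> (E w) v = Af (\<tau> w) v"
proof -
  assume v: "\<tau> v = 0"
  have "Ad G \<kappa> (E w) v = Ad G \<kappa> (expo (\<pi> w)) (Af (\<tau> w) v)"
    by (simp add: E_def Ad_mult Af_def)
  also have "\<dots> = Af (\<tau> w) v"
    using Ad_expo_commuting[of "\<pi> w" "Af (\<tau> w) v" 1] mm_abelian[of "\<pi> w" "Af (\<tau> w) v"] v by simp
  finally show ?thesis .
qed

text \<open>With the ideal abelian, \<open>br Y Z\<close> equals \<tau> Y ad (\<pi> Z) - \<tau> Z ad
  (\<pi> Y), so the derived algebra is the span of the range of \<open>ad\<close>.\<close>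

lemma vanishes_on_derived:
  assumes l: "linear l"
  shows "(\<forall>u\<in>derived_algebra br. l u = (0::real)) \<longleftrightarrow> (\<forall>v. l (ad v) = 0)"
proof
  assume "\<forall>u\<in>derived_algebra br. l u = 0"
  moreover have "ad v \<in> derived_algebra br" for v
    unfolding derived_algebra_def ad_def by (rule span_base) blast
  ultimately show "\<forall>v. l (ad v) = 0" by blast
next
  assume a: "\<forall>v. l (ad v) = 0"
  have "l (br Y Z) = 0" for Y Z
  proof -
    have "br Y Z = br (\<pi> Y + \<tau> Y *\<^sub>R X n) (\<pi> Z + \<tau> Z *\<^sub>R X n)"
      using \<pi>_\<tau>[of Y] \<pi>_\<tau>[of Z] by simp
    also have "\<dots> = \<tau> Z *\<^sub>R br (\<pi> Y) (X n) + \<tau> Y *\<^sub>R ad (\<pi> Z)"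
      by (simp add: linear_add[OF linear_br_left] linear_add[OF linear_br_right]
          linear_cmul[OF linear_br_left] linear_cmul[OF linear_br_right] mm_abelian br_self ad_def)
    also have "br (\<pi> Y) (X n) = - ad (\<pi> Y)" using br_antisym unfolding ad_def by blast
    finally show ?thesis using a by (simp add: linear_diff[OF l] linear_add[OF l] linear_cmul[OF l] linear_neg[OF l])
  qed
  then have "derived_algebra br \<subseteq> {u. l u = 0}"
    unfolding derived_algebra_def
    by (intro span_minimal) (auto simp: subspace_def linear_add[OF l] linear_cmul[OF l] linear_0[OF l])
  then show "\<forall>u\<in>derived_algebra br. l u = 0" by blast
qed

text \<open>Strongness of the basis makes \<open>ad\<close> triangular; a nonzero diagonal entry c
  would survive in every power, contradicting nilpotency. So \<open>Af t\<close> is unipotent and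
  triangular.\<close>

lemma Af_X_lower:
  assumes i: "i \<in> {1..n}"
  shows "Af t (X i) - X i \<in> span (X ` {1..<i})"
proof -
  let ?S = "span (X ` {1..<i})"
  have adS: "ad v \<in> ?S" if "v \<in> ?S" for v
  proof (cases "i = 1")
    case True
    then show ?thesis using that by (simp add: linear_0[OF linear_ad])
  next
    case False
    then have eq: "{1..<i} = {1..i - 1}" "i - 1 \<in> {1..n}" using i by auto
    then show ?thesis using basis(4)[OF eq(2)] that unfolding lie_ideal_def ad_def by simp
  qed
  have "ad (X i) \<in> span (X ` {1..i})"
  proof -
    have "X i \<in> span (X ` {1..i})" using i by (intro span_base) auto
    then show ?thesis using basis(4)[OF i] unfolding lie_ideal_def ad_def by blast
  qed
  also have "{1..i} = insert i {1..<i}" using i by auto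
  finally have "ad (X i) \<in> span (insert (X i) (X ` {1..<i}))" by simp
  then obtain c where c: "ad (X i) - c *\<^sub>R X i \<in> ?S"
    using span_breakdown_eq by blast
  have pow: "(ad ^^ k) (X i) - c ^ k *\<^sub>R X i \<in> ?S" for k
  proof (induction k)
    case (Suc k)
    have "(ad ^^ Suc k) (X i) - c ^ Suc k *\<^sub>R X i
      = ad ((ad ^^ k) (X i) - c ^ k *\<^sub>R X i) + c ^ k *\<^sub>R (ad (X i) - c *\<^sub>R X i)"
      by (simp add: linear_diff[OF linear_ad] linear_cmul[OF linear_ad] algebra_simps)
    then show ?case using Suc adS c by (simp add: span_add span_scale)
  qed (simp add: span_zero)
  have c0: "c = 0"
  proof (rule ccontr)
    assume "c \<noteq> 0"
    have "c ^ nil *\<^sub>R X i \<in> ?S" using pow[of nil] by (metis ad_nil diff_0 span_neg minus_minus)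
    then have "X i \<in> ?S" using \<open>c \<noteq> 0\<close> span_scale[of _ _ "inverse (c ^ nil)"] by fastforce
    moreover have "?S \<subseteq> {v. co i v = 0}"
      using i by (intro span_minimal)
        (auto simp: co_X subspace_def linear_0[OF linear_co] linear_add[OF linear_co] linear_cmul[OF linear_co])
    ultimately show False using co_X[OF i i] by auto
  qed
  obtain m where m: "nil = Suc m" using nil_pos gr0_conv_Suc by blast
  have "Af t (X i) - X i = (\<Sum>j<m. (t ^ Suc j / fact (Suc j)) *\<^sub>R (ad ^^ Suc j) (X i))"
    unfolding Af_eq m by (subst sum.lessThan_Suc_shift) simp
  also have "\<dots> \<in> ?S"
    using pow[of "Suc _"] c0 by (intro span_sum span_scale) simp
  finally show ?thesis .
qed

end

section \<open>Sums, averages and Parseval's identity\<close>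

text \<open>Reading a countable sum as an integral over a counting measure makes Tonelli, Fatou and
  additivity available for the sums over characters.\<close>

lemma infsum_eq_nn_integral:
  fixes f :: "'i \<Rightarrow> ennreal"
  assumes A: "countable A"
  shows "(\<Sum>\<^sub>\<infinity>x\<in>A. f x) = (\<integral>\<^sup>+x. f x \<partial>count_space A)"
proof (cases "finite A")
  case True
  then show ?thesis by (simp add: nn_integral_count_space_finite)
next
  case False
  have sup: "(\<Sum>\<^sub>\<infinity>x\<in>A. f x) = (SUP F\<in>{F. finite F \<and> F \<subseteq> A}. sum f F)"
    by (rule nonneg_infsum_complete) simp
  define e where "e = from_nat_into A"
  have bij: "bij_betw e UNIV A"
    unfolding e_def using A False by (rule bij_betw_from_nat_into)
  then have inj: "inj e" and im: "range e = A" by (auto simp: bij_betw_def)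
  have "(\<integral>\<^sup>+x. f x \<partial>count_space A) = (\<integral>\<^sup>+k. f (e k) \<partial>count_space UNIV)"
    by (rule nn_integral_bij_count_space[OF bij, symmetric])
  also have "\<dots> = (\<Sum>k. f (e k))" by (rule nn_integral_count_space_nat)
  also have "\<dots> = (SUP k. \<Sum>i<k. f (e i))" by (rule suminf_eq_SUP)
  finally have nn: "(\<integral>\<^sup>+x. f x \<partial>count_space A) = (SUP k. \<Sum>i<k. f (e i))" .
  show ?thesis
  proof (rule antisym)
    show "(\<Sum>\<^sub>\<infinity>x\<in>A. f x) \<le> (\<integral>\<^sup>+x. f x \<partial>count_space A)"
      unfolding sup
    proof (rule SUP_least)
      fix F assume F: "F \<in> {F. finite F \<and> F \<subseteq> A}"
      then have "finite (inv_into UNIV e ` F)" by auto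
      then obtain k where k: "inv_into UNIV e ` F \<subseteq> {..<k}"
        using finite_nat_set_iff_bounded by auto
      have "F \<subseteq> e ` {..<k}"
      proof
        fix x assume x: "x \<in> F"
        then have "e (inv_into UNIV e x) = x" using F im by (auto intro: f_inv_into_f)
        then show "x \<in> e ` {..<k}" using k x by (metis image_iff image_subset_iff)
      qed
      then have "sum f F \<le> sum f (e ` {..<k})" by (intro sum_mono2) auto
      also have "\<dots> = (\<Sum>i<k. f (e i))"
        using inj by (subst sum.reindex) (auto intro: inj_on_subset)
      also have "\<dots> \<le> (SUP k. \<Sum>i<k. f (e i))" by (intro SUP_upper) auto
      finally show "sum f F \<le> (\<integral>\<^sup>+x. f x \<partial>count_space A)" unfolding nn .
    qed
    show "(\<integral>\<^sup>+x. f x \<partial>count_space A) \<le> (\<Sum>\<^sub>\<infinity>x\<in>A. f x)"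
      unfolding sup nn
    proof (rule SUP_least)
      fix k
      have "(\<Sum>i<k. f (e i)) = sum f (e ` {..<k})"
        using inj by (subst sum.reindex) (auto intro: inj_on_subset)
      also have "\<dots> \<le> (SUP F\<in>{F. finite F \<and> F \<subseteq> A}. sum f F)"
        using im by (intro SUP_upper) auto
      finally show "(\<Sum>i<k. f (e i)) \<le> (SUP F\<in>{F. finite F \<and> F \<subseteq> A}. sum f F)" .
    qed
  qed
qed

lemma infsum_ennreal_ge:
  fixes f :: "'i \<Rightarrow> ennreal"
  assumes "x \<in> A"
  shows "f x \<le> (\<Sum>\<^sub>\<infinity>x\<in>A. f x)"
    using assms by (subst nonneg_infsum_complete) (auto intro!: SUP_upper2[of "{x}"])

section \<open>Joint measurability and averages over the unit interval\<close>

lemma borel_measurable_cnj [measurable (raw)]: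
  "f \<in> borel_measurable M \<Longrightarrow> (\<lambda>x. cnj (f x)) \<in> borel_measurable M"
  by (rule measurable_compose[OF _ borel_measurable_continuous_onI]) (auto intro!: continuous_intros)

text \<open>Rounding u down to a multiple of 1/(k+1) leaves countably many measurable cases, and
  continuity in u gives the pointwise limit.\<close>

lemma borel_measurable_caratheodory:
  fixes h :: "real \<Rightarrow> 'a \<Rightarrow> 'b::metric_space"
  assumes meas: "\<And>u. h u \<in> borel_measurable M"
    and cont: "\<And>x. x \<in> space M \<Longrightarrow> continuous_on UNIV (\<lambda>u. h u x)"
  shows "(\<lambda>(u, x). h u x) \<in> borel_measurable (borel \<Otimes>\<^sub>M M)"
proof (rule borel_measurable_LIMSEQ_metric)
  fix k :: nat
  have "(\<lambda>p. (\<lambda>i p. h (real_of_int i / real (Suc k)) (snd p)) \<lfloor>fst p * real (Suc k)\<rfloor> p)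
    \<in> borel_measurable (borel \<Otimes>\<^sub>M M)"
  proof (rule measurable_compose_countable[where f = "\<lambda>i p. h (real_of_int i / real (Suc k)) (snd p)"])
    show "(\<lambda>p. \<lfloor>fst p * real (Suc k)\<rfloor>) \<in> measurable (borel \<Otimes>\<^sub>M M) (count_space UNIV)"
      by measurable
    show "(\<lambda>p. h (real_of_int i / real (Suc k)) (snd p)) \<in> borel_measurable (borel \<Otimes>\<^sub>M M)" for i
      using meas by (rule measurable_compose[OF measurable_snd])
  qed
  then show "(\<lambda>p. h (real_of_int \<lfloor>fst p * real (Suc k)\<rfloor> / real (Suc k)) (snd p))
    \<in> borel_measurable (borel \<Otimes>\<^sub>M M)" by simp
next
  fix p :: "real \<times> 'a" assume "p \<in> space (borel \<Otimes>\<^sub>M M)"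
  then obtain u x where p: "p = (u, x)" "x \<in> space M" by (auto simp: space_pair_measure)
  have "(\<lambda>k. real_of_int \<lfloor>u * real (Suc k)\<rfloor> / real (Suc k)) \<longlonglongrightarrow> u"
  proof (rule LIMSEQ_I)
    fix e :: real assume "e > 0"
    then obtain N where N: "inverse (real (Suc N)) < e" using reals_Archimedean by blast
    show "\<exists>N. \<forall>k\<ge>N. norm (real_of_int \<lfloor>u * real (Suc k)\<rfloor> / real (Suc k) - u) < e"
    proof (intro exI allI impI)
      fix k assume k: "N \<le> k"
      have "real_of_int \<lfloor>u * real (Suc k)\<rfloor> / real (Suc k) - u = (real_of_int \<lfloor>u * real (Suc k)\<rfloor> - u * real (Suc k)) / real (Suc k)"
        by (simp add: field_simps del: of_nat_Suc)
      also have "\<bar>\<dots>\<bar> \<le> 1 / real (Suc k)"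
        unfolding abs_divide by (intro frac_le) linarith+
      also have "\<dots> \<le> inverse (real (Suc N))" using k by (simp add: field_simps)
      finally show "norm (real_of_int \<lfloor>u * real (Suc k)\<rfloor> / real (Suc k) - u) < e" using N by simp
    qed
  qed
  moreover have "isCont (\<lambda>u. h u x) u"
    using cont[OF p(2)] by (simp add: continuous_on_eq_continuous_at)
  ultimately show "(\<lambda>k. h (real_of_int \<lfloor>fst p * real (Suc k)\<rfloor> / real (Suc k)) (snd p)) \<longlonglongrightarrow> (case p of (u, x) \<Rightarrow> h u x)"
    unfolding p fst_conv snd_conv prod.case by (rule isCont_tendsto_compose[rotated])
qed

abbreviation unit_interval :: "real measure" where
  "unit_interval \<equiv> restrict_space lborel {0..<1}"

lemma space_unit_interval [simp]: "space unit_interval = {0..<1}"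
  by (simp add: space_restrict_space)

lemma emeasure_unit_interval: "emeasure unit_interval (space unit_interval) = 1"
  by (simp add: emeasure_restrict_space)

lemma finite_measure_unit_interval: "finite_measure unit_interval"
  by (rule finite_measureI) (simp add: emeasure_restrict_space)

lemma measurable_unit_interval:
  "f \<in> borel_measurable borel \<Longrightarrow> f \<in> borel_measurable unit_interval"
  by (intro measurable_restrict_space1) simp

lemma integrable_bounded:
  fixes f :: "'a \<Rightarrow> 'b::{banach, second_countable_topology}"
  assumes "finite_measure M" "f \<in> borel_measurable M" "\<And>x. x \<in> space M \<Longrightarrow> norm (f x) \<le> B"
  shows "integrable M f"
  using assms by (intro finite_measure.integrable_const_bound[of M _ B]) auto

text \<open>Fubini: every slice \<open>h u\<close> has the same integral, and the unit interval has
  mass 1.\<close>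

lemma integral_average:
  fixes h :: "real \<Rightarrow> 'a \<Rightarrow> complex"
  assumes P: "finite_measure P"
    and meas: "\<And>u. h u \<in> borel_measurable P"
    and cont: "\<And>x. x \<in> space P \<Longrightarrow> continuous_on UNIV (\<lambda>u. h u x)"
    and bdd: "\<And>u x. x \<in> space P \<Longrightarrow> cmod (h u x) \<le> B"
    and const: "\<And>u. (\<integral>x. h u x \<partial>P) = I"
  shows "(\<integral>x. (\<integral>u. h u x \<partial>unit_interval) \<partial>P) = I"
    and "(\<lambda>x. \<integral>u. h u x \<partial>unit_interval) \<in> borel_measurable P"
proof -
  interpret P: finite_measure P by fact
  interpret U: finite_measure unit_interval by (rule finite_measure_unit_interval)
  interpret UP: pair_sigma_finite unit_interval P ..
  have m: "(\<lambda>(u, x). h u x) \<in> borel_measurable (unit_interval \<Otimes>\<^sub>M P)"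
  proof -
    have "(\<lambda>p. (fst p, snd p)) \<in> measurable (unit_interval \<Otimes>\<^sub>M P) (borel \<Otimes>\<^sub>M P)"
      by (intro measurable_Pair measurable_compose[OF measurable_fst measurable_unit_interval[of "\<lambda>x. x"]] measurable_snd) simp_all
    from measurable_compose[OF this borel_measurable_caratheodory[OF meas cont]]
    show ?thesis by (simp add: case_prod_beta)
  qed
  then have "(\<lambda>(x, u). h u x) \<in> borel_measurable (P \<Otimes>\<^sub>M unit_interval)"
    using measurable_compose[OF measurable_pair_swap' m] by (simp add: case_prod_beta)
  then show "(\<lambda>x. \<integral>u. h u x \<partial>unit_interval) \<in> borel_measurable P"
    by (rule U.borel_measurable_lebesgue_integral)
  have "integrable (unit_interval \<Otimes>\<^sub>M P) (\<lambda>(u, x). h u x)"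
    using m bdd by (intro integrable_bounded[where B = B] finite_measure_pair_measure P finite_measure_unit_interval)
      (auto simp: space_pair_measure)
  then have "(\<integral>x. (\<integral>u. h u x \<partial>unit_interval) \<partial>P) = (\<integral>u. (\<integral>x. h u x \<partial>P) \<partial>unit_interval)"
    by (rule UP.Fubini_integral)
  also have "\<dots> = I" using emeasure_unit_interval by (simp add: const measure_def emeasure_restrict_space)
  finally show "(\<integral>x. (\<integral>u. h u x \<partial>unit_interval) \<partial>P) = I" .
qed

lemma integral_unit_interval_eq:
  fixes f :: "real \<Rightarrow> complex"
  assumes "continuous_on UNIV f"
  shows "(\<integral>u. f u \<partial>unit_interval) = integral {0..1} f"
proof -
  have "(\<integral>u. f u \<partial>unit_interval) = (LINT u:{0..<1}|lborel. f u)"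
    by (subst integral_restrict_space) (auto simp: set_lebesgue_integral_def)
  also have "\<dots> = (LINT u:{0..1}|lborel. f u)"
    unfolding set_lebesgue_integral_def
  proof (rule integral_cong_AE)
    have [measurable]: "f \<in> borel_measurable borel" using assms by (rule borel_measurable_continuous_onI)
    show "(\<lambda>x. indicat_real {0..<1} x *\<^sub>R f x) \<in> borel_measurable lborel"
      "(\<lambda>x. indicat_real {0..1} x *\<^sub>R f x) \<in> borel_measurable lborel" by measurable
    have "AE x in lborel. x \<noteq> (1::real)" by (rule AE_lborel_singleton)
    then show "AE x in lborel. indicat_real {0..<1} x *\<^sub>R f x = indicat_real {0..1} x *\<^sub>R f x"
      by eventually_elim (auto simp: indicator_def)
  qed
  also have "\<dots> = integral {0..1} f"
    by (intro set_borel_integral_eq_integral(2) borel_integrable_atLeastAtMost')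
       (rule continuous_on_subset[OF assms], simp)
  finally show ?thesis .
qed

text \<open>Periodicity reduces the shift to the fractional part r of s; then the piece over
  [1, 1 + r] is moved back to [0, r].\<close>

lemma integral_periodic_shift:
  fixes f :: "real \<Rightarrow> complex"
  assumes cont: "continuous_on UNIV f" and per: "\<And>u. f (u + 1) = f u"
  shows "(\<integral>u. f (u + s) \<partial>unit_interval) = (\<integral>u. f u \<partial>unit_interval)"
proof -
  have per_nat: "f (u + real k) = f u" for u k
  proof (induction k)
    case (Suc k)
    have "f (u + real (Suc k)) = f ((u + real k) + 1)" by (simp add: add_ac)
    then show ?case using per[of "u + real k"] Suc by simp
  qed simp
  have per_int: "f (u + of_int k) = f u" for u k
  proof (cases "k \<ge> 0")
    case True
    then show ?thesis using per_nat[of u "nat k"] by simp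
  next
    case False
    then show ?thesis using per_nat[of "u + of_int k" "nat (- k)"] by simp
  qed
  define r where "r = frac s"
  have r: "0 \<le> r" "r < 1" by (simp_all add: r_def frac_lt_1)
  have "f (u + s) = f (u + r)" for u
    using per_int[of "u + r" "\<lfloor>s\<rfloor>"] by (simp add: r_def frac_def)
  then have "(\<integral>u. f (u + s) \<partial>unit_interval) = (\<integral>u. f (u + r) \<partial>unit_interval)" by simp
  also have "\<dots> = integral {0..1} (\<lambda>u. f (u + r))"
    by (intro integral_unit_interval_eq continuous_on_compose2[OF cont]) (auto intro!: continuous_intros)
  also have "\<dots> = integral {r..1 + r} f"
    using integral_shift_real_ivl[of r r "1 + r" f] by simp
  also have "\<dots> = integral {r..1} f + integral {1..1 + r} f"
    using r by (intro Henstock_Kurzweil_Integration.integral_combine[symmetric] integrable_continuous_interval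
        continuous_on_subset[OF cont]) auto
  also have "integral {1..1 + r} f = integral {0..r} f"
  proof -
    have "integral {1 - 1..(1 + r) - 1} (\<lambda>x. f (x + 1)) = integral {1..1 + r} f"
      by (rule integral_shift_real_ivl)
    then show ?thesis by (simp add: per)
  qed
  also have "integral {r..1} f + integral {0..r} f = integral {0..1} f"
    using r by (subst add.commute, intro Henstock_Kurzweil_Integration.integral_combine integrable_continuous_interval
        continuous_on_subset[OF cont]) auto
  also have "\<dots> = (\<integral>u. f u \<partial>unit_interval)" by (rule integral_unit_interval_eq[OF cont, symmetric])
  finally show ?thesis .
qed

text \<open>Expanding the square gives |F - T|^2 = |F|^2 - \<Sum>|a|^2 + \<Sum>|c - a|^2 for a
  finite combination T with coefficients c. The choice c = a yields Bessel's inequality; a uniformly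
  close T yields the reverse one. Coefficients are integrals against \<open>e l\<close> itself, as
  in the operator of the theorem, so the expansion uses the conjugates.\<close>

lemma parseval_of_approximation:
  fixes e :: "'i \<Rightarrow> 'a \<Rightarrow> complex" and F :: "'a \<Rightarrow> complex"
  assumes P: "finite_measure P"
    and e: "\<And>l. l \<in> I \<Longrightarrow> e l \<in> borel_measurable P" "\<And>l x. l \<in> I \<Longrightarrow> x \<in> space P \<Longrightarrow> cmod (e l x) \<le> 1"
    and orth: "\<And>l k. l \<in> I \<Longrightarrow> k \<in> I \<Longrightarrow> (\<integral>x. e l x * cnj (e k x) \<partial>P) = (if l = k then 1 else 0)"
    and F: "F \<in> borel_measurable P" "\<And>x. x \<in> space P \<Longrightarrow> cmod (F x) \<le> B"
    and approx: "\<And>\<epsilon>. \<epsilon> > 0 \<Longrightarrow> \<exists>S c. finite S \<and> S \<subseteq> I \<and>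
        (\<forall>x\<in>space P. cmod (F x - (\<Sum>l\<in>S. c l * cnj (e l x))) \<le> \<epsilon>)"
    and mass: "emeasure P (space P) = 1"
  shows "(\<Sum>\<^sub>\<infinity>l\<in>I. ennreal ((cmod (\<integral>x. F x * e l x \<partial>P))\<^sup>2)) = (\<integral>\<^sup>+x. ennreal ((cmod (F x))\<^sup>2) \<partial>P)"
proof -
  interpret P: finite_measure P by fact
  define a where "a l = (\<integral>x. F x * e l x \<partial>P)" for l
  define T where "T S c x = (\<Sum>l\<in>S. c l * cnj (e l x))" for S c x
  have intF: "integrable P (\<lambda>x. (cmod (F x))\<^sup>2)"
    using F by (intro integrable_bounded[OF P, where B = "B\<^sup>2"]) (auto intro: power_mono)
  have int1: "integrable P (\<lambda>x. F x * e l x)" if "l \<in> I" for l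
  proof (rule integrable_bounded[OF P, where B = "B * 1"])
    show "norm (F x * e l x) \<le> B * 1" if "x \<in> space P" for x
      unfolding norm_mult using F(2)[OF that] e(2)[OF \<open>l \<in> I\<close> that] order_trans[OF norm_ge_zero F(2)[OF that]]
      by (intro mult_mono) auto
  qed (use F(1) e(1)[OF that] in auto)
  have int2: "integrable P (\<lambda>x. e l x * cnj (e k x))" if "l \<in> I" "k \<in> I" for l k
  proof (rule integrable_bounded[OF P, where B = "1 * 1"])
    show "norm (e l x * cnj (e k x)) \<le> 1 * 1" if "x \<in> space P" for x
      unfolding norm_mult using e(2)[OF \<open>l \<in> I\<close> that] e(2)[OF \<open>k \<in> I\<close> that] by (intro mult_mono) auto
  qed (use e(1)[OF that(1)] e(1)[OF that(2)] in \<open>intro borel_measurable_times borel_measurable_cnj\<close>)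
  define nF where "nF = (\<integral>x. (cmod (F x))\<^sup>2 \<partial>P)"
  have key: "(\<integral>x. (cmod (F x - T S c x))\<^sup>2 \<partial>P) = nF - (\<Sum>l\<in>S. (cmod (a l))\<^sup>2) + (\<Sum>l\<in>S. (cmod (c l - a l))\<^sup>2)"
    if S: "finite S" "S \<subseteq> I" for S c
  proof -
    have pt: "complex_of_real ((cmod (F x - T S c x))\<^sup>2) =
        complex_of_real ((cmod (F x))\<^sup>2) - (\<Sum>l\<in>S. cnj (c l) * (F x * e l x)) - (\<Sum>l\<in>S. c l * cnj (F x * e l x))
        + (\<Sum>l\<in>S. \<Sum>k\<in>S. c l * cnj (c k) * (e k x * cnj (e l x)))" for x
    proof -
      have "complex_of_real ((cmod (F x - T S c x))\<^sup>2) = (F x - T S c x) * cnj (F x - T S c x)"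
        by (rule complex_norm_square)
      also have "\<dots> = F x * cnj (F x) - F x * cnj (T S c x) - T S c x * cnj (F x) + T S c x * cnj (T S c x)"
        by (simp add: algebra_simps)
      also have "F x * cnj (F x) = complex_of_real ((cmod (F x))\<^sup>2)" by (rule complex_norm_square[symmetric])
      also have "F x * cnj (T S c x) = (\<Sum>l\<in>S. cnj (c l) * (F x * e l x))"
        unfolding T_def cnj_sum sum_distrib_left by (intro sum.cong refl) (simp add: mult_ac)
      also have "T S c x * cnj (F x) = (\<Sum>l\<in>S. c l * cnj (F x * e l x))"
        unfolding T_def cnj_sum sum_distrib_right by (intro sum.cong refl) (simp add: mult_ac)
      also have "T S c x * cnj (T S c x) = (\<Sum>l\<in>S. \<Sum>k\<in>S. c l * cnj (c k) * (e k x * cnj (e l x)))"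
        unfolding T_def cnj_sum sum_product by (intro sum.cong refl) (simp add: mult_ac)
      finally show ?thesis .
    qed
    have SI: "\<And>l. l \<in> S \<Longrightarrow> l \<in> I" using S by blast
    have "complex_of_real (\<integral>x. (cmod (F x - T S c x))\<^sup>2 \<partial>P) = (\<integral>x. complex_of_real ((cmod (F x - T S c x))\<^sup>2) \<partial>P)"
      by (rule integral_complex_of_real[symmetric])
    also have "\<dots> = (\<integral>x. complex_of_real ((cmod (F x))\<^sup>2) \<partial>P) - (\<Sum>l\<in>S. cnj (c l) * a l) - (\<Sum>l\<in>S. c l * cnj (a l))
        + (\<Sum>l\<in>S. \<Sum>k\<in>S. c l * cnj (c k) * (if k = l then 1 else 0))"
    proof -
      have i1: "integrable P (\<lambda>x. complex_of_real ((cmod (F x))\<^sup>2))" by (rule integrable_of_real[OF intF])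
      have i2: "integrable P (\<lambda>x. \<Sum>l\<in>S. cnj (c l) * (F x * e l x))"
        using int1 SI by (intro Bochner_Integration.integrable_sum integrable_mult_right) auto
      have i3: "integrable P (\<lambda>x. \<Sum>l\<in>S. c l * cnj (F x * e l x))"
        using int1 SI by (intro Bochner_Integration.integrable_sum integrable_mult_right integrable_cnj) auto
      have i4: "integrable P (\<lambda>x. \<Sum>l\<in>S. \<Sum>k\<in>S. c l * cnj (c k) * (e k x * cnj (e l x)))"
        using int2 SI by (intro Bochner_Integration.integrable_sum integrable_mult_right) auto
      have e2: "(\<integral>x. (\<Sum>l\<in>S. cnj (c l) * (F x * e l x)) \<partial>P) = (\<Sum>l\<in>S. cnj (c l) * a l)"
        unfolding a_def using int1 SI
        by (subst Bochner_Integration.integral_sum) (auto intro!: sum.cong integral_mult_right_zero)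
      have e3: "(\<integral>x. (\<Sum>l\<in>S. c l * cnj (F x * e l x)) \<partial>P) = (\<Sum>l\<in>S. c l * cnj (a l))"
        unfolding a_def Bochner_Integration.integral_cnj[symmetric] using int1 SI
        by (subst Bochner_Integration.integral_sum)
          (auto intro!: sum.cong integral_mult_right_zero integrable_mult_right integrable_cnj simp del: complex_cnj_mult)
      have e4: "(\<integral>x. (\<Sum>l\<in>S. \<Sum>k\<in>S. c l * cnj (c k) * (e k x * cnj (e l x))) \<partial>P) =
          (\<Sum>l\<in>S. \<Sum>k\<in>S. c l * cnj (c k) * (if k = l then 1 else 0))"
        using int2 SI orth
        by (subst Bochner_Integration.integral_sum, fastforce intro!: Bochner_Integration.integrable_sum integrable_mult_right,
            intro sum.cong refl, subst Bochner_Integration.integral_sum,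
            auto intro!: sum.cong integrable_mult_right simp del: mult_eq_0_iff)
      show ?thesis
        unfolding pt e2[symmetric] e3[symmetric] e4[symmetric]
        using i1 i2 i3 i4 by (simp del: complex_cnj_mult)
    qed
    also have "(\<Sum>l\<in>S. \<Sum>k\<in>S. c l * cnj (c k) * (if k = l then 1 else 0)) = (\<Sum>l\<in>S. c l * cnj (c l))"
      using S(1) by (intro sum.cong refl) (simp add: if_distrib[of "\<lambda>x. _ * x"] cong: if_cong)
    also have "(\<integral>x. complex_of_real ((cmod (F x))\<^sup>2) \<partial>P) = complex_of_real nF"
      unfolding nF_def by (rule integral_complex_of_real)
    also have "complex_of_real nF - (\<Sum>l\<in>S. cnj (c l) * a l) - (\<Sum>l\<in>S. c l * cnj (a l)) + (\<Sum>l\<in>S. c l * cnj (c l))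
       = complex_of_real nF - (\<Sum>l\<in>S. a l * cnj (a l)) + (\<Sum>l\<in>S. (c l - a l) * cnj (c l - a l))"
      by (simp add: algebra_simps sum.distrib sum_subtractf)
    also have "\<dots> = complex_of_real (nF - (\<Sum>l\<in>S. (cmod (a l))\<^sup>2) + (\<Sum>l\<in>S. (cmod (c l - a l))\<^sup>2))"
      by (simp only: complex_norm_square of_real_add of_real_diff of_real_sum)
    finally show ?thesis unfolding of_real_eq_iff .
  qed
  have bessel: "(\<Sum>l\<in>S. (cmod (a l))\<^sup>2) \<le> nF" if "finite S" "S \<subseteq> I" for S
  proof -
    have "0 \<le> (\<integral>x. (cmod (F x - T S a x))\<^sup>2 \<partial>P)" by simp
    then show ?thesis unfolding key[OF that] by simp
  qed
  have nnF: "(\<integral>\<^sup>+x. ennreal ((cmod (F x))\<^sup>2) \<partial>P) = ennreal nF"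
    unfolding nF_def by (rule nn_integral_eq_integral[OF intF]) simp
  have sup: "(\<Sum>\<^sub>\<infinity>l\<in>I. ennreal ((cmod (a l))\<^sup>2)) = (SUP S\<in>{S. finite S \<and> S \<subseteq> I}. (\<Sum>l\<in>S. ennreal ((cmod (a l))\<^sup>2)))"
    by (rule nonneg_infsum_complete) simp
  have "(\<Sum>\<^sub>\<infinity>l\<in>I. ennreal ((cmod (a l))\<^sup>2)) = ennreal nF"
  proof (rule antisym)
    show "(\<Sum>\<^sub>\<infinity>l\<in>I. ennreal ((cmod (a l))\<^sup>2)) \<le> ennreal nF"
      unfolding sup using bessel by (intro SUP_least) (auto simp: sum_ennreal intro!: ennreal_leI)
    show "ennreal nF \<le> (\<Sum>\<^sub>\<infinity>l\<in>I. ennreal ((cmod (a l))\<^sup>2))"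
    proof (rule ennreal_le_epsilon)
      fix \<epsilon> :: real assume "\<epsilon> > 0"
      \<comment> \<open>The measure has mass 1, so a uniform error of sqrt \<epsilon> becomes a mean
        square error of at most \<epsilon>.\<close>
      then obtain S c where S: "finite S" "S \<subseteq> I"
        and ap: "\<And>x. x \<in> space P \<Longrightarrow> cmod (F x - T S c x) \<le> sqrt \<epsilon>"
        using approx[of "sqrt \<epsilon>"] unfolding T_def by auto
      have "(\<integral>x. (cmod (F x - T S c x))\<^sup>2 \<partial>P) \<le> \<epsilon>"
      proof -
        have Tm: "T S c \<in> borel_measurable P"
          unfolding T_def using e(1) S by (intro borel_measurable_sum borel_measurable_times borel_measurable_cnj borel_measurable_const) auto
        have b: "(cmod (F x - T S c x))\<^sup>2 \<le> \<epsilon>" if "x \<in> space P" for x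
          using power_mono[OF ap[OF that], of 2] \<open>\<epsilon> > 0\<close> by simp
        have "(\<integral>x. (cmod (F x - T S c x))\<^sup>2 \<partial>P) \<le> (\<integral>x. \<epsilon> \<partial>P)"
          using F(1) Tm b by (intro integral_mono integrable_bounded[OF P, where B = \<epsilon>]) (use \<open>\<epsilon> > 0\<close> in auto)
        also have "\<dots> = \<epsilon>" using mass by (simp add: measure_def)
        finally show ?thesis .
      qed
      then have "nF \<le> (\<Sum>l\<in>S. (cmod (a l))\<^sup>2) + \<epsilon>"
        unfolding key[OF S] using sum_nonneg[of S "\<lambda>l. (cmod (c l - a l))\<^sup>2"] by simp
      then have "ennreal nF \<le> ennreal (\<Sum>l\<in>S. (cmod (a l))\<^sup>2) + ennreal \<epsilon>"
        using \<open>\<epsilon> > 0\<close> by (simp add: ennreal_plus[symmetric] sum_nonneg ennreal_leI del: ennreal_plus)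
      also have "ennreal (\<Sum>l\<in>S. (cmod (a l))\<^sup>2) = (\<Sum>l\<in>S. ennreal ((cmod (a l))\<^sup>2))" by (simp add: sum_ennreal)
      also have "\<dots> \<le> (\<Sum>\<^sub>\<infinity>l\<in>I. ennreal ((cmod (a l))\<^sup>2))"
        unfolding sup using S by (intro SUP_upper) auto
      finally show "ennreal nF \<le> (\<Sum>\<^sub>\<infinity>l\<in>I. ennreal ((cmod (a l))\<^sup>2)) + ennreal \<epsilon>" by (simp add: add_right_mono)
    qed
  qed
  then show ?thesis using nnF by (simp add: a_def)
qed

section \<open>Integration over coset spaces\<close>

text \<open>One setting for both compact quotients: S is the whole group with H = \<Gamma>, or S = M
  with H = M \<inter> \<Gamma>. Functions on the quotient are kept as functions on the group
  invariant under H from the right.\<close>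

locale coset_prob = lie_chart G \<A> \<kappa>
  for G :: "'g::{t2_space,second_countable_topology} monoid" (structure)
    and \<A> :: "('g, 'a::euclidean_space) chart set" and \<kappa> +
  fixes S H :: "'g set" and P :: "'g set measure"
  assumes subS: "subgroup S G" and subH: "subgroup H G" and HS: "H \<subseteq> S"
    and inv_P: "invariant_probability (G\<lparr>carrier := S\<rparr>) H P"
begin

definition "cs a = (\<lambda>h. a \<otimes> h) ` H"
definition "rinv f \<longleftrightarrow> (\<forall>g\<in>S. \<forall>h\<in>H. f (g \<otimes> h) = f g)"

lemma S_closed: "a \<in> S \<Longrightarrow> b \<in> S \<Longrightarrow> a \<otimes> b \<in> S" "a \<in> S \<Longrightarrow> inv a \<in> S" "\<one> \<in> S"
  using subS by (auto intro: subgroup.m_closed subgroup.m_inv_closed subgroup.one_closed)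

lemma H_closed: "a \<in> H \<Longrightarrow> b \<in> H \<Longrightarrow> a \<otimes> b \<in> H" "a \<in> H \<Longrightarrow> inv a \<in> H" "\<one> \<in> H"
  using subH by (auto intro: subgroup.m_closed subgroup.m_inv_closed subgroup.one_closed)

lemma l_coset_restrict: "a <#\<^bsub>G\<lparr>carrier := S\<rparr>\<^esub> C = a <#\<^bsub>G\<^esub> C"
  by (simp add: l_coset_def)

lemma l_coset_eq: "a <#\<^bsub>G\<^esub> C = (\<lambda>h. a \<otimes> h) ` C"
  by (auto simp: l_coset_def)

lemma lcosets_eq: "lcosets\<^bsub>G\<lparr>carrier := S\<rparr>\<^esub> H = cs ` S"
  by (auto simp: LCOSETS_def l_coset_restrict l_coset_eq cs_def)

lemma l_coset_cs: "a <#\<^bsub>G\<^esub> cs b = cs (a \<otimes> b)"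
  by (simp add: l_coset_eq cs_def image_image mult_assoc)

lemma cs_eq_iff: "cs a = cs b \<longleftrightarrow> inv a \<otimes> b \<in> H"
proof
  assume "cs a = cs b"
  moreover have "b \<in> cs b" unfolding cs_def using H_closed(3) by (metis image_eqI one_mult(2))
  ultimately obtain h where "h \<in> H" "b = a \<otimes> h" unfolding cs_def by auto
  then show "inv a \<otimes> b \<in> H" by simp
next
  assume ab: "inv a \<otimes> b \<in> H"
  have "b \<otimes> h = a \<otimes> ((inv a \<otimes> b) \<otimes> h)" for h by (simp add: mult_assoc)
  moreover have "a \<otimes> h = b \<otimes> ((inv b \<otimes> a) \<otimes> h)" for h by (simp add: mult_assoc)
  moreover have "inv b \<otimes> a \<in> H" using H_closed(2)[OF ab] by (simp add: inv_prod)
  ultimately show "cs a = cs b" unfolding cs_def using H_closed(1) ab by blast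
qed

lemma space_P: "space P = cs ` S"
proof -
  have "sets P = sets (coset_borel (G\<lparr>carrier := S\<rparr>) H)"
    using inv_P unfolding invariant_probability_def by auto
  then have "space P = space (coset_borel (G\<lparr>carrier := S\<rparr>) H)" by (rule sets_eq_imp_space_eq)
  also have "\<dots> = cs ` S"
    unfolding coset_borel_def by (subst space_measure_of) (auto simp: openin_coset_topology lcosets_eq)
  finally show ?thesis .
qed

lemma sets_P: "sets P = sigma_sets (cs ` S) {U. openin (coset_topology (G\<lparr>carrier := S\<rparr>) H) U}"
proof -
  have "sets P = sets (coset_borel (G\<lparr>carrier := S\<rparr>) H)"
    using inv_P unfolding invariant_probability_def by auto
  also have "\<dots> = sigma_sets (cs ` S) {U. openin (coset_topology (G\<lparr>carrier := S\<rparr>) H) U}"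
    unfolding coset_borel_def by (subst sets_measure_of) (auto simp: openin_coset_topology lcosets_eq)
  finally show ?thesis .
qed

lemma openin_iff: "openin (coset_topology (G\<lparr>carrier := S\<rparr>) H) U \<longleftrightarrow>
   U \<subseteq> cs ` S \<and> openin (top_of_set S) {g \<in> S. cs g \<in> U}"
  unfolding openin_coset_topology lcosets_eq by (simp add: l_coset_restrict l_coset_eq cs_def)

lemma mass_P: "emeasure P (space P) = 1"
  using inv_P unfolding invariant_probability_def by auto

lemma finite_P: "finite_measure P"
  by (rule finite_measureI) (simp add: mass_P)

lemma on_cosets_cs: "rinv f \<Longrightarrow> a \<in> S \<Longrightarrow> on_cosets f (cs a) = f a"
proof -
  assume f: "rinv f" and a: "a \<in> S"
  have "a \<in> cs a" unfolding cs_def using H_closed(3) by (metis image_eqI one_mult(2))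
  then have "(SOME g. g \<in> cs a) \<in> cs a" by (rule someI)
  then obtain h where h: "h \<in> H" "(SOME g. g \<in> cs a) = a \<otimes> h" unfolding cs_def by auto
  show ?thesis unfolding on_cosets_def h(2) using f a h(1) by (simp add: rinv_def)
qed

lemma measurable_on_cosets:
  fixes f :: "'g \<Rightarrow> 'b::topological_space"
  assumes f: "continuous_on S f" "rinv f"
  shows "on_cosets f \<in> borel_measurable P"
proof (rule borel_measurableI)
  fix T :: "'b set" assume T: "open T"
  have "openin (coset_topology (G\<lparr>carrier := S\<rparr>) H) (on_cosets f -` T \<inter> space P)"
    unfolding openin_iff space_P
  proof (intro conjI)
    have "{g \<in> S. cs g \<in> on_cosets f -` T \<inter> cs ` S} = S \<inter> f -` T"
      using on_cosets_cs[OF f(2)] by auto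
    then show "openin (top_of_set S) {g \<in> S. cs g \<in> on_cosets f -` T \<inter> cs ` S}"
      using f(1) T by (simp add: continuous_openin_preimage_gen)
  qed auto
  then show "on_cosets f -` T \<inter> space P \<in> sets P" unfolding sets_P by blast
qed

lemma translate_measurable:
  assumes a: "a \<in> S"
  shows "(\<lambda>c. a <#\<^bsub>G\<^esub> c) \<in> measurable P P"
proof (rule measurable_sigma_sets[OF sets_P])
  show "{U. openin (coset_topology (G\<lparr>carrier := S\<rparr>) H) U} \<subseteq> Pow (cs ` S)" by (auto simp: openin_iff)
  show "(\<lambda>c. a <#\<^bsub>G\<^esub> c) \<in> space P \<rightarrow> cs ` S"
    using a S_closed unfolding space_P by (auto simp: l_coset_cs)
  fix U assume "U \<in> {U. openin (coset_topology (G\<lparr>carrier := S\<rparr>) H) U}"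
  then have U: "U \<subseteq> cs ` S" "openin (top_of_set S) {g \<in> S. cs g \<in> U}" by (auto simp: openin_iff)
  have "openin (coset_topology (G\<lparr>carrier := S\<rparr>) H) ((\<lambda>c. a <#\<^bsub>G\<^esub> c) -` U \<inter> space P)"
    unfolding openin_iff space_P
  proof (intro conjI)
    have "continuous_on S (\<lambda>g. a \<otimes> g)" by (intro continuous_intros)
    moreover have "(\<lambda>g. a \<otimes> g) \<in> S \<rightarrow> S" using a S_closed by auto
    ultimately have "openin (top_of_set S) (S \<inter> (\<lambda>g. a \<otimes> g) -` {g \<in> S. cs g \<in> U})"
      using U(2) by (rule continuous_openin_preimage)
    also have "S \<inter> (\<lambda>g. a \<otimes> g) -` {g \<in> S. cs g \<in> U}
       = {g \<in> S. cs g \<in> (\<lambda>c. a <#\<^bsub>G\<^esub> c) -` U \<inter> cs ` S}"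
      using a S_closed by (auto simp: l_coset_cs)
    finally show "openin (top_of_set S) {g \<in> S. cs g \<in> (\<lambda>c. a <#\<^bsub>G\<^esub> c) -` U \<inter> cs ` S}" .
  qed auto
  then show "(\<lambda>c. a <#\<^bsub>G\<^esub> c) -` U \<inter> space P \<in> sets P" unfolding sets_P by blast
qed

text \<open>Invariance is given for images of sets, while a push-forward uses preimages; the
  preimage under translation by a is the image under translation by its inverse.\<close>

lemma distr_translate:
  assumes a: "a \<in> S"
  shows "distr P P (\<lambda>c. a <#\<^bsub>G\<^esub> c) = P"
proof (rule measure_eqI)
  fix A assume "A \<in> sets (distr P P (\<lambda>c. a <#\<^bsub>G\<^esub> c))"
  then have A: "A \<in> sets P" by simp
  then have sub: "A \<subseteq> cs ` S" using sets.sets_into_space space_P by blast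
  have "(\<lambda>c. a <#\<^bsub>G\<^esub> c) -` A \<inter> space P = (\<lambda>c. inv a <#\<^bsub>G\<^esub> c) ` A"
  proof (rule Set.set_eqI, rule iffI)
    fix c assume c: "c \<in> (\<lambda>c. a <#\<^bsub>G\<^esub> c) -` A \<inter> space P"
    then obtain g where g: "g \<in> S" "c = cs g" by (auto simp: space_P)
    then have "cs (a \<otimes> g) \<in> A" using c by (simp add: l_coset_cs)
    moreover have "c = inv a <#\<^bsub>G\<^esub> cs (a \<otimes> g)" by (simp add: l_coset_cs g)
    ultimately show "c \<in> (\<lambda>c. inv a <#\<^bsub>G\<^esub> c) ` A" by blast
  next
    fix c assume "c \<in> (\<lambda>c. inv a <#\<^bsub>G\<^esub> c) ` A"
    then obtain g where g: "g \<in> S" "cs g \<in> A" "c = cs (inv a \<otimes> g)" using sub by (auto simp: l_coset_cs)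
    then show "c \<in> (\<lambda>c. a <#\<^bsub>G\<^esub> c) -` A \<inter> space P"
      using a S_closed by (auto simp: space_P l_coset_cs)
  qed
  moreover have "emeasure P ((\<lambda>c. inv a <#\<^bsub>G\<^esub> c) ` A) = emeasure P A"
    using inv_P A S_closed(2)[OF a] unfolding invariant_probability_def by (simp add: l_coset_restrict)
  ultimately show "emeasure (distr P P (\<lambda>c. a <#\<^bsub>G\<^esub> c)) A = emeasure P A"
    using A translate_measurable[OF a] by (simp add: emeasure_distr)
qed simp

lemma rinv_translate: "rinv f \<Longrightarrow> a \<in> S \<Longrightarrow> rinv (\<lambda>g. f (a \<otimes> g))"
  unfolding rinv_def using S_closed by (metis mult_assoc)

lemma on_cosets_translate:
  "rinv f \<Longrightarrow> a \<in> S \<Longrightarrow> c \<in> space P \<Longrightarrow> on_cosets (\<lambda>g. f (a \<otimes> g)) c = on_cosets f (a <#\<^bsub>G\<^esub> c)"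
  using S_closed by (auto simp: space_P l_coset_cs on_cosets_cs on_cosets_cs[OF rinv_translate])

lemma integral_translate:
  fixes f :: "'g \<Rightarrow> 'b::{banach, second_countable_topology}"
  assumes f: "on_cosets f \<in> borel_measurable P" "rinv f" and a: "a \<in> S"
  shows "(\<integral>c. on_cosets (\<lambda>g. f (a \<otimes> g)) c \<partial>P) = (\<integral>c. on_cosets f c \<partial>P)"
proof -
  have "(\<integral>c. on_cosets (\<lambda>g. f (a \<otimes> g)) c \<partial>P) = (\<integral>c. on_cosets f (a <#\<^bsub>G\<^esub> c) \<partial>P)"
    by (intro Bochner_Integration.integral_cong on_cosets_translate f a refl)
  also have "\<dots> = (\<integral>c. on_cosets f c \<partial>distr P P (\<lambda>c. a <#\<^bsub>G\<^esub> c))"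
    by (rule integral_distr[symmetric, OF translate_measurable[OF a] f(1)])
  finally show ?thesis by (simp add: distr_translate[OF a])
qed

lemma nn_integral_translate:
  assumes f: "on_cosets f \<in> borel_measurable P" "rinv f" and a: "a \<in> S"
  shows "(\<integral>\<^sup>+c. on_cosets (\<lambda>g. f (a \<otimes> g)) c \<partial>P) = (\<integral>\<^sup>+c. on_cosets f c \<partial>P)"
proof -
  have "(\<integral>\<^sup>+c. on_cosets (\<lambda>g. f (a \<otimes> g)) c \<partial>P) = (\<integral>\<^sup>+c. on_cosets f (a <#\<^bsub>G\<^esub> c) \<partial>P)"
    by (intro nn_integral_cong on_cosets_translate f a)
  also have "\<dots> = (\<integral>\<^sup>+c. on_cosets f c \<partial>distr P P (\<lambda>c. a <#\<^bsub>G\<^esub> c))"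
    by (rule nn_integral_distr[symmetric, OF translate_measurable[OF a]]) (use f(1) in simp)
  finally show ?thesis by (simp add: distr_translate[OF a])
qed

lemma integrable_on_cosets:
  fixes f :: "'g \<Rightarrow> 'b::{banach, second_countable_topology}"
  assumes f: "continuous_on S f" "rinv f" and B: "\<And>g. g \<in> S \<Longrightarrow> norm (f g) \<le> B"
  shows "integrable P (on_cosets f)"
  using B on_cosets_cs[OF f(2)]
  by (intro integrable_bounded[OF finite_P measurable_on_cosets[OF f], where B = B]) (auto simp: space_P)

end

section \<open>Trigonometric approximation\<close>

context malcev
begin

definition "ee l v = exp (2 * \<i> * of_real pi * of_real (l v :: real))" for v :: 'a
text \<open>Integral functionals supported on the coordinates in I. The index set stays a parameter
  because {1..n-1} gives the dual of the torus, {n} that of the circle, and {p+1..n} the lattice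
  V.\<close>

definition "Latt I = {(\<lambda>v. \<Sum>i\<in>I. of_int (c i) * co i v) | c :: nat \<Rightarrow> int. True}"

lemma norm_ee [simp]: "cmod (ee l v) = 1"
proof -
  have "ee l v = exp (\<i> * of_real (2 * pi * l v))" by (simp add: ee_def mult_ac)
  then show ?thesis by (simp only: norm_exp_i_times)
qed

lemma ee_add: "ee (\<lambda>v. l v + k v) v = ee l v * ee k v"
  by (simp add: ee_def exp_add[symmetric] algebra_simps)

lemma Latt_add: "l \<in> Latt I \<Longrightarrow> k \<in> Latt I \<Longrightarrow> (\<lambda>v. l v + k v) \<in> Latt I"
  unfolding Latt_def mem_Collect_eq
proof (elim exE conjE)
  fix c d assume "l = (\<lambda>v. \<Sum>i\<in>I. of_int (c i) * co i v)" "k = (\<lambda>v. \<Sum>i\<in>I. of_int (d i) * co i v)"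
  then have "(\<lambda>v. l v + k v) = (\<lambda>v. \<Sum>i\<in>I. of_int (c i + d i) * co i v)"
    by (simp add: sum.distrib distrib_right)
  then show "\<exists>c::nat \<Rightarrow> int. (\<lambda>v. l v + k v) = (\<lambda>v. \<Sum>i\<in>I. of_int (c i) * co i v) \<and> True" 
    by (intro exI[of _ "\<lambda>i. c i + d i"]) simp
qed

lemma Latt_0: "(\<lambda>v. 0) \<in> Latt I"
  unfolding Latt_def by (intro CollectI exI[of _ "\<lambda>i. 0"]) simp

lemma Latt_uminus: "l \<in> Latt I \<Longrightarrow> (\<lambda>v. - l v) \<in> Latt I"
  unfolding Latt_def mem_Collect_eq
proof (elim exE conjE)
  fix c assume "l = (\<lambda>v. \<Sum>i\<in>I. of_int (c i) * co i v)"
  then have "(\<lambda>v. - l v) = (\<lambda>v. \<Sum>i\<in>I. of_int (- c i) * co i v)" by (simp add: sum_negf)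
  then show "\<exists>c::nat \<Rightarrow> int. (\<lambda>v. - l v) = (\<lambda>v. \<Sum>i\<in>I. of_int (c i) * co i v) \<and> True"
    by (intro exI[of _ "\<lambda>i. - c i"]) simp
qed

lemma Latt_co: "finite I \<Longrightarrow> i \<in> I \<Longrightarrow> (\<lambda>v. of_int k * co i v) \<in> Latt I"
  unfolding Latt_def
  by (intro CollectI exI[of _ "\<lambda>j. if j = i then k else 0"]) (simp add: if_distrib[of "\<lambda>x. of_int x * _"] cong: if_cong)

lemma Latt_linear: "l \<in> Latt I \<Longrightarrow> linear l"
proof -
  assume "l \<in> Latt I"
  then obtain c :: "nat \<Rightarrow> int" where l: "l = (\<lambda>v. \<Sum>i\<in>I. of_int (c i) * co i v)" by (auto simp: Latt_def)
  show ?thesis unfolding l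
    by (rule linearI) (simp_all add: linear_add[OF linear_co] linear_cmul[OF linear_co]
        distrib_left sum.distrib sum_distrib_left mult_ac)
qed

text \<open>Trigonometric polynomials as a closure, which makes products easy by induction;
  \<open>TP_repr\<close> recovers the finite sums.\<close>

inductive_set TP for I where
  TP_monom: "l \<in> Latt I \<Longrightarrow> (\<lambda>v. a * ee l v) \<in> TP I"
| TP_add: "f \<in> TP I \<Longrightarrow> g \<in> TP I \<Longrightarrow> (\<lambda>v. f v + g v) \<in> TP I"

lemma TP_const: "(\<lambda>v. a) \<in> TP I"
  using TP_monom[OF Latt_0, of a I] by (simp add: ee_def)

lemma TP_monom_mult: "l \<in> Latt I \<Longrightarrow> g \<in> TP I \<Longrightarrow> (\<lambda>v. a * ee l v * g v) \<in> TP I"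
proof (rotate_tac, induction rule: TP.induct)
  case (TP_monom k b)
  have "(\<lambda>v. (a * b) * ee (\<lambda>v. l v + k v) v) \<in> TP I" by (intro TP.TP_monom Latt_add TP_monom)
  then show ?case by (simp add: ee_add mult_ac)
next
  case (TP_add f g)
  then show ?case using TP.TP_add by (fastforce simp: distrib_left)
qed

lemma TP_mult: "f \<in> TP I \<Longrightarrow> g \<in> TP I \<Longrightarrow> (\<lambda>v. f v * g v) \<in> TP I"
proof (induction rule: TP.induct)
  case (TP_monom l a)
  then show ?case by (intro TP_monom_mult)
next
  case (TP_add f g')
  then show ?case using TP.TP_add by (fastforce simp: distrib_right)
qed

lemma TP_sum: "finite A \<Longrightarrow> (\<And>i. i \<in> A \<Longrightarrow> f i \<in> TP I) \<Longrightarrow> (\<lambda>v. \<Sum>i\<in>A. f i v) \<in> TP I"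
  by (induction A rule: finite_induct) (auto intro: TP_const TP_add)

lemma TP_repr: "f \<in> TP I \<Longrightarrow> \<exists>S c. finite S \<and> S \<subseteq> Latt I \<and> f = (\<lambda>v. \<Sum>l\<in>S. c l * ee l v)"
proof (induction rule: TP.induct)
  case (TP_monom l a)
  then show ?case by (intro exI[of _ "{l}"] exI[of _ "\<lambda>_. a"]) auto
next
  case (TP_add f g)
  then obtain S c S' c' where S: "finite S" "S \<subseteq> Latt I" "f = (\<lambda>v. \<Sum>l\<in>S. c l * ee l v)"
    and S': "finite S'" "S' \<subseteq> Latt I" "g = (\<lambda>v. \<Sum>l\<in>S'. c' l * ee l v)" by blast
  have "(\<Sum>l\<in>S. c l * ee l v) = (\<Sum>l\<in>S \<union> S'. (if l \<in> S then c l else 0) * ee l v)" for v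
    using S(1) S'(1) by (intro sum.mono_neutral_cong_left) auto
  moreover have "(\<Sum>l\<in>S'. c' l * ee l v) = (\<Sum>l\<in>S \<union> S'. (if l \<in> S' then c' l else 0) * ee l v)" for v
    using S(1) S'(1) by (intro sum.mono_neutral_cong_left) auto
  ultimately have "(\<lambda>v. f v + g v) = (\<lambda>v. \<Sum>l\<in>S \<union> S'. ((if l \<in> S then c l else 0) + (if l \<in> S' then c' l else 0)) * ee l v)"
    unfolding S(3) S'(3) by (simp only: sum.distrib distrib_right)
  then show ?case using S S'
    by (intro exI[of _ "S \<union> S'"] exI[of _ "\<lambda>l. (if l \<in> S then c l else 0) + (if l \<in> S' then c' l else 0)"]) auto
qed

lemma TP_cos: "finite I \<Longrightarrow> i \<in> I \<Longrightarrow> (\<lambda>v. of_real (cos (2 * pi * co i v))) \<in> TP I"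
  and TP_sin: "finite I \<Longrightarrow> i \<in> I \<Longrightarrow> (\<lambda>v. of_real (sin (2 * pi * co i v))) \<in> TP I"
proof -
  assume I: "finite I" "i \<in> I"
  have ee: "ee (\<lambda>v. of_int k * co i v) v = cis (2 * pi * (of_int k * co i v))" for k v
    by (simp add: ee_def cis_conv_exp mult_ac)
  have p: "(\<lambda>v. a * ee (\<lambda>v. of_int 1 * co i v) v + b * ee (\<lambda>v. of_int (- 1) * co i v) v) \<in> TP I" for a b
    by (intro TP_add TP_monom Latt_co I)
  show "(\<lambda>v. of_real (cos (2 * pi * co i v))) \<in> TP I"
    using p[of "1/2" "1/2"] unfolding ee by (simp add: cis.ctr complex_eq_iff[abs_def] Complex_eq scaleR_conv_of_real field_simps)
  show "(\<lambda>v. of_real (sin (2 * pi * co i v))) \<in> TP I"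
    using p[of "- \<i>/2" "\<i>/2"] unfolding ee by (simp add: cis.ctr Complex_eq field_simps)
qed

lemma compact_cube: "compact {v. \<forall>i\<in>{1..n}. co i v \<in> {0..1}}"
proof -
  have "closed {v. \<forall>i\<in>{1..n}. co i v \<in> {0..1}}"
  proof -
    have "{v. \<forall>i\<in>{1..n}. co i v \<in> {0..1}} = (\<Inter>i\<in>{1..n}. co i -` {0..1})" by auto
    moreover have "closed (co i -` {0..1})" for i
      by (rule continuous_closed_vimage) (auto intro: linear_continuous_at linear_co[unfolded linear_conv_bounded_linear])
    ultimately show ?thesis by (auto intro: closed_INT)
  qed
  moreover have "bounded {v. \<forall>i\<in>{1..n}. co i v \<in> {0..1}}"
    unfolding bounded_iff
  proof (intro exI ballI)
    fix v assume v: "v \<in> {v. \<forall>i\<in>{1..n}. co i v \<in> {0..1}}"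
    have "norm v = norm (\<Sum>i\<in>{1..n}. co i v *\<^sub>R X i)" by (simp only: co_expand)
    also have "\<dots> \<le> (\<Sum>i\<in>{1..n}. norm (co i v *\<^sub>R X i))" by (rule norm_sum)
    also have "\<dots> \<le> (\<Sum>i\<in>{1..n}. norm (X i))"
      using v by (intro sum_mono) (auto intro!: mult_left_le_one_le)
    finally show "norm v \<le> (\<Sum>i\<in>{1..n}. norm (X i))" .
  qed
  ultimately show ?thesis by (simp add: compact_eq_bounded_closed)
qed

text \<open>Cosines and sines embed the torus in a Euclidean space. The periodic function descends
  to the compact image, where Stone-Weierstrass supplies a polynomial; a polynomial in cosines and
  sines is a trigonometric polynomial.\<close>

lemma trig_approx:
  fixes F :: "'a \<Rightarrow> complex"
  assumes I: "I \<subseteq> {1..n}" and cont: "continuous_on UNIV F"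
    and per: "\<And>v w. (\<forall>i\<in>I. co i v - co i w \<in> \<int>) \<Longrightarrow> F v = F w" and \<epsilon>: "\<epsilon> > 0"
  shows "\<exists>S c. finite S \<and> S \<subseteq> Latt I \<and> (\<forall>v. cmod (F v - (\<Sum>l\<in>S. c l * ee l v)) \<le> \<epsilon>)"
proof -
  have finI: "finite I" using I finite_subset by blast
  define K where "K = {v. \<forall>i\<in>{1..n}. co i v \<in> {0..1}}"
  define z where "z v = (\<Sum>i\<in>I. cos (2 * pi * co i v) *\<^sub>R X i, \<Sum>i\<in>I. sin (2 * pi * co i v) *\<^sub>R X i)" for v
  have cz: "continuous_on A z" for A unfolding z_def by (intro continuous_intros)
  have zper: "F v = F w" if "z v = z w" for v w
  proof (rule per, intro ballI)
    fix i assume i: "i \<in> I"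
    have "co i (fst (z v)) = co i (fst (z w))" "co i (snd (z v)) = co i (snd (z w))" using that by auto
    then have "cos (2 * pi * co i v) = cos (2 * pi * co i w)" "sin (2 * pi * co i v) = sin (2 * pi * co i w)"
      using i I co_sum[OF _ I] unfolding z_def by auto
    then obtain k :: int where "2 * pi * co i v = 2 * pi * co i w + 2 * pi * k"
      using sin_cos_eq_iff by blast
    then have "2 * pi * (co i v - co i w) = 2 * pi * of_int k" by (simp add: algebra_simps)
    then have "co i v - co i w = of_int k" by simp
    then show "co i v - co i w \<in> \<int>" by simp
  qed
  have zK: "\<exists>w\<in>K. z v = z w" for v
  proof -
    define w where "w = (\<Sum>i\<in>{1..n}. frac (co i v) *\<^sub>R X i)"
    have cw: "co i w = frac (co i v)" if "i \<in> {1..n}" for i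
      using co_sum[OF that order_refl, of "\<lambda>i. frac (co i v)"] that unfolding w_def by simp
    have "w \<in> K" unfolding K_def using cw by (auto simp: less_imp_le[OF frac_lt_1])
    moreover have "cos (2 * pi * co i v) = cos (2 * pi * co i w) \<and> sin (2 * pi * co i v) = sin (2 * pi * co i w)"
      if "i \<in> I" for i
    proof -
      have "co i v = co i w + of_int \<lfloor>co i v\<rfloor>" using cw that I by (auto simp: frac_def)
      then have "2 * pi * co i v = 2 * pi * co i w + 2 * pi * of_int \<lfloor>co i v\<rfloor>"
        by (metis distrib_left)
      then show ?thesis using sin_cos_eq_iff by blast
    qed
    ultimately show ?thesis unfolding z_def by (intro bexI[of _ w]) auto
  qed
  have Z: "range z = z ` K" using zK by blast
  have cK: "compact K" unfolding K_def by (rule compact_cube)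
  \<comment> \<open>The function induced on the image of the embedding; any preimage may be chosen
    because points with the same image differ by integers in the coordinates from I.\<close>
  define Fb where "Fb s = F (SOME v. z v = s)" for s
  have Fb: "Fb (z v) = F v" for v
    unfolding Fb_def by (rule zper) (metis (mono_tags, lifting) someI)
  have "continuous_on (z ` K) Fb"
  \<comment> \<open>The embedding restricted to the cube is a closed map by compactness, so closed
    preimages can be checked upstairs.\<close>
  proof (rule continuous_on_closed_vimage[THEN iffD2, rule_format])
    show "closed (z ` K)" by (intro compact_imp_closed compact_continuous_image cz cK)
    fix B :: "complex set" assume B: "closed B"
    have "Fb -` B \<inter> z ` K = z ` (K \<inter> F -` B)" using Fb by auto
    moreover have "closed (F -` B)"
      using cont B by (simp add: continuous_on_closed_vimage)
    then have "compact (K \<inter> F -` B)" using cK by (rule compact_Int_closed[rotated])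
    ultimately show "closed (Fb -` B \<inter> z ` K)"
      by (simp only:) (intro compact_imp_closed compact_continuous_image cz)
  qed
  then obtain g :: "'a \<times> 'a \<Rightarrow> complex" where g: "polynomial_function g" "\<And>x. x \<in> z ` K \<Longrightarrow> norm (Fb x - g x) < \<epsilon>"
    using Stone_Weierstrass_polynomial_function[of "z ` K" Fb \<epsilon>] compact_continuous_image[OF cz cK] \<epsilon> by blast
  have poly: "(\<lambda>v. complex_of_real (p (z v))) \<in> TP I" if "real_polynomial_function p" for p :: "'a \<times> 'a \<Rightarrow> real"
    using that
  proof (induction p rule: real_polynomial_function.induct)
    case (linear f)
    then have lin: "linear f" by (simp add: linear_conv_bounded_linear)
    have "f (z v) = (\<Sum>i\<in>I. cos (2 * pi * co i v) * f (X i, 0)) + (\<Sum>i\<in>I. sin (2 * pi * co i v) * f (0, X i))" for v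
    proof -
      have "z v = (\<Sum>i\<in>I. cos (2 * pi * co i v) *\<^sub>R (X i, 0)) + (\<Sum>i\<in>I. sin (2 * pi * co i v) *\<^sub>R (0, X i))"
        unfolding z_def by (simp add: prod_eq_iff fst_sum snd_sum)
      then show ?thesis by (simp add: linear_add[OF lin] linear_sum[OF lin] linear_cmul[OF lin] del: scaleR_Pair)
    qed
    then have "(\<lambda>v. complex_of_real (f (z v))) = (\<lambda>v. (\<Sum>i\<in>I. of_real (f (X i, 0)) * of_real (cos (2 * pi * co i v)))
        + (\<Sum>i\<in>I. of_real (f (0, X i)) * of_real (sin (2 * pi * co i v))))"
      by (simp add: mult.commute)
    also have "\<dots> \<in> TP I"
      by (intro TP_add TP_sum TP_mult TP_const TP_cos TP_sin finI)
    finally show ?case .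
  next
    case (const c) show ?case by (rule TP_const)
  next
    case (add f g) then show ?case using TP_add by fastforce
  next
    case (mult f g) then show ?case using TP_mult by fastforce
  qed
  have "(\<lambda>v. g (z v)) \<in> TP I"
  proof -
    have "real_polynomial_function (\<lambda>x. Re (g x))" "real_polynomial_function (\<lambda>x. Im (g x))"
      using g(1) unfolding polynomial_function_iff_Basis_inner by (auto simp: Basis_complex_def inner_complex_def)
    from poly[OF this(1)] poly[OF this(2)]
    have "(\<lambda>v. complex_of_real (Re (g (z v))) + \<i> * complex_of_real (Im (g (z v)))) \<in> TP I"
      by (intro TP_add TP_mult TP_const)
    then show ?thesis by (simp add: complex_eq[symmetric])
  qed
  from TP_repr[OF this] obtain S c where S: "finite S" "S \<subseteq> Latt I"
    "(\<lambda>v. g (z v)) = (\<lambda>v. \<Sum>l\<in>S. c l * ee l v)"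
    by (elim exE conjE) (rule that; assumption)
  have "cmod (F v - (\<Sum>l\<in>S. c l * ee l v)) \<le> \<epsilon>" for v
  proof -
    have "z v \<in> z ` K" using Z by blast
    then have "cmod (Fb (z v) - g (z v)) < \<epsilon>" by (rule g(2))
    then show ?thesis using fun_cong[OF S(3), of v] by (simp add: Fb)
  qed
  then show ?thesis using S(1,2) by (intro exI[of _ S] exI[of _ c]) simp
qed

end

section \<open>Integrals with a parameter and the quadratic form of the triangle inequality\<close>

lemma continuous_on_integral_bounded:
  fixes k :: "'b \<Rightarrow> 'a::metric_space \<Rightarrow> complex"
  assumes P: "finite_measure P"
    and meas: "\<And>v. (\<lambda>b. k b v) \<in> borel_measurable P"
    and cont: "\<And>b. b \<in> space P \<Longrightarrow> continuous_on UNIV (k b)"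
    and bdd: "\<And>b v. b \<in> space P \<Longrightarrow> cmod (k b v) \<le> B"
  shows "continuous_on UNIV (\<lambda>v. \<integral>b. k b v \<partial>P)"
proof -
  interpret P: finite_measure P by fact
  show ?thesis
    unfolding continuous_on_sequentially o_def
  proof (intro allI ballI impI, elim conjE)
    fix x :: "nat \<Rightarrow> 'a" and a assume x: "x \<longlonglongrightarrow> a"
    show "(\<lambda>j. \<integral>b. k b (x j) \<partial>P) \<longlonglongrightarrow> (\<integral>b. k b a \<partial>P)"
    proof (rule integral_dominated_convergence[where w = "\<lambda>_. B"])
      show "AE b in P. (\<lambda>j. k b (x j)) \<longlonglongrightarrow> k b a"
      proof (rule AE_I2)
        fix b assume "b \<in> space P"
        then have "isCont (k b) a" using cont by (simp add: continuous_on_eq_continuous_at)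
        then show "(\<lambda>j. k b (x j)) \<longlonglongrightarrow> k b a" using x by (rule isCont_tendsto_compose)
      qed
      show "AE b in P. norm (k b (x j)) \<le> B" for j using bdd by (intro AE_I2) auto
    qed (use meas in auto)
  qed
qed

text \<open>The substitute for the triangle inequality on squared norms. Its factor 2 is harmless
  for limits and accounts for the divisions by 4 in the approximations below.\<close>

lemma ennreal_sq_add: "ennreal ((cmod (a + b))\<^sup>2) \<le> 2 * ennreal ((cmod a)\<^sup>2) + 2 * ennreal ((cmod b)\<^sup>2)"
proof -
  have "(cmod (a + b))\<^sup>2 \<le> (cmod a + cmod b)\<^sup>2" by (intro power_mono norm_triangle_ineq) auto
  also have "\<dots> \<le> 2 * (cmod a)\<^sup>2 + 2 * (cmod b)\<^sup>2"
    using zero_le_power2[of "cmod a - cmod b"] by (simp add: power2_eq_square algebra_simps)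
  finally have "ennreal ((cmod (a + b))\<^sup>2) \<le> ennreal (2 * (cmod a)\<^sup>2 + 2 * (cmod b)\<^sup>2)" by (rule ennreal_leI)
  also have "\<dots> = 2 * ennreal ((cmod a)\<^sup>2) + 2 * ennreal ((cmod b)\<^sup>2)"
    by (simp add: ennreal_plus ennreal_mult)
  finally show ?thesis .
qed

lemma nn_integral_sq_add:
  assumes [measurable]: "f \<in> borel_measurable M" "g \<in> borel_measurable M"
  shows "(\<integral>\<^sup>+x. ennreal ((cmod (f x + g x))\<^sup>2) \<partial>M)
    \<le> 2 * (\<integral>\<^sup>+x. ennreal ((cmod (f x))\<^sup>2) \<partial>M) + 2 * (\<integral>\<^sup>+x. ennreal ((cmod (g x))\<^sup>2) \<partial>M)"
proof -
  have "(\<integral>\<^sup>+x. ennreal ((cmod (f x + g x))\<^sup>2) \<partial>M)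
     \<le> (\<integral>\<^sup>+x. 2 * ennreal ((cmod (f x))\<^sup>2) + 2 * ennreal ((cmod (g x))\<^sup>2) \<partial>M)"
    by (intro nn_integral_mono ennreal_sq_add)
  also have "\<dots> = 2 * (\<integral>\<^sup>+x. ennreal ((cmod (f x))\<^sup>2) \<partial>M) + 2 * (\<integral>\<^sup>+x. ennreal ((cmod (g x))\<^sup>2) \<partial>M)"
    by (simp add: nn_integral_add nn_integral_cmult)
  finally show ?thesis .
qed

lemma ennreal_half_sum: "\<epsilon> > 0 \<Longrightarrow> 2 * ennreal (\<epsilon> / 4) + 2 * ennreal (\<epsilon> / 4) = ennreal \<epsilon>"
proof -
  assume e: "\<epsilon> > 0"
  have "2 * ennreal (\<epsilon> / 4) = ennreal (\<epsilon> / 2)" using ennreal_mult'[of 2 "\<epsilon> / 4"] by simp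
  then show ?thesis using e by (simp add: ennreal_plus[symmetric] del: ennreal_plus)
qed

section \<open>Density of continuous functions\<close>

context coset_prob
begin

abbreviation "T \<equiv> coset_topology (G\<lparr>carrier := S\<rparr>) H"

lemma topspace_T: "topspace T = cs ` S"
proof -
  have "{g \<in> S. cs g \<in> cs ` S} = S" by auto
  then have "openin T (cs ` S)" unfolding openin_iff by simp
  moreover have "topspace T \<subseteq> cs ` S" using openin_iff openin_topspace by blast
  ultimately show ?thesis using openin_subset by blast
qed

lemma openin_sets: "openin T U \<Longrightarrow> U \<in> sets P"
  unfolding sets_P by blast

lemma continuous_map_measurable:
  fixes u :: "'g set \<Rightarrow> 'b::topological_space"
  assumes "continuous_map T euclidean u"
  shows "u \<in> borel_measurable P"
proof (rule borel_measurableI)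
  fix V :: "'b set" assume "open V"
  then have "openin T {c \<in> topspace T. u c \<in> V}" using assms unfolding continuous_map_def by auto
  moreover have "{c \<in> topspace T. u c \<in> V} = u -` V \<inter> space P" by (auto simp: topspace_T space_P)
  ultimately show "u -` V \<inter> space P \<in> sets P" by (metis openin_sets)
qed

definition approximable :: "('g set \<Rightarrow> complex) \<Rightarrow> bool" where
  "approximable f \<longleftrightarrow> f \<in> borel_measurable P \<and>
    (\<forall>\<epsilon>>0. \<exists>u. continuous_map T euclidean u \<and> (\<integral>\<^sup>+c. ennreal ((cmod (f c - u c))\<^sup>2) \<partial>P) < ennreal \<epsilon>)"

lemma approximable_limit:
  assumes f: "f \<in> borel_measurable P"
    and lim: "\<And>\<epsilon>. \<epsilon> > 0 \<Longrightarrow> \<exists>g. approximable g \<and> (\<integral>\<^sup>+c. ennreal ((cmod (f c - g c))\<^sup>2) \<partial>P) < ennreal \<epsilon>"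
  shows "approximable f"
  unfolding approximable_def
proof (intro conjI allI impI f)
  fix \<epsilon> :: real assume "\<epsilon> > 0"
  then obtain g where g: "approximable g" "(\<integral>\<^sup>+c. ennreal ((cmod (f c - g c))\<^sup>2) \<partial>P) < ennreal (\<epsilon> / 4)"
    using lim[of "\<epsilon> / 4"] by auto
  then obtain u where u: "continuous_map T euclidean u" "(\<integral>\<^sup>+c. ennreal ((cmod (g c - u c))\<^sup>2) \<partial>P) < ennreal (\<epsilon> / 4)"
    using \<open>\<epsilon> > 0\<close> unfolding approximable_def by (metis divide_pos_pos zero_less_numeral)
  have m [measurable]: "g \<in> borel_measurable P" "u \<in> borel_measurable P" "f \<in> borel_measurable P"
    using g u f continuous_map_measurable by (auto simp: approximable_def)
  have "(\<integral>\<^sup>+c. ennreal ((cmod (f c - u c))\<^sup>2) \<partial>P) = (\<integral>\<^sup>+c. ennreal ((cmod ((f c - g c) + (g c - u c)))\<^sup>2) \<partial>P)" by simp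
  also have "\<dots> \<le> 2 * (\<integral>\<^sup>+c. ennreal ((cmod (f c - g c))\<^sup>2) \<partial>P) + 2 * (\<integral>\<^sup>+c. ennreal ((cmod (g c - u c))\<^sup>2) \<partial>P)"
    by (rule nn_integral_sq_add) measurable
  also have "\<dots> < 2 * ennreal (\<epsilon> / 4) + 2 * ennreal (\<epsilon> / 4)"
    using g(2) u(2) by (intro add_strict_mono ennreal_mult_strict_left_mono) auto
  also have "\<dots> = ennreal \<epsilon>"
    using \<open>\<epsilon> > 0\<close> by (simp add: ennreal_half_sum)
  finally show "\<exists>u. continuous_map T euclidean u \<and> (\<integral>\<^sup>+c. ennreal ((cmod (f c - u c))\<^sup>2) \<partial>P) < ennreal \<epsilon>"
    using u(1) by blast
qed

lemma approximable_add:
  assumes f: "approximable f" and g: "approximable g"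
  shows "approximable (\<lambda>c. f c + g c)"
  unfolding approximable_def
proof (intro conjI allI impI)
  have m [measurable]: "f \<in> borel_measurable P" "g \<in> borel_measurable P" using f g by (auto simp: approximable_def)
  show "(\<lambda>c. f c + g c) \<in> borel_measurable P" by measurable
  fix \<epsilon> :: real assume "\<epsilon> > 0"
  then have e4: "\<epsilon> / 4 > 0" by simp
  obtain u where u: "continuous_map T euclidean u" "(\<integral>\<^sup>+c. ennreal ((cmod (f c - u c))\<^sup>2) \<partial>P) < ennreal (\<epsilon> / 4)"
    using f e4 unfolding approximable_def by blast
  obtain w where w: "continuous_map T euclidean w" "(\<integral>\<^sup>+c. ennreal ((cmod (g c - w c))\<^sup>2) \<partial>P) < ennreal (\<epsilon> / 4)"
    using g e4 unfolding approximable_def by blast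
  have [measurable]: "u \<in> borel_measurable P" "w \<in> borel_measurable P"
    using u w continuous_map_measurable by auto
  have "(\<integral>\<^sup>+c. ennreal ((cmod (f c + g c - (u c + w c)))\<^sup>2) \<partial>P) = (\<integral>\<^sup>+c. ennreal ((cmod ((f c - u c) + (g c - w c)))\<^sup>2) \<partial>P)"
    by (simp add: algebra_simps)
  also have "\<dots> \<le> 2 * (\<integral>\<^sup>+c. ennreal ((cmod (f c - u c))\<^sup>2) \<partial>P) + 2 * (\<integral>\<^sup>+c. ennreal ((cmod (g c - w c))\<^sup>2) \<partial>P)"
    by (rule nn_integral_sq_add) measurable
  also have "\<dots> < 2 * ennreal (\<epsilon> / 4) + 2 * ennreal (\<epsilon> / 4)"
    using u(2) w(2) by (intro add_strict_mono ennreal_mult_strict_left_mono) auto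
  also have "\<dots> = ennreal \<epsilon>"
    using \<open>\<epsilon> > 0\<close> by (simp add: ennreal_half_sum)
  finally show "\<exists>u. continuous_map T euclidean u \<and> (\<integral>\<^sup>+c. ennreal ((cmod (f c + g c - u c))\<^sup>2) \<partial>P) < ennreal \<epsilon>"
    using continuous_map_add[OF u(1) w(1)] by (intro exI[of _ "\<lambda>c. u c + w c"]) auto
qed

lemma approximable_cmult:
  assumes f: "approximable f"
  shows "approximable (\<lambda>c. a * f c)"
  unfolding approximable_def
proof (intro conjI allI impI)
  have m [measurable]: "f \<in> borel_measurable P" using f by (auto simp: approximable_def)
  show "(\<lambda>c. a * f c) \<in> borel_measurable P" by measurable
  fix \<epsilon> :: real assume \<epsilon>: "\<epsilon> > 0"
  define \<delta> where "\<delta> = \<epsilon> / ((cmod a)\<^sup>2 + 1)"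
  have pos: "(cmod a)\<^sup>2 + 1 > 0" by (simp add: add_nonneg_pos)
  then have "\<delta> > 0" using \<epsilon> by (simp add: \<delta>_def)
  then obtain u where u: "continuous_map T euclidean u" "(\<integral>\<^sup>+c. ennreal ((cmod (f c - u c))\<^sup>2) \<partial>P) < ennreal \<delta>"
    using f unfolding approximable_def by blast
  have [measurable]: "u \<in> borel_measurable P" using u continuous_map_measurable by auto
  have "(\<integral>\<^sup>+c. ennreal ((cmod (a * f c - a * u c))\<^sup>2) \<partial>P) \<le> (\<integral>\<^sup>+c. ennreal ((cmod a)\<^sup>2 + 1) * ennreal ((cmod (f c - u c))\<^sup>2) \<partial>P)"
  proof (intro nn_integral_mono)
    fix c
    have "(cmod (a * f c - a * u c))\<^sup>2 = (cmod a)\<^sup>2 * (cmod (f c - u c))\<^sup>2"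
      by (simp add: right_diff_distrib[symmetric] norm_mult power_mult_distrib)
    also have "\<dots> \<le> ((cmod a)\<^sup>2 + 1) * (cmod (f c - u c))\<^sup>2" by (intro mult_right_mono) auto
    finally show "ennreal ((cmod (a * f c - a * u c))\<^sup>2) \<le> ennreal ((cmod a)\<^sup>2 + 1) * ennreal ((cmod (f c - u c))\<^sup>2)"
      using pos by (simp add: ennreal_mult[symmetric] ennreal_leI del: ennreal_plus)
  qed
  also have "\<dots> = ennreal ((cmod a)\<^sup>2 + 1) * (\<integral>\<^sup>+c. ennreal ((cmod (f c - u c))\<^sup>2) \<partial>P)"
    by (rule nn_integral_cmult) measurable
  also have "\<dots> < ennreal ((cmod a)\<^sup>2 + 1) * ennreal \<delta>"
    using u(2) pos by (intro ennreal_mult_strict_left_mono) (auto simp del: ennreal_plus)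
  also have "\<dots> = ennreal \<epsilon>"
    using pos \<open>\<delta> > 0\<close> by (simp add: ennreal_mult[symmetric] \<delta>_def less_imp_le del: ennreal_plus)
  finally have *: "(\<integral>\<^sup>+c. ennreal ((cmod (a * f c - a * u c))\<^sup>2) \<partial>P) < ennreal \<epsilon>" .
  have "continuous_map T euclidean (\<lambda>c. a * u c)"
    using continuous_map_compose[OF u(1), of euclidean "\<lambda>z. a * z"]
    by (simp add: o_def continuous_on_mult_const)
  with * show "\<exists>u. continuous_map T euclidean u \<and> (\<integral>\<^sup>+c. ennreal ((cmod (a * f c - u c))\<^sup>2) \<partial>P) < ennreal \<epsilon>"
    by (intro exI[of _ "\<lambda>c. a * u c"]) auto
qed

lemma approximable_cong: "approximable f \<Longrightarrow> (\<And>c. c \<in> space P \<Longrightarrow> f c = g c) \<Longrightarrow> approximable g"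
  unfolding approximable_def by (simp cong: measurable_cong nn_integral_cong)

lemma approximable_one: "approximable (\<lambda>c. 1)"
  unfolding approximable_def by (auto intro!: exI[of _ "\<lambda>c. 1"])

lemma approximable_sum: "finite A \<Longrightarrow> (\<And>i. i \<in> A \<Longrightarrow> approximable (f i)) \<Longrightarrow> approximable (\<lambda>c. \<Sum>i\<in>A. f i c)"
proof (induction A rule: finite_induct)
  case empty
  then show ?case using approximable_cmult[OF approximable_one, of 0] by simp
next
  case (insert x A)
  then show ?case by (auto intro!: approximable_add)
qed

text \<open>Closed sets \<open>D k\<close> increase to U, so their measures converge. An Urysohn
  function that is 1 on \<open>D k\<close> and 0 off U differs from the indicator only on U - D k,
  and there by at most 1.\<close>

lemma approximable_open:
  assumes nrm: "normal_space T"
    and fsig: "\<exists>C :: nat \<Rightarrow> 'g set set. (\<forall>k. closedin T (C k)) \<and> U = (\<Union>k. C k)"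
    and U: "openin T U"
  shows "approximable (indicator U)"
proof -
  interpret P: finite_measure P by (rule finite_P)
  obtain C :: "nat \<Rightarrow> 'g set set" where C: "\<And>k. closedin T (C k)" "U = (\<Union>k. C k)" using fsig by blast
  define D where "D k = (\<Union>i\<le>k. C i)" for k
  have D: "closedin T (D k)" "D k \<subseteq> U" for k unfolding D_def using C by (auto intro!: closedin_Union)
  have Us [measurable]: "U \<in> sets P" using U by (rule openin_sets)
  have Ds [measurable]: "D k \<in> sets P" for k
  proof -
    have "topspace T - D k \<in> sets P" using D(1) by (intro openin_sets) auto
    then have "space P - (topspace T - D k) \<in> sets P" by blast
    moreover have "space P - (topspace T - D k) = D k"
      using D(1)[of k] closedin_subset by (fastforce simp: space_P topspace_T)
    ultimately show ?thesis by simp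
  qed
  have "(\<lambda>k. measure P (D k)) \<longlonglongrightarrow> measure P (\<Union>k. D k)"
  proof (rule P.finite_Lim_measure_incseq)
    show "range D \<subseteq> sets P" using Ds by blast
    show "incseq D" unfolding incseq_def D_def by (auto intro: order_trans)
  qed
  moreover have "(\<Union>k. D k) = U" unfolding D_def C(2) by auto
  ultimately have lim: "(\<lambda>k. measure P (D k)) \<longlonglongrightarrow> measure P U" by simp
  show ?thesis
    unfolding approximable_def
  proof (intro conjI allI impI)
    show "indicator U \<in> borel_measurable P" by measurable
    fix \<epsilon> :: real assume "\<epsilon> > 0"
    then obtain k where k: "measure P U - measure P (D k) < \<epsilon>"
      using LIMSEQ_D[OF lim, of \<epsilon>] by (auto simp: abs_less_iff)
    have "closedin T (topspace T - U)" using U by blast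
    moreover have "disjnt (D k) (topspace T - U)" using D(2) by (auto simp: disjnt_def)
    ultimately obtain f where f: "continuous_map T (top_of_set {0..1::real}) f" "f ` (topspace T - U) \<subseteq> {0}" "f ` D k \<subseteq> {1}"
      using Urysohn_lemma[OF nrm, of "topspace T - U" "D k" 0 1] D(1) by (metis disjnt_sym zero_le_one)
    have f01: "0 \<le> f c \<and> f c \<le> 1" if "c \<in> topspace T" for c
      using f(1) that unfolding continuous_map_def by auto
    have fc: "continuous_map T euclidean f" using f(1) by (simp add: continuous_map_in_subtopology)
    have cc: "continuous_map T euclidean (\<lambda>c. complex_of_real (f c))"
      using continuous_map_compose[OF fc, of euclidean complex_of_real] by (simp add: o_def continuous_on_of_real)
    have "(\<integral>\<^sup>+c. ennreal ((cmod (indicator U c - complex_of_real (f c)))\<^sup>2) \<partial>P) \<le> (\<integral>\<^sup>+c. indicator (U - D k) c \<partial>P)"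
    proof (intro nn_integral_mono)
      fix c assume c: "c \<in> space P"
      then have ct: "c \<in> topspace T" by (simp add: space_P topspace_T)
      consider "c \<in> D k" | "c \<in> U - D k" | "c \<in> topspace T - U" using ct by blast
      then show "ennreal ((cmod (indicator U c - complex_of_real (f c)))\<^sup>2) \<le> indicator (U - D k) c"
      proof cases
        case 1 then show ?thesis using f(3) D(2) by (auto simp: indicator_def)
      next
        case 2
        have "cmod (1 - complex_of_real (f c)) = \<bar>1 - f c\<bar>" by (metis norm_of_real of_real_1 of_real_diff)
        also have "\<dots> \<le> 1" using f01[OF ct] by auto
        finally have "(cmod (1 - complex_of_real (f c)))\<^sup>2 \<le> 1" by (simp add: power_le_one)
        then show ?thesis using 2 by simp
      next
        case 3 then show ?thesis using f(2) D(2) by (auto simp: indicator_def)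
      qed
    qed
    also have "\<dots> = ennreal (measure P (U - D k))" by (simp add: P.emeasure_eq_measure)
    also have "measure P (U - D k) = measure P U - measure P (D k)"
      using D(2) by (intro P.finite_measure_Diff) auto
    also have "ennreal \<dots> < ennreal \<epsilon>" using k \<open>\<epsilon> > 0\<close> by (rule ennreal_lessI[rotated])
    finally show "\<exists>u. continuous_map T euclidean u \<and> (\<integral>\<^sup>+c. ennreal ((cmod (indicator U c - u c))\<^sup>2) \<partial>P) < ennreal \<epsilon>"
      using cc by blast
  qed
qed

text \<open>Dynkin's argument: open sets generate and are stable under intersection, complements use
  1 - indicator, and disjoint unions are limits of finite ones by continuity of the measure.\<close>

lemma approximable_indicator:
  assumes nrm: "normal_space T"
    and fsig: "\<And>U. openin T U \<Longrightarrow> \<exists>C :: nat \<Rightarrow> 'g set set. (\<forall>k. closedin T (C k)) \<and> U = (\<Union>k. C k)"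
    and A: "A \<in> sets P"
  shows "approximable (indicator A)"
proof -
  interpret P: finite_measure P by (rule finite_P)
  have st: "Int_stable {U. openin T U}" by (auto simp: Int_stable_def)
  have sub: "{U. openin T U} \<subseteq> Pow (cs ` S)" by (auto simp: openin_iff)
  have "A \<in> sigma_sets (cs ` S) {U. openin T U}" using A sets_P by simp
  then show ?thesis
  proof (induction rule: sigma_sets_induct_disjoint[OF st sub])
    case 1
    then show ?case using A sets_P by simp
  next
    case (2 U)
    then show ?case using approximable_open[OF nrm fsig] by simp
  next
    case 3
    then show ?case using approximable_cmult[OF approximable_one, of 0] by simp
  next
    case (4 B)
    then have B: "B \<in> sets P" "approximable (indicator B)" using sets_P by auto
    have "approximable (\<lambda>c. 1 + (- 1) * indicator B c)"
      by (intro approximable_add approximable_cmult approximable_one B)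
    then show ?case by (rule approximable_cong) (auto simp: space_P indicator_def)
  next
    case (5 B)
    then have B [measurable]: "\<And>i. B i \<in> sets P" and Ba: "\<And>i. approximable (indicator (B i))"
      and dj: "disjoint_family B" using sets_P by auto
    define D where "D k = (\<Union>i<k. B i)" for k
    have D [measurable]: "D k \<in> sets P" for k unfolding D_def by measurable
    have Da: "approximable (indicator (D k))" for k
    proof -
      have "approximable (\<lambda>c. \<Sum>i<k. indicator (B i) c)" by (intro approximable_sum Ba) auto
      moreover have "(\<Sum>i<k. indicator (B i) c :: complex) = indicator (D k) c" for c
        unfolding D_def using dj
        by (subst indicator_UN_disjoint) (auto simp: disjoint_family_on_def)
      ultimately show ?thesis by simp
    qed
    have "(\<lambda>k. measure P (D k)) \<longlonglongrightarrow> measure P (\<Union>k. D k)"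
    proof (rule P.finite_Lim_measure_incseq)
      show "range D \<subseteq> sets P" using D by blast
      show "incseq D" unfolding incseq_def D_def by (auto intro: less_le_trans)
    qed
    moreover have "(\<Union>k. D k) = (\<Union>i. B i)" unfolding D_def by auto
    ultimately have lim: "(\<lambda>k. measure P (D k)) \<longlonglongrightarrow> measure P (\<Union>i. B i)" by simp
    show ?case
    proof (rule approximable_limit)
      show "indicator (\<Union>i. B i) \<in> borel_measurable P" by measurable
      fix \<epsilon> :: real assume "\<epsilon> > 0"
      then obtain k where k: "measure P (\<Union>i. B i) - measure P (D k) < \<epsilon>"
        using LIMSEQ_D[OF lim, of \<epsilon>] by (auto simp: abs_less_iff)
      have sub: "D k \<subseteq> (\<Union>i. B i)" by (auto simp: D_def)
      have "(\<integral>\<^sup>+c. ennreal ((cmod (indicator (\<Union>i. B i) c - indicator (D k) c))\<^sup>2) \<partial>P)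
         = (\<integral>\<^sup>+c. indicator ((\<Union>i. B i) - D k) c \<partial>P)"
        using sub by (intro nn_integral_cong) (auto simp: indicator_def)
      also have "\<dots> = ennreal (measure P ((\<Union>i. B i) - D k))"
        by (subst nn_integral_indicator) (simp_all add: P.emeasure_eq_measure)
      also have "measure P ((\<Union>i. B i) - D k) = measure P (\<Union>i. B i) - measure P (D k)"
        using sub by (intro P.finite_measure_Diff) auto
      also have "ennreal \<dots> < ennreal \<epsilon>" using k \<open>\<epsilon> > 0\<close> by (rule ennreal_lessI[rotated])
      finally show "\<exists>g. approximable g \<and> (\<integral>\<^sup>+c. ennreal ((cmod (indicator (\<Union>i. B i) c - g c))\<^sup>2) \<partial>P) < ennreal \<epsilon>"
        using Da by blast
    qed
  qed
qed

text \<open>Simple functions converge to f pointwise and are bounded by 2 |f|; dominated convergence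
  turns this into convergence in mean square.\<close>

lemma approximable_L2:
  assumes nrm: "normal_space T"
    and fsig: "\<And>U. openin T U \<Longrightarrow> \<exists>C :: nat \<Rightarrow> 'g set set. (\<forall>k. closedin T (C k)) \<and> U = (\<Union>k. C k)"
    and f [measurable]: "f \<in> borel_measurable P" and fin: "(\<integral>\<^sup>+c. ennreal ((cmod (f c))\<^sup>2) \<partial>P) < \<infinity>"
  shows "approximable f"
proof -
  obtain s where s: "\<And>i. simple_function P (s i)" "\<And>x. x \<in> space P \<Longrightarrow> (\<lambda>i. s i x) \<longlonglongrightarrow> f x"
    "\<And>i x. x \<in> space P \<Longrightarrow> dist (s i x) 0 \<le> 2 * dist (f x) 0"
    using borel_measurable_implies_sequence_metric[OF f, of 0] by blast
  have sm [measurable]: "s i \<in> borel_measurable P" for i using s(1) by (rule borel_measurable_simple_function)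
  have sa: "approximable (s i)" for i
  proof -
    have fin: "finite (s i ` space P)" using s(1) by (simp add: simple_function_def)
    have "approximable (\<lambda>c. \<Sum>y\<in>s i ` space P. y * indicator (s i -` {y} \<inter> space P) c)"
      using s(1)[of i] by (intro approximable_sum fin approximable_cmult approximable_indicator nrm fsig)
        (auto simp: simple_function_def)
    then show ?thesis
    proof (rule approximable_cong)
      fix c assume c: "c \<in> space P"
      have "(\<Sum>y\<in>s i ` space P. y * indicator (s i -` {y} \<inter> space P) c) = (\<Sum>y\<in>s i ` space P. if y = s i c then y else 0)"
        using c by (intro sum.cong) (auto simp: indicator_def)
      then show "(\<Sum>y\<in>s i ` space P. y * indicator (s i -` {y} \<inter> space P) c) = s i c"
        using c fin by simp
    qed
  qed
  have "(\<lambda>i. \<integral>\<^sup>+c. ennreal ((cmod (f c - s i c))\<^sup>2) \<partial>P) \<longlonglongrightarrow> (\<integral>\<^sup>+c. 0 \<partial>P)"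
  \<comment> \<open>The constant 9 is the square of 1 + 2, from |f - s| \<le> |f| + 2 |f|.\<close>
  proof (rule nn_integral_dominated_convergence[where w = "\<lambda>c. 9 * ennreal ((cmod (f c))\<^sup>2)"])
    show "AE c in P. ennreal ((cmod (f c - s i c))\<^sup>2) \<le> 9 * ennreal ((cmod (f c))\<^sup>2)" for i
    proof (rule AE_I2)
      fix c assume c: "c \<in> space P"
      have "cmod (f c - s i c) \<le> cmod (f c) + cmod (s i c)" by (rule norm_triangle_ineq4)
      also have "\<dots> \<le> 3 * cmod (f c)" using s(3)[OF c, of i] by simp
      finally have "(cmod (f c - s i c))\<^sup>2 \<le> (3 * cmod (f c))\<^sup>2" by (intro power_mono) auto
      then have "ennreal ((cmod (f c - s i c))\<^sup>2) \<le> ennreal (9 * (cmod (f c))\<^sup>2)" by (intro ennreal_leI) (simp add: power_mult_distrib)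
      then show "ennreal ((cmod (f c - s i c))\<^sup>2) \<le> 9 * ennreal ((cmod (f c))\<^sup>2)" by (simp add: ennreal_mult)
    qed
    show "(\<integral>\<^sup>+c. 9 * ennreal ((cmod (f c))\<^sup>2) \<partial>P) < \<infinity>"
      using fin by (simp add: nn_integral_cmult ennreal_mult_less_top)
    show "AE c in P. (\<lambda>i. ennreal ((cmod (f c - s i c))\<^sup>2)) \<longlonglongrightarrow> 0"
    proof (rule AE_I2)
      fix c assume c: "c \<in> space P"
      have "(\<lambda>i. ennreal ((cmod (f c - s i c))\<^sup>2)) \<longlonglongrightarrow> ennreal ((cmod (f c - f c))\<^sup>2)"
        by (intro tendsto_ennrealI tendsto_intros s(2) c)
      then show "(\<lambda>i. ennreal ((cmod (f c - s i c))\<^sup>2)) \<longlonglongrightarrow> 0" by simp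
    qed
  qed measurable
  then have lim: "(\<lambda>i. \<integral>\<^sup>+c. ennreal ((cmod (f c - s i c))\<^sup>2) \<partial>P) \<longlonglongrightarrow> 0" by simp
  show ?thesis
  proof (rule approximable_limit[OF f])
    fix \<epsilon> :: real assume "\<epsilon> > 0"
    then have "\<forall>\<^sub>F i in sequentially. (\<integral>\<^sup>+c. ennreal ((cmod (f c - s i c))\<^sup>2) \<partial>P) < ennreal \<epsilon>"
      using order_tendstoD(2)[OF lim, of "ennreal \<epsilon>"] by simp
    then obtain i where "(\<integral>\<^sup>+c. ennreal ((cmod (f c - s i c))\<^sup>2) \<partial>P) < ennreal \<epsilon>"
      by (meson eventually_sequentially order_refl)
    then show "\<exists>g. approximable g \<and> (\<integral>\<^sup>+c. ennreal ((cmod (f c - g c))\<^sup>2) \<partial>P) < ennreal \<epsilon>"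
      using sa by blast
  qed
qed

lemma continuous_dense_L2:
  assumes nrm: "normal_space T"
    and fsig: "\<And>U. openin T U \<Longrightarrow> \<exists>C :: nat \<Rightarrow> 'g set set. (\<forall>k. closedin T (C k)) \<and> U = (\<Union>k. C k)"
    and f: "rinv f" "on_cosets f \<in> borel_measurable P" "sq_norm P f < \<infinity>" and \<epsilon>: "\<epsilon> > 0"
  shows "\<exists>\<xi>. continuous_on S \<xi> \<and> rinv \<xi> \<and> sq_norm P (\<lambda>g. f g - \<xi> g) < ennreal \<epsilon>"
proof -
  have "sq_norm P f = (\<integral>\<^sup>+c. ennreal ((cmod (on_cosets f c))\<^sup>2) \<partial>P)"
    unfolding sq_norm_def on_cosets_def ..
  then have "approximable (on_cosets f)"
    using approximable_L2[OF nrm fsig f(2)] f(3) by simp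
  then obtain u where u: "continuous_map T euclidean u" "(\<integral>\<^sup>+c. ennreal ((cmod (on_cosets f c - u c))\<^sup>2) \<partial>P) < ennreal \<epsilon>"
    using \<epsilon> unfolding approximable_def by blast
  define \<xi> where "\<xi> g = u (cs g)" for g
  have r: "rinv \<xi>"
    unfolding rinv_def \<xi>_def
  proof (intro ballI)
    fix g h assume "h \<in> H"
    then have "cs g = cs (g \<otimes> h)" unfolding cs_eq_iff by simp
    then show "u (cs (g \<otimes> h)) = u (cs g)" by simp
  qed
  have c: "continuous_on S \<xi>"
    unfolding continuous_on_open_gen[where T = UNIV, simplified]
  proof (intro allI impI)
    fix V :: "complex set" assume "open V"
    then have "openin T {c \<in> topspace T. u c \<in> V}" using u(1) unfolding continuous_map_def by auto
    then have "openin (top_of_set S) {g \<in> S. cs g \<in> {c \<in> topspace T. u c \<in> V}}" unfolding openin_iff by blast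
    also have "{g \<in> S. cs g \<in> {c \<in> topspace T. u c \<in> V}} = S \<inter> \<xi> -` V"
      by (auto simp: topspace_T \<xi>_def)
    finally show "openin (top_of_set S) (S \<inter> \<xi> -` V)" .
  qed
  have rr: "rinv (\<lambda>g. (cmod (f g - \<xi> g))\<^sup>2)" using f(1) r unfolding rinv_def by simp
  have "sq_norm P (\<lambda>g. f g - \<xi> g) = (\<integral>\<^sup>+c. ennreal ((cmod (on_cosets f c - u c))\<^sup>2) \<partial>P)"
    unfolding sq_norm_def
    by (intro nn_integral_cong) (auto simp: space_P on_cosets_cs[OF rr[unfolded \<xi>_def]] on_cosets_cs[OF f(1)] \<xi>_def)
  then show ?thesis using u(2) c r by auto
qed

end

section \<open>The nilmanifold and its Fourier coefficients\<close>

locale nilmanifold = malcev G \<A> \<kappa> expo \<mm> X n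
  for G :: "'g::{t2_space,second_countable_topology} monoid" (structure)
    and \<A> :: "('g, 'a::euclidean_space) chart set" and \<kappa> and expo and \<mm> and X and n +
  fixes \<Gamma> M :: "'g set" and p :: nat and \<mu> \<mu>M :: "'g set measure"
  assumes unif: "uniform_subgroup G \<Gamma>" and M_def: "M = expo ` \<mm>"
    and based: "strongly_based_on G expo X \<Gamma>" and pn: "p \<le> n"
    and derived: "derived_algebra (lie_bracket G \<kappa>) = span (X ` {1..p})"
    and inv_\<mu>: "invariant_probability G \<Gamma> \<mu>"
    and inv_\<mu>M: "invariant_probability (G\<lparr>carrier := M\<rparr>) (M \<inter> \<Gamma>) \<mu>M"
begin

section \<open>Integer coordinates of the lattice and the dual lattice of the ideal\<close>

lemma M_iff: "g \<in> M \<longleftrightarrow> \<tau> (L g) = 0"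
proof
  assume "g \<in> M"
  then obtain v where "\<tau> v = 0" "g = expo v" unfolding M_def using mm_iff by auto
  then show "\<tau> (L g) = 0" using E_mm[of v] L_E[of v] by simp
next
  assume t: "\<tau> (L g) = 0"
  then have "g = expo (L g)" using E_mm[of "L g"] by simp
  then show "g \<in> M" unfolding M_def using t mm_iff by blast
qed

definition "int_vec v \<longleftrightarrow> (\<forall>i\<in>{1..n}. co i v \<in> \<int>)"

lemma of_int_floor_Ints: "x \<in> \<int> \<Longrightarrow> of_int \<lfloor>x\<rfloor> = (x :: real)"
  by (elim Ints_cases) simp

text \<open>All indices below m \<le> n belong to the abelian ideal, so the ordered product
  collapses to the exponential of the sum; the factor along X_n is treated separately in
  \<open>\<Gamma>_iff\<close>.\<close>

lemma foldr_expo: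
  assumes "m \<le> n"
  shows "foldr (\<lambda>i g. expo (of_int (k i) *\<^sub>R X i) \<otimes> g) [1..<m] h = E (\<Sum>i\<in>{1..<m}. of_int (k i) *\<^sub>R X i) \<otimes> h"
  using assms
proof (induction m arbitrary: h)
  case (Suc m)
  show ?case
  proof (cases "m = 0")
    case False
    let ?s = "\<Sum>i\<in>{1..<m}. of_int (k i) *\<^sub>R X i"
    have tau: "\<tau> (X i) = 0" if "i \<in> {1..m}" for i
    proof -
      have "i \<in> {1..n}" "n \<in> {1..n}" "n \<noteq> i" using that Suc.prems n_pos by auto
      then show ?thesis by (simp add: \<tau>_def co_X)
    qed
    have ts: "\<tau> ?s = 0" by (simp add: linear_sum[OF linear_\<tau>] tau)
    have "foldr (\<lambda>i g. expo (of_int (k i) *\<^sub>R X i) \<otimes> g) [1..<Suc m] h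
       = E ?s \<otimes> (expo (of_int (k m) *\<^sub>R X m) \<otimes> h)"
      using Suc False by simp
    also have "\<dots> = E (star ?s (of_int (k m) *\<^sub>R X m)) \<otimes> h"
      using E_mm[of "of_int (k m) *\<^sub>R X m"] tau[of m] False by (simp add: mult_assoc[symmetric] E_mult[symmetric])
    also have "star ?s (of_int (k m) *\<^sub>R X m) = (\<Sum>i\<in>{1..<Suc m}. of_int (k i) *\<^sub>R X i)"
      using False by (simp add: star_def ts del: One_nat_def)
    finally show ?thesis .
  qed simp
qed simp

text \<open>The ordered product defining \<Gamma> has its X_n factor last, exactly as in the
  coordinates \<open>E\<close>; so the exponents of the product are the coordinates.\<close>

lemma \<Gamma>_iff: "g \<in> \<Gamma> \<longleftrightarrow> int_vec (L g)"
proof -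
  have f: "foldr (\<lambda>i g. expo (of_int (k i) *\<^sub>R X i) \<otimes> g) [1..<Suc n] \<one> = E (\<Sum>i\<in>{1..n}. of_int (k i) *\<^sub>R X i)" for k :: "nat \<Rightarrow> int"
  proof -
    have "foldr (\<lambda>i g. expo (of_int (k i) *\<^sub>R X i) \<otimes> g) [1..<Suc n] \<one>
       = foldr (\<lambda>i g. expo (of_int (k i) *\<^sub>R X i) \<otimes> g) [1..<n] (expo (of_int (k n) *\<^sub>R X n))"
      using n_pos by simp
    also have "\<dots> = E (\<Sum>i\<in>{1..<n}. of_int (k i) *\<^sub>R X i) \<otimes> E (of_int (k n) *\<^sub>R X n)"
      by (simp only: foldr_expo[OF order_refl] E_Xn)
    also have "\<dots> = E ((\<Sum>i\<in>{1..<n}. of_int (k i) *\<^sub>R X i) + of_int (k n) *\<^sub>R X n)"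
      by (simp add: E_mult star_def)
    also have "(\<Sum>i\<in>{1..<n}. of_int (k i) *\<^sub>R X i) + of_int (k n) *\<^sub>R X n = (\<Sum>i\<in>{1..n}. of_int (k i) *\<^sub>R X i)"
      using n_pos by (subst sum.last_plus) (auto simp: add.commute atLeastLessThanSuc_atLeastAtMost[symmetric])
    finally show ?thesis .
  qed
  have "\<Gamma> = {E (\<Sum>i\<in>{1..n}. of_int (k i) *\<^sub>R X i) | k :: nat \<Rightarrow> int. True}"
    using based unfolding strongly_based_on_def n_dim[symmetric] f .
  then have G: "g \<in> \<Gamma> \<longleftrightarrow> (\<exists>k :: nat \<Rightarrow> int. g = E (\<Sum>i\<in>{1..n}. of_int (k i) *\<^sub>R X i))" by blast
  show ?thesis
  proof
    assume "g \<in> \<Gamma>"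
    then obtain k :: "nat \<Rightarrow> int" where k: "g = E (\<Sum>i\<in>{1..n}. of_int (k i) *\<^sub>R X i)" using G by blast
    show "int_vec (L g)"
      unfolding int_vec_def k L_E using co_sum[OF _ order_refl, of _ "\<lambda>i. of_int (k i)"] by auto
  next
    assume a: "int_vec (L g)"
    define k where "k i = \<lfloor>co i (L g)\<rfloor>" for i
    have "(\<Sum>i\<in>{1..n}. of_int (k i) *\<^sub>R X i) = (\<Sum>i\<in>{1..n}. co i (L g) *\<^sub>R X i)"
      using a unfolding int_vec_def k_def by (intro sum.cong refl) (simp add: of_int_floor_Ints)
    then have "g = E (\<Sum>i\<in>{1..n}. of_int (k i) *\<^sub>R X i)" by (simp only: co_expand E_L)
    then show "g \<in> \<Gamma>" using G by blast
  qed
qed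

lemma E_\<Gamma>: "E v \<in> \<Gamma> \<longleftrightarrow> int_vec v" by (simp add: \<Gamma>_iff)
lemma E_M: "E v \<in> M \<longleftrightarrow> \<tau> v = 0" by (simp add: M_iff)

lemma sub_\<Gamma>: "subgroup \<Gamma> G" using unif by (simp add: uniform_subgroup_def)

lemma sub_M: "subgroup M G"
proof (rule subgroup.intro)
  show "x \<otimes> y \<in> M" if "x \<in> M" "y \<in> M" for x y using that by (simp add: M_iff L_mult)
  show "inv x \<in> M" if "x \<in> M" for x
    using that E_inv[of "L x"] by (simp add: M_iff)
  show "\<one> \<in> M" using E_M[of 0] by simp
qed simp

lemma carrier_UNIV: "G\<lparr>carrier := UNIV\<rparr> = G"
  by (rule monoid.equality) simp_all

sublocale GG: coset_prob G \<A> \<kappa> UNIV \<Gamma> \<mu>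
proof (intro coset_prob.intro coset_prob_axioms.intro lie_chart_axioms)
  show "subgroup UNIV G" using group.subgroup_self[OF grp] by simp
qed (use sub_\<Gamma> inv_\<mu> in \<open>simp_all add: carrier_UNIV\<close>)

sublocale MM: coset_prob G \<A> \<kappa> M "M \<inter> \<Gamma>" \<mu>M
proof (intro coset_prob.intro coset_prob_axioms.intro lie_chart_axioms)
  show "subgroup (M \<inter> \<Gamma>) G"
    using sub_M sub_\<Gamma>
    by (intro subgroup.intro) (auto intro: subgroup.m_closed subgroup.one_closed subgroup.m_inv_closed)
qed (use sub_M inv_\<mu>M in simp_all)

lemma int_vec_X: "i \<in> {1..n} \<Longrightarrow> int_vec (of_int k *\<^sub>R X i)"
  unfolding int_vec_def by (auto simp: linear_cmul[OF linear_co] co_X)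

lemma \<Gamma>_closed: "g \<in> \<Gamma> \<Longrightarrow> h \<in> \<Gamma> \<Longrightarrow> g \<otimes> h \<in> \<Gamma>" "g \<in> \<Gamma> \<Longrightarrow> inv g \<in> \<Gamma>" "\<one> \<in> \<Gamma>"
  using GG.H_closed by auto

text \<open>Multiplying by exp (k X_n) on the left stays in \<Gamma>; its coordinate vector is k X_n
  plus the image under \<open>Af k\<close>, and k X_n is itself integral.\<close>

lemma int_vec_Af: "int_vec v \<Longrightarrow> int_vec (Af (of_int k) v)"
proof -
  assume v: "int_vec v"
  have nn: "n \<in> {1..n}" using n_pos by simp
  have "star (of_int k *\<^sub>R X n) v = of_int k *\<^sub>R X n + Af (of_int k) v" by (simp add: star_def)
  moreover have "int_vec (star (of_int k *\<^sub>R X n) v)"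
    using \<Gamma>_closed(1)[of "E (of_int k *\<^sub>R X n)" "E v"] int_vec_X[OF nn, of k] v by (simp add: E_mult E_\<Gamma>)
  ultimately have a: "int_vec (of_int k *\<^sub>R X n + Af (of_int k) v)" by simp
  show ?thesis
    unfolding int_vec_def
  proof
    fix i assume i: "i \<in> {1..n}"
    have "co i (of_int k *\<^sub>R X n + Af (of_int k) v) \<in> \<int>" "co i (of_int k *\<^sub>R X n) \<in> \<int>"
      using a int_vec_X[OF nn, of k] i unfolding int_vec_def by auto
    then show "co i (Af (of_int k) v) \<in> \<int>"
      by (metis Ints_diff add_diff_cancel_left' linear_diff[OF linear_co])
  qed
qed

text \<open>The dual lattice of the ideal: its elements index the characters of the torus M / (M
  \<inter> \<Gamma>).\<close>

definition "LM = Latt {1..n - 1}"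

lemma I_sub: "{1..n - 1} \<subseteq> {1..n}" by auto

lemma LM_linear: "l \<in> LM \<Longrightarrow> linear l" unfolding LM_def by (rule Latt_linear)

lemma LM_repr: "l \<in> LM \<Longrightarrow> l v = (\<Sum>i\<in>{1..n - 1}. l (X i) * co i v) \<and> (\<forall>i\<in>{1..n - 1}. l (X i) \<in> \<int>) \<and> l (X n) = 0"
proof -
  assume "l \<in> LM"
  then obtain c :: "nat \<Rightarrow> int" where c: "l = (\<lambda>v. \<Sum>i\<in>{1..n - 1}. of_int (c i) * co i v)"
    unfolding LM_def Latt_def by blast
  have lX: "l (X j) = of_int (c j)" if "j \<in> {1..n - 1}" for j
  proof -
    have "l (X j) = (\<Sum>i\<in>{1..n - 1}. if i = j then of_int (c j) else 0)"
      unfolding c using that I_sub by (intro sum.cong refl) (auto simp: co_X)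
    then show ?thesis using that by simp
  qed
  have "l (X n) = 0"
    unfolding c
  proof (intro sum.neutral ballI)
    fix i assume "i \<in> {1..n - 1}"
    then have "i \<noteq> n" "i \<in> {1..n}" "n \<in> {1..n}" using n_pos by auto
    then show "of_int (c i) * co i (X n) = 0" by (simp add: co_X)
  qed
  moreover have "l v = (\<Sum>i\<in>{1..n - 1}. l (X i) * co i v)"
    by (subst c) (intro sum.cong refl, simp add: lX)
  ultimately show ?thesis using lX by auto
qed

lemma LM_I:
  assumes l: "linear l" "\<And>i. i \<in> {1..n - 1} \<Longrightarrow> l (X i) \<in> \<int>" "l (X n) = 0"
  shows "l \<in> LM"
  unfolding LM_def Latt_def
proof (intro CollectI exI conjI TrueI)
  show "l = (\<lambda>v. \<Sum>i\<in>{1..n - 1}. of_int \<lfloor>l (X i)\<rfloor> * co i v)"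
  proof
    fix v
    have "l v = l (\<pi> v)" by (subst \<pi>_\<tau>[of v]) (simp add: linear_add[OF l(1)] linear_cmul[OF l(1)] l(3))
    also have "\<dots> = (\<Sum>i\<in>{1..n - 1}. co i v * l (X i))"
      unfolding \<pi>_sum by (simp add: linear_sum[OF l(1)] linear_cmul[OF l(1)])
    also have "\<dots> = (\<Sum>i\<in>{1..n - 1}. of_int \<lfloor>l (X i)\<rfloor> * co i v)"
      using l(2) by (intro sum.cong refl) (simp add: of_int_floor_Ints)
    finally show "l v = (\<Sum>i\<in>{1..n - 1}. of_int \<lfloor>l (X i)\<rfloor> * co i v)" .
  qed
qed

lemma LM_\<pi>: "l \<in> LM \<Longrightarrow> l (\<pi> v) = l v"
proof -
  assume l: "l \<in> LM"
  have "l (X n) = 0" using LM_repr[OF l] by blast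
  have "l v = l (\<pi> v + \<tau> v *\<^sub>R X n)" by (rule arg_cong[OF \<pi>_\<tau>])
  also have "\<dots> = l (\<pi> v)"
    by (simp add: linear_add[OF LM_linear[OF l]] linear_cmul[OF LM_linear[OF l]] \<open>l (X n) = 0\<close>)
  finally show ?thesis by (rule sym)
qed

lemma ee_int: "l v \<in> \<int> \<Longrightarrow> ee l v = 1"
proof -
  assume "l v \<in> \<int>"
  then obtain k where "l v = of_int k" by (elim Ints_cases)
  then have "ee l v = cis (2 * pi * of_int k)" by (simp add: ee_def cis_conv_exp mult_ac)
  then show ?thesis by simp
qed

lemma LM_int: "l \<in> LM \<Longrightarrow> int_vec v \<Longrightarrow> l v \<in> \<int>"
proof -
  assume l: "l \<in> LM" and v: "int_vec v"
  have "l (X i) * co i v \<in> \<int>" if "i \<in> {1..n - 1}" for i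
    using LM_repr[OF l] v that I_sub unfolding int_vec_def by (blast intro: Ints_mult)
  then have "(\<Sum>i\<in>{1..n - 1}. l (X i) * co i v) \<in> \<int>" by (rule Ints_sum)
  then show ?thesis by (subst conjunct1[OF LM_repr[OF l]])
qed

lemma ee_linear: "linear l \<Longrightarrow> ee l (v + w) = ee l v * ee l w"
  by (simp add: ee_def linear_add exp_add[symmetric] algebra_simps)

lemma ee_cnj: "cnj (ee l v) = ee (\<lambda>v. - l v) v"
  by (simp add: ee_def exp_cnj)

lemma ee_neg: "linear l \<Longrightarrow> ee l (- v) = inverse (ee l v)"
  by (simp add: ee_def linear_neg exp_minus[symmetric])

lemma continuous_ee [continuous_intros]:
  assumes "linear l" "continuous_on S f"
  shows "continuous_on S (\<lambda>x. ee l (f x))"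
  unfolding ee_def
  by (intro continuous_intros bounded_linear.continuous_on[OF assms(1)[unfolded linear_conv_bounded_linear] assms(2)])

lemma character_M: "m \<in> M \<Longrightarrow> character expo l m = ee l (L m)"
  unfolding character_def ee_def using log_mm[of "L m"] by (simp add: M_iff)

lemma ee_M_mult: "linear l \<Longrightarrow> g \<in> M \<Longrightarrow> ee l (L (g \<otimes> h)) = ee l (L g) * ee l (L h)"
  by (simp add: L_mult star_def M_iff ee_linear)

subsection \<open>Parseval's identity on the torus \<open>M / (M \<inter> \<Gamma>)\<close>\<close>

lemma ee_M_rinv: "l \<in> LM \<Longrightarrow> MM.rinv (\<lambda>m. ee l (L m))"
  unfolding MM.rinv_def using LM_int by (auto simp: ee_M_mult[OF LM_linear] ee_int \<Gamma>_iff)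

lemma ee_M_cont: "l \<in> LM \<Longrightarrow> continuous_on A (\<lambda>m. ee l (L m))"
  by (intro continuous_intros LM_linear) auto

text \<open>A nontrivial character takes the value -1 half a period along some \<open>X j\<close>
  with \<open>l (X j) \<noteq> 0\<close>. Translation by that element preserves the integral and
  changes its sign.\<close>

lemma integral_ee_M:
  assumes l: "l \<in> LM"
  shows "(\<integral>c. on_cosets (\<lambda>m. ee l (L m)) c \<partial>\<mu>M) = (if l = (\<lambda>v. 0) then 1 else 0)"
proof (cases "l = (\<lambda>v. 0)")
  case True
  then show ?thesis using MM.mass_P by (simp add: ee_def on_cosets_def measure_def)
next
  case False
  have "\<exists>j\<in>{1..n - 1}. l (X j) \<noteq> 0"
  proof (rule ccontr)
    assume "\<not> ?thesis"
    then have "(\<Sum>i\<in>{1..n - 1}. l (X i) * co i v) = 0" for v by (intro sum.neutral) auto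
    then have "l v = 0" for v by (rule trans[OF conjunct1[OF LM_repr[OF l]]])
    then show False using False by blast
  qed
  then obtain j where j: "j \<in> {1..n - 1}" "l (X j) \<noteq> 0" by blast
  define a where "a = E ((1 / (2 * l (X j))) *\<^sub>R X j)"
  have "n \<noteq> j" "n \<in> {1..n}" "j \<in> {1..n}" using j n_pos by auto
  then have aM: "a \<in> M" by (simp add: a_def E_M \<tau>_def linear_cmul[OF linear_co] co_X)
  have la: "ee l (L a) = -1"
  proof -
    have "ee l (L a) = exp (2 * \<i> * complex_of_real pi * complex_of_real (1/2))"
      using j(2) by (simp add: ee_def a_def linear_cmul[OF LM_linear[OF l]])
    also have "2 * \<i> * complex_of_real pi * complex_of_real (1/2) = \<i> * complex_of_real pi" by simp
    finally show ?thesis by (simp add: mult.commute)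
  qed
  let ?I = "\<integral>c. on_cosets (\<lambda>m. ee l (L m)) c \<partial>\<mu>M"
  have "?I = (\<integral>c. on_cosets (\<lambda>m. ee l (L (a \<otimes> m))) c \<partial>\<mu>M)"
    by (rule MM.integral_translate[OF MM.measurable_on_cosets[OF ee_M_cont[OF l] ee_M_rinv[OF l]] ee_M_rinv[OF l] aM, symmetric])
  also have "\<dots> = (\<integral>c. - on_cosets (\<lambda>m. ee l (L m)) c \<partial>\<mu>M)"
    by (simp add: ee_M_mult[OF LM_linear[OF l] aM] la on_cosets_def)
  also have "\<dots> = - ?I" by simp
  finally show ?thesis using False by simp
qed

lemma trig_approx_M:
  fixes h :: "'g \<Rightarrow> complex"
  assumes h: "continuous_on M h" "MM.rinv h" and \<epsilon>: "\<epsilon> > 0"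
  shows "\<exists>S c. finite S \<and> S \<subseteq> LM \<and> (\<forall>m\<in>M. cmod (h m - (\<Sum>l\<in>S. c l * ee l (L m))) \<le> \<epsilon>)"
proof -
  define F where "F v = h (E (\<pi> v))" for v
  have "continuous_on UNIV \<pi>" unfolding \<pi>_def by (intro continuous_intros)
  then have "continuous_on UNIV (\<lambda>v. E (\<pi> v))" by (intro continuous_intros)
  then have "continuous_on UNIV F"
    unfolding F_def by (rule continuous_on_compose2[OF h(1)]) (auto simp: E_M)
  moreover have "F v = F w" if vw: "\<forall>i\<in>{1..n - 1}. co i v - co i w \<in> \<int>" for v w
  proof -
    have "int_vec (\<pi> v - \<pi> w)"
      unfolding int_vec_def
    proof
      fix i assume i: "i \<in> {1..n}"
      have "co i (\<pi> u) = (if i \<in> {1..n - 1} then co i u else 0)" for u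
        unfolding \<pi>_sum by (rule co_sum[OF i I_sub])
      then show "co i (\<pi> v - \<pi> w) \<in> \<int>" using vw by (simp add: linear_diff[OF linear_co])
    qed
    then have "E (\<pi> v - \<pi> w) \<in> M \<inter> \<Gamma>" by (simp add: E_M E_\<Gamma>)
    then have "h (E (\<pi> w) \<otimes> E (\<pi> v - \<pi> w)) = h (E (\<pi> w))"
      using h(2) unfolding MM.rinv_def by (simp add: E_M)
    then show ?thesis by (simp add: F_def E_mult star_def)
  qed
  ultimately obtain S c where S: "finite S" "S \<subseteq> LM" and ap: "\<And>v. cmod (F v - (\<Sum>l\<in>S. c l * ee l v)) \<le> \<epsilon>"
    using trig_approx[OF I_sub, of F \<epsilon>] \<epsilon> unfolding LM_def by blast
  have "cmod (h m - (\<Sum>l\<in>S. c l * ee l (L m))) \<le> \<epsilon>" if "m \<in> M" for m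
    using ap[of "L m"] that by (simp add: F_def M_iff \<pi>_def)
  then show ?thesis using S by blast
qed

lemma parseval_M:
  assumes h: "continuous_on M h" "MM.rinv h" and B: "\<And>m. m \<in> M \<Longrightarrow> cmod (h m) \<le> B"
  shows "(\<Sum>\<^sub>\<infinity>l\<in>LM. ennreal ((cmod (\<integral>c. on_cosets (\<lambda>m. h m * ee l (L m)) c \<partial>\<mu>M))\<^sup>2))
    = (\<integral>\<^sup>+c. ennreal ((cmod (on_cosets h c))\<^sup>2) \<partial>\<mu>M)"
proof -
  have "(\<Sum>\<^sub>\<infinity>l\<in>LM. ennreal ((cmod (\<integral>c. on_cosets h c * on_cosets (\<lambda>m. ee l (L m)) c \<partial>\<mu>M))\<^sup>2))
    = (\<integral>\<^sup>+c. ennreal ((cmod (on_cosets h c))\<^sup>2) \<partial>\<mu>M)"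
  proof (rule parseval_of_approximation[OF MM.finite_P])
    show "on_cosets (\<lambda>m. ee l (L m)) \<in> borel_measurable \<mu>M" if "l \<in> LM" for l
      by (rule MM.measurable_on_cosets[OF ee_M_cont[OF that] ee_M_rinv[OF that]])
    show "cmod (on_cosets (\<lambda>m. ee l (L m)) c) \<le> 1" for l c by (simp add: on_cosets_def)
    show "(\<integral>c. on_cosets (\<lambda>m. ee l (L m)) c * cnj (on_cosets (\<lambda>m. ee k (L m)) c) \<partial>\<mu>M) = (if l = k then 1 else 0)"
      if "l \<in> LM" "k \<in> LM" for l k
    proof -
      have "(\<integral>c. on_cosets (\<lambda>m. ee l (L m)) c * cnj (on_cosets (\<lambda>m. ee k (L m)) c) \<partial>\<mu>M)
         = (\<integral>c. on_cosets (\<lambda>m. ee (\<lambda>v. l v + - k v) (L m)) c \<partial>\<mu>M)"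
        by (simp only: on_cosets_def ee_cnj ee_add)
      also have "\<dots> = (if (\<lambda>v. l v + - k v) = (\<lambda>v. 0) then 1 else 0)"
        using that unfolding LM_def
        by (intro integral_ee_M[unfolded LM_def] Latt_add Latt_uminus)
      also have "(\<lambda>v. l v + - k v) = (\<lambda>v. 0) \<longleftrightarrow> l = k" by (simp add: fun_eq_iff)
      finally show ?thesis .
    qed
    show "on_cosets h \<in> borel_measurable \<mu>M" by (rule MM.measurable_on_cosets[OF h])
    show "cmod (on_cosets h c) \<le> B" if "c \<in> space \<mu>M" for c
      using that B by (auto simp: MM.space_P MM.on_cosets_cs[OF h(2)])
    show "emeasure \<mu>M (space \<mu>M) = 1" by (rule MM.mass_P)
    fix \<epsilon> :: real assume "\<epsilon> > 0"
    \<comment> \<open>The abstract Parseval identity asks for approximation by conjugate characters;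
      this is obtained by approximating the conjugate of h and conjugating back.\<close>
    have "continuous_on M (\<lambda>m. cnj (h m))" "MM.rinv (\<lambda>m. cnj (h m))"
      using h unfolding MM.rinv_def by (auto intro!: continuous_intros)
    then obtain S c where S: "finite S" "S \<subseteq> LM" and ap: "\<And>m. m \<in> M \<Longrightarrow> cmod (cnj (h m) - (\<Sum>l\<in>S. c l * ee l (L m))) \<le> \<epsilon>"
      using trig_approx_M[of "\<lambda>m. cnj (h m)" \<epsilon>] \<open>\<epsilon> > 0\<close> by blast
    have "cmod (on_cosets h x - (\<Sum>l\<in>S. cnj (c l) * cnj (on_cosets (\<lambda>m. ee l (L m)) x))) \<le> \<epsilon>"
      if x: "x \<in> space \<mu>M" for x
    proof -
      obtain m where m: "m \<in> M" "x = MM.cs m" using x by (auto simp: MM.space_P)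
      have "(\<Sum>l\<in>S. cnj (c l) * cnj (on_cosets (\<lambda>m. ee l (L m)) x)) = (\<Sum>l\<in>S. cnj (c l) * cnj (ee l (L m)))"
        using S(2) m by (intro sum.cong refl) (auto simp: MM.on_cosets_cs[OF ee_M_rinv])
      then have "on_cosets h x - (\<Sum>l\<in>S. cnj (c l) * cnj (on_cosets (\<lambda>m. ee l (L m)) x))
         = cnj (cnj (h m) - (\<Sum>l\<in>S. c l * ee l (L m)))"
        using m by (simp add: MM.on_cosets_cs[OF h(2)])
      then show ?thesis using ap[OF m(1)] by (simp only: complex_mod_cnj)
    qed
    then show "\<exists>S c. finite S \<and> S \<subseteq> LM \<and> (\<forall>x\<in>space \<mu>M. cmod (on_cosets h x - (\<Sum>l\<in>S. c l * cnj (on_cosets (\<lambda>m. ee l (L m)) x))) \<le> \<epsilon>)"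
      using S by (intro exI[of _ S] exI[of _ "\<lambda>l. cnj (c l)"]) auto
  qed
  then show ?thesis by (simp add: on_cosets_def)
qed

text \<open>The coadjoint action of exp (s X_n) on functionals of the ideal. The projection
  \<open>\<pi>\<close> extends the result by 0 along X_n, so that it is again a functional on the
  whole algebra.\<close>

definition "act s l v = l (Af (- s) (\<pi> v))" for s :: real and l :: "'a \<Rightarrow> real"

lemma act_LM:
  assumes l: "l \<in> LM"
  shows "act (of_int k) l \<in> LM"
proof (rule LM_I)
  show "linear (act (of_int k) l)"
    unfolding act_def[abs_def]
    by (rule linearI) (simp_all add: linear_add[OF LM_linear[OF l]] linear_cmul[OF LM_linear[OF l]])
  show "act (of_int k) l (X n) = 0" by (simp add: act_def linear_0[OF LM_linear[OF l]])
  fix i assume i: "i \<in> {1..n - 1}"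
  then have "n \<noteq> i" "n \<in> {1..n}" "i \<in> {1..n}" using n_pos by auto
  then have "\<pi> (X i) = X i" by (simp add: \<pi>_def \<tau>_def co_X)
  then have "int_vec (Af (of_int (- k)) (\<pi> (X i)))"
    using int_vec_Af[of "X i" "- k"] int_vec_X[of i 1] \<open>i \<in> {1..n}\<close> by simp
  then show "act (of_int k) l (X i) \<in> \<int>" unfolding act_def using LM_int[OF l] by simp
qed

lemma act_act: "act s (act t l) = act (s + t) l"
proof
  fix v
  have "\<pi> (Af (- s) (\<pi> v)) = Af (- s) (\<pi> v)" by (simp add: \<pi>_Af) (simp add: \<pi>_def)
  then show "act s (act t l) v = act (s + t) l v"
    using Af_add[of "- t" "- s" "\<pi> v"] by (simp add: act_def add.commute[of s t])
qed

lemma act_0: "l \<in> LM \<Longrightarrow> act 0 l = l"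
  by (simp add: act_def fun_eq_iff LM_\<pi>)

text \<open>Conjugation by exp (k X_n) induces an automorphism of the torus. It permutes the
  characters and fixes the trivial one, so integrals of trigonometric polynomials are preserved;
  uniform approximation extends this to continuous functions.\<close>

lemma integral_automorphism:
  fixes h :: "'g \<Rightarrow> complex"
  assumes h: "continuous_on M h" "MM.rinv h"
  shows "(\<integral>c. on_cosets (\<lambda>m. h (E (Af (of_int k) (L m)))) c \<partial>\<mu>M) = (\<integral>c. on_cosets h c \<partial>\<mu>M)"
proof -
  let ?\<alpha> = "\<lambda>m. E (Af (of_int k) (L m))"
  have \<alpha>M: "?\<alpha> m \<in> M \<longleftrightarrow> m \<in> M" for m by (simp add: M_iff)
  have \<alpha>c: "continuous_on A ?\<alpha>" for A by (intro continuous_intros)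
  have \<alpha>m: "?\<alpha> (g \<otimes> m) = ?\<alpha> g \<otimes> ?\<alpha> m" if "g \<in> M" for g m
    using that by (simp add: L_mult star_def M_iff E_mult)
  have \<alpha>\<Gamma>: "?\<alpha> g \<in> \<Gamma>" if "g \<in> \<Gamma>" for g
    using that int_vec_Af by (simp add: \<Gamma>_iff)
  have h\<alpha>: "continuous_on M (\<lambda>m. h (?\<alpha> m))" "MM.rinv (\<lambda>m. h (?\<alpha> m))"
    subgoal by (rule continuous_on_compose2[OF h(1) \<alpha>c]) (auto simp: \<alpha>M)
    subgoal using h(2) \<alpha>M \<alpha>\<Gamma> unfolding MM.rinv_def by (simp add: \<alpha>m)
    done
  have two: "cmod ((\<integral>c. on_cosets (\<lambda>m. h (?\<alpha> m)) c \<partial>\<mu>M) - (\<integral>c. on_cosets h c \<partial>\<mu>M)) \<le> 2 * \<epsilon>" if \<epsilon>: "\<epsilon> > 0" for \<epsilon>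
  proof -
    interpret F: finite_measure \<mu>M by (rule MM.finite_P)
    obtain S c where S: "finite S" "S \<subseteq> LM" and ap: "\<And>m. m \<in> M \<Longrightarrow> cmod (h m - (\<Sum>l\<in>S. c l * ee l (L m))) \<le> \<epsilon>"
      using trig_approx_M[OF h \<epsilon>] by blast
    have act: "ee l (L (?\<alpha> m)) = ee (act (of_int (- k)) l) (L m)" if "m \<in> M" for l m
      using that by (simp add: ee_def act_def M_iff \<pi>_def)
    define t where "t m = (\<Sum>l\<in>S. c l * ee l (L m))" for m
    have tr: "MM.rinv t" unfolding t_def MM.rinv_def
      using ee_M_rinv S(2) unfolding MM.rinv_def by (auto intro!: sum.cong)
    have tc: "continuous_on A t" for A unfolding t_def
      using S(2) by (intro continuous_intros ee_M_cont) auto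
    have tI: "(\<integral>c. on_cosets t c \<partial>\<mu>M) = (\<Sum>l\<in>S. c l * (if l = (\<lambda>v. 0) then 1 else 0))"
    proof -
      have ii: "integrable \<mu>M (on_cosets (\<lambda>m. ee l (L m)))" if "l \<in> S" for l
        by (rule MM.integrable_on_cosets[where B = 1]) (use S(2) that ee_M_cont ee_M_rinv in auto)
      have "(\<integral>c. on_cosets t c \<partial>\<mu>M) = (\<integral>x. (\<Sum>l\<in>S. c l * on_cosets (\<lambda>m. ee l (L m)) x) \<partial>\<mu>M)"
        by (simp add: on_cosets_def t_def)
      also have "\<dots> = (\<Sum>l\<in>S. c l * (\<integral>x. on_cosets (\<lambda>m. ee l (L m)) x \<partial>\<mu>M))"
        using ii by (subst Bochner_Integration.integral_sum) auto
      also have "\<dots> = (\<Sum>l\<in>S. c l * (if l = (\<lambda>v. 0) then 1 else 0))"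
        using S(2) by (intro sum.cong refl) (auto simp: integral_ee_M)
      finally show ?thesis .
    qed
    have t\<alpha>r: "MM.rinv (\<lambda>m. t (?\<alpha> m))"
      using tr \<alpha>M \<alpha>\<Gamma> unfolding MM.rinv_def by (simp add: \<alpha>m)
    have t\<alpha>c: "continuous_on M (\<lambda>m. t (?\<alpha> m))"
      by (rule continuous_on_compose2[OF tc[of UNIV] \<alpha>c]) auto
    have "(\<integral>c. on_cosets (\<lambda>m. t (?\<alpha> m)) c \<partial>\<mu>M) = (\<Sum>l\<in>S. c l * (if l = (\<lambda>v. 0) then 1 else 0))"
    proof -
      have al: "act (of_int (- k)) l \<in> LM" if "l \<in> S" for l using act_LM S(2) that by blast
      have ii: "integrable \<mu>M (on_cosets (\<lambda>m. ee (act (of_int (- k)) l) (L m)))" if "l \<in> S" for l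
        by (rule MM.integrable_on_cosets[where B = 1]) (use al[OF that] ee_M_cont ee_M_rinv in auto)
      have r: "MM.rinv (\<lambda>m. \<Sum>l\<in>S. c l * ee (act (of_int (- k)) l) (L m))"
        using ee_M_rinv[OF al] unfolding MM.rinv_def by (auto intro!: sum.cong)
      have "(\<integral>c. on_cosets (\<lambda>m. t (?\<alpha> m)) c \<partial>\<mu>M) = (\<integral>x. on_cosets (\<lambda>m. \<Sum>l\<in>S. c l * ee (act (of_int (- k)) l) (L m)) x \<partial>\<mu>M)"
      proof (rule Bochner_Integration.integral_cong[OF refl])
        fix x assume "x \<in> space \<mu>M"
        then obtain m where m: "m \<in> M" "x = MM.cs m" by (auto simp: MM.space_P)
        show "on_cosets (\<lambda>m. t (?\<alpha> m)) x = on_cosets (\<lambda>m. \<Sum>l\<in>S. c l * ee (act (of_int (- k)) l) (L m)) x"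
          unfolding m(2) MM.on_cosets_cs[OF t\<alpha>r m(1)] MM.on_cosets_cs[OF r m(1)]
          by (simp only: t_def act[OF m(1)])
      qed
      also have "\<dots> = (\<integral>x. (\<Sum>l\<in>S. c l * on_cosets (\<lambda>m. ee (act (of_int (- k)) l) (L m)) x) \<partial>\<mu>M)"
        by (simp add: on_cosets_def)
      also have "\<dots> = (\<Sum>l\<in>S. c l * (\<integral>x. on_cosets (\<lambda>m. ee (act (of_int (- k)) l) (L m)) x \<partial>\<mu>M))"
        using ii by (subst Bochner_Integration.integral_sum) auto
      also have "\<dots> = (\<Sum>l\<in>S. c l * (if l = (\<lambda>v. 0) then 1 else 0))"
      proof (intro sum.cong refl)
        fix l assume l: "l \<in> S"
        \<comment> \<open>The action is invertible, so the trivial character is the image of itself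
          alone; on both sides only its coefficient survives integration.\<close>
        have "act (of_int (- k)) l = (\<lambda>v. 0) \<longleftrightarrow> l = (\<lambda>v. 0)"
        proof
          assume "act (of_int (- k)) l = (\<lambda>v. 0)"
          then have "act (of_int k) (act (of_int (- k)) l) = (\<lambda>v. 0)" by (simp add: act_def fun_eq_iff)
          then show "l = (\<lambda>v. 0)" unfolding act_act using act_0[of l] l S(2) by auto
        qed (simp add: act_def fun_eq_iff)
        then show "c l * (\<integral>x. on_cosets (\<lambda>m. ee (act (of_int (- k)) l) (L m)) x \<partial>\<mu>M) = c l * (if l = (\<lambda>v. 0) then 1 else 0)"
          using integral_ee_M[OF al[OF l]] by simp
      qed
      finally show ?thesis .
    qed
    then have teq: "(\<integral>c. on_cosets (\<lambda>m. t (?\<alpha> m)) c \<partial>\<mu>M) = (\<integral>c. on_cosets t c \<partial>\<mu>M)" using tI by simp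
    have close: "cmod ((\<integral>c. on_cosets f c \<partial>\<mu>M) - (\<integral>c. on_cosets g c \<partial>\<mu>M)) \<le> \<epsilon>"
      if f: "continuous_on M f" "MM.rinv f" and g: "continuous_on M g" "MM.rinv g"
        and fg: "\<And>m. m \<in> M \<Longrightarrow> cmod (f m - g m) \<le> \<epsilon>" and gB: "\<And>m. m \<in> M \<Longrightarrow> cmod (g m) \<le> Bd" for f g Bd
    proof -
      have fB: "cmod (f m) \<le> \<epsilon> + Bd" if "m \<in> M" for m
        using norm_triangle_ineq[of "f m - g m" "g m"] fg[OF that] gB[OF that] by simp
      have i1: "integrable \<mu>M (on_cosets f)" by (rule MM.integrable_on_cosets[OF f fB])
      have i2: "integrable \<mu>M (on_cosets g)" by (rule MM.integrable_on_cosets[OF g gB])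
      have "cmod ((\<integral>c. on_cosets f c \<partial>\<mu>M) - (\<integral>c. on_cosets g c \<partial>\<mu>M)) = cmod (\<integral>c. (on_cosets f c - on_cosets g c) \<partial>\<mu>M)"
        using i1 i2 by simp
      also have "\<dots> \<le> (\<integral>c. cmod (on_cosets f c - on_cosets g c) \<partial>\<mu>M)"
        by (rule integral_norm_bound)
      also have "\<dots> \<le> (\<integral>c. \<epsilon> \<partial>\<mu>M)"
        using i1 i2 fg by (intro integral_mono) (auto simp: MM.space_P MM.on_cosets_cs[OF f(2)] MM.on_cosets_cs[OF g(2)])
      also have "\<dots> = \<epsilon>" using MM.mass_P by (simp add: measure_def)
      finally show ?thesis .
    qed
    have tB: "cmod (t m) \<le> (\<Sum>l\<in>S. cmod (c l))" for m
      unfolding t_def by (rule sum_norm_le) (simp add: norm_mult)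
    have 1: "cmod ((\<integral>c. on_cosets h c \<partial>\<mu>M) - (\<integral>c. on_cosets t c \<partial>\<mu>M)) \<le> \<epsilon>"
      by (rule close[OF h tc tr _ tB]) (use ap in \<open>simp add: t_def\<close>)
    have 2: "cmod ((\<integral>c. on_cosets (\<lambda>m. h (?\<alpha> m)) c \<partial>\<mu>M) - (\<integral>c. on_cosets (\<lambda>m. t (?\<alpha> m)) c \<partial>\<mu>M)) \<le> \<epsilon>"
      by (rule close[OF h\<alpha> t\<alpha>c t\<alpha>r _ tB]) (use ap[of "?\<alpha> _"] in \<open>simp add: t_def \<alpha>M\<close>)
    show ?thesis
      using 1 2 norm_triangle_ineq4[of "(\<integral>c. on_cosets (\<lambda>m. h (?\<alpha> m)) c \<partial>\<mu>M) - (\<integral>c. on_cosets t c \<partial>\<mu>M)"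
        "(\<integral>c. on_cosets h c \<partial>\<mu>M) - (\<integral>c. on_cosets t c \<partial>\<mu>M)"] unfolding teq by simp
  qed
  then have "cmod ((\<integral>c. on_cosets (\<lambda>m. h (?\<alpha> m)) c \<partial>\<mu>M) - (\<integral>c. on_cosets h c \<partial>\<mu>M)) \<le> 0 + \<epsilon>" if "\<epsilon> > 0" for \<epsilon>
    using two[of "\<epsilon> / 2"] that by simp
  then have "cmod ((\<integral>c. on_cosets (\<lambda>m. h (?\<alpha> m)) c \<partial>\<mu>M) - (\<integral>c. on_cosets h c \<partial>\<mu>M)) \<le> 0"
    by (rule field_le_epsilon)
  then show ?thesis by simp
qed

end

section \<open>Interchanging countable sums and integrals, and tiling the line by unit
  intervals\<close>

lemma infsum_Times_ennreal:
  fixes f :: "'i \<times> 'j \<Rightarrow> ennreal"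
  assumes A: "countable A" and B: "countable B"
  shows "(\<Sum>\<^sub>\<infinity>p\<in>A \<times> B. f p) = (\<Sum>\<^sub>\<infinity>a\<in>A. \<Sum>\<^sub>\<infinity>b\<in>B. f (a, b))"
proof -
  interpret B: sigma_finite_measure "count_space B" using B by (rule sigma_finite_measure_count_space_countable)
  have "(\<Sum>\<^sub>\<infinity>p\<in>A \<times> B. f p) = (\<integral>\<^sup>+p. f p \<partial>count_space (A \<times> B))"
    using A B by (intro infsum_eq_nn_integral) auto
  also have "\<dots> = (\<integral>\<^sup>+p. f p \<partial>(count_space A \<Otimes>\<^sub>M count_space B))" by (simp add: pair_measure_countable A B)
  also have "\<dots> = (\<integral>\<^sup>+a. \<integral>\<^sup>+b. f (a, b) \<partial>count_space B \<partial>count_space A)"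
    by (rule B.nn_integral_fst[symmetric]) (simp add: pair_measure_countable A B)
  finally show ?thesis by (simp add: infsum_eq_nn_integral A B)
qed

lemma nn_integral_infsum:
  fixes f :: "'i \<Rightarrow> 'b \<Rightarrow> ennreal"
  assumes I: "countable I" and f: "\<And>i. i \<in> I \<Longrightarrow> f i \<in> borel_measurable M"
  shows "(\<integral>\<^sup>+x. (\<Sum>\<^sub>\<infinity>i\<in>I. f i x) \<partial>M) = (\<Sum>\<^sub>\<infinity>i\<in>I. \<integral>\<^sup>+x. f i x \<partial>M)"
  using nn_integral_count_space_nn_integral[of I f M] I f by (simp add: infsum_eq_nn_integral)

text \<open>After translation the terms are integrals over [k, k + 1); at each t exactly the
  interval with k = \<lfloor>t\<rfloor> contributes.\<close>

lemma nn_integral_tile: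
  fixes \<phi> :: "real \<Rightarrow> ennreal"
  assumes [measurable]: "\<phi> \<in> borel_measurable borel"
  shows "(\<Sum>\<^sub>\<infinity>k\<in>(UNIV :: int set). \<integral>\<^sup>+t. \<phi> (t + of_int k) \<partial>unit_interval) = (\<integral>\<^sup>+t. \<phi> t \<partial>lborel)"
proof -
  have 1: "(\<integral>\<^sup>+t. \<phi> (t + of_int k) \<partial>unit_interval) = (\<integral>\<^sup>+t. \<phi> t * indicator {of_int k..<of_int k + 1} t \<partial>lborel)" for k :: int
  proof -
    have "(\<integral>\<^sup>+t. \<phi> t * indicator {of_int k..<of_int k + 1} t \<partial>lborel)
       = ennreal \<bar>1\<bar> * (\<integral>\<^sup>+t. \<phi> (of_int k + 1 * t) * indicator {of_int k..<of_int k + 1} (of_int k + 1 * t) \<partial>lborel)"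
      by (rule nn_integral_real_affine) auto
    also have "\<dots> = (\<integral>\<^sup>+t. \<phi> (t + of_int k) * indicator {0..<1} t \<partial>lborel)"
      by (simp add: add.commute indicator_def)
    also have "\<dots> = (\<integral>\<^sup>+t. \<phi> (t + of_int k) \<partial>unit_interval)"
      by (rule nn_integral_restrict_space[symmetric]) simp
    finally show ?thesis by simp
  qed
  have "(\<Sum>\<^sub>\<infinity>k\<in>(UNIV :: int set). \<integral>\<^sup>+t. \<phi> (t + of_int k) \<partial>unit_interval)
    = (\<integral>\<^sup>+t. (\<Sum>\<^sub>\<infinity>k\<in>(UNIV :: int set). \<phi> t * indicator {of_int k..<of_int k + 1} t) \<partial>lborel)"
    unfolding 1 by (rule nn_integral_infsum[symmetric]) auto
  moreover have pt: "(\<Sum>\<^sub>\<infinity>k\<in>(UNIV :: int set). \<phi> t * indicator {of_int k..<of_int k + 1} t) = \<phi> t" for t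
  proof -
    have "(\<Sum>\<^sub>\<infinity>k\<in>(UNIV :: int set). \<phi> t * indicator {of_int k..<of_int k + 1} t)
       = (\<Sum>\<^sub>\<infinity>k\<in>{\<lfloor>t\<rfloor>}. \<phi> t * indicator {of_int k..<of_int k + 1} t)"
    proof (rule infsum_cong_neutral)
      fix k :: int assume "k \<in> UNIV - {\<lfloor>t\<rfloor>}"
      then have "\<not> (of_int k \<le> t \<and> t < of_int k + 1)" using floor_unique[of k t] by auto
      then show "\<phi> t * indicator {of_int k..<of_int k + 1} t = 0" by (auto simp: indicator_def)
    qed auto
    also have "\<dots> = \<phi> t" by (simp add: indicator_def)
    finally show ?thesis .
  qed
  ultimately show ?thesis by (simp only: pt)
qed

section \<open>Bounds and representatives on a compact quotient\<close>

context coset_prob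
begin

lemma continuous_map_on_cosets:
  fixes f :: "'g \<Rightarrow> 'b::topological_space"
  assumes f: "continuous_on S f" "rinv f"
  shows "continuous_map T euclidean (on_cosets f)"
  unfolding continuous_map_def
proof (intro conjI allI impI)
  fix V :: "'b set" assume "openin euclidean V"
  then have V: "open V" by simp
  have eq: "{g \<in> S. cs g \<in> {x \<in> topspace T. on_cosets f x \<in> V}} = S \<inter> f -` V"
    using on_cosets_cs[OF f(2)] by (auto simp: topspace_T)
  have "openin (top_of_set S) (S \<inter> f -` V)" using f(1) V by (simp add: continuous_openin_preimage_gen)
  then show "openin T {x \<in> topspace T. on_cosets f x \<in> V}"
    unfolding openin_iff eq by (auto simp: topspace_T)
qed simp

lemma bounded_if_compact:
  fixes f :: "'g \<Rightarrow> 'b::real_normed_vector"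
  assumes cpt: "compact_space T" and f: "continuous_on S f" "rinv f"
  obtains B where "\<And>g. g \<in> S \<Longrightarrow> norm (f g) \<le> B"
proof -
  have "compactin euclidean (on_cosets f ` topspace T)"
    using cpt continuous_map_on_cosets[OF f] image_compactin unfolding compact_space_def by blast
  then have "bounded (on_cosets f ` topspace T)" by (simp add: compact_imp_bounded)
  then obtain B where B: "\<And>x. x \<in> topspace T \<Longrightarrow> norm (on_cosets f x) \<le> B" by (auto simp: bounded_iff)
  have "norm (f g) \<le> B" if "g \<in> S" for g
    using B[of "cs g"] that on_cosets_cs[OF f(2) that] by (auto simp: topspace_T)
  then show thesis by (rule that)
qed

text \<open>\<open>on_cosets\<close> evaluates at a chosen representative, so an integrand on S / H
  may be rewritten using facts valid only on S.\<close>

lemma some_in_S: "c \<in> space P \<Longrightarrow> (SOME g. g \<in> c) \<in> S"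
proof -
  assume "c \<in> space P"
  then obtain a where a: "a \<in> S" "c = cs a" by (auto simp: space_P)
  have "a \<in> cs a" unfolding cs_def using H_closed(3) by (metis image_eqI one_mult(2))
  then have "(SOME g. g \<in> cs a) \<in> cs a" by (rule someI)
  then show ?thesis unfolding a(2) cs_def using a(1) HS S_closed(1) by auto
qed

lemma on_cosets_cong: "c \<in> space P \<Longrightarrow> (\<And>g. g \<in> S \<Longrightarrow> f g = f' g) \<Longrightarrow> on_cosets f c = on_cosets f' c"
  unfolding on_cosets_def using some_in_S by simp

end

context nilmanifold
begin

abbreviation "CC \<equiv> cont_coset_functions G \<Gamma>"

lemma CC_iff: "f \<in> CC \<longleftrightarrow> continuous_on UNIV f \<and> GG.rinv f"
  by (simp add: cont_coset_functions_def GG.rinv_def)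

lemma CC_D: "f \<in> CC \<Longrightarrow> continuous_on UNIV f" "f \<in> CC \<Longrightarrow> GG.rinv f" "f \<in> CC \<Longrightarrow> h \<in> \<Gamma> \<Longrightarrow> f (g \<otimes> h) = f g"
  by (auto simp: CC_iff GG.rinv_def)

lemma CC_continuous_on: "f \<in> CC \<Longrightarrow> continuous_on A u \<Longrightarrow> continuous_on A (\<lambda>x. f (u x))"
  using continuous_on_compose2[OF CC_D(1)] by blast

lemma bounded_CC: assumes "f \<in> CC" obtains B where "\<And>g. cmod (f g) \<le> B"
proof -
  have "compact_space GG.T" using unif by (simp add: uniform_subgroup_def carrier_UNIV)
  from GG.bounded_if_compact[OF this CC_D(1,2)[OF assms]] show thesis using that by (metis UNIV_I)
qed

lemma MM_rinv_slice: "f \<in> CC \<Longrightarrow> MM.rinv (\<lambda>m. f (a \<otimes> m))"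
  unfolding MM.rinv_def by (auto simp: CC_D(3) mult_assoc[symmetric])

lemma MM_cont_slice: "f \<in> CC \<Longrightarrow> continuous_on A (\<lambda>m. f (a \<otimes> m))"
  by (intro CC_continuous_on continuous_intros)

subsection \<open>Disintegration of the invariant measure on \<open>G / \<Gamma>\<close>\<close>

text \<open>Averaging successively along \<open>X\<^sub>1, \<dots>, X\<^sub>n\<^sub>-\<^sub>1\<close> over unit intervals leaves both integrals to be compared unchanged and
  turns \<open>f\<close> into a function of the last coordinate alone. The averages stay left invariant along the
  earlier directions because the basis is strong.\<close>

definition "av i f g = (\<integral>u. f (E (u *\<^sub>R X i) \<otimes> g) \<partial>unit_interval)" for f :: "'g \<Rightarrow> complex"

text \<open>Continuity is checked in the coordinates \<open>E v\<close>, because the sequential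
  argument for parameter integrals takes place in a metric space.\<close>

lemma av_CC:
  assumes f: "f \<in> CC"
  shows "av i f \<in> CC"
proof -
  obtain B where B: "\<And>g. cmod (f g) \<le> B" using bounded_CC[OF f] by blast
  have "continuous_on UNIV (\<lambda>v. \<integral>u. f (E (u *\<^sub>R X i) \<otimes> E v) \<partial>unit_interval)"
  proof (rule continuous_on_integral_bounded[OF finite_measure_unit_interval])
    show "(\<lambda>u. f (E (u *\<^sub>R X i) \<otimes> E v)) \<in> borel_measurable unit_interval" for v
      by (intro measurable_unit_interval borel_measurable_continuous_onI CC_continuous_on[OF f] continuous_intros)
    show "continuous_on UNIV (\<lambda>v. f (E (u *\<^sub>R X i) \<otimes> E v))" for u
      by (intro CC_continuous_on[OF f] continuous_intros)
  qed (rule B)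
  then have "continuous_on UNIV (\<lambda>g. \<integral>u. f (E (u *\<^sub>R X i) \<otimes> E (L g)) \<partial>unit_interval)"
    by (rule continuous_on_compose2[OF _ continuous_L]) auto
  then have "continuous_on UNIV (av i f)" by (simp add: av_def[abs_def])
  moreover have "GG.rinv (av i f)"
    unfolding GG.rinv_def av_def using CC_D(3)[OF f] by (simp add: mult_assoc[symmetric])
  ultimately show ?thesis by (simp add: CC_iff)
qed

lemma integral_av:
  assumes f: "f \<in> CC"
  shows "(\<integral>c. on_cosets (av i f) c \<partial>\<mu>) = (\<integral>c. on_cosets f c \<partial>\<mu>)"
proof -
  obtain B where B: "\<And>g. cmod (f g) \<le> B" using bounded_CC[OF f] by blast
  have "(\<integral>c. (\<integral>u. on_cosets (\<lambda>g. f (E (u *\<^sub>R X i) \<otimes> g)) c \<partial>unit_interval) \<partial>\<mu>) = (\<integral>c. on_cosets f c \<partial>\<mu>)"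
  proof (rule integral_average(1)[OF GG.finite_P])
    fix u
    have "continuous_on UNIV (\<lambda>g. f (E (u *\<^sub>R X i) \<otimes> g))" by (intro CC_continuous_on[OF f] continuous_intros)
    then show "on_cosets (\<lambda>g. f (E (u *\<^sub>R X i) \<otimes> g)) \<in> borel_measurable \<mu>"
      by (intro GG.measurable_on_cosets GG.rinv_translate CC_D(2)[OF f]) auto
    show "(\<integral>c. on_cosets (\<lambda>g. f (E (u *\<^sub>R X i) \<otimes> g)) c \<partial>\<mu>) = (\<integral>c. on_cosets f c \<partial>\<mu>)"
      by (intro GG.integral_translate GG.measurable_on_cosets CC_D[OF f]) auto
  next
    show "continuous_on UNIV (\<lambda>u. on_cosets (\<lambda>g. f (E (u *\<^sub>R X i) \<otimes> g)) c)" for c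
      unfolding on_cosets_def by (intro CC_continuous_on[OF f] continuous_intros)
    show "cmod (on_cosets (\<lambda>g. f (E (u *\<^sub>R X i) \<otimes> g)) c) \<le> B" for u c
      unfolding on_cosets_def by (rule B)
  qed
  then show ?thesis by (simp add: on_cosets_def av_def)
qed

definition "linv k f \<longleftrightarrow> (\<forall>j\<in>{1..k}. \<forall>s g. f (E (s *\<^sub>R X j) \<otimes> g) = f g)" for f :: "'g \<Rightarrow> complex"

lemma \<tau>_X: "j \<in> {1..<n} \<Longrightarrow> \<tau> (X j) = 0"
proof -
  assume "j \<in> {1..<n}"
  then have "n \<noteq> j" "n \<in> {1..n}" "j \<in> {1..n}" by auto
  then show ?thesis by (simp add: \<tau>_def co_X)
qed

text \<open>For k < n all directions lie in the abelian ideal, where exponentials multiply as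
  vectors add; the vectors whose line leaves f invariant thus form a subspace.\<close>

lemma linv_span:
  assumes f: "linv k f" and k: "k < n" and w: "w \<in> span (X ` {1..k})"
  shows "\<tau> w = 0 \<and> f (E w \<otimes> g) = f g"
proof -
  define Q where "Q = {w. \<tau> w = 0 \<and> (\<forall>s g. f (E (s *\<^sub>R w) \<otimes> g) = f g)}"
  have "span (X ` {1..k}) \<subseteq> Q"
  proof (rule span_minimal)
    show "X ` {1..k} \<subseteq> Q" using f k \<tau>_X by (auto simp: Q_def linv_def)
    show "subspace Q"
      unfolding subspace_def
    proof (intro conjI ballI allI)
      show "0 \<in> Q" by (simp add: Q_def)
      fix v w assume vw: "v \<in> Q" "w \<in> Q"
      have "E (s *\<^sub>R (v + w)) = E (s *\<^sub>R v) \<otimes> E (s *\<^sub>R w)" for s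
        using vw by (simp add: E_mult star_def Q_def scaleR_right_distrib)
      then show "v + w \<in> Q" using vw by (simp add: Q_def mult_assoc)
    next
      fix c v assume "v \<in> Q"
      then show "c *\<^sub>R v \<in> Q" by (simp add: Q_def)
    qed
  qed
  then have "w \<in> Q" using w by blast
  then have "\<tau> w = 0" "f (E (1 *\<^sub>R w) \<otimes> g) = f g" unfolding Q_def by blast+
  then show ?thesis by simp
qed

text \<open>Two facts are needed: moving an earlier direction past exp (u X_i) produces only earlier
  directions, and f (exp (u X_i) g) has period 1 in u. Periodicity makes the average invariant under
  shifts of u.\<close>

lemma av_linv:
  assumes f: "f \<in> CC" and i: "i \<in> {1..n}" and l: "linv (i - 1) f"
  shows "linv i (av i f)"
proof -
  have kn: "i - 1 < n" using i by auto
  have X_low: "{1..<i} = {1..i - 1}" using i by auto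
  have conj_low: "f (E (u *\<^sub>R X i) \<otimes> (E (s *\<^sub>R X j) \<otimes> g)) = f (E (u *\<^sub>R X i) \<otimes> g)"
    if j: "j \<in> {1..i - 1}" for j s u g
  proof -
    define w where "w = Af (u * \<tau> (X i)) (s *\<^sub>R X j)"
    have jn: "j \<in> {1..<n}" "j \<in> {1..n}" using j i by auto
    have "Af (u * \<tau> (X i)) (X j) - X j \<in> span (X ` {1..<j})" by (rule Af_X_lower[OF jn(2)])
    moreover have "span (X ` {1..<j}) \<subseteq> span (X ` {1..i - 1})" using j by (intro span_mono image_mono) auto
    moreover have "X j \<in> span (X ` {1..i - 1})" using j by (intro span_base) auto
    ultimately have "Af (u * \<tau> (X i)) (X j) \<in> span (X ` {1..i - 1})"
      using span_add[of "Af (u * \<tau> (X i)) (X j) - X j" "X ` {1..i - 1}" "X j"] by auto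
    then have w: "w \<in> span (X ` {1..i - 1})" unfolding w_def by (simp add: span_scale)
    have \<tau>w: "\<tau> w = 0" using linv_span[OF l kn w] by blast
    have "star (u *\<^sub>R X i) (s *\<^sub>R X j) = star w (u *\<^sub>R X i)"
      by (simp add: star_def \<tau>w add.commute) (simp add: w_def)
    then have "E (u *\<^sub>R X i) \<otimes> E (s *\<^sub>R X j) = E w \<otimes> E (u *\<^sub>R X i)"
      by (simp only: E_mult)
    then show ?thesis using linv_span[OF l kn w] by (metis mult_assoc)
  qed
  have per: "f (E ((u + 1) *\<^sub>R X i) \<otimes> g) = f (E (u *\<^sub>R X i) \<otimes> g)" for u g
  proof (cases "i = n")
    case True
    \<comment> \<open>Invariance under the whole ideal lets f depend on the last coordinate alone,
      so u merely adds to the last coordinate of g.\<close>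
    have *: "f (E (u *\<^sub>R X n) \<otimes> g) = f (E ((u + \<tau> (L g)) *\<^sub>R X n))" for u
    proof -
      define w where "w = Af u (\<pi> (L g))"
      have "w \<in> span (X ` {1..i - 1})" using True mm_span mm_iff by (auto simp: w_def)
      moreover have "E (u *\<^sub>R X n) \<otimes> E (L g) = E w \<otimes> E ((u + \<tau> (L g)) *\<^sub>R X n)"
      proof -
        have "star (u *\<^sub>R X n) (L g) = u *\<^sub>R X n + Af u (\<pi> (L g) + \<tau> (L g) *\<^sub>R X n)"
          using \<pi>_\<tau>[of "L g"] by (simp add: star_def)
        also have "\<dots> = star w ((u + \<tau> (L g)) *\<^sub>R X n)" by (simp add: star_def w_def algebra_simps)
        finally have "star (u *\<^sub>R X n) (L g) = star w ((u + \<tau> (L g)) *\<^sub>R X n)" .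
        then show ?thesis by (simp only: E_mult)
      qed
      ultimately show ?thesis using linv_span[OF l kn] by simp
    qed
    have nn: "n \<in> {1..n}" using n_pos by simp
    have "E ((u + 1 + \<tau> (L g)) *\<^sub>R X n) = E ((u + \<tau> (L g)) *\<^sub>R X n) \<otimes> E (X n)"
      by (simp add: E_mult star_def algebra_simps)
    moreover have "E (X n) \<in> \<Gamma>" using int_vec_X[OF nn, of 1] by (simp add: E_\<Gamma>)
    ultimately show ?thesis using True *[of "u + 1"] *[of u] CC_D(3)[OF f] by simp
  next
    case False
    then have i': "i \<in> {1..<n}" using i by auto
    \<comment> \<open>By triangularity of \<open>Af\<close>, moving exp (u X_i) from the left of g
      to the right costs only earlier directions, which f does not see. On the right,
      \<open>E (X i)\<close> belongs to \<Gamma>, so u = 1 acts trivially.\<close>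
    have *: "f (E (u *\<^sub>R X i) \<otimes> g) = f (g \<otimes> E (u *\<^sub>R X i))" for u
    proof -
      define w where "w = u *\<^sub>R (Af (\<tau> (L g)) (X i) - X i)"
      have w: "w \<in> span (X ` {1..i - 1})"
        unfolding w_def using Af_X_lower[OF i, of "\<tau> (L g)"] unfolding X_low by (rule span_scale)
      have \<tau>w: "\<tau> w = 0" using linv_span[OF l kn w] by blast
      have "star (L g) (u *\<^sub>R X i) = star w (star (u *\<^sub>R X i) (L g))"
        using \<tau>_X[OF i'] by (simp add: star_def \<tau>w) (simp add: w_def algebra_simps)
      then have "E (L g) \<otimes> E (u *\<^sub>R X i) = E w \<otimes> (E (u *\<^sub>R X i) \<otimes> E (L g))"
        by (simp only: E_mult)
      then show ?thesis using linv_span[OF l kn w] by simp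
    qed
    have "E ((u + 1) *\<^sub>R X i) = E (u *\<^sub>R X i) \<otimes> E (X i)"
      using \<tau>_X[OF i'] by (simp add: E_mult star_def algebra_simps)
    moreover have "E (X i) \<in> \<Gamma>" using int_vec_X[OF i, of 1] by (simp add: E_\<Gamma>)
    ultimately show ?thesis using *[of "u + 1"] *[of u] CC_D(3)[OF f] by (simp add: mult_assoc[symmetric])
  qed
  show ?thesis
    unfolding linv_def
  proof (intro ballI allI)
    fix j s g assume j: "j \<in> {1..i}"
    show "av i f (E (s *\<^sub>R X j) \<otimes> g) = av i f g"
    proof (cases "j = i")
      case True
      have "E (u *\<^sub>R X i) \<otimes> (E (s *\<^sub>R X i) \<otimes> g) = E ((u + s) *\<^sub>R X i) \<otimes> g" for u
      proof -
        have "E (u *\<^sub>R X i) \<otimes> E (s *\<^sub>R X i) = E ((u + s) *\<^sub>R X i)"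
        proof (cases "i = n")
          case True then show ?thesis by (simp add: E_mult star_def scaleR_left_distrib)
        next
          case False
          then have "\<tau> (X i) = 0" using i \<tau>_X by auto
          then show ?thesis by (simp add: E_mult star_def scaleR_left_distrib)
        qed
        then show ?thesis by (simp add: mult_assoc[symmetric])
      qed
      then have "av i f (E (s *\<^sub>R X j) \<otimes> g) = (\<integral>u. f (E ((u + s) *\<^sub>R X i) \<otimes> g) \<partial>unit_interval)"
        by (simp add: av_def True)
      also have "\<dots> = (\<integral>u. f (E (u *\<^sub>R X i) \<otimes> g) \<partial>unit_interval)"
        by (rule integral_periodic_shift[where f = "\<lambda>u. f (E (u *\<^sub>R X i) \<otimes> g)"])
          (intro CC_continuous_on[OF f] continuous_intros, rule per)
      finally show ?thesis by (simp add: av_def)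
    next
      case False
      then have "j \<in> {1..i - 1}" using j by auto
      then show ?thesis by (simp only: av_def conj_low)
    qed
  qed
qed

primrec avs :: "nat \<Rightarrow> ('g \<Rightarrow> complex) \<Rightarrow> 'g \<Rightarrow> complex" where
  "avs 0 f = f" | "avs (Suc k) f = av (Suc k) (avs k f)"

lemma avs_props: "f \<in> CC \<Longrightarrow> k \<le> n \<Longrightarrow> avs k f \<in> CC \<and> linv k (avs k f) \<and>
   (\<integral>c. on_cosets (avs k f) c \<partial>\<mu>) = (\<integral>c. on_cosets f c \<partial>\<mu>)"
proof (induction k)
  case 0 then show ?case by (simp add: linv_def)
next
  case (Suc k)
  then show ?case using av_CC[of "avs k f" "Suc k"] av_linv[of "avs k f" "Suc k"] integral_av[of "avs k f" "Suc k"] by simp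
qed

definition "sl f t = (\<integral>c. on_cosets (\<lambda>m. f (E (t *\<^sub>R X n) \<otimes> m)) c \<partial>\<mu>M)" for f :: "'g \<Rightarrow> complex"

text \<open>Moving exp (u X_i) past exp (t X_n) turns it into an element of M, and translation by M
  leaves the fibre integral unchanged.\<close>

lemma sl_av:
  assumes f: "f \<in> CC" and i: "i \<in> {1..<n}"
  shows "sl (av i f) t = sl f t"
proof -
  obtain B where B: "\<And>g. cmod (f g) \<le> B" using bounded_CC[OF f] by blast
  define a where "a u = E (u *\<^sub>R Af (- t) (X i))" for u
  have aM: "a u \<in> M" for u by (simp add: a_def E_M \<tau>_X[OF i])
  have comm: "E (u *\<^sub>R X i) \<otimes> (E (t *\<^sub>R X n) \<otimes> m) = E (t *\<^sub>R X n) \<otimes> (a u \<otimes> m)" for u m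
  proof -
    have "E (u *\<^sub>R X i) \<otimes> E (t *\<^sub>R X n) = E (t *\<^sub>R X n) \<otimes> a u"
      by (simp add: a_def E_mult star_def \<tau>_X[OF i] add.commute)
    then show ?thesis by (simp add: mult_assoc[symmetric])
  qed
  have "(\<integral>c. (\<integral>u. on_cosets (\<lambda>m. f (E (u *\<^sub>R X i) \<otimes> (E (t *\<^sub>R X n) \<otimes> m))) c \<partial>unit_interval) \<partial>\<mu>M)
      = (\<integral>c. on_cosets (\<lambda>m. f (E (t *\<^sub>R X n) \<otimes> m)) c \<partial>\<mu>M)"
  proof (rule integral_average(1)[OF MM.finite_P])
    fix u
    have "MM.rinv (\<lambda>m. f (E (u *\<^sub>R X i) \<otimes> E (t *\<^sub>R X n) \<otimes> m))" by (rule MM_rinv_slice[OF f])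
    moreover have "continuous_on M (\<lambda>m. f (E (u *\<^sub>R X i) \<otimes> E (t *\<^sub>R X n) \<otimes> m))" by (rule MM_cont_slice[OF f])
    ultimately show "on_cosets (\<lambda>m. f (E (u *\<^sub>R X i) \<otimes> (E (t *\<^sub>R X n) \<otimes> m))) \<in> borel_measurable \<mu>M"
      using MM.measurable_on_cosets by (simp only: mult_assoc)
    show "(\<integral>c. on_cosets (\<lambda>m. f (E (u *\<^sub>R X i) \<otimes> (E (t *\<^sub>R X n) \<otimes> m))) c \<partial>\<mu>M)
       = (\<integral>c. on_cosets (\<lambda>m. f (E (t *\<^sub>R X n) \<otimes> m)) c \<partial>\<mu>M)"
      unfolding comm
      by (rule MM.integral_translate[OF MM.measurable_on_cosets[OF MM_cont_slice[OF f] MM_rinv_slice[OF f]] MM_rinv_slice[OF f] aM])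
  next
    show "continuous_on UNIV (\<lambda>u. on_cosets (\<lambda>m. f (E (u *\<^sub>R X i) \<otimes> (E (t *\<^sub>R X n) \<otimes> m))) c)" for c
      unfolding on_cosets_def by (intro CC_continuous_on[OF f] continuous_intros)
    show "cmod (on_cosets (\<lambda>m. f (E (u *\<^sub>R X i) \<otimes> (E (t *\<^sub>R X n) \<otimes> m))) c) \<le> B" for u c
      unfolding on_cosets_def by (rule B)
  qed
  then show ?thesis by (simp add: sl_def av_def on_cosets_def)
qed

text \<open>Both sides are unchanged by the first n - 1 averages, after which the fibre integral is
  just the value at exp (t X_n); the last average evaluates the left side.\<close>

lemma integral_GG:
  assumes f: "f \<in> CC"
  shows "(\<integral>c. on_cosets f c \<partial>\<mu>) = (\<integral>t. sl f t \<partial>unit_interval)"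
proof -
  define F where "F = avs (n - 1) f"
  have F: "F \<in> CC" "linv (n - 1) F" "(\<integral>c. on_cosets F c \<partial>\<mu>) = (\<integral>c. on_cosets f c \<partial>\<mu>)"
    using avs_props[OF f, of "n - 1"] by (auto simp: F_def)
  have sl_avs: "k \<le> n - 1 \<Longrightarrow> sl (avs k f) t = sl f t" for k t
  proof (induction k)
    case (Suc k)
    then have "avs k f \<in> CC" using avs_props[OF f, of k] by auto
    then show ?case using Suc sl_av[of "avs k f" "Suc k" t] by auto
  qed simp
  have nn: "n \<in> {1..n}" using n_pos by simp
  have Fm: "F (E (t *\<^sub>R X n) \<otimes> m) = F (E (t *\<^sub>R X n))" if m: "m \<in> M" for t m
  proof -
    define w where "w = Af t (L m)"
    have "w \<in> span (X ` {1..n - 1})" using m mm_span mm_iff by (auto simp: w_def M_iff)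
    then have w: "\<tau> w = 0" "\<And>g. F (E w \<otimes> g) = F g" using linv_span[OF F(2)] n_pos by auto
    have "star (t *\<^sub>R X n) (L m) = star w (t *\<^sub>R X n)"
      using w(1) by (simp add: star_def) (simp add: w_def add.commute)
    then have "E (t *\<^sub>R X n) \<otimes> E (L m) = E w \<otimes> E (t *\<^sub>R X n)"
      by (simp only: E_mult)
    then show ?thesis using w(2) by simp
  qed
  have slF: "sl F t = F (E (t *\<^sub>R X n))" for t
  proof -
    have "sl F t = (\<integral>c. F (E (t *\<^sub>R X n)) \<partial>\<mu>M)"
      unfolding sl_def by (intro Bochner_Integration.integral_cong refl) (auto simp: on_cosets_def MM.some_in_S Fm)
    then show ?thesis using MM.mass_P by (simp add: measure_def)
  qed
  \<comment> \<open>One more average, along X_n, makes the function constant; its value at the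
    identity is by definition the integral of \<open>F\<close> over t in [0, 1).\<close>
  define F' where "F' = av n F"
  have F': "F' \<in> CC" "linv n F'" "(\<integral>c. on_cosets F' c \<partial>\<mu>) = (\<integral>c. on_cosets F c \<partial>\<mu>)"
    using av_CC[OF F(1)] av_linv[OF F(1) nn F(2)] integral_av[OF F(1)] by (auto simp: F'_def)
  have F'c: "F' g = F' \<one>" for g
  proof -
    have "linv (n - 1) F'" using F'(2) by (auto simp: linv_def)
    moreover have "\<pi> (L g) \<in> span (X ` {1..n - 1})" using mm_span mm_iff by auto
    ultimately have "F' (E (\<pi> (L g)) \<otimes> h) = F' h" for h using linv_span n_pos by auto
    moreover have "g = E (\<pi> (L g)) \<otimes> (E (\<tau> (L g) *\<^sub>R X n) \<otimes> \<one>)"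
    proof -
      have "E (\<pi> (L g)) \<otimes> E (\<tau> (L g) *\<^sub>R X n) = E (\<pi> (L g) + \<tau> (L g) *\<^sub>R X n)" by (simp add: E_mult star_def)
      also have "\<dots> = E (L g)" by (rule arg_cong[OF \<pi>_\<tau>[symmetric]])
      finally show ?thesis by simp
    qed
    ultimately have "F' g = F' (E (\<tau> (L g) *\<^sub>R X n) \<otimes> \<one>)" by metis
    also have "\<dots> = F' \<one>" by (rule F'(2)[unfolded linv_def, rule_format, OF nn])
    finally show ?thesis .
  qed
  have "(\<integral>c. on_cosets f c \<partial>\<mu>) = (\<integral>c. on_cosets F' c \<partial>\<mu>)" using F(3) F'(3) by simp
  also have "\<dots> = (\<integral>c. F' \<one> \<partial>\<mu>)" unfolding on_cosets_def by (subst F'c) simp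
  also have "\<dots> = F' \<one>" using GG.mass_P by (simp add: measure_def)
  also have "\<dots> = (\<integral>t. F (E (t *\<^sub>R X n)) \<partial>unit_interval)" by (simp add: F'_def av_def)
  also have "\<dots> = (\<integral>t. sl f t \<partial>unit_interval)"
  proof -
    have "F (E (t *\<^sub>R X n)) = sl f t" for t
      using slF[of t] sl_avs[OF order_refl, of t] by (simp only: F_def)
    then show ?thesis by (simp only:)
  qed
  finally show ?thesis .
qed

subsection \<open>Fourier coefficients\<close>

definition "Uh f l g = (\<integral>c. on_cosets (\<lambda>m. f (g \<otimes> m) * ee l (L m)) c \<partial>\<mu>M)" for f :: "'g \<Rightarrow> complex"
definition "H f l t = Uh f l (E (t *\<^sub>R X n))"

lemma Uh_rinv: "f \<in> CC \<Longrightarrow> l \<in> LM \<Longrightarrow> MM.rinv (\<lambda>m. f (g \<otimes> m) * ee l (L m))"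
  using MM_rinv_slice[of f g] ee_M_rinv[of l] unfolding MM.rinv_def by simp

lemma Uh_cont: "f \<in> CC \<Longrightarrow> l \<in> LM \<Longrightarrow> continuous_on A (\<lambda>m. f (g \<otimes> m) * ee l (L m))"
  by (intro continuous_on_mult' MM_cont_slice ee_M_cont continuous_intros)

lemma continuous_Uh:
  assumes f: "f \<in> CC" and l: "l \<in> LM"
  shows "continuous_on UNIV (Uh f l)"
proof -
  obtain B where B: "\<And>g. cmod (f g) \<le> B" using bounded_CC[OF f] by blast
  have "continuous_on UNIV (\<lambda>v. \<integral>c. on_cosets (\<lambda>m. f (E v \<otimes> m) * ee l (L m)) c \<partial>\<mu>M)"
  proof (rule continuous_on_integral_bounded[OF MM.finite_P])
    show "on_cosets (\<lambda>m. f (E v \<otimes> m) * ee l (L m)) \<in> borel_measurable \<mu>M" for v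
      by (intro MM.measurable_on_cosets Uh_cont Uh_rinv f l)
    show "continuous_on UNIV (\<lambda>v. on_cosets (\<lambda>m. f (E v \<otimes> m) * ee l (L m)) c)" for c
      unfolding on_cosets_def by (intro CC_continuous_on[OF f] continuous_intros)
    show "cmod (on_cosets (\<lambda>m. f (E v \<otimes> m) * ee l (L m)) c) \<le> B" for c v
      unfolding on_cosets_def using B by (simp add: norm_mult)
  qed
  then have "continuous_on UNIV (\<lambda>g. \<integral>c. on_cosets (\<lambda>m. f (E (L g) \<otimes> m) * ee l (L m)) c \<partial>\<mu>M)"
    by (rule continuous_on_compose2[OF _ continuous_L]) auto
  then show ?thesis by (simp add: Uh_def[abs_def])
qed

lemma continuous_H: "f \<in> CC \<Longrightarrow> l \<in> LM \<Longrightarrow> continuous_on UNIV (H f l)"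
  unfolding H_def by (rule continuous_on_compose2[OF continuous_Uh]) (auto intro!: continuous_intros)

lemma measurable_H [measurable]: "f \<in> CC \<Longrightarrow> l \<in> LM \<Longrightarrow> H f l \<in> borel_measurable borel"
  by (intro borel_measurable_continuous_onI continuous_H)

lemma H_bounded: "(\<And>g. cmod (f g) \<le> B) \<Longrightarrow> f \<in> CC \<Longrightarrow> l \<in> LM \<Longrightarrow> cmod (Uh f l g) \<le> B"
proof -
  assume B: "\<And>g. cmod (f g) \<le> B" and f: "f \<in> CC" and l: "l \<in> LM"
  interpret F: finite_measure \<mu>M by (rule MM.finite_P)
  have "integrable \<mu>M (on_cosets (\<lambda>m. f (g \<otimes> m) * ee l (L m)))"
    by (rule MM.integrable_on_cosets[OF Uh_cont[OF f l] Uh_rinv[OF f l], where B = B]) (use B in \<open>simp add: norm_mult\<close>)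
  then have i: "integrable \<mu>M (\<lambda>c. cmod (on_cosets (\<lambda>m. f (g \<otimes> m) * ee l (L m)) c))" by simp
  have "cmod (Uh f l g) \<le> (\<integral>c. cmod (on_cosets (\<lambda>m. f (g \<otimes> m) * ee l (L m)) c) \<partial>\<mu>M)"
    unfolding Uh_def by (rule integral_norm_bound)
  also have "\<dots> \<le> (\<integral>c. B \<partial>\<mu>M)"
    using i B by (intro integral_mono) (auto simp: on_cosets_def norm_mult)
  also have "\<dots> = B" using MM.mass_P by (simp add: measure_def)
  finally show ?thesis .
qed

text \<open>The substitution replacing m by m0^-1 m, which preserves the measure on M / (M \<inter>
  \<Gamma>), takes the character value at the inverse of m0 out of the integral.\<close>

lemma Uh_covariant:
  assumes f: "f \<in> CC" and l: "l \<in> LM" and m0: "m0 \<in> M"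
  shows "Uh f l (g \<otimes> m0) = inverse (ee l (L m0)) * Uh f l g"
proof -
  have inv: "ee l (L (inv m0)) = inverse (ee l (L m0))"
  proof -
    have "L (inv m0) = - L m0"
      using m0 E_inv[of "L m0"] by (simp add: M_iff starinv_def)
    then show ?thesis by (simp add: ee_neg[OF LM_linear[OF l]])
  qed
  define k where "k m = f (g \<otimes> m) * ee l (L (inv m0 \<otimes> m))" for m
  have im: "inv m0 \<in> M" using m0 MM.S_closed by blast
  have k_eq: "k = (\<lambda>m. inverse (ee l (L m0)) * (f (g \<otimes> m) * ee l (L m)))"
    unfolding k_def ee_M_mult[OF LM_linear[OF l] im] inv by (simp add: mult_ac)
  have kr: "MM.rinv k" using Uh_rinv[OF f l, of g] unfolding k_eq MM.rinv_def by auto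
  have kc: "continuous_on M k" unfolding k_eq by (intro continuous_intros Uh_cont f l)
  have "Uh f l (g \<otimes> m0) = (\<integral>c. on_cosets (\<lambda>m. k (m0 \<otimes> m)) c \<partial>\<mu>M)"
    unfolding Uh_def k_def by (simp add: mult_assoc)
  also have "\<dots> = (\<integral>c. on_cosets k c \<partial>\<mu>M)"
    by (rule MM.integral_translate[OF MM.measurable_on_cosets[OF kc kr] kr m0])
  also have "\<dots> = inverse (ee l (L m0)) * Uh f l g"
    unfolding k_eq Uh_def on_cosets_def by simp
  finally show ?thesis .
qed

text \<open>In exp ((t + k) X_n) m the factor exp (k X_n) is moved to the right of m, where it lies
  in \<Gamma> and is absorbed by f. What remains is the torus automorphism \<open>Af k\<close>,
  which the integral does not see and which acts on the character by \<open>act\<close>.\<close>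

lemma H_shift:
  assumes f: "f \<in> CC" and l: "l \<in> LM"
  shows "H f l (t + of_int k) = H f (act (of_int k) l) t"
proof -
  have nn: "n \<in> {1..n}" using n_pos by simp
  have kG: "E (of_int k *\<^sub>R X n) \<in> \<Gamma>" using int_vec_X[OF nn] by (simp add: E_\<Gamma>)
  define h where "h m = f (E (t *\<^sub>R X n) \<otimes> m) * ee (act (of_int k) l) (L m)" for m
  have lk: "act (of_int k) l \<in> LM" by (rule act_LM[OF l])
  have hr: "MM.rinv h" "continuous_on M h"
    unfolding h_def[abs_def] by (intro Uh_rinv Uh_cont f lk)+
  have eq: "f (E ((t + of_int k) *\<^sub>R X n) \<otimes> m) * ee l (L m) = h (E (Af (of_int k) (L m)))" if m: "m \<in> M" for m
  proof -
    have tm: "\<tau> (L m) = 0" using m by (simp add: M_iff)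
    have "star ((t + of_int k) *\<^sub>R X n) (L m) = star (star (t *\<^sub>R X n) (Af (of_int k) (L m))) (of_int k *\<^sub>R X n)"
      using tm by (simp add: star_def Af_add algebra_simps)
    then have "E ((t + of_int k) *\<^sub>R X n) \<otimes> E (L m) = E (t *\<^sub>R X n) \<otimes> E (Af (of_int k) (L m)) \<otimes> E (of_int k *\<^sub>R X n)"
      by (simp only: E_mult)
    then have "f (E ((t + of_int k) *\<^sub>R X n) \<otimes> m) = f (E (t *\<^sub>R X n) \<otimes> E (Af (of_int k) (L m)))"
      using CC_D(3)[OF f kG] by simp
    moreover have "ee (act (of_int k) l) (Af (of_int k) (L m)) = ee l (L m)"
      using tm by (simp add: ee_def act_def \<pi>_def)
    ultimately show ?thesis by (simp add: h_def)
  qed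
  have "H f l (t + of_int k) = (\<integral>c. on_cosets (\<lambda>m. h (E (Af (of_int k) (L m)))) c \<partial>\<mu>M)"
    unfolding H_def Uh_def by (intro Bochner_Integration.integral_cong refl MM.on_cosets_cong eq)
  also have "\<dots> = (\<integral>c. on_cosets h c \<partial>\<mu>M)" by (rule integral_automorphism[OF hr(2,1)])
  also have "\<dots> = H f (act (of_int k) l) t" unfolding H_def Uh_def h_def[abs_def] ..
  finally show ?thesis .
qed

lemma sq_norm_slices:
  assumes f: "f \<in> CC"
  shows "sq_norm \<mu> f = (\<integral>\<^sup>+t. (\<Sum>\<^sub>\<infinity>l\<in>LM. ennreal ((cmod (H f l t))\<^sup>2)) \<partial>unit_interval)"
proof -
  obtain B where B: "\<And>g. cmod (f g) \<le> B" using bounded_CC[OF f] by blast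
  define r where "r g = (cmod (f g))\<^sup>2" for g
  have rC: "(\<lambda>g. complex_of_real (r g)) \<in> CC"
    using f unfolding CC_iff r_def GG.rinv_def by (auto intro!: continuous_intros)
  have rr: "GG.rinv r" using CC_D(2)[OF f] unfolding r_def GG.rinv_def by simp
  have rc: "continuous_on UNIV r" unfolding r_def using CC_D(1)[OF f] by (intro continuous_intros)
  have rB: "norm (r g) \<le> B\<^sup>2" for g unfolding r_def using B by (auto intro: power_mono)
  have mr: "MM.rinv (\<lambda>m. r (a \<otimes> m))" for a
    using MM_rinv_slice[OF f, of a] unfolding MM.rinv_def r_def by simp
  have mc: "continuous_on M (\<lambda>m. r (a \<otimes> m))" for a
    unfolding r_def by (intro continuous_intros MM_cont_slice f)
  define q where "q t = (\<integral>c. on_cosets (\<lambda>m. r (E (t *\<^sub>R X n) \<otimes> m)) c \<partial>\<mu>M)" for t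
  have im: "integrable \<mu>M (on_cosets (\<lambda>m. r (a \<otimes> m)))" for a
    by (rule MM.integrable_on_cosets[OF mc mr rB])
  have ig: "integrable \<mu> (on_cosets r)"
    by (rule GG.integrable_on_cosets[OF rc rr rB])
  have slq: "sl (\<lambda>g. complex_of_real (r g)) t = complex_of_real (q t)" for t
    unfolding sl_def q_def on_cosets_def by (rule integral_complex_of_real)
  have q0: "0 \<le> q t" for t unfolding q_def r_def on_cosets_def by simp
  have qB: "norm (q t) \<le> B\<^sup>2" for t
  proof -
    interpret F: finite_measure \<mu>M by (rule MM.finite_P)
    have "q t \<le> (\<integral>c. B\<^sup>2 \<partial>\<mu>M)"
      unfolding q_def using im rB by (intro integral_mono) (auto simp: on_cosets_def abs_le_iff)
    then show ?thesis using q0[of t] MM.mass_P by (simp add: measure_def)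
  qed
  have zero: "(\<lambda>v. 0) \<in> LM" unfolding LM_def by (rule Latt_0)
  \<comment> \<open>The fibre integral of |f|^2 is the Fourier coefficient at the zero functional,
    so its measurability in t comes from \<open>measurable_H\<close>.\<close>
  have "q = (\<lambda>t. Re (H (\<lambda>g. complex_of_real (r g)) (\<lambda>v. 0) t))"
    using slq by (simp add: fun_eq_iff H_def Uh_def sl_def ee_def)
  then have qm: "q \<in> borel_measurable borel"
    using measurable_H[OF rC zero] by simp
  have iq: "integrable unit_interval q"
    using qm qB by (intro integrable_bounded[OF finite_measure_unit_interval measurable_unit_interval]) auto
  have "complex_of_real (\<integral>c. on_cosets r c \<partial>\<mu>) = (\<integral>c. on_cosets (\<lambda>g. complex_of_real (r g)) c \<partial>\<mu>)"
    unfolding on_cosets_def by (rule integral_complex_of_real[symmetric])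
  also have "\<dots> = (\<integral>t. sl (\<lambda>g. complex_of_real (r g)) t \<partial>unit_interval)" by (rule integral_GG[OF rC])
  also have "\<dots> = complex_of_real (\<integral>t. q t \<partial>unit_interval)"
    unfolding slq by (rule integral_complex_of_real)
  finally have eq: "(\<integral>c. on_cosets r c \<partial>\<mu>) = (\<integral>t. q t \<partial>unit_interval)" by (simp only: of_real_eq_iff)
  have "sq_norm \<mu> f = (\<integral>\<^sup>+c. ennreal (on_cosets r c) \<partial>\<mu>)" unfolding sq_norm_def r_def[abs_def] ..
  also have "\<dots> = ennreal (\<integral>c. on_cosets r c \<partial>\<mu>)"
    by (rule nn_integral_eq_integral[OF ig]) (simp add: on_cosets_def r_def)
  also have "\<dots> = (\<integral>\<^sup>+t. ennreal (q t) \<partial>unit_interval)"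
    unfolding eq by (rule nn_integral_eq_integral[OF iq, symmetric]) (simp add: q0)
  also have "\<dots> = (\<integral>\<^sup>+t. (\<Sum>\<^sub>\<infinity>l\<in>LM. ennreal ((cmod (H f l t))\<^sup>2)) \<partial>unit_interval)"
  proof (rule nn_integral_cong)
    fix t
    have "ennreal (q t) = (\<integral>\<^sup>+c. ennreal (on_cosets (\<lambda>m. r (E (t *\<^sub>R X n) \<otimes> m)) c) \<partial>\<mu>M)"
      unfolding q_def by (rule nn_integral_eq_integral[OF im, symmetric]) (simp add: on_cosets_def r_def)
    also have "\<dots> = (\<integral>\<^sup>+c. ennreal ((cmod (on_cosets (\<lambda>m. f (E (t *\<^sub>R X n) \<otimes> m)) c))\<^sup>2) \<partial>\<mu>M)"
      by (simp add: on_cosets_def r_def)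
    also have "\<dots> = (\<Sum>\<^sub>\<infinity>l\<in>LM. ennreal ((cmod (\<integral>c. on_cosets (\<lambda>m. f (E (t *\<^sub>R X n) \<otimes> m) * ee l (L m)) c \<partial>\<mu>M))\<^sup>2))"
      by (rule parseval_M[OF MM_cont_slice[OF f] MM_rinv_slice[OF f], symmetric]) (rule B)
    finally show "ennreal (q t) = (\<Sum>\<^sub>\<infinity>l\<in>LM. ennreal ((cmod (H f l t))\<^sup>2))" by (simp add: H_def Uh_def)
  qed
  finally show ?thesis .
qed

end

context nilmanifold
begin

subsection \<open>Sums over the dual lattice\<close>

lemma Latt_val:
  assumes l: "l \<in> Latt I" and I: "I \<subseteq> {1..n}" and i: "i \<in> {1..n}"
  shows "l (X i) \<in> \<int>" "i \<notin> I \<Longrightarrow> l (X i) = 0"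
proof -
  obtain c :: "nat \<Rightarrow> int" where c: "l = (\<lambda>v. \<Sum>i\<in>I. of_int (c i) * co i v)" using l by (auto simp: Latt_def)
  have fin: "finite I" using I finite_subset by blast
  have "l (X i) = (\<Sum>j\<in>I. if j = i then of_int (c i) else 0)"
    unfolding c using I i by (intro sum.cong refl) (auto simp: co_X)
  then have "l (X i) = (if i \<in> I then of_int (c i) else 0)" using fin by simp
  then show "l (X i) \<in> \<int>" "i \<notin> I \<Longrightarrow> l (X i) = 0" by auto
qed

lemma linear_expand: "linear l \<Longrightarrow> l v = (\<Sum>i\<in>{1..n}. l (X i) * co i v)" for l :: "'a \<Rightarrow> real"
proof -
  assume l: "linear l"
  have "l v = l (\<Sum>i\<in>{1..n}. co i v *\<^sub>R X i)" by (simp only: co_expand)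
  then show ?thesis by (simp add: linear_sum[OF l] linear_cmul[OF l] mult.commute)
qed

lemma linear_eq_on_basis:
  fixes l k :: "'a \<Rightarrow> real"
  assumes "linear l" "linear k" "\<And>i. i \<in> {1..n} \<Longrightarrow> l (X i) = k (X i)"
  shows "l = k"
proof
  fix v
  have "(\<Sum>i\<in>{1..n}. l (X i) * co i v) = (\<Sum>i\<in>{1..n}. k (X i) * co i v)"
    using assms(3) by (intro sum.cong) auto
  then show "l v = k v" using linear_expand[OF assms(1), of v] linear_expand[OF assms(2), of v] by argo
qed

lemma Latt_I:
  assumes l: "linear l" and I: "I \<subseteq> {1..n}" and int: "\<And>i. i \<in> I \<Longrightarrow> l (X i) \<in> \<int>"
    and z: "\<And>i. i \<in> {1..n} - I \<Longrightarrow> l (X i) = 0"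
  shows "l \<in> Latt I"
  unfolding Latt_def
proof (intro CollectI exI conjI TrueI)
  show "l = (\<lambda>v. \<Sum>i\<in>I. of_int \<lfloor>l (X i)\<rfloor> * co i v)"
  proof
    fix v
    have "l v = (\<Sum>i\<in>{1..n}. l (X i) * co i v)" by (rule linear_expand[OF l])
    also have "\<dots> = (\<Sum>i\<in>I. l (X i) * co i v)" using I z by (intro sum.mono_neutral_right) auto
    also have "\<dots> = (\<Sum>i\<in>I. of_int \<lfloor>l (X i)\<rfloor> * co i v)"
      using int by (intro sum.cong refl) (simp add: of_int_floor_Ints)
    finally show "l v = (\<Sum>i\<in>I. of_int \<lfloor>l (X i)\<rfloor> * co i v)" .
  qed
qed

lemma countable_Latt:
  assumes I: "I \<subseteq> {1..n}"
  shows "countable (Latt I)"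
proof (rule countable_image_inj_on)
  define e where "e l = map (\<lambda>i. \<lfloor>l (X i)\<rfloor>) [1..<Suc n]" for l :: "'a \<Rightarrow> real"
  show "countable (e ` Latt I)" by (rule countableI_type)
  show "inj_on e (Latt I)"
  proof (rule inj_onI)
    fix l k assume lk: "l \<in> Latt I" "k \<in> Latt I" "e l = e k"
    show "l = k"
    proof (rule linear_eq_on_basis[OF Latt_linear[OF lk(1)] Latt_linear[OF lk(2)]])
      fix i assume i: "i \<in> {1..n}"
      then have "i \<in> set [1..<Suc n]" by auto
      then have "\<lfloor>l (X i)\<rfloor> = \<lfloor>k (X i)\<rfloor>" using lk(3) unfolding e_def by (metis (no_types, lifting) map_eq_conv)
      then show "l (X i) = k (X i)"
        using of_int_floor_Ints[OF Latt_val(1)[OF lk(1) I i]] of_int_floor_Ints[OF Latt_val(1)[OF lk(2) I i]] by metis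
    qed
  qed
qed

lemma countable_LM: "countable LM" unfolding LM_def by (rule countable_Latt) auto

lemma functional_Af:
  assumes l: "linear l" and ad: "\<And>v. l (ad v) = (0::real)"
  shows "l (Af t v) = l v"
proof -
  obtain m where m: "nil = Suc m" using nil_pos gr0_conv_Suc by blast
  show ?thesis
    unfolding Af_eq m by (subst sum.lessThan_Suc_shift) (simp add: linear_add[OF l] linear_sum[OF l] linear_cmul[OF l] ad)
qed

lemma ad_Af: "ad (Af t v) = Af t (ad v)"
  unfolding Af_eq by (simp add: linear_sum[OF linear_ad] linear_cmul[OF linear_ad] funpow_swap1)

text \<open>Along the powers of \<open>exp X\<^sub>n\<close> the functional is polynomial in the exponent, and a
  polynomial that takes one value infinitely often is constant.\<close>

lemma functional_periodic:
  assumes l: "linear l" and s: "s \<noteq> 0" and per: "\<And>v. \<tau> v = 0 \<Longrightarrow> l (Af s v) = (l v :: real)"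
  shows "l (ad v) = 0"
proof -
  define w where "w = \<pi> v"
  have \<tau>w: "\<tau> w = 0" by (simp add: w_def)
  have per_k: "l (Af (of_nat k * s) w) = l w" for k
  proof (induction k)
    case (Suc k)
    have "Af (of_nat (Suc k) * s) w = Af s (Af (of_nat k * s) w)"
      by (simp add: Af_add[symmetric] distrib_right)
    then show ?case using per[of "Af (of_nat k * s) w"] Suc \<tau>w by simp
  qed simp
  \<comment> \<open>Coefficients in t of \<open>l (Af t w) - l w\<close>; the entry at index
    \<open>nil\<close> is 0 and only pads the sum to the form \<le> nil.\<close>
  define c where "c i = (if i < nil then l ((ad ^^ i) w) / fact i else 0) - (if i = 0 then l w else 0)" for i
  have poly: "l (Af t w) - l w = (\<Sum>i\<le>nil. c i * t ^ i)" for t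
  proof -
    have "l (Af t w) = (\<Sum>i<nil. l ((ad ^^ i) w) / fact i * t ^ i)"
      unfolding Af_eq by (simp add: linear_sum[OF l] linear_cmul[OF l] mult_ac)
    also have "\<dots> = (\<Sum>i\<le>nil. (if i < nil then l ((ad ^^ i) w) / fact i else 0) * t ^ i)"
      by (intro sum.mono_neutral_cong_left) auto
    finally have 1: "l (Af t w) = (\<Sum>i\<le>nil. (if i < nil then l ((ad ^^ i) w) / fact i else 0) * t ^ i)" .
    have "(\<Sum>i\<le>nil. (if i = 0 then l w else 0) * t ^ i) = (\<Sum>i\<in>{0}. (if i = 0 then l w else 0) * t ^ i)"
      by (intro sum.mono_neutral_right) auto
    then have 2: "(\<Sum>i\<le>nil. (if i = 0 then l w else 0) * t ^ i) = l w" by simp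
    show ?thesis unfolding c_def left_diff_distrib sum_subtractf 1 2 ..
  qed
  have "range (\<lambda>k. of_nat k * s) \<subseteq> {t. (\<Sum>i\<le>nil. c i * t ^ i) = 0}"
    using per_k by (auto simp: poly[symmetric])
  moreover have "infinite (range (\<lambda>k::nat. of_nat k * s))"
    using s by (intro range_inj_infinite injI) auto
  ultimately have "infinite {t. (\<Sum>i\<le>nil. c i * t ^ i) = 0}" using finite_subset by blast
  then have c0: "\<And>i. i \<le> nil \<Longrightarrow> c i = 0"
    using Transcendental.polyfun_finite_roots[of c nil] by auto
  have "ad w = ad v"
    unfolding w_def \<pi>_def by (simp add: linear_diff[OF linear_ad] linear_cmul[OF linear_ad])
  moreover have "l (ad w) = 0"
  \<comment> \<open>The linear coefficient of the polynomial is \<open>l (ad w)\<close>; if the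
    series is too short to contain it, \<open>ad w\<close> is already 0.\<close>
  proof (cases "1 < nil")
    case True then show ?thesis using c0[of 1] by (simp add: c_def)
  next
    case False
    then have "(ad ^^ 1) w = 0" by (intro ad_nil_ge) auto
    then show ?thesis by (simp add: linear_0[OF l])
  qed
  ultimately show ?thesis by simp
qed

abbreviation "W \<equiv> W_lattice br X"
abbreviation "V \<equiv> V_lattice X p"
text \<open>The restrictions to the ideal of the functionals in V, that is, the functionals in
  \<open>LM\<close> that vanish on the derived algebra.\<close>

definition "L0 = Latt {Suc p..n - 1}"

lemma W_iff: "l \<in> W \<longleftrightarrow> l \<in> LM \<and> (\<exists>v. l (ad v) \<noteq> 0)"
proof -
  have "{1..<n} = {1..n - 1}" by auto
  then have "l \<in> W \<longleftrightarrow> l \<in> LM \<and> (\<exists>v\<in>derived_algebra br. l v \<noteq> 0)"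
    unfolding W_lattice_def LM_def Latt_def n_dim[symmetric] by auto
  then show ?thesis using vanishes_on_derived[OF LM_linear, of l] by blast
qed

lemma V_eq: "V = Latt {Suc p..n}"
  unfolding V_lattice_def Latt_def n_dim[symmetric] ..

text \<open>The functional \<open>\<tau>\<close> kills the derived algebra but not X_n, so X_n
  cannot be among the vectors spanning it.\<close>

lemma p_less: "p < n"
proof (rule ccontr)
  assume "\<not> p < n"
  then have "p = n" using pn by simp
  then have "X n \<in> span (X ` {1..p})"
    using n_pos by (intro span_base imageI) (simp del: One_nat_def)
  then have "X n \<in> derived_algebra br" by (simp only: derived)
  moreover have "\<forall>u\<in>derived_algebra br. \<tau> u = 0"
    unfolding vanishes_on_derived[OF linear_\<tau>] by simp
  ultimately have "\<tau> (X n) = 0" by (rule bspec[rotated])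
  then show False unfolding \<tau>_simps(6) by (rule notE[OF zero_neq_one, OF sym])
qed

lemma derived_X:
  assumes l: "linear l"
  shows "(\<forall>v. l (ad v) = (0::real)) \<longleftrightarrow> (\<forall>i\<in>{1..p}. l (X i) = 0)"
  unfolding vanishes_on_derived[OF l, symmetric] derived
proof
  assume "\<forall>i\<in>{1..p}. l (X i) = 0"
  then have "span (X ` {1..p}) \<subseteq> {u. l u = 0}"
    by (intro span_minimal) (auto simp: subspace_def linear_add[OF l] linear_cmul[OF l] linear_0[OF l])
  then show "\<forall>u\<in>span (X ` {1..p}). l u = 0" by blast
next
  assume a: "\<forall>u\<in>span (X ` {1..p}). l u = 0"
  show "\<forall>i\<in>{1..p}. l (X i) = 0"
  proof
    fix i assume "i \<in> {1..p}"
    then show "l (X i) = 0" by (intro bspec[OF a] span_base imageI)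
  qed
qed

lemma L0_iff: "l \<in> L0 \<longleftrightarrow> l \<in> LM \<and> (\<forall>v. l (ad v) = 0)"
proof
  assume l: "l \<in> L0"
  have sub: "{Suc p..n - 1} \<subseteq> {1..n}" by auto
  have lin: "linear l" using l unfolding L0_def by (rule Latt_linear)
  note val = Latt_val[OF l[unfolded L0_def] sub]
  have nn: "n \<in> {1..n}" and n_notin: "n \<notin> {Suc p..n - 1}" using n_pos by auto
  have "l \<in> LM" using val(1) by (intro LM_I lin val(2)[OF nn n_notin]) auto
  moreover have "\<forall>i\<in>{1..p}. l (X i) = 0" using val(2) p_less by auto
  ultimately show "l \<in> LM \<and> (\<forall>v. l (ad v) = 0)" using derived_X[OF lin] by blast
next
  assume l: "l \<in> LM \<and> (\<forall>v. l (ad v) = 0)"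
  then have lin: "linear l" using LM_linear by blast
  have sub: "{1..n - 1} \<subseteq> {1..n}" by auto
  note val = Latt_val[OF conjunct1[OF l, unfolded LM_def] sub]
  have z: "\<forall>i\<in>{1..p}. l (X i) = 0" using derived_X[OF lin] l by blast
  show "l \<in> L0"
    unfolding L0_def
  proof (rule Latt_I[OF lin])
    fix i assume "i \<in> {1..n} - {Suc p..n - 1}"
    then have "i \<in> {1..n}" "i \<in> {1..p} \<or> i = n" by auto
    then show "l (X i) = 0" using z val(2)[of n] n_pos by auto
  qed (use val in auto)
qed

text \<open>Each functional in V splits uniquely into its part on the ideal and an integer multiple
  of the last dual basis vector; the second part indexes the Fourier modes of a 1-periodic
  coefficient.\<close>

lemma V_bij: "bij_betw (\<lambda>(l, k) v. l v + k v) (L0 \<times> Latt {n}) V"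
proof -
  have s0: "{Suc p..n - 1} \<subseteq> {1..n}" and sn: "{n} \<subseteq> {1..n}" and sv: "{Suc p..n} \<subseteq> {1..n}" using n_pos by auto
  have nn: "n \<in> {1..n}" and n_notin: "n \<notin> {Suc p..n - 1}" using n_pos by auto
  have lin_add: "linear (\<lambda>v. l v + k v)" if "linear l" "linear k" for l k :: "'a \<Rightarrow> real"
    using that by (simp add: linear_compose_add)
  show ?thesis
    unfolding bij_betw_def
  proof (rule conjI, rule inj_onI)
    fix x y assume x: "x \<in> L0 \<times> Latt {n}" and y: "y \<in> L0 \<times> Latt {n}"
      and eq: "(case x of (l, k) \<Rightarrow> \<lambda>v. l v + k v) = (case y of (l, k) \<Rightarrow> \<lambda>v. l v + k v)"
    obtain l k l' k' where xy: "x = (l, k)" "y = (l', k')" by (metis surj_pair)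
    have l: "l \<in> Latt {Suc p..n - 1}" "l' \<in> Latt {Suc p..n - 1}" and k: "k \<in> Latt {n}" "k' \<in> Latt {n}"
      using x y by (auto simp: xy L0_def)
    have e: "l v + k v = l' v + k' v" for v using eq by (simp add: xy fun_eq_iff)
    have ln: "l (X n) = 0" "l' (X n) = 0" using Latt_val(2)[OF l(1) s0 nn n_notin] Latt_val(2)[OF l(2) s0 nn n_notin] .
    have ki: "k (X i) = 0" "k' (X i) = 0" if "i \<in> {1..n}" "i \<noteq> n" for i
      using Latt_val(2)[OF k(1) sn that(1)] Latt_val(2)[OF k(2) sn that(1)] that(2) by auto
    have "l = l'"
      by (rule linear_eq_on_basis[OF Latt_linear[OF l(1)] Latt_linear[OF l(2)]]) (metis add.right_neutral e ki ln)
    moreover have "k = k'"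
      by (rule linear_eq_on_basis[OF Latt_linear[OF k(1)] Latt_linear[OF k(2)]]) (metis add.left_neutral e ki ln)
    ultimately show "x = y" by (simp add: xy)
  next
    show "(\<lambda>(l, k) v. l v + k v) ` (L0 \<times> Latt {n}) = V"
    proof (intro subset_antisym subsetI)
      fix s assume "s \<in> (\<lambda>(l, k) v. l v + k v) ` (L0 \<times> Latt {n})"
      then obtain l k where lk: "l \<in> Latt {Suc p..n - 1}" "k \<in> Latt {n}" "s = (\<lambda>v. l v + k v)" by (auto simp: L0_def)
      note vl = Latt_val[OF lk(1) s0] and vk = Latt_val[OF lk(2) sn]
      show "s \<in> V"
        unfolding V_eq lk(3)
      proof (rule Latt_I[OF lin_add[OF Latt_linear[OF lk(1)] Latt_linear[OF lk(2)]] sv])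
        show "l (X i) + k (X i) \<in> \<int>" if "i \<in> {Suc p..n}" for i
          using vl(1)[of i] vk(1)[of i] that by (intro Ints_add) auto
        show "l (X i) + k (X i) = 0" if "i \<in> {1..n} - {Suc p..n}" for i
          using vl(2)[of i] vk(2)[of i] that p_less by auto
      qed
    next
      fix s assume s: "s \<in> V"
      then have sl: "s \<in> Latt {Suc p..n}" by (simp add: V_eq)
      have lin: "linear s" by (rule Latt_linear[OF sl])
      note vs = Latt_val[OF sl sv]
      have pX: "\<pi> (X i) = (if i = n then 0 else X i)" "\<tau> (X i) = (if i = n then 1 else 0)" if "i \<in> {1..n}" for i
        using that co_X[OF nn that] by (auto simp: \<pi>_def \<tau>_def)
      have "(\<lambda>v. s (\<pi> v)) \<in> L0"
        unfolding L0_def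
      proof (rule Latt_I[OF _ s0])
        show "linear (\<lambda>v. s (\<pi> v))" by (rule linearI) (simp_all add: linear_add[OF lin] linear_cmul[OF lin])
        show "s (\<pi> (X i)) \<in> \<int>" if "i \<in> {Suc p..n - 1}" for i
          using pX(1)[of i] vs(1)[of i] that by (auto simp: linear_0[OF lin])
        show "s (\<pi> (X i)) = 0" if "i \<in> {1..n} - {Suc p..n - 1}" for i
          using pX(1)[of i] vs(2)[of i] that by (auto simp: linear_0[OF lin])
      qed
      moreover have "(\<lambda>v. \<tau> v * s (X n)) \<in> Latt {n}"
      proof (rule Latt_I[OF _ sn])
        show "linear (\<lambda>v. \<tau> v * s (X n))" by (rule linearI) (simp_all add: algebra_simps)
        show "\<tau> (X i) * s (X n) \<in> \<int>" if "i \<in> {n}" for i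
          using vs(1)[OF nn] that by simp
        show "\<tau> (X i) * s (X n) = 0" if "i \<in> {1..n} - {n}" for i
          using pX(2)[of i] that by auto
      qed
      moreover have "s = (\<lambda>v. s (\<pi> v) + \<tau> v * s (X n))"
      proof
        fix v
        have "s v = s (\<pi> v + \<tau> v *\<^sub>R X n)" by (rule arg_cong[OF \<pi>_\<tau>])
        then show "s v = s (\<pi> v) + \<tau> v * s (X n)" by (simp only: linear_add[OF lin] linear_cmul[OF lin] real_scaleR_def)
      qed
      ultimately show "s \<in> (\<lambda>(l, k) v. l v + k v) ` (L0 \<times> Latt {n})"
        by (intro image_eqI[of _ _ "(\<lambda>v. s (\<pi> v), \<lambda>v. \<tau> v * s (X n))"]) auto
    qed
  qed
qed

text \<open>The general approximation theorem is applied to the function \<phi> (\<tau> v) with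
  index set {n}, so the circle needs no separate trigonometric approximation.\<close>

lemma parseval_circle:
  fixes \<phi> :: "real \<Rightarrow> complex"
  assumes cont: "continuous_on UNIV \<phi>" and per: "\<And>t. \<phi> (t + 1) = \<phi> t" and B: "\<And>t. cmod (\<phi> t) \<le> B"
  shows "(\<Sum>\<^sub>\<infinity>k\<in>Latt {n}. ennreal ((cmod (\<integral>t. \<phi> t * ee k (t *\<^sub>R X n) \<partial>unit_interval))\<^sup>2))
    = (\<integral>\<^sup>+t. ennreal ((cmod (\<phi> t))\<^sup>2) \<partial>unit_interval)"
proof -
  have sn: "{n} \<subseteq> {1..n}" and nn: "n \<in> {1..n}" using n_pos by auto
  have ce: "continuous_on UNIV (\<lambda>t. ee k (t *\<^sub>R X n))" if "k \<in> Latt {n}" for k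
    by (intro continuous_intros Latt_linear[OF that])
  have kt: "k (t *\<^sub>R X n) = t * k (X n)" if "k \<in> Latt {n}" for k t
    using linear_cmul[OF Latt_linear[OF that], of t "X n"] by simp
  have int0: "(\<integral>t. ee k (t *\<^sub>R X n) \<partial>unit_interval) = (if k = (\<lambda>v. 0) then 1 else 0)" if k: "k \<in> Latt {n}" for k
  proof (cases "k = (\<lambda>v. 0)")
    case True
    then show ?thesis by (simp add: ee_def measure_def emeasure_restrict_space)
  next
    case False
    have kn: "k (X n) \<noteq> 0"
    proof
      assume "k (X n) = 0"
      have "k = (\<lambda>v. 0)"
      proof (rule linear_eq_on_basis[OF Latt_linear[OF k]])
        show "linear (\<lambda>v::'a. 0::real)" by (rule linearI) auto
        show "k (X i) = 0" if "i \<in> {1..n}" for i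
          using Latt_val(2)[OF k sn that] \<open>k (X n) = 0\<close> by (cases "i = n") auto
      qed
      then show False using False by blast
    qed
    have ki: "k (X n) \<in> \<int>" by (rule Latt_val(1)[OF k sn nn])
    have add: "ee k ((t + s) *\<^sub>R X n) = ee k (t *\<^sub>R X n) * ee k (s *\<^sub>R X n)" for t s
      by (simp only: scaleR_left_distrib ee_linear[OF Latt_linear[OF k]])
    have one: "ee k (1 *\<^sub>R X n) = 1" by (rule ee_int) (use ki in simp)
    \<comment> \<open>Half a period of the character on the circle, where it takes the value
      -1.\<close>
    define s where "s = 1 / (2 * k (X n))"
    have "ee k (s *\<^sub>R X n) = exp (2 * \<i> * complex_of_real pi * complex_of_real (1/2))"
      using kn by (simp add: ee_def kt[OF k] s_def)
    also have "2 * \<i> * complex_of_real pi * complex_of_real (1/2) = \<i> * complex_of_real pi" by simp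
    finally have ms: "ee k (s *\<^sub>R X n) = -1" by (simp add: mult.commute)
    have "(\<integral>t. ee k ((t + s) *\<^sub>R X n) \<partial>unit_interval) = (\<integral>t. ee k (t *\<^sub>R X n) \<partial>unit_interval)"
      by (rule integral_periodic_shift[where f = "\<lambda>t. ee k (t *\<^sub>R X n)"]) (rule ce[OF k], simp only: add one mult_1_right)
    then have "- (\<integral>t. ee k (t *\<^sub>R X n) \<partial>unit_interval) = (\<integral>t. ee k (t *\<^sub>R X n) \<partial>unit_interval)"
      unfolding add ms by simp
    then show ?thesis using False by simp
  qed
  show ?thesis
  proof (rule parseval_of_approximation[OF finite_measure_unit_interval])
    show "(\<lambda>t. ee k (t *\<^sub>R X n)) \<in> borel_measurable unit_interval" if "k \<in> Latt {n}" for k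
      by (intro measurable_unit_interval borel_measurable_continuous_onI ce that)
    show "cmod (ee k (t *\<^sub>R X n)) \<le> 1" for k t by simp
    show "(\<integral>t. ee l (t *\<^sub>R X n) * cnj (ee k (t *\<^sub>R X n)) \<partial>unit_interval) = (if l = k then 1 else 0)"
      if "l \<in> Latt {n}" "k \<in> Latt {n}" for l k
    proof -
      have "(\<integral>t. ee l (t *\<^sub>R X n) * cnj (ee k (t *\<^sub>R X n)) \<partial>unit_interval)
         = (\<integral>t. ee (\<lambda>v. l v + - k v) (t *\<^sub>R X n) \<partial>unit_interval)"
        by (simp only: ee_cnj ee_add)
      also have "\<dots> = (if (\<lambda>v. l v + - k v) = (\<lambda>v. 0) then 1 else 0)"
        using that by (intro int0 Latt_add Latt_uminus)
      also have "(\<lambda>v. l v + - k v) = (\<lambda>v. 0) \<longleftrightarrow> l = k" by (simp add: fun_eq_iff)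
      finally show ?thesis .
    qed
    show "\<phi> \<in> borel_measurable unit_interval"
      by (intro measurable_unit_interval borel_measurable_continuous_onI cont)
    show "cmod (\<phi> t) \<le> B" for t by (rule B)
    show "emeasure unit_interval (space unit_interval) = 1" by (rule emeasure_unit_interval)
    fix \<epsilon> :: real assume "\<epsilon> > 0"
    have per_nat: "\<phi> (t + of_nat j) = \<phi> t" for t j
    proof (induction j)
      case (Suc j)
      have "\<phi> (t + of_nat (Suc j)) = \<phi> ((t + of_nat j) + 1)" by (simp add: add_ac)
      then show ?case using per[of "t + of_nat j"] Suc by simp
    qed simp
    have per_int: "\<phi> (t + of_int j) = \<phi> t" for t j
    proof (cases "j \<ge> 0")
      case True then show ?thesis using per_nat[of t "nat j"] by simp
    next
      case False then show ?thesis using per_nat[of "t + of_int j" "nat (- j)"] by simp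
    qed
    have "continuous_on UNIV (\<lambda>v. cnj (\<phi> (\<tau> v)))"
      by (intro continuous_intros continuous_on_compose2[OF cont]) auto
    moreover have "cnj (\<phi> (\<tau> v)) = cnj (\<phi> (\<tau> w))" if vw: "\<forall>i\<in>{n}. co i v - co i w \<in> \<int>" for v w
    proof -
      have "\<tau> v - \<tau> w \<in> \<int>" using vw by (simp add: \<tau>_def)
      then obtain j where "\<tau> v - \<tau> w = of_int j" by (elim Ints_cases)
      then have "\<tau> v = \<tau> w + of_int j" by simp
      then show ?thesis by (simp only: per_int)
    qed
    ultimately obtain S c where S: "finite S" "S \<subseteq> Latt {n}"
      and ap: "\<And>v. cmod (cnj (\<phi> (\<tau> v)) - (\<Sum>l\<in>S. c l * ee l v)) \<le> \<epsilon>"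
      using trig_approx[OF sn, of "\<lambda>v. cnj (\<phi> (\<tau> v))" \<epsilon>] \<open>\<epsilon> > 0\<close> by blast
    have "cmod (\<phi> t - (\<Sum>l\<in>S. cnj (c l) * cnj (ee l (t *\<^sub>R X n)))) \<le> \<epsilon>" for t
    proof -
      have "\<phi> t - (\<Sum>l\<in>S. cnj (c l) * cnj (ee l (t *\<^sub>R X n)))
         = cnj (cnj (\<phi> (\<tau> (t *\<^sub>R X n))) - (\<Sum>l\<in>S. c l * ee l (t *\<^sub>R X n)))" by simp
      then show ?thesis using ap[of "t *\<^sub>R X n"] by (simp only: complex_mod_cnj)
    qed
    then show "\<exists>S c. finite S \<and> S \<subseteq> Latt {n} \<and> (\<forall>t\<in>space unit_interval. cmod (\<phi> t - (\<Sum>l\<in>S. c l * cnj (ee l (t *\<^sub>R X n)))) \<le> \<epsilon>)"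
      using S by (intro exI[of _ S] exI[of _ "\<lambda>l. cnj (c l)"]) auto
  qed
qed

definition "Uv f l g = (\<integral>c. on_cosets (\<lambda>m. f (g \<otimes> m) * ee l (L m)) c \<partial>\<mu>)" for f :: "'g \<Rightarrow> complex"

lemma V_lin: "l \<in> V \<Longrightarrow> linear l \<and> (\<forall>v. l (ad v) = 0) \<and> (\<forall>v. int_vec v \<longrightarrow> l v \<in> \<int>)"
proof -
  assume "l \<in> V"
  then have l: "l \<in> Latt {Suc p..n}" by (simp add: V_eq)
  have sv: "{Suc p..n} \<subseteq> {1..n}" by auto
  have lin: "linear l" by (rule Latt_linear[OF l])
  have "\<forall>v. l (ad v) = 0" unfolding derived_X[OF lin] using Latt_val(2)[OF l sv] pn by auto
  moreover have "l v \<in> \<int>" if "int_vec v" for v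
  proof -
    have "(\<Sum>i\<in>{1..n}. l (X i) * co i v) \<in> \<int>"
      using Latt_val(1)[OF l sv] that unfolding int_vec_def by (intro Ints_sum Ints_mult) auto
    then show ?thesis by (subst linear_expand[OF lin])
  qed
  ultimately show ?thesis using lin by blast
qed

text \<open>A functional that vanishes on the range of \<open>ad\<close> is invariant under
  \<open>Af\<close>, so it turns the twisted product \<open>star\<close> into a sum.\<close>

lemma ee_V_mult: "l \<in> V \<Longrightarrow> ee l (L (g \<otimes> h)) = ee l (L g) * ee l (L h)"
  using V_lin[of l] functional_Af[of l] by (simp add: L_mult star_def ee_linear) (simp add: ee_def)

lemma CC_mult_ee: "f \<in> CC \<Longrightarrow> l \<in> V \<Longrightarrow> (\<lambda>m. f (g \<otimes> m) * ee l (L m)) \<in> CC"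
  unfolding CC_iff
proof (intro conjI)
  assume f: "continuous_on UNIV f \<and> GG.rinv f" and l: "l \<in> V"
  then have fC: "f \<in> CC" by (simp add: CC_iff)
  show "continuous_on UNIV (\<lambda>m. f (g \<otimes> m) * ee l (L m))"
    using V_lin[OF l] by (intro continuous_on_mult' MM_cont_slice fC continuous_intros) auto
  have "ee l (L h) = 1" if "h \<in> \<Gamma>" for h using that V_lin[OF l] by (intro ee_int) (simp add: \<Gamma>_iff)
  then show "GG.rinv (\<lambda>m. f (g \<otimes> m) * ee l (L m))"
    unfolding GG.rinv_def using CC_D(3)[OF fC] by (simp add: ee_V_mult[OF l] mult_assoc[symmetric])
qed

text \<open>On a fibre exp (t X_n) M the k-part of the character is constant, and the l-part does
  not depend on t; the disintegration therefore gives the k-th Fourier coefficient of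
  \<open>H f l\<close>.\<close>

lemma Uv_H:
  assumes f: "f \<in> CC" and l: "l \<in> L0" and k: "k \<in> Latt {n}"
  shows "Uv f (\<lambda>v. l v + k v) \<one> = (\<integral>t. H f l t * ee k (t *\<^sub>R X n) \<partial>unit_interval)"
proof -
  let ?l = "\<lambda>v. l v + k v"
  have lV: "?l \<in> V" using V_bij l k unfolding bij_betw_def by (auto intro: image_eqI[of _ _ "(l, k)"])
  have lLM: "l \<in> LM" using l L0_iff by blast
  have sn: "{n} \<subseteq> {1..n}" using n_pos by auto
  have km: "k (L m) = 0" if "m \<in> M" for m
  proof -
    have "k (L m) = (\<Sum>i\<in>{1..n}. k (X i) * co i (L m))" by (rule linear_expand[OF Latt_linear[OF k]])
    also have "\<dots> = 0"
    proof (intro sum.neutral ballI)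
      fix i assume "i \<in> {1..n}"
      then show "k (X i) * co i (L m) = 0"
        using Latt_val(2)[OF k sn] that by (cases "i = n") (auto simp: M_iff \<tau>_def)
    qed
    finally show ?thesis .
  qed
  have "l (X n) = 0"
    using Latt_val(2)[OF lLM[unfolded LM_def], of n] n_pos by fastforce
  then have ln: "l (t *\<^sub>R X n) = 0" for t by (simp add: linear_cmul[OF LM_linear[OF lLM]])
  define F where "F m = f m * ee ?l (L m)" for m
  have FC: "F \<in> CC" using CC_mult_ee[OF f lV, of \<one>] by (simp add: F_def[abs_def])
  have "sl F t = H f l t * ee k (t *\<^sub>R X n)" for t
  proof -
    have "sl F t = (\<integral>c. ee k (t *\<^sub>R X n) * on_cosets (\<lambda>m. f (E (t *\<^sub>R X n) \<otimes> m) * ee l (L m)) c \<partial>\<mu>M)"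
      unfolding sl_def
    proof (rule Bochner_Integration.integral_cong[OF refl])
      fix c assume c: "c \<in> space \<mu>M"
      have "F (E (t *\<^sub>R X n) \<otimes> m) = ee k (t *\<^sub>R X n) * (f (E (t *\<^sub>R X n) \<otimes> m) * ee l (L m))" if "m \<in> M" for m
        unfolding F_def ee_V_mult[OF lV] L_E by (simp add: ee_def km[OF that] ln)
      then have "on_cosets (\<lambda>m. F (E (t *\<^sub>R X n) \<otimes> m)) c
         = on_cosets (\<lambda>m. ee k (t *\<^sub>R X n) * (f (E (t *\<^sub>R X n) \<otimes> m) * ee l (L m))) c"
        by (rule MM.on_cosets_cong[OF c])
      then show "on_cosets (\<lambda>m. F (E (t *\<^sub>R X n) \<otimes> m)) c
         = ee k (t *\<^sub>R X n) * on_cosets (\<lambda>m. f (E (t *\<^sub>R X n) \<otimes> m) * ee l (L m)) c"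
        by (simp add: on_cosets_def)
    qed
    then show ?thesis by (simp add: H_def Uh_def mult.commute)
  qed
  then show ?thesis using integral_GG[OF FC] by (simp add: Uv_def F_def[abs_def])
qed

lemma sum_V:
  assumes f: "f \<in> CC"
  shows "(\<Sum>\<^sub>\<infinity>l\<in>V. ennreal ((cmod (Uv f l \<one>))\<^sup>2)) = (\<Sum>\<^sub>\<infinity>l\<in>L0. \<integral>\<^sup>+t. ennreal ((cmod (H f l t))\<^sup>2) \<partial>unit_interval)"
proof -
  obtain B where B: "\<And>g. cmod (f g) \<le> B" using bounded_CC[OF f] by blast
  have "(\<Sum>\<^sub>\<infinity>l\<in>V. ennreal ((cmod (Uv f l \<one>))\<^sup>2))
     = (\<Sum>\<^sub>\<infinity>x\<in>L0 \<times> Latt {n}. ennreal ((cmod (Uv f ((\<lambda>(l, k) v. l v + k v) x) \<one>))\<^sup>2))"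
    by (rule infsum_reindex_bij_betw[OF V_bij, symmetric])
  also have "\<dots> = (\<Sum>\<^sub>\<infinity>l\<in>L0. \<Sum>\<^sub>\<infinity>k\<in>Latt {n}. ennreal ((cmod (Uv f ((\<lambda>(l, k) v. l v + k v) (l, k)) \<one>))\<^sup>2))"
    unfolding L0_def using n_pos by (intro infsum_Times_ennreal countable_Latt) auto
  also have "\<dots> = (\<Sum>\<^sub>\<infinity>l\<in>L0. \<integral>\<^sup>+t. ennreal ((cmod (H f l t))\<^sup>2) \<partial>unit_interval)"
  proof (rule infsum_cong)
    fix l assume l: "l \<in> L0"
    then have lM: "l \<in> LM" "\<forall>v. l (ad v) = 0" using L0_iff by auto
    have a1: "act (of_int 1) l = l"
      using functional_Af[OF LM_linear[OF lM(1)]] lM by (simp add: act_def fun_eq_iff LM_\<pi>)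
    have "(\<Sum>\<^sub>\<infinity>k\<in>Latt {n}. ennreal ((cmod (Uv f ((\<lambda>(l, k) v. l v + k v) (l, k)) \<one>))\<^sup>2))
       = (\<Sum>\<^sub>\<infinity>k\<in>Latt {n}. ennreal ((cmod (\<integral>t. H f l t * ee k (t *\<^sub>R X n) \<partial>unit_interval))\<^sup>2))"
      by (intro infsum_cong) (simp add: Uv_H[OF f l])
    also have "\<dots> = (\<integral>\<^sup>+t. ennreal ((cmod (H f l t))\<^sup>2) \<partial>unit_interval)"
    proof (rule parseval_circle[OF continuous_H[OF f lM(1)]])
      show "H f l (t + 1) = H f l t" for t using H_shift[OF f lM(1), of t 1] unfolding a1 by simp
      show "cmod (H f l t) \<le> B" for t unfolding H_def by (rule H_bounded[OF B f lM(1)])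
    qed
    finally show "(\<Sum>\<^sub>\<infinity>k\<in>Latt {n}. ennreal ((cmod (Uv f ((\<lambda>(l, k) v. l v + k v) (l, k)) \<one>))\<^sup>2))
       = (\<integral>\<^sup>+t. ennreal ((cmod (H f l t))\<^sup>2) \<partial>unit_interval)" .
  qed
  finally show ?thesis .
qed

text \<open>\<open>Ad_mm\<close> shows that on the ideal only the last coordinate of the group
  element acts, and the sum over the basis reassembles the projection
  \<open>\<pi> v\<close>.\<close>

lemma coAd0_act:
  assumes l: "linear l"
  shows "coAd0 G \<kappa> X g l = act (\<tau> (L g)) l"
proof
  fix v
  have "\<tau> (L (inv g)) = - \<tau> (L g)" using E_inv[of "L g"] by simp
  then have ad: "coAd G \<kappa> g l (X i) = l (Af (- \<tau> (L g)) (X i))" if "i \<in> {1..<n}" for i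
    using Ad_mm[OF \<tau>_X[OF that], of "L (inv g)"] by (simp add: coAd_def)
  have "coAd0 G \<kappa> X g l v = (\<Sum>i\<in>{1..<n}. l (Af (- \<tau> (L g)) (X i)) * co i v)"
    unfolding coAd0_def n_dim[symmetric] by (intro sum.cong refl) (simp add: ad)
  also have "\<dots> = l (Af (- \<tau> (L g)) (\<Sum>i\<in>{1..<n}. co i v *\<^sub>R X i))"
    by (simp add: linear_sum[OF l] linear_sum[OF linear_Af] linear_cmul[OF l] mult.commute)
  also have "(\<Sum>i\<in>{1..<n}. co i v *\<^sub>R X i) = \<pi> v"
    unfolding \<pi>_sum by (intro sum.cong) auto
  finally show "coAd0 G \<kappa> X g l v = act (\<tau> (L g)) l v" by (simp add: act_def)
qed

text \<open>The witness is transported by \<open>Af k\<close>, which commutes with \<open>ad\<close>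
  and undoes the action.\<close>

lemma act_W: "l \<in> W \<Longrightarrow> act (of_int k) l \<in> W"
proof -
  assume "l \<in> W"
  then obtain v where l: "l \<in> LM" and v: "l (ad v) \<noteq> 0" by (auto simp: W_iff)
  have "act (of_int k) l (ad (Af (of_int k) v)) = l (ad v)"
    by (simp add: act_def ad_Af \<pi>_def)
  then have "\<exists>v. act (of_int k) l (ad v) \<noteq> 0" using v by (intro exI[of _ "Af (of_int k) v"]) simp
  then show ?thesis unfolding W_iff using act_LM[OF l] by blast
qed

end

section \<open>Orbits of the integers in W and the Plancherel formula for continuous
  functions\<close>

locale plancherel = nilmanifold G \<A> \<kappa> expo \<mm> X n \<Gamma> M p \<mu> \<mu>M
  for G :: "'g::{t2_space,second_countable_topology} monoid" (structure)
    and \<A> :: "('g, 'a::euclidean_space) chart set" and \<kappa> and expo and \<mm> and X and n and \<Gamma> and M and p and \<mu> and \<mu>M +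
  fixes \<Sigma> :: "('a \<Rightarrow> real) set"
  assumes cross: "cross_section \<Gamma> (coAd0 G \<kappa> X) (W_lattice (lie_bracket G \<kappa>) X) \<Sigma>"
begin

lemma \<Sigma>_W: "l \<in> \<Sigma> \<Longrightarrow> l \<in> W" and \<Sigma>_LM: "l \<in> \<Sigma> \<Longrightarrow> l \<in> LM"
  using cross W_iff unfolding cross_section_def by auto

lemma \<Sigma>_V: "l \<in> \<Sigma> \<Longrightarrow> l \<notin> V"
  using \<Sigma>_W[of l] W_iff[of l] V_lin[of l] by blast

lemma countable_\<Sigma>: "countable \<Sigma>"
  by (rule countable_subset[OF subsetI[OF \<Sigma>_LM] countable_LM])

lemma countable_V: "countable V" unfolding V_eq by (rule countable_Latt) auto

lemma orbit_iff: "l \<in> LM \<Longrightarrow> (\<exists>\<gamma>\<in>\<Gamma>. s = coAd0 G \<kappa> X \<gamma> l) \<longleftrightarrow> (\<exists>k::int. s = act (of_int k) l)"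
proof -
  assume l: "l \<in> LM"
  have nn: "n \<in> {1..n}" using n_pos by simp
  show ?thesis
  proof
    assume "\<exists>\<gamma>\<in>\<Gamma>. s = coAd0 G \<kappa> X \<gamma> l"
    then obtain \<gamma> where g: "\<gamma> \<in> \<Gamma>" "s = act (\<tau> (L \<gamma>)) l" using coAd0_act[OF LM_linear[OF l]] by auto
    have "\<tau> (L \<gamma>) \<in> \<int>" using g(1) nn unfolding \<Gamma>_iff int_vec_def \<tau>_def by blast
    then obtain k where "\<tau> (L \<gamma>) = of_int k" by (elim Ints_cases)
    then show "\<exists>k::int. s = act (of_int k) l" using g(2) by (intro exI[of _ k]) simp
  next
    assume "\<exists>k::int. s = act (of_int k) l"
    then obtain k :: int where k: "s = act (of_int k) l" by blast
    have "E (of_int k *\<^sub>R X n) \<in> \<Gamma>" using int_vec_X[OF nn] by (simp add: E_\<Gamma>)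
    moreover have "s = coAd0 G \<kappa> X (E (of_int k *\<^sub>R X n)) l"
      unfolding coAd0_act[OF LM_linear[OF l]] using k by simp
    ultimately show "\<exists>\<gamma>\<in>\<Gamma>. s = coAd0 G \<kappa> X \<gamma> l" by blast
  qed
qed

text \<open>Existence and uniqueness of the representative come from the cross-section; uniqueness
  of the integer is the triviality of the stabilizer, which rests on
  \<open>functional_periodic\<close>.\<close>

lemma W_bij: "bij_betw (\<lambda>(s, k::int). act (of_int k) s) (\<Sigma> \<times> UNIV) W"
proof -
  have uniq: "\<exists>!s. s \<in> \<Sigma> \<and> (\<exists>k::int. s = act (of_int k) l)" if l: "l \<in> W" for l
  proof -
    have lLM: "l \<in> LM" using l W_iff by blast
    have "\<exists>!s. s \<in> \<Sigma> \<and> (\<exists>\<gamma>\<in>\<Gamma>. s = coAd0 G \<kappa> X \<gamma> l)"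
      using cross l unfolding cross_section_def by blast
    then show ?thesis by (simp only: orbit_iff[OF lLM])
  qed
  show ?thesis
    unfolding bij_betw_def
  proof (rule conjI, rule inj_onI)
    fix x y :: "('a \<Rightarrow> real) \<times> int"
    assume x: "x \<in> \<Sigma> \<times> UNIV" and y: "y \<in> \<Sigma> \<times> UNIV"
      and eq: "(case x of (s, k) \<Rightarrow> act (of_int k) s) = (case y of (s, k) \<Rightarrow> act (of_int k) s)"
    obtain s k s' k' where xy: "x = (s, k)" "y = (s', k')" by (metis surj_pair)
    have s: "s \<in> \<Sigma>" "s' \<in> \<Sigma>" and e: "act (of_int k) s = act (of_int k') s'" using x y eq by (auto simp: xy)
    have "act (of_int (- k')) (act (of_int k) s) = s'"
      unfolding e act_act using act_0[OF \<Sigma>_LM[OF s(2)]] by simp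
    then have s': "s' = act (of_int (k - k')) s" by (simp add: act_act)
    have "s = act (of_int 0) s" using act_0[OF \<Sigma>_LM[OF s(1)]] by simp
    then have ss: "s = s'" using uniq[OF \<Sigma>_W[OF s(1)]] s s' by blast
    \<comment> \<open>A nonzero difference would make s invariant under a nontrivial power of exp
      X_n, hence zero on the derived algebra, contrary to membership in W.\<close>
    have "k = k'"
    proof (rule ccontr)
      assume "k \<noteq> k'"
      have "s (ad v) = 0" for v
      proof (rule functional_periodic[OF LM_linear[OF \<Sigma>_LM[OF s(1)]]])
        show "of_int (k' - k) \<noteq> (0::real)" using \<open>k \<noteq> k'\<close> by simp
        fix v assume "\<tau> v = 0"
        then have "\<pi> v = v" by (simp add: \<pi>_def)
        then show "s (Af (of_int (k' - k)) v) = s v"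
          using fun_cong[OF s', of v] ss by (simp add: act_def)
      qed
      then show False using \<Sigma>_W[OF s(1)] W_iff by blast
    qed
    then show "x = y" using ss by (simp add: xy)
  next
    show "(\<lambda>(s, k::int). act (of_int k) s) ` (\<Sigma> \<times> UNIV) = W"
    proof (intro subset_antisym subsetI)
      fix l assume "l \<in> (\<lambda>(s, k::int). act (of_int k) s) ` (\<Sigma> \<times> UNIV)"
      then show "l \<in> W" using act_W \<Sigma>_W by auto
    next
      fix l assume l: "l \<in> W"
      then obtain s k where s: "s \<in> \<Sigma>" "s = act (of_int k) l" using uniq by blast
      have "l = act (of_int (- k)) s" unfolding s(2) act_act using act_0[of l] l W_iff by simp
      then show "l \<in> (\<lambda>(s, k::int). act (of_int k) s) ` (\<Sigma> \<times> UNIV)"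
        using s(1) by (intro image_eqI[of _ _ "(s, - k)"]) auto
    qed
  qed
qed

text \<open>The stabilizer of \<open>l \<in> W\<close> in \<open>\<int>\<close> is trivial, so its orbit lists the restrictions of one function \<open>H f l\<close>
  to the intervals \<open>[k, k + 1)\<close>, which tile the real line.\<close>

lemma sum_W:
  assumes f: "f \<in> CC"
  shows "(\<Sum>\<^sub>\<infinity>l\<in>W. \<integral>\<^sup>+t. ennreal ((cmod (H f l t))\<^sup>2) \<partial>unit_interval) = (\<Sum>\<^sub>\<infinity>l\<in>\<Sigma>. \<integral>\<^sup>+t. ennreal ((cmod (H f l t))\<^sup>2) \<partial>lborel)"
proof -
  let ?I = "\<lambda>l. \<integral>\<^sup>+t. ennreal ((cmod (H f l t))\<^sup>2) \<partial>unit_interval"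
  have "(\<Sum>\<^sub>\<infinity>l\<in>W. ?I l) = (\<Sum>\<^sub>\<infinity>x\<in>\<Sigma> \<times> UNIV. ?I ((\<lambda>(s, k::int). act (of_int k) s) x))"
    by (rule infsum_reindex_bij_betw[OF W_bij, symmetric])
  also have "\<dots> = (\<Sum>\<^sub>\<infinity>s\<in>\<Sigma>. \<Sum>\<^sub>\<infinity>k\<in>(UNIV::int set). ?I ((\<lambda>(s, k::int). act (of_int k) s) (s, k)))"
    by (intro infsum_Times_ennreal countable_\<Sigma>) auto
  also have "\<dots> = (\<Sum>\<^sub>\<infinity>l\<in>\<Sigma>. \<integral>\<^sup>+t. ennreal ((cmod (H f l t))\<^sup>2) \<partial>lborel)"
  proof (rule infsum_cong)
    fix s assume s: "s \<in> \<Sigma>"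
    have "(\<Sum>\<^sub>\<infinity>k\<in>(UNIV::int set). ?I ((\<lambda>(s, k::int). act (of_int k) s) (s, k)))
       = (\<Sum>\<^sub>\<infinity>k\<in>(UNIV::int set). \<integral>\<^sup>+t. ennreal ((cmod (H f s (t + of_int k)))\<^sup>2) \<partial>unit_interval)"
      by (simp add: H_shift[OF f \<Sigma>_LM[OF s]])
    also have "\<dots> = (\<integral>\<^sup>+t. ennreal ((cmod (H f s t))\<^sup>2) \<partial>lborel)"
      by (rule nn_integral_tile) (use measurable_H[OF f \<Sigma>_LM[OF s]] in measurable)
    finally show "(\<Sum>\<^sub>\<infinity>k\<in>(UNIV::int set). ?I ((\<lambda>(s, k::int). act (of_int k) s) (s, k))) = (\<integral>\<^sup>+t. ennreal ((cmod (H f s t))\<^sup>2) \<partial>lborel)" .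
  qed
  finally show ?thesis .
qed

lemma plancherel_formula:
  assumes f: "f \<in> CC"
  shows "(\<Sum>\<^sub>\<infinity>l\<in>\<Sigma>. \<integral>\<^sup>+t. ennreal ((cmod (H f l t))\<^sup>2) \<partial>lborel) + (\<Sum>\<^sub>\<infinity>l\<in>V. ennreal ((cmod (Uv f l \<one>))\<^sup>2)) = sq_norm \<mu> f"
proof -
  have LM: "LM = W \<union> L0" "W \<inter> L0 = {}" by (auto simp: W_iff L0_iff)
  have "sq_norm \<mu> f = (\<Sum>\<^sub>\<infinity>l\<in>LM. \<integral>\<^sup>+t. ennreal ((cmod (H f l t))\<^sup>2) \<partial>unit_interval)"
    unfolding sq_norm_slices[OF f]
  proof (rule nn_integral_infsum[OF countable_LM])
    fix l assume "l \<in> LM"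
    then have "H f l \<in> borel_measurable unit_interval" by (intro measurable_unit_interval measurable_H f)
    then show "(\<lambda>t. ennreal ((cmod (H f l t))\<^sup>2)) \<in> borel_measurable unit_interval" by measurable
  qed
  also have "\<dots> = (\<Sum>\<^sub>\<infinity>l\<in>W. \<integral>\<^sup>+t. ennreal ((cmod (H f l t))\<^sup>2) \<partial>unit_interval)
      + (\<Sum>\<^sub>\<infinity>l\<in>L0. \<integral>\<^sup>+t. ennreal ((cmod (H f l t))\<^sup>2) \<partial>unit_interval)"
    unfolding LM(1) by (intro infsum_Un_disjoint nonneg_summable_on_complete LM(2)) auto
  finally show ?thesis unfolding sum_W[OF f] sum_V[OF f] by (rule sym)
qed

end

section \<open>The Plancherel operator\<close>

subsection \<open>Limits of rapidly converging sequences\<close>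

text \<open>The value \<open>0\<close> at divergent sequences makes \<open>limf\<close> commute with multiplication by nonzero constants
  everywhere, so that pointwise limits of covariant functions are covariant without null sets.\<close>

definition "limf s = (if convergent s then lim s else 0)" for s :: "nat \<Rightarrow> complex"

lemma limf_cmult: "c \<noteq> 0 \<Longrightarrow> limf (\<lambda>k. c * s k) = c * limf s"
proof -
  assume c: "c \<noteq> 0"
  show ?thesis
  proof (cases "convergent s")
    case True
    then have "(\<lambda>k. c * s k) \<longlonglongrightarrow> c * lim s"
      by (intro tendsto_mult_left) (rule convergent_LIMSEQ_iff[THEN iffD1])
    then show ?thesis
      unfolding limf_def convergent_mult_const_iff[OF c] if_P[OF True] by (rule limI)
  next
    case False
    then show ?thesis unfolding limf_def convergent_mult_const_iff[OF c] by (simp only: if_False mult_zero_right)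
  qed
qed

lemma measurable_limf:
  assumes [measurable]: "\<And>k. f k \<in> borel_measurable M"
  shows "(\<lambda>x. limf (\<lambda>k. f k x)) \<in> borel_measurable M"
  unfolding limf_def Cauchy_convergent_iff[symmetric] by measurable

text \<open>Weighting the k-th squared increment by 4^k still leaves a convergent series of
  integrals, with terms C / 4^k. So almost everywhere the weighted sum is finite and the increments
  are bounded by a multiple of 2^-k. This is why the rate 16^-k is imposed.\<close>

lemma AE_convergent:
  fixes f :: "nat \<Rightarrow> 'b \<Rightarrow> complex"
  assumes [measurable]: "\<And>k. f k \<in> borel_measurable M" and C: "C \<ge> 0"
    and b: "\<And>k. (\<integral>\<^sup>+x. ennreal ((cmod (f (Suc k) x - f k x))\<^sup>2) \<partial>M) \<le> ennreal (C * (1 / 16) ^ k)"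
  shows "AE x in M. convergent (\<lambda>k. f k x)"
proof -
  let ?d = "\<lambda>k x. f (Suc k) x - f k x"
  let ?S = "\<lambda>x. \<Sum>k. ennreal (4 ^ k) * ennreal ((cmod (?d k x))\<^sup>2)"
  have "(\<integral>\<^sup>+x. ?S x \<partial>M) = (\<Sum>k. \<integral>\<^sup>+x. ennreal (4 ^ k) * ennreal ((cmod (?d k x))\<^sup>2) \<partial>M)"
    by (rule nn_integral_suminf) measurable
  also have "\<dots> = (\<Sum>k. ennreal (4 ^ k) * (\<integral>\<^sup>+x. ennreal ((cmod (?d k x))\<^sup>2) \<partial>M))"
    by (intro suminf_cong nn_integral_cmult) measurable
  also have "\<dots> \<le> (\<Sum>k. ennreal (C * (1 / 4) ^ k))"
  proof (intro suminf_le summableI)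
    fix k
    have "ennreal (4 ^ k) * (\<integral>\<^sup>+x. ennreal ((cmod (?d k x))\<^sup>2) \<partial>M) \<le> ennreal (4 ^ k) * ennreal (C * (1 / 16) ^ k)"
      by (intro mult_left_mono b) auto
    also have "\<dots> = ennreal (4 ^ k * (C * (1 / 16) ^ k))" using C by (simp add: ennreal_mult)
    also have "4 ^ k * (C * (1 / 16) ^ k) = C * (1 / 4 :: real) ^ k" by (simp add: power_mult_distrib[symmetric])
    finally show "ennreal (4 ^ k) * (\<integral>\<^sup>+x. ennreal ((cmod (?d k x))\<^sup>2) \<partial>M) \<le> ennreal (C * (1 / 4) ^ k)" .
  qed
  also have "\<dots> < \<infinity>"
  proof -
    have "summable (\<lambda>k. C * (1 / 4) ^ k)" by (intro summable_mult summable_geometric) simp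
    then have "(\<Sum>k. ennreal (C * (1 / 4) ^ k)) \<noteq> \<infinity>" unfolding infinity_ennreal_def by (rule ennreal_suminf_neq_top) (use C in simp)
    then show ?thesis unfolding infinity_ennreal_def by (simp only: less_top)
  qed
  finally have fin_int: "(\<integral>\<^sup>+x. ?S x \<partial>M) < \<infinity>" .
  have "AE x in M. ?S x \<noteq> \<infinity>" by (intro nn_integral_PInf_AE) (measurable, rule less_imp_neq[OF fin_int])
  then show ?thesis
  proof (rule AE_mp, intro AE_I2 impI)
    fix x assume fin: "?S x \<noteq> \<infinity>"
    define B where "B = enn2real (?S x)"
    have SB: "?S x = ennreal B"
      using fin unfolding B_def infinity_ennreal_def less_top by (rule ennreal_enn2real[symmetric])
    have "B \<ge> 0" unfolding B_def by (rule enn2real_nonneg)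
    have d: "cmod (?d k x) \<le> sqrt B * (1 / 2) ^ k" for k
    proof -
      have "ennreal (4 ^ k * (cmod (?d k x))\<^sup>2) \<le> ennreal B"
        using sum_le_suminf[of "\<lambda>k. ennreal (4 ^ k) * ennreal ((cmod (?d k x))\<^sup>2)" "{k}"]
        unfolding SB by (simp add: ennreal_mult)
      then have "4 ^ k * (cmod (?d k x))\<^sup>2 \<le> B" using ennreal_le_iff[OF \<open>B \<ge> 0\<close>] by blast
      moreover have "(4::real) ^ k = 2 ^ k * 2 ^ k" by (simp flip: power_mult_distrib)
      ultimately have "(2 ^ k * cmod (?d k x))\<^sup>2 \<le> B" by (simp only: power2_eq_square mult_ac)
      then have "2 ^ k * cmod (?d k x) \<le> sqrt B" by (rule real_le_rsqrt)
      then show ?thesis by (simp add: power_one_over field_simps)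
    qed
    have "summable (\<lambda>k. ?d k x)"
      by (rule summable_comparison_test[of _ "\<lambda>k. sqrt B * (1 / 2) ^ k"])
        (use d in \<open>auto intro: summable_mult summable_geometric\<close>)
    then have "convergent (\<lambda>m. \<Sum>k<m. ?d k x)" by (simp add: summable_iff_convergent)
    then have "convergent (\<lambda>m. f m x - f 0 x)" by (simp only: sum_lessThan_telescope[of "\<lambda>k. f k x"])
    then have "convergent (\<lambda>m. (f m x - f 0 x) + f 0 x)" by (intro convergent_add convergent_const)
    then show "convergent (\<lambda>m. f m x)" by simp
  qed
qed

text \<open>Fatou's lemma is applied twice, to the integral for each index and to the sum over the
  indices seen as an integral over a counting measure.\<close>

lemma L2_limit:
  fixes f :: "nat \<Rightarrow> 'i \<Rightarrow> 'b \<Rightarrow> complex"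
  assumes I: "countable I" and m [measurable]: "\<And>k i. i \<in> I \<Longrightarrow> f k i \<in> borel_measurable N" and C: "C \<ge> 0"
    and b: "\<And>j k. k \<le> j \<Longrightarrow> (\<Sum>\<^sub>\<infinity>i\<in>I. \<integral>\<^sup>+x. ennreal ((cmod (f j i x - f k i x))\<^sup>2) \<partial>N) \<le> ennreal (C * (1 / 16) ^ k)"
  shows "(\<Sum>\<^sub>\<infinity>i\<in>I. \<integral>\<^sup>+x. ennreal ((cmod (limf (\<lambda>j. f j i x) - f k i x))\<^sup>2) \<partial>N) \<le> ennreal (C * (1 / 16) ^ k)"
proof -
  let ?u = "\<lambda>j i. \<integral>\<^sup>+x. ennreal ((cmod (f j i x - f k i x))\<^sup>2) \<partial>N"
  have fatou: "(\<integral>\<^sup>+x. ennreal ((cmod (limf (\<lambda>j. f j i x) - f k i x))\<^sup>2) \<partial>N) \<le> liminf (\<lambda>j. ?u j i)" if i: "i \<in> I" for i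
  proof -
    have mi [measurable]: "\<And>k. f k i \<in> borel_measurable N" using m[OF i] .
    have "AE x in N. convergent (\<lambda>k. f k i x)"
    proof (rule AE_convergent[OF mi C])
      fix k
      have "(\<integral>\<^sup>+x. ennreal ((cmod (f (Suc k) i x - f k i x))\<^sup>2) \<partial>N)
         \<le> (\<Sum>\<^sub>\<infinity>i\<in>I. \<integral>\<^sup>+x. ennreal ((cmod (f (Suc k) i x - f k i x))\<^sup>2) \<partial>N)" by (rule infsum_ennreal_ge[OF i])
      also have "\<dots> \<le> ennreal (C * (1 / 16) ^ k)" by (rule b) simp
      finally show "(\<integral>\<^sup>+x. ennreal ((cmod (f (Suc k) i x - f k i x))\<^sup>2) \<partial>N) \<le> ennreal (C * (1 / 16) ^ k)" .
    qed
    then have "AE x in N. ennreal ((cmod (limf (\<lambda>j. f j i x) - f k i x))\<^sup>2) = liminf (\<lambda>j. ennreal ((cmod (f j i x - f k i x))\<^sup>2))"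
    proof (rule AE_mp, intro AE_I2 impI)
      fix x assume "convergent (\<lambda>k. f k i x)"
      then have "(\<lambda>j. f j i x) \<longlonglongrightarrow> limf (\<lambda>j. f j i x)" by (simp add: limf_def convergent_LIMSEQ_iff)
      then have "(\<lambda>j. ennreal ((cmod (f j i x - f k i x))\<^sup>2)) \<longlonglongrightarrow> ennreal ((cmod (limf (\<lambda>j. f j i x) - f k i x))\<^sup>2)"
        by (intro tendsto_intros)
      then show "ennreal ((cmod (limf (\<lambda>j. f j i x) - f k i x))\<^sup>2) = liminf (\<lambda>j. ennreal ((cmod (f j i x - f k i x))\<^sup>2))"
        by (intro lim_imp_Liminf[symmetric]) auto
    qed
    then have "(\<integral>\<^sup>+x. ennreal ((cmod (limf (\<lambda>j. f j i x) - f k i x))\<^sup>2) \<partial>N)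
       = (\<integral>\<^sup>+x. liminf (\<lambda>j. ennreal ((cmod (f j i x - f k i x))\<^sup>2)) \<partial>N)" by (rule nn_integral_cong_AE)
    also have "\<dots> \<le> liminf (\<lambda>j. ?u j i)" by (rule nn_integral_liminf) measurable
    finally show ?thesis .
  qed
  have "(\<Sum>\<^sub>\<infinity>i\<in>I. \<integral>\<^sup>+x. ennreal ((cmod (limf (\<lambda>j. f j i x) - f k i x))\<^sup>2) \<partial>N) \<le> (\<Sum>\<^sub>\<infinity>i\<in>I. liminf (\<lambda>j. ?u j i))"
    by (intro infsum_mono nonneg_summable_on_complete fatou) auto
  also have "\<dots> \<le> liminf (\<lambda>j. \<Sum>\<^sub>\<infinity>i\<in>I. ?u j i)"
    unfolding infsum_eq_nn_integral[OF I] by (rule nn_integral_liminf) simp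
  also have "\<dots> \<le> liminf (\<lambda>j::nat. ennreal (C * (1 / 16) ^ k))"
    by (intro Liminf_mono eventually_sequentiallyI[of k] b)
  also have "\<dots> = ennreal (C * (1 / 16) ^ k)" by (simp add: Liminf_const)
  finally show ?thesis .
qed

lemma infsum_sq_add:
  fixes f g :: "'i \<Rightarrow> 'b \<Rightarrow> complex"
  assumes "\<And>i. i \<in> I \<Longrightarrow> f i \<in> borel_measurable N" "\<And>i. i \<in> I \<Longrightarrow> g i \<in> borel_measurable N" and I: "countable I"
  shows "(\<Sum>\<^sub>\<infinity>i\<in>I. \<integral>\<^sup>+x. ennreal ((cmod (f i x + g i x))\<^sup>2) \<partial>N)
    \<le> 2 * (\<Sum>\<^sub>\<infinity>i\<in>I. \<integral>\<^sup>+x. ennreal ((cmod (f i x))\<^sup>2) \<partial>N) + 2 * (\<Sum>\<^sub>\<infinity>i\<in>I. \<integral>\<^sup>+x. ennreal ((cmod (g i x))\<^sup>2) \<partial>N)"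
proof -
  have "(\<Sum>\<^sub>\<infinity>i\<in>I. \<integral>\<^sup>+x. ennreal ((cmod (f i x + g i x))\<^sup>2) \<partial>N)
     \<le> (\<Sum>\<^sub>\<infinity>i\<in>I. 2 * (\<integral>\<^sup>+x. ennreal ((cmod (f i x))\<^sup>2) \<partial>N) + 2 * (\<integral>\<^sup>+x. ennreal ((cmod (g i x))\<^sup>2) \<partial>N))"
    using assms by (intro infsum_mono nonneg_summable_on_complete nn_integral_sq_add) auto
  then show ?thesis
    unfolding infsum_eq_nn_integral[OF I] by (simp add: nn_integral_add nn_integral_cmult)
qed

context nilmanifold
begin

subsection \<open>Square integrals over \<open>G / M\<close>\<close>

abbreviation "\<nu> \<equiv> line_measure G expo M (X n)"

definition "M_inv k \<longleftrightarrow> (\<forall>g. \<forall>m\<in>M. k (g \<otimes> m) = k g)"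

lemma on_cosets_M:
  assumes k: "M_inv k"
  shows "on_cosets k (g <#\<^bsub>G\<^esub> M) = k g"
proof -
  have "\<one> \<in> M" using MM.S_closed(3) .
  then have "g \<in> g <#\<^bsub>G\<^esub> M" unfolding MM.l_coset_eq by (metis image_eqI one_mult(2))
  then have "(SOME x. x \<in> g <#\<^bsub>G\<^esub> M) \<in> g <#\<^bsub>G\<^esub> M" by (rule someI)
  then obtain m where "m \<in> M" "(SOME x. x \<in> g <#\<^bsub>G\<^esub> M) = g \<otimes> m" unfolding MM.l_coset_eq by blast
  then show ?thesis using k by (simp add: on_cosets_def M_inv_def)
qed

lemma M_inv_section:
  assumes k: "M_inv k"
  shows "k g = k (E (\<tau> (L g) *\<^sub>R X n))"
proof -
  let ?a = "E (\<tau> (L g) *\<^sub>R X n)"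
  have "inv ?a \<otimes> g \<in> M" by (simp add: M_iff L_mult E_inv)
  then have "k (?a \<otimes> (inv ?a \<otimes> g)) = k ?a" using k unfolding M_inv_def by blast
  then show ?thesis by simp
qed

lemma M_inv_\<tau>: "M_inv (\<lambda>g. \<tau> (L g))"
  unfolding M_inv_def by (simp add: L_mult M_iff)

lemma lcosets_M: "lcosets\<^bsub>G\<^esub> M = range (\<lambda>g. g <#\<^bsub>G\<^esub> M)"
  by (auto simp: LCOSETS_def)

lemma space_coset_M: "space (coset_borel G M) = range (\<lambda>g. g <#\<^bsub>G\<^esub> M)"
  unfolding coset_borel_def
  by (subst space_measure_of) (auto simp: openin_coset_topology lcosets_M)

lemma open_coset_M: "U \<subseteq> range (\<lambda>g. g <#\<^bsub>G\<^esub> M) \<Longrightarrow> open {g. g <#\<^bsub>G\<^esub> M \<in> U} \<Longrightarrow> U \<in> sets (coset_borel G M)"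
  unfolding coset_borel_def
  by (subst sets_measure_of) (auto simp: openin_coset_topology lcosets_M intro!: sigma_sets.Basic)

lemma measurable_line: "(\<lambda>t. expo (t *\<^sub>R X n) <#\<^bsub>G\<^esub> M) \<in> measurable lborel (coset_borel G M)"
  unfolding coset_borel_def
proof (rule measurable_measure_of)
  fix U assume "U \<in> {U. openin (coset_topology G M) U}"
  then have "open {g. g <#\<^bsub>G\<^esub> M \<in> U}" by (simp add: openin_coset_topology)
  then have "open ((\<lambda>t. E (t *\<^sub>R X n)) -` {g. g <#\<^bsub>G\<^esub> M \<in> U})"
    by (rule open_vimage) (intro continuous_intros)
  then have "(\<lambda>t. E (t *\<^sub>R X n)) -` {g. g <#\<^bsub>G\<^esub> M \<in> U} \<in> sets borel" by (rule borel_open)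
  then show "(\<lambda>t. expo (t *\<^sub>R X n) <#\<^bsub>G\<^esub> M) -` U \<inter> space lborel \<in> sets lborel"
    by (simp add: E_Xn vimage_def)
qed (auto simp: openin_coset_topology lcosets_M)

lemma measurable_coset_\<tau>: "on_cosets (\<lambda>g. \<tau> (L g)) \<in> borel_measurable (coset_borel G M)"
proof (rule borel_measurableI)
  fix U :: "real set" assume "open U"
  then have "open ((\<lambda>g. \<tau> (L g)) -` U)" by (rule open_vimage) (intro continuous_intros)
  then show "on_cosets (\<lambda>g. \<tau> (L g)) -` U \<inter> space (coset_borel G M) \<in> sets (coset_borel G M)"
    by (intro open_coset_M) (auto simp: space_coset_M on_cosets_M[OF M_inv_\<tau>] vimage_def)
qed

lemma measurable_left_mult [measurable]: "(\<lambda>g. a \<otimes> g) \<in> measurable borel borel"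
proof -
  have "continuous_on UNIV (\<lambda>g. a \<otimes> g)" by (intro continuous_intros)
  then show ?thesis by (rule borel_measurable_continuous_onI)
qed

lemma measurable_EX [measurable]: "(\<lambda>t. E (t *\<^sub>R X n)) \<in> measurable borel borel"
proof -
  have "continuous_on UNIV (\<lambda>t. E (t *\<^sub>R X n))" by (intro continuous_intros)
  then show ?thesis by (rule borel_measurable_continuous_onI)
qed

text \<open>The measure on G / M is a push-forward from the line, so the substitution requires
  measurability on the quotient. It holds because an M-invariant function factors through the
  coordinate \<open>\<tau>\<close>, which is continuous on the quotient.\<close>

lemma sq_norm_line:
  assumes F [measurable]: "F \<in> borel_measurable borel" and inv: "M_inv (\<lambda>g. cmod (F g))"
  shows "sq_norm \<nu> F = (\<integral>\<^sup>+t. ennreal ((cmod (F (E (t *\<^sub>R X n))))\<^sup>2) \<partial>lborel)"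
proof -
  let ?k = "\<lambda>g. (cmod (F g))\<^sup>2"
  have k: "M_inv ?k" using inv by (simp add: M_inv_def)
  have "(\<lambda>c. ennreal (?k (E (on_cosets (\<lambda>g. \<tau> (L g)) c *\<^sub>R X n)))) \<in> borel_measurable (coset_borel G M)"
    by (rule measurable_compose[OF measurable_coset_\<tau>]) measurable
  moreover have "ennreal (?k (E (on_cosets (\<lambda>g. \<tau> (L g)) c *\<^sub>R X n))) = ennreal (on_cosets ?k c)"
    if "c \<in> space (coset_borel G M)" for c
    using that M_inv_section[OF k] by (auto simp: space_coset_M on_cosets_M[OF k] on_cosets_M[OF M_inv_\<tau>])
  ultimately have m: "(\<lambda>c. ennreal (on_cosets ?k c)) \<in> borel_measurable (coset_borel G M)"
    by (simp cong: measurable_cong)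
  show ?thesis
    unfolding sq_norm_def line_measure_def
    by (subst nn_integral_distr[OF measurable_line]) (use m in \<open>simp_all add: on_cosets_M[OF k] E_Xn\<close>)
qed

text \<open>Modulo M, left multiplication by a only shifts t by the last coordinate of a.\<close>

lemma sq_norm_line_translate:
  assumes F [measurable]: "F \<in> borel_measurable borel" and inv: "M_inv (\<lambda>g. cmod (F g))"
  shows "sq_norm \<nu> (\<lambda>g. F (a \<otimes> g)) = sq_norm \<nu> F"
proof -
  have "M_inv (\<lambda>g. cmod (F (a \<otimes> g)))" using inv by (simp add: M_inv_def mult_assoc[symmetric])
  then have "sq_norm \<nu> (\<lambda>g. F (a \<otimes> g)) = (\<integral>\<^sup>+t. ennreal ((cmod (F (a \<otimes> E (t *\<^sub>R X n))))\<^sup>2) \<partial>lborel)"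
    by (intro sq_norm_line) measurable
  also have "\<dots> = (\<integral>\<^sup>+t. ennreal ((cmod (F (E ((\<tau> (L a) + 1 * t) *\<^sub>R X n))))\<^sup>2) \<partial>lborel)"
    by (subst M_inv_section[OF inv]) (simp add: L_mult)
  also have "\<dots> = (\<integral>\<^sup>+t. ennreal ((cmod (F (E (t *\<^sub>R X n))))\<^sup>2) \<partial>lborel)"
    using nn_integral_real_affine[of "\<lambda>t. ennreal ((cmod (F (E (t *\<^sub>R X n))))\<^sup>2)" 1 "\<tau> (L a)"] by simp
  also have "\<dots> = sq_norm \<nu> F" by (rule sq_norm_line[symmetric, OF F inv])
  finally show ?thesis .
qed

subsection \<open>Continuous functions are dense in \<open>L\<^sup>2(G / \<Gamma>)\<close>\<close>

lemma cs_continuous: "continuous_map euclidean GG.T GG.cs"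
  unfolding continuous_map_def GG.topspace_T using GG.openin_iff by auto

text \<open>In coordinates \<Gamma> is cut out by the closed conditions that all coordinates are
  integers.\<close>

lemma \<Gamma>_complement_open: "open (- \<Gamma>)"
proof -
  have "\<Gamma> = (\<Inter>i\<in>{1..n}. (\<lambda>g. co i (L g)) -` \<int>)" by (auto simp: \<Gamma>_iff int_vec_def)
  moreover have "closed ((\<lambda>g. co i (L g)) -` \<int>)" for i
    by (rule closed_vimage[OF closed_Ints]) (intro continuous_intros)
  ultimately have "closed \<Gamma>" by auto
  then show ?thesis by (rule open_Compl)
qed

text \<open>The full preimage of the image of U is the union of the translates of U by elements of
  \<Gamma>, so the quotient map is open.\<close>

lemma openin_cs_image: "open U \<Longrightarrow> openin GG.T (GG.cs ` U)"
proof -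
  assume U: "open U"
  have "{g. GG.cs g \<in> GG.cs ` U} = (\<Union>\<gamma>\<in>\<Gamma>. (\<lambda>x. x \<otimes> \<gamma>) -` U)"
  proof (intro subset_antisym subsetI)
    fix g assume "g \<in> {g. GG.cs g \<in> GG.cs ` U}"
    then obtain u where u: "u \<in> U" "inv g \<otimes> u \<in> \<Gamma>" by (auto simp: GG.cs_eq_iff)
    have "g \<otimes> (inv g \<otimes> u) \<in> U" using u(1) by simp
    then show "g \<in> (\<Union>\<gamma>\<in>\<Gamma>. (\<lambda>x. x \<otimes> \<gamma>) -` U)" using u(2) by blast
  next
    fix g assume "g \<in> (\<Union>\<gamma>\<in>\<Gamma>. (\<lambda>x. x \<otimes> \<gamma>) -` U)"
    then obtain \<gamma> where g: "\<gamma> \<in> \<Gamma>" "g \<otimes> \<gamma> \<in> U" by auto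
    then have "GG.cs g = GG.cs (g \<otimes> \<gamma>)" by (simp add: GG.cs_eq_iff)
    then show "g \<in> {g. GG.cs g \<in> GG.cs ` U}" using g(2) by blast
  qed
  moreover have "open ((\<lambda>x. x \<otimes> \<gamma>) -` U)" for \<gamma>
    using U by (rule open_vimage) (intro continuous_intros)
  ultimately have "open {g. GG.cs g \<in> GG.cs ` U}" by auto
  then show ?thesis unfolding GG.openin_iff by auto
qed

text \<open>If two cosets differ, g^-1 h lies in the open complement of \<Gamma>, and so do all
  nearby quotients; the quotient map being open, the two neighbourhoods have disjoint open
  images.\<close>

lemma Hausdorff_T: "Hausdorff_space GG.T"
  unfolding Hausdorff_space_def
proof (intro allI impI)
  fix x y assume "x \<in> topspace GG.T \<and> y \<in> topspace GG.T \<and> x \<noteq> y"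
  then obtain g h where gh: "x = GG.cs g" "y = GG.cs h" "GG.cs g \<noteq> GG.cs h" unfolding GG.topspace_T by blast
  have "open ((\<lambda>z. inv (fst z) \<otimes> snd z) -` (- \<Gamma>))"
    by (rule open_vimage[OF \<Gamma>_complement_open])
      (intro continuous_on_mult continuous_on_inverse continuous_on_fst continuous_on_snd continuous_on_id)
  moreover have "(g, h) \<in> (\<lambda>z. inv (fst z) \<otimes> snd z) -` (- \<Gamma>)" 
    using gh(3) unfolding GG.cs_eq_iff vimage_eq fst_conv snd_conv Compl_iff .
  ultimately obtain U V where UV: "open U" "open V" "(g, h) \<in> U \<times> V" "U \<times> V \<subseteq> (\<lambda>z. inv (fst z) \<otimes> snd z) -` (- \<Gamma>)"
    by (rule open_prod_elim)
  have "disjnt (GG.cs ` U) (GG.cs ` V)"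
    unfolding disjnt_def
  proof (intro equals0I)
    fix c assume "c \<in> GG.cs ` U \<inter> GG.cs ` V"
    then obtain u v where uv: "u \<in> U" "v \<in> V" "GG.cs u = GG.cs v" by auto
    then have "inv u \<otimes> v \<in> \<Gamma>" by (simp add: GG.cs_eq_iff)
    then show False using uv UV(4) by auto
  qed
  then show "\<exists>U V. openin GG.T U \<and> openin GG.T V \<and> x \<in> U \<and> y \<in> V \<and> disjnt U V"
    using UV openin_cs_image gh by (intro exI[of _ "GG.cs ` U"] exI[of _ "GG.cs ` V"]) auto
qed

text \<open>The preimage of U in the Euclidean coordinates is a countable union of compact sets;
  their images are compact, hence closed in the Hausdorff quotient.\<close>

lemma F_sigma_T:
  assumes "openin GG.T U"
  shows "\<exists>C :: nat \<Rightarrow> 'g set set. (\<forall>k. closedin GG.T (C k)) \<and> U = (\<Union>k. C k)"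
proof -
  have U: "U \<subseteq> range GG.cs" "open {g. GG.cs g \<in> U}" using assms GG.openin_iff by auto
  have "open (E -` {g. GG.cs g \<in> U})" by (rule open_vimage[OF U(2) continuous_E])
  from open_Union_compact_subsets[OF this] obtain K :: "nat \<Rightarrow> 'a set"
    where K: "\<And>k. compact (K k)" "\<Union> (range K) = E -` {g. GG.cs g \<in> U}" by metis
  have ct: "continuous_map euclidean GG.T (\<lambda>v. GG.cs (E v))"
    using continuous_map_compose[OF _ cs_continuous, of euclidean E] continuous_E
    by (simp add: o_def)
  have "compactin GG.T ((\<lambda>v. GG.cs (E v)) ` K k)" for k
    using image_compactin[OF _ ct] K(1) by simp
  then have "closedin GG.T ((\<lambda>v. GG.cs (E v)) ` K k)" for k
    by (rule compactin_imp_closedin[OF Hausdorff_T])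
  moreover have "U = (\<Union>k. (\<lambda>v. GG.cs (E v)) ` K k)"
  proof -
    have "(\<Union>k. (\<lambda>v. GG.cs (E v)) ` K k) = (\<lambda>v. GG.cs (E v)) ` (E -` {g. GG.cs g \<in> U})"
      unfolding K(2)[symmetric] by auto
    also have "\<dots> = U"
    proof (intro subset_antisym subsetI)
      fix c assume c: "c \<in> U"
      then obtain g where g: "c = GG.cs g" using U(1) by auto
      then have "L g \<in> E -` {g. GG.cs g \<in> U}" "c = GG.cs (E (L g))" using c by auto
      then show "c \<in> (\<lambda>v. GG.cs (E v)) ` (E -` {g. GG.cs g \<in> U})" by blast
    qed auto
    finally show ?thesis by (rule sym)
  qed
  ultimately show ?thesis by (intro exI[of _ "\<lambda>k. (\<lambda>v. GG.cs (E v)) ` K k"]) simp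
qed

abbreviation "L2 \<equiv> L2_coset_functions G \<Gamma> \<mu>"

lemma L2_iff: "f \<in> L2 \<longleftrightarrow> GG.rinv f \<and> on_cosets f \<in> borel_measurable \<mu> \<and> sq_norm \<mu> f < \<infinity>"
  by (simp add: L2_coset_functions_def GG.rinv_def)

lemma CC_dense:
  assumes f: "f \<in> L2" and e: "\<epsilon> > 0"
  shows "\<exists>\<xi>\<in>CC. sq_norm \<mu> (\<lambda>g. f g - \<xi> g) < ennreal \<epsilon>"
proof -
  have "compact_space GG.T" using unif by (simp add: uniform_subgroup_def carrier_UNIV)
  then have nrm: "normal_space GG.T"
    by (rule compact_Hausdorff_or_regular_imp_normal_space) (rule disjI1[OF Hausdorff_T])
  have f': "GG.rinv f" "on_cosets f \<in> borel_measurable \<mu>" "sq_norm \<mu> f < \<infinity>" using f unfolding L2_iff by auto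
  obtain \<xi> where "continuous_on UNIV \<xi>" "GG.rinv \<xi>" "sq_norm \<mu> (\<lambda>g. f g - \<xi> g) < ennreal \<epsilon>"
    using GG.continuous_dense_L2[OF nrm F_sigma_T f' e] by blast
  then show ?thesis by (intro bexI[of _ \<xi>]) (simp_all only: CC_iff)
qed

lemma sq_norm_eq: "sq_norm \<mu> f = (\<integral>\<^sup>+c. ennreal ((cmod (on_cosets f c))\<^sup>2) \<partial>\<mu>)"
  by (simp add: sq_norm_def on_cosets_def)

lemma sq_norm_add:
  assumes "on_cosets f \<in> borel_measurable \<mu>" "on_cosets h \<in> borel_measurable \<mu>"
  shows "sq_norm \<mu> (\<lambda>g. f g + h g) \<le> 2 * sq_norm \<mu> f + 2 * sq_norm \<mu> h"
  using nn_integral_sq_add[OF assms] unfolding sq_norm_eq by (simp add: on_cosets_def)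

lemma sq_norm_cmult:
  assumes [measurable]: "on_cosets f \<in> borel_measurable \<mu>"
  shows "sq_norm \<mu> (\<lambda>g. a * f g) = ennreal ((cmod a)\<^sup>2) * sq_norm \<mu> f"
proof -
  have "sq_norm \<mu> (\<lambda>g. a * f g) = (\<integral>\<^sup>+c. ennreal ((cmod a)\<^sup>2) * ennreal ((cmod (on_cosets f c))\<^sup>2) \<partial>\<mu>)"
    unfolding sq_norm_eq by (simp add: on_cosets_def norm_mult power_mult_distrib ennreal_mult)
  then show ?thesis unfolding sq_norm_eq by (simp add: nn_integral_cmult)
qed

lemma sq_norm_translate:
  assumes f: "on_cosets f \<in> borel_measurable \<mu>" "GG.rinv f"
  shows "sq_norm \<mu> (\<lambda>g. f (a \<otimes> g)) = sq_norm \<mu> f"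
proof -
  let ?k = "\<lambda>g. ennreal ((cmod (f g))\<^sup>2)"
  have "on_cosets ?k = (\<lambda>c. ennreal ((cmod (on_cosets f c))\<^sup>2))" by (simp add: on_cosets_def fun_eq_iff)
  then have 1: "on_cosets ?k \<in> borel_measurable \<mu>" using f(1) by simp
  have 2: "GG.rinv ?k" using f(2) by (simp add: GG.rinv_def)
  show ?thesis using GG.nn_integral_translate[OF 1 2, of a] by (simp add: sq_norm_eq on_cosets_def)
qed

lemma L2_translate:
  assumes f: "f \<in> L2"
  shows "(\<lambda>g. f (a \<otimes> g)) \<in> L2"
proof -
  have f': "GG.rinv f" "on_cosets f \<in> borel_measurable \<mu>" "sq_norm \<mu> f < \<infinity>" using f by (auto simp: L2_iff)
  have "(\<lambda>c. on_cosets f (a <#\<^bsub>G\<^esub> c)) \<in> borel_measurable \<mu>"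
    by (rule measurable_compose[OF GG.translate_measurable f'(2)]) simp
  then have "on_cosets (\<lambda>g. f (a \<otimes> g)) \<in> borel_measurable \<mu>"
    using GG.on_cosets_translate[OF f'(1), of a] by (simp cong: measurable_cong)
  then show ?thesis
    using GG.rinv_translate[OF f'(1), of a] sq_norm_translate[OF f'(2,1)] f'(3) by (simp add: L2_iff)
qed

lemma CC_measurable: "\<xi> \<in> CC \<Longrightarrow> on_cosets \<xi> \<in> borel_measurable \<mu>"
  by (intro GG.measurable_on_cosets CC_D)

lemma CC_L2: "\<xi> \<in> CC \<Longrightarrow> \<xi> \<in> L2"
proof -
  assume \<xi>: "\<xi> \<in> CC"
  obtain B where B: "\<And>g. cmod (\<xi> g) \<le> B" using bounded_CC[OF \<xi>] by blast
  have "sq_norm \<mu> \<xi> \<le> (\<integral>\<^sup>+c. ennreal (B\<^sup>2) \<partial>\<mu>)"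
    unfolding sq_norm_eq by (intro nn_integral_mono ennreal_leI power_mono) (auto simp: on_cosets_def B)
  also have "\<dots> < \<infinity>" using GG.mass_P by simp
  finally show ?thesis using CC_measurable[OF \<xi>] CC_D(2)[OF \<xi>] by (simp add: L2_iff)
qed

lemma CC_combine: "\<xi> \<in> CC \<Longrightarrow> \<eta> \<in> CC \<Longrightarrow> (\<lambda>g. a * \<xi> g + b * \<eta> g) \<in> CC"
  by (auto simp: CC_iff GG.rinv_def intro!: continuous_intros)

lemma CC_translate: "\<xi> \<in> CC \<Longrightarrow> (\<lambda>g. \<xi> (a \<otimes> g)) \<in> CC"
  by (auto simp: CC_iff MM_cont_slice CC_D(3) mult_assoc[symmetric] GG.rinv_def intro!: continuous_on_compose2[of UNIV \<xi> UNIV] continuous_intros)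

end

context plancherel
begin

subsection \<open>The operator on continuous functions\<close>

abbreviation "chm \<equiv> character expo"

lemma chm_V: "l \<in> V \<Longrightarrow> chm l g = ee l (L g)"
  using log_functional[of l g] V_lin[of l] by (simp add: character_def ee_def)

definition "U f l g = (if l \<in> \<Sigma> then Uh f l g else if l \<in> V then Uv f l g else 0)"

lemma U_\<Sigma>: "l \<in> \<Sigma> \<Longrightarrow> U f l = Uh f l" and U_V: "l \<in> V \<Longrightarrow> U f l = Uv f l"
  using \<Sigma>_V[of l] by (auto simp: U_def fun_eq_iff)

lemma U_op_eq: "U_op G expo \<mu>M \<mu> \<Sigma> V f = U f"
proof (intro ext)
  fix l g
  have "U_op G expo \<mu>M \<mu> \<Sigma> V f l g = Uh f l g" if l: "l \<in> \<Sigma>"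
    unfolding U_op_def Uh_def if_P[OF l]
    by (intro Bochner_Integration.integral_cong refl MM.on_cosets_cong) (simp_all only: character_M)
  moreover have "U_op G expo \<mu>M \<mu> \<Sigma> V f l g = Uv f l g" if l: "l \<notin> \<Sigma>" "l \<in> V"
    unfolding U_op_def Uv_def if_not_P[OF l(1)] if_P[OF l(2)]
    by (intro Bochner_Integration.integral_cong refl GG.on_cosets_cong) (simp_all only: chm_V[OF l(2)])
  ultimately show "U_op G expo \<mu>M \<mu> \<Sigma> V f l g = U f l g" by (simp add: U_def) (simp add: U_op_def)
qed

lemma Uh_linear:
  assumes f: "f \<in> CC" and h: "h \<in> CC" and l: "l \<in> LM"
  shows "Uh (\<lambda>x. a * f x + b * h x) l g = a * Uh f l g + b * Uh h l g"
proof -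
  have i: "integrable \<mu>M (on_cosets (\<lambda>m. f (g \<otimes> m) * ee l (L m)))" if f: "f \<in> CC" for f
  proof -
    obtain B where "\<And>g. cmod (f g) \<le> B" using bounded_CC[OF f] by blast
    then show ?thesis
      by (intro MM.integrable_on_cosets[where B = B] Uh_cont Uh_rinv f l) (simp add: norm_mult)
  qed
  have "(\<integral>c. on_cosets (\<lambda>m. (a * f (g \<otimes> m) + b * h (g \<otimes> m)) * ee l (L m)) c \<partial>\<mu>M)
     = (\<integral>c. a * on_cosets (\<lambda>m. f (g \<otimes> m) * ee l (L m)) c + b * on_cosets (\<lambda>m. h (g \<otimes> m) * ee l (L m)) c \<partial>\<mu>M)"
    by (intro Bochner_Integration.integral_cong refl) (simp add: on_cosets_def algebra_simps)
  then show ?thesis unfolding Uh_def by (simp add: i[OF f] i[OF h])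
qed

lemma Uv_linear:
  assumes f: "f \<in> CC" and h: "h \<in> CC" and l: "l \<in> V"
  shows "Uv (\<lambda>x. a * f x + b * h x) l g = a * Uv f l g + b * Uv h l g"
proof -
  have i: "integrable \<mu> (on_cosets (\<lambda>m. f (g \<otimes> m) * ee l (L m)))" if f: "f \<in> CC" for f
  proof -
    obtain B where "\<And>g. cmod (f g) \<le> B" using bounded_CC[OF f] by blast
    then show ?thesis
      by (intro GG.integrable_on_cosets[where B = B] CC_D[OF CC_mult_ee[OF f l]]) (simp add: norm_mult)
  qed
  have "(\<integral>c. on_cosets (\<lambda>m. (a * f (g \<otimes> m) + b * h (g \<otimes> m)) * ee l (L m)) c \<partial>\<mu>)
     = (\<integral>c. a * on_cosets (\<lambda>m. f (g \<otimes> m) * ee l (L m)) c + b * on_cosets (\<lambda>m. h (g \<otimes> m) * ee l (L m)) c \<partial>\<mu>)"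
    by (intro Bochner_Integration.integral_cong refl) (simp add: on_cosets_def algebra_simps)
  then show ?thesis unfolding Uv_def by (simp add: i[OF f] i[OF h])
qed

lemma U_linear:
  assumes "f \<in> CC" "h \<in> CC" "l \<in> \<Sigma> \<union> V"
  shows "U (\<lambda>x. a * f x + b * h x) l g = a * U f l g + b * U h l g"
proof (cases "l \<in> \<Sigma>")
  case True
  then show ?thesis using assms by (simp only: U_\<Sigma> Uh_linear \<Sigma>_LM)
next
  case False
  then have "l \<in> V" using assms by blast
  then show ?thesis using assms by (simp only: U_V Uv_linear)
qed

lemma U_translate: "U (\<lambda>g. f (a \<otimes> g)) l g = U f l (a \<otimes> g)"
  by (simp add: U_def Uh_def Uv_def mult_assoc)

text \<open>Translation by x in the integral over G / \<Gamma> multiplies the integrand by the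
  character value at x.\<close>

lemma Uv_covariant:
  assumes f: "f \<in> CC" and l: "l \<in> V"
  shows "Uv f l (g \<otimes> x) = inverse (ee l (L x)) * Uv f l g"
proof -
  let ?F = "\<lambda>m. f (g \<otimes> m) * ee l (L m)"
  have FC: "?F \<in> CC" by (rule CC_mult_ee[OF f l])
  have "(\<integral>c. on_cosets (\<lambda>m. ?F (x \<otimes> m)) c \<partial>\<mu>) = Uv f l g"
    unfolding Uv_def by (rule GG.integral_translate[OF CC_measurable[OF FC] CC_D(2)[OF FC]]) simp
  moreover have "(\<integral>c. on_cosets (\<lambda>m. ?F (x \<otimes> m)) c \<partial>\<mu>)
     = (\<integral>c. ee l (L x) * on_cosets (\<lambda>m. f (g \<otimes> x \<otimes> m) * ee l (L m)) c \<partial>\<mu>)"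
    by (intro Bochner_Integration.integral_cong refl) (simp add: on_cosets_def ee_V_mult[OF l] mult_assoc)
  ultimately have "ee l (L x) * Uv f l (g \<otimes> x) = Uv f l g" unfolding Uv_def by simp
  moreover have "ee l (L x) \<noteq> 0" using norm_ee[of l "L x"] by (metis norm_zero zero_neq_one)
  ultimately show ?thesis by (metis (no_types) mult.assoc left_inverse mult_1_left)
qed

subsection \<open>Families of covariant functions\<close>

text \<open>The ambient space for limits: measurability and covariance at every point, with no
  condition on the norm, so that it is closed under pointwise \<open>limf\<close>.\<close>

definition "covariant_family K \<longleftrightarrow> (\<forall>l\<in>\<Sigma>. K l \<in> borel_measurable borel \<and> covariant G M (chm l) (K l)) \<and>
  (\<forall>l\<in>V. covariant G UNIV (chm l) (K l))"

lemma covariant_family_D: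
  assumes "covariant_family K"
  shows "l \<in> \<Sigma> \<Longrightarrow> K l \<in> borel_measurable borel" "l \<in> \<Sigma> \<Longrightarrow> covariant G M (chm l) (K l)"
    "l \<in> V \<Longrightarrow> covariant G UNIV (chm l) (K l)"
  using assms by (simp_all add: covariant_family_def)

lemma norm_chm [simp]: "cmod (chm l g) = 1"
  unfolding character_def using norm_ee[of l "log_map expo g"] by (simp only: ee_def)

lemma chm_nonzero: "inverse (chm l g) \<noteq> 0"
  using norm_chm[of l g] by (metis nonzero_imp_inverse_nonzero norm_zero zero_neq_one)

lemma covariant_norm: "covariant G S (chm l) F \<Longrightarrow> x \<in> S \<Longrightarrow> cmod (F (g \<otimes> x)) = cmod (F g)"
  by (simp add: covariant_def norm_mult norm_inverse)

lemma covariant_M_inv: "covariant G M (chm l) F \<Longrightarrow> M_inv (\<lambda>g. cmod (F g))"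
  unfolding M_inv_def using covariant_norm by blast

lemma covariant_combine:
  "covariant G S c F \<Longrightarrow> covariant G S c F' \<Longrightarrow> covariant G S c (\<lambda>g. a * F g + b * F' g)"
  by (simp add: covariant_def algebra_simps)

lemma covariant_translate: "covariant G S c F \<Longrightarrow> covariant G S c (\<lambda>g. F (a \<otimes> g))"
  by (simp add: covariant_def mult_assoc[symmetric])

lemma covariant_limf: "(\<And>k. covariant G S (chm l) (F k)) \<Longrightarrow> covariant G S (chm l) (\<lambda>g. limf (\<lambda>k. F k g))"
  by (simp add: covariant_def limf_cmult[OF chm_nonzero])

lemma covariant_family_U: "\<xi> \<in> CC \<Longrightarrow> covariant_family (U \<xi>)"
  unfolding covariant_family_def
proof (intro conjI ballI)
  assume \<xi>: "\<xi> \<in> CC"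
  show "U \<xi> l \<in> borel_measurable borel" if l: "l \<in> \<Sigma>" for l
    unfolding U_\<Sigma>[OF l] by (rule borel_measurable_continuous_onI[OF continuous_Uh[OF \<xi> \<Sigma>_LM[OF l]]])
  show "covariant G M (chm l) (U \<xi> l)" if l: "l \<in> \<Sigma>" for l
    unfolding U_\<Sigma>[OF l] covariant_def using Uh_covariant[OF \<xi> \<Sigma>_LM[OF l]] by (simp add: character_M)
  show "covariant G UNIV (chm l) (U \<xi> l)" if l: "l \<in> V" for l
    unfolding U_V[OF l] covariant_def using Uv_covariant[OF \<xi> l] by (simp add: chm_V[OF l])
qed

lemma covariant_family_combine: "covariant_family K \<Longrightarrow> covariant_family K' \<Longrightarrow> covariant_family (\<lambda>l g. a * K l g + b * K' l g)"
  unfolding covariant_family_def by (auto intro!: covariant_combine borel_measurable_add borel_measurable_times)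

lemma covariant_family_cmult: "covariant_family K \<Longrightarrow> covariant_family (\<lambda>l g. a * K l g)"
  using covariant_family_combine[of K K a 0] by simp

lemma covariant_family_diff: "covariant_family K \<Longrightarrow> covariant_family K' \<Longrightarrow> covariant_family (\<lambda>l g. K l g - K' l g)"
  using covariant_family_combine[of K K' 1 "- 1"] by simp

lemma covariant_family_translate: "covariant_family K \<Longrightarrow> covariant_family (\<lambda>l g. K l (a \<otimes> g))"
  unfolding covariant_family_def
  by (auto intro!: covariant_translate measurable_compose[OF measurable_left_mult])

lemma covariant_family_limf: "(\<And>k. covariant_family (F k)) \<Longrightarrow> covariant_family (\<lambda>l g. limf (\<lambda>k. F k l g))"
  unfolding covariant_family_def by (auto intro!: covariant_limf measurable_limf)

definition "q K = rho_sq_norm G \<nu> \<Sigma> V K"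

lemma q_cong: "(\<And>l g. l \<in> \<Sigma> \<union> V \<Longrightarrow> K l g = K' l g) \<Longrightarrow> q K = q K'"
proof -
  assume a: "\<And>l g. l \<in> \<Sigma> \<union> V \<Longrightarrow> K l g = K' l g"
  then have "\<And>l. l \<in> \<Sigma> \<Longrightarrow> K l = K' l" by (intro ext) simp
  then show ?thesis unfolding q_def rho_sq_norm_def using a by (intro arg_cong2[of _ _ _ _ "(+)"] infsum_cong) auto
qed

text \<open>The one-dimensional components are written as integrals over a one-point space. Both
  halves of the norm then have the same shape, and \<open>infsum_sq_add\<close> and
  \<open>L2_limit\<close> apply to each.\<close>

lemma q_eq: "covariant_family K \<Longrightarrow> q K = (\<Sum>\<^sub>\<infinity>l\<in>\<Sigma>. \<integral>\<^sup>+t. ennreal ((cmod (K l (E (t *\<^sub>R X n))))\<^sup>2) \<partial>lborel)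
    + (\<Sum>\<^sub>\<infinity>l\<in>V. \<integral>\<^sup>+x. ennreal ((cmod (K l \<one>))\<^sup>2) \<partial>count_space {()})"
proof -
  assume K: "covariant_family K"
  have "sq_norm \<nu> (K l) = (\<integral>\<^sup>+t. ennreal ((cmod (K l (E (t *\<^sub>R X n))))\<^sup>2) \<partial>lborel)" if l: "l \<in> \<Sigma>" for l
    by (rule sq_norm_line[OF covariant_family_D(1)[OF K l] covariant_M_inv[OF covariant_family_D(2)[OF K l]]])
  then show ?thesis
    unfolding q_def rho_sq_norm_def
    by (intro arg_cong2[of _ _ _ _ "(+)"] infsum_cong) (simp_all add: nn_integral_count_space_finite)
qed

lemma covariant_family_measurable: "covariant_family K \<Longrightarrow> l \<in> \<Sigma> \<Longrightarrow> (\<lambda>t. K l (E (t *\<^sub>R X n))) \<in> borel_measurable lborel"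
  using measurable_compose[OF measurable_EX covariant_family_D(1)] by simp

lemma covariant_family_add: "covariant_family K \<Longrightarrow> covariant_family K' \<Longrightarrow> covariant_family (\<lambda>l g. K l g + K' l g)"
  using covariant_family_combine[of K K' 1 1] by simp

lemma q_add: 
  assumes K: "covariant_family K" "covariant_family K'"
  shows "q (\<lambda>l g. K l g + K' l g) \<le> 2 * q K + 2 * q K'"
proof -
  let ?a = "\<lambda>K. \<Sum>\<^sub>\<infinity>l\<in>\<Sigma>. \<integral>\<^sup>+t. ennreal ((cmod (K l (E (t *\<^sub>R X n))))\<^sup>2) \<partial>lborel"
  let ?b = "\<lambda>K. \<Sum>\<^sub>\<infinity>l\<in>V. \<integral>\<^sup>+x. ennreal ((cmod (K l \<one>))\<^sup>2) \<partial>count_space {()}"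
  have "?a (\<lambda>l g. K l g + K' l g) + ?b (\<lambda>l g. K l g + K' l g) \<le> (2 * ?a K + 2 * ?a K') + (2 * ?b K + 2 * ?b K')"
    by (intro add_mono infsum_sq_add countable_\<Sigma> countable_V covariant_family_measurable K) simp_all
  also have "\<dots> = 2 * (?a K + ?b K) + 2 * (?a K' + ?b K')" by (simp add: distrib_left add_ac)
  finally show ?thesis by (simp only: q_eq[OF K(1)] q_eq[OF K(2)] q_eq[OF covariant_family_add[OF K]])
qed

lemma q_cmult:
  assumes K: "covariant_family K"
  shows "q (\<lambda>l g. a * K l g) = ennreal ((cmod a)\<^sup>2) * q K"
proof -
  have e: "ennreal ((cmod (a * z))\<^sup>2) = ennreal ((cmod a)\<^sup>2) * ennreal ((cmod z)\<^sup>2)" for z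
    by (simp add: norm_mult power_mult_distrib ennreal_mult)
  have m: "(\<lambda>t. ennreal ((cmod (K l (E (t *\<^sub>R X n))))\<^sup>2)) \<in> borel_measurable lborel" if "l \<in> \<Sigma>" for l
    using covariant_family_measurable[OF K that] by measurable
  show ?thesis
    unfolding q_eq[OF K] q_eq[OF covariant_family_cmult[OF K]] e distrib_left
      infsum_eq_nn_integral[OF countable_\<Sigma>] infsum_eq_nn_integral[OF countable_V]
    by (simp add: nn_integral_cmult[OF m] nn_integral_cmult nn_integral_count_space_finite
        cong: nn_integral_cong_simp)
qed

lemma q_diff:
  assumes K: "covariant_family K" "covariant_family K'"
  shows "q (\<lambda>l g. K l g - K' l g) \<le> 2 * q K + 2 * q K'"
  using q_add[OF K(1) covariant_family_cmult[OF K(2), of "- 1"]] q_cmult[OF K(2), of "- 1"] by simp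

lemma q_translate:
  assumes K: "covariant_family K"
  shows "q (\<lambda>l g. K l (a \<otimes> g)) = q K"
proof -
  have "cmod (K l (a \<otimes> \<one>)) = cmod (K l \<one>)" if "l \<in> V" for l
    using covariant_norm[OF covariant_family_D(3)[OF K that], of a \<one>] by simp
  moreover have "sq_norm \<nu> (\<lambda>g. K l (a \<otimes> g)) = sq_norm \<nu> (K l)" if "l \<in> \<Sigma>" for l
    by (rule sq_norm_line_translate[OF covariant_family_D(1)[OF K that] covariant_M_inv[OF covariant_family_D(2)[OF K that]]])
  ultimately show ?thesis
    unfolding q_def rho_sq_norm_def by (intro arg_cong2[of _ _ _ _ "(+)"] infsum_cong) auto
qed

lemma q_U: "\<xi> \<in> CC \<Longrightarrow> q (U \<xi>) = sq_norm \<mu> \<xi>"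
proof -
  assume \<xi>: "\<xi> \<in> CC"
  have "q (U \<xi>) = (\<Sum>\<^sub>\<infinity>l\<in>\<Sigma>. \<integral>\<^sup>+t. ennreal ((cmod (H \<xi> l t))\<^sup>2) \<partial>lborel) + (\<Sum>\<^sub>\<infinity>l\<in>V. ennreal ((cmod (Uv \<xi> l \<one>))\<^sup>2))"
    unfolding q_eq[OF covariant_family_U[OF \<xi>]]
    by (intro arg_cong2[of _ _ _ _ "(+)"] infsum_cong) (simp_all add: U_\<Sigma> U_V H_def nn_integral_count_space_finite)
  then show ?thesis using plancherel_formula[OF \<xi>] by simp
qed

lemma q_U_diff:
  assumes "\<xi> \<in> CC" "\<eta> \<in> CC"
  shows "q (\<lambda>l g. U \<xi> l g - U \<eta> l g) = sq_norm \<mu> (\<lambda>g. \<xi> g - \<eta> g)"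
proof -
  have "q (\<lambda>l g. U \<xi> l g - U \<eta> l g) = q (U (\<lambda>g. 1 * \<xi> g + (- 1) * \<eta> g))"
    by (rule q_cong) (simp only: U_linear[OF assms], simp)
  also have "\<dots> = sq_norm \<mu> (\<lambda>g. 1 * \<xi> g + (- 1) * \<eta> g)" by (rule q_U[OF CC_combine[OF assms]])
  finally show ?thesis by simp
qed

lemma q_component: "l \<in> \<Sigma> \<Longrightarrow> sq_norm \<nu> (K l) \<le> q K"
proof -
  assume "l \<in> \<Sigma>"
  then have "sq_norm \<nu> (K l) \<le> (\<Sum>\<^sub>\<infinity>l\<in>\<Sigma>. sq_norm \<nu> (K l))" by (rule infsum_ennreal_ge)
  then show ?thesis unfolding q_def rho_sq_norm_def by (rule order_trans) simp
qed

end

lemma tendsto_zero_le: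
  fixes u v :: "nat \<Rightarrow> ennreal"
  assumes "\<And>k. u k \<le> v k" "v \<longlonglongrightarrow> 0"
  shows "u \<longlonglongrightarrow> 0"
  by (rule tendsto_sandwich[OF always_eventually always_eventually tendsto_const assms(2)]) (simp_all add: assms(1))

context plancherel
begin

subsection \<open>Approximation by compactly supported functions\<close>

text \<open>The function is continuous and covariant but need not have compact support modulo M.
  Cutting it off by a factor depending only on \<open>\<tau>\<close> keeps covariance, and dominated
  convergence along the line controls the error.\<close>

lemma ind_core_dense:
  assumes \<xi>: "\<xi> \<in> CC" and l: "l \<in> \<Sigma>" and e: "\<epsilon> > 0"
  shows "\<exists>\<Phi>\<in>ind_core G M (chm l). sq_norm \<nu> (\<lambda>g. U \<xi> l g - \<Phi> g) < ennreal \<epsilon>"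
proof -
  let ?F = "U \<xi> l"
  note lM = \<Sigma>_LM[OF l]
  have FD: "?F \<in> borel_measurable borel" "covariant G M (chm l) ?F"
    using covariant_family_D[OF covariant_family_U[OF \<xi>]] l by auto
  have Fc: "continuous_on UNIV ?F" unfolding U_\<Sigma>[OF l] by (rule continuous_Uh[OF \<xi> lM])
  \<comment> \<open>A trapezoid equal to 1 on [-k, k], equal to 0 outside [-(k + 1), k + 1] and
    linear in between.\<close>
  define \<theta> where "\<theta> k t = max 0 (min 1 (real k + 1 - \<bar>t\<bar>))" for k and t :: real
  define \<Phi> where "\<Phi> k g = complex_of_real (\<theta> k (\<tau> (L g))) * ?F g" for k g
  have \<tau>M: "\<tau> (L (g \<otimes> m)) = \<tau> (L g)" if "m \<in> M" for g m using M_inv_\<tau> that by (simp add: M_inv_def)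
  have \<Phi>c: "continuous_on UNIV (\<Phi> k)" for k
    unfolding \<Phi>_def \<theta>_def by (intro continuous_intros Fc)
  have \<Phi>cov: "covariant G M (chm l) (\<Phi> k)" for k
    using FD(2) unfolding covariant_def \<Phi>_def by (simp add: \<tau>M)
  have core: "\<Phi> k \<in> ind_core G M (chm l)" for k
    unfolding ind_core_def
  proof (intro CollectI conjI \<Phi>c \<Phi>cov exI)
    let ?C = "(\<lambda>t. E (t *\<^sub>R X n)) ` {- (real k + 1)..real k + 1}"
    show "compact ?C" by (intro compact_continuous_image continuous_intros compact_Icc)
    show "{g. \<Phi> k g \<noteq> 0} \<subseteq> ?C <#>\<^bsub>G\<^esub> M"
    proof
      fix g assume "g \<in> {g. \<Phi> k g \<noteq> 0}"
      then have "\<theta> k (\<tau> (L g)) \<noteq> 0" by (auto simp: \<Phi>_def)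
      then have "\<tau> (L g) \<in> {- (real k + 1)..real k + 1}" by (auto simp: \<theta>_def split: if_splits)
      then have a: "E (\<tau> (L g) *\<^sub>R X n) \<in> ?C" by blast
      have "inv (E (\<tau> (L g) *\<^sub>R X n)) \<otimes> g \<in> M" by (simp add: M_iff L_mult E_inv)
      then have "E (\<tau> (L g) *\<^sub>R X n) \<otimes> (inv (E (\<tau> (L g) *\<^sub>R X n)) \<otimes> g) \<in> ?C <#>\<^bsub>G\<^esub> M"
        using a unfolding set_mult_def by blast
      then show "g \<in> ?C <#>\<^bsub>G\<^esub> M" by simp
    qed
  qed
  let ?h = "\<lambda>t. ?F (E (t *\<^sub>R X n))"
  have hm [measurable]: "?h \<in> borel_measurable borel"
    using covariant_family_measurable[OF covariant_family_U[OF \<xi>] l] by simp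
  have eq: "sq_norm \<nu> (\<lambda>g. ?F g - \<Phi> k g) = (\<integral>\<^sup>+t. ennreal ((cmod (?h t - of_real (\<theta> k t) * ?h t))\<^sup>2) \<partial>lborel)" for k
  proof -
    have "covariant G M (chm l) (\<lambda>g. 1 * ?F g + (- 1) * \<Phi> k g)" by (intro covariant_combine FD(2) \<Phi>cov)
    then have "M_inv (\<lambda>g. cmod (?F g - \<Phi> k g))" using covariant_M_inv by fastforce
    moreover have "(\<lambda>g. ?F g - \<Phi> k g) \<in> borel_measurable borel"
      by (intro borel_measurable_continuous_onI continuous_on_diff Fc \<Phi>c)
    ultimately show ?thesis by (subst sq_norm_line) (simp_all add: \<Phi>_def)
  qed
  have fin: "(\<integral>\<^sup>+t. ennreal ((cmod (?h t))\<^sup>2) \<partial>lborel) < \<infinity>"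
  proof -
    have "(\<integral>\<^sup>+t. ennreal ((cmod (?h t))\<^sup>2) \<partial>lborel) = sq_norm \<nu> ?F"
      by (rule sq_norm_line[symmetric, OF FD(1) covariant_M_inv[OF FD(2)]])
    also have "\<dots> \<le> q (U \<xi>)" by (rule q_component[OF l])
    also have "\<dots> < \<infinity>" using q_U[OF \<xi>] CC_L2[OF \<xi>] by (simp add: L2_iff)
    finally show ?thesis .
  qed
  have "(\<lambda>k. \<integral>\<^sup>+t. ennreal ((cmod (?h t - of_real (\<theta> k t) * ?h t))\<^sup>2) \<partial>lborel) \<longlonglongrightarrow> (\<integral>\<^sup>+t. 0 \<partial>(lborel :: real measure))"
  proof (rule nn_integral_dominated_convergence[where w = "\<lambda>t. ennreal ((cmod (?h t))\<^sup>2)"])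
    show "(\<lambda>t. ennreal ((cmod (?h t - of_real (\<theta> k t) * ?h t))\<^sup>2)) \<in> borel_measurable lborel" for k
    proof -
      have "continuous_on UNIV (\<theta> k)" unfolding \<theta>_def by (intro continuous_intros)
      then have [measurable]: "\<theta> k \<in> borel_measurable borel" by (rule borel_measurable_continuous_onI)
      show ?thesis by measurable
    qed
    show "AE t in lborel. ennreal ((cmod (?h t - of_real (\<theta> k t) * ?h t))\<^sup>2) \<le> ennreal ((cmod (?h t))\<^sup>2)" for k
    proof (intro AE_I2 ennreal_leI power_mono)
      fix t
      have "?h t - of_real (\<theta> k t) * ?h t = of_real (1 - \<theta> k t) * ?h t" by (simp add: algebra_simps)
      then have "cmod (?h t - of_real (\<theta> k t) * ?h t) = \<bar>1 - \<theta> k t\<bar> * cmod (?h t)"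
        by (simp only: norm_mult norm_of_real)
      also have "\<dots> \<le> 1 * cmod (?h t)" by (intro mult_right_mono) (auto simp: \<theta>_def)
      finally show "cmod (?h t - of_real (\<theta> k t) * ?h t) \<le> cmod (?h t)" by simp
    qed simp
    show "AE t in lborel. (\<lambda>k. ennreal ((cmod (?h t - of_real (\<theta> k t) * ?h t))\<^sup>2)) \<longlonglongrightarrow> 0"
    proof (rule AE_I2)
      fix t
      have "\<theta> k t = 1" if "k \<ge> nat \<lceil>\<bar>t\<bar>\<rceil>" for k
      proof -
        have "\<bar>t\<bar> \<le> real k" using that by linarith
        then show ?thesis by (simp add: \<theta>_def)
      qed
      then show "(\<lambda>k. ennreal ((cmod (?h t - of_real (\<theta> k t) * ?h t))\<^sup>2)) \<longlonglongrightarrow> 0"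
        by (intro tendsto_eventually eventually_sequentiallyI[of "nat \<lceil>\<bar>t\<bar>\<rceil>"]) simp
    qed
  qed (use fin in simp_all)
  then have "(\<lambda>k. sq_norm \<nu> (\<lambda>g. ?F g - \<Phi> k g)) \<longlonglongrightarrow> 0" by (simp add: eq)
  then have "\<forall>\<^sub>F k in sequentially. sq_norm \<nu> (\<lambda>g. ?F g - \<Phi> k g) < ennreal \<epsilon>"
    by (rule order_tendstoD(2)) (simp only: ennreal_less_zero_iff e)
  from eventually_happens'[OF sequentially_bot this]
  obtain k where "sq_norm \<nu> (\<lambda>g. ?F g - \<Phi> k g) < ennreal \<epsilon>" by (elim exE)
  then show ?thesis by (rule bexI[OF _ core])
qed

lemma ind_space_I:
  assumes "F \<in> borel_measurable borel" "covariant G M (chm l) F"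
    and ap: "\<And>\<epsilon>. \<epsilon> > 0 \<Longrightarrow> \<exists>\<Phi>\<in>ind_core G M (chm l). sq_norm \<nu> (\<lambda>g. F g - \<Phi> g) < ennreal \<epsilon>"
  shows "F \<in> ind_space G M (chm l) \<nu>"
proof -
  have "\<forall>k::nat. \<exists>\<Phi>. \<Phi> \<in> ind_core G M (chm l) \<and> sq_norm \<nu> (\<lambda>g. F g - \<Phi> g) < ennreal (1 / real (Suc k))"
    by (rule allI, rule ap[unfolded Bex_def]) (simp only: zero_less_divide_1_iff of_nat_0_less_iff zero_less_Suc)
  from choice[OF this] obtain \<Phi> :: "nat \<Rightarrow> 'g \<Rightarrow> complex" where
    \<Phi>: "\<And>k. \<Phi> k \<in> ind_core G M (chm l) \<and> sq_norm \<nu> (\<lambda>g. F g - \<Phi> k g) < ennreal (1 / real (Suc k))"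
    by blast
  have "(\<lambda>k. ennreal (1 / real (Suc k))) \<longlonglongrightarrow> ennreal 0"
    by (intro tendsto_ennrealI LIMSEQ_Suc lim_1_over_n)
  then have up: "(\<lambda>k. ennreal (1 / real (Suc k))) \<longlonglongrightarrow> 0" by (simp only: ennreal_0)
  have "(\<lambda>k. sq_norm \<nu> (\<lambda>g. F g - \<Phi> k g)) \<longlonglongrightarrow> 0"
    by (rule tendsto_zero_le[OF less_imp_le[OF conjunct2[OF \<Phi>]] up])
  then show ?thesis
    unfolding ind_space_def using assms(1,2) conjunct1[OF \<Phi>] by (auto intro!: exI[of _ \<Phi>])
qed

subsection \<open>Extension by continuity\<close>

text \<open>The image of \<open>f\<close> under the extended operator is determined up to families of norm zero; this
  relation says that \<open>K\<close> represents it.\<close>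

definition "limit_family f K \<longleftrightarrow> covariant_family K \<and> (\<exists>\<xi>. (\<forall>k::nat. \<xi> k \<in> CC) \<and>
  (\<lambda>k. sq_norm \<mu> (\<lambda>g. f g - \<xi> k g)) \<longlonglongrightarrow> 0 \<and> (\<lambda>k. q (\<lambda>l g. K l g - U (\<xi> k) l g)) \<longlonglongrightarrow> 0)"

lemma limit_family_I:
  "covariant_family K \<Longrightarrow> (\<And>k::nat. \<xi> k \<in> CC) \<Longrightarrow> (\<lambda>k. sq_norm \<mu> (\<lambda>g. f g - \<xi> k g)) \<longlonglongrightarrow> 0 \<Longrightarrow>
    (\<lambda>k. q (\<lambda>l g. K l g - U (\<xi> k) l g)) \<longlonglongrightarrow> 0 \<Longrightarrow> limit_family f K"
  unfolding limit_family_def by blast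

lemma L2_D: "f \<in> L2 \<Longrightarrow> GG.rinv f" "f \<in> L2 \<Longrightarrow> on_cosets f \<in> borel_measurable \<mu>" "f \<in> L2 \<Longrightarrow> sq_norm \<mu> f < \<infinity>"
  by (auto simp: L2_iff)

lemma on_cosets_combine: "on_cosets (\<lambda>g. a * f g + b * h g) = (\<lambda>c. a * on_cosets f c + b * on_cosets h c)"
  for f h :: "'g \<Rightarrow> complex"
  by (simp add: on_cosets_def fun_eq_iff)

lemma sq_norm_combine:
  assumes [measurable]: "on_cosets f \<in> borel_measurable \<mu>" "on_cosets h \<in> borel_measurable \<mu>"
  shows "sq_norm \<mu> (\<lambda>g. a * f g + b * h g)
    \<le> 2 * (ennreal ((cmod a)\<^sup>2) * sq_norm \<mu> f) + 2 * (ennreal ((cmod b)\<^sup>2) * sq_norm \<mu> h)"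
proof -
  have m: "on_cosets (\<lambda>g. a * f g) \<in> borel_measurable \<mu>" "on_cosets (\<lambda>g. b * h g) \<in> borel_measurable \<mu>"
    using on_cosets_combine[of a f 0 f] on_cosets_combine[of b h 0 h] by simp_all
  show ?thesis using sq_norm_add[OF m] by (simp add: sq_norm_cmult assms)
qed

lemma L2_combine:
  assumes f: "f \<in> L2" and h: "h \<in> L2"
  shows "(\<lambda>g. a * f g + b * h g) \<in> L2"
proof -
  note D = L2_D[OF f] L2_D[OF h]
  have "sq_norm \<mu> (\<lambda>g. a * f g + b * h g)
    \<le> 2 * (ennreal ((cmod a)\<^sup>2) * sq_norm \<mu> f) + 2 * (ennreal ((cmod b)\<^sup>2) * sq_norm \<mu> h)"
    by (rule sq_norm_combine[OF D(2,5)])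
  also have "\<dots> < \<infinity>" using D(3,6) by (simp add: ennreal_mult_less_top)
  finally have "sq_norm \<mu> (\<lambda>g. a * f g + b * h g) < \<infinity>" .
  moreover have "on_cosets (\<lambda>g. a * f g + b * h g) \<in> borel_measurable \<mu>"
    unfolding on_cosets_combine using D(2,5) by measurable
  moreover have "GG.rinv (\<lambda>g. a * f g + b * h g)" using D(1,4) by (simp add: GG.rinv_def)
  ultimately show ?thesis by (simp add: L2_iff)
qed

lemma sq_norm_diff:
  assumes "f \<in> L2" "h \<in> L2" "k \<in> L2"
  shows "sq_norm \<mu> (\<lambda>g. f g - k g) \<le> 2 * sq_norm \<mu> (\<lambda>g. f g - h g) + 2 * sq_norm \<mu> (\<lambda>g. h g - k g)"
proof -
  have m: "on_cosets (\<lambda>g. f g - h g) \<in> borel_measurable \<mu>" "on_cosets (\<lambda>g. h g - k g) \<in> borel_measurable \<mu>"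
    using L2_D(2)[OF L2_combine[OF assms(1,2), of 1 "- 1"]] L2_D(2)[OF L2_combine[OF assms(2,3), of 1 "- 1"]] by simp_all
  show ?thesis using sq_norm_add[OF m] by simp
qed

lemma sq_norm_swap: "sq_norm \<mu> (\<lambda>g. f g - h g) = sq_norm \<mu> (\<lambda>g. h g - f g)"
  by (simp add: sq_norm_def norm_minus_commute)

text \<open>Both families are compared through the images of the approximating continuous functions,
  where the operator is isometric. The constant 16 is four successive factors 2. Taking f = h gives
  uniqueness of the limit family, and taking h = 0 gives its boundedness.\<close>

lemma limit_family_compare:
  assumes f: "f \<in> L2" and h: "h \<in> L2" and K: "limit_family f K" and K': "limit_family h K'"
  shows "q (\<lambda>l g. K l g - K' l g) \<le> 16 * sq_norm \<mu> (\<lambda>g. f g - h g)"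
proof -
  obtain \<xi> where g: "covariant_family K" and \<xi>: "\<And>k::nat. \<xi> k \<in> CC" "(\<lambda>k. sq_norm \<mu> (\<lambda>g. f g - \<xi> k g)) \<longlonglongrightarrow> 0"
      "(\<lambda>k. q (\<lambda>l g. K l g - U (\<xi> k) l g)) \<longlonglongrightarrow> 0" using K unfolding limit_family_def by blast
  obtain \<eta> where g': "covariant_family K'" and \<eta>: "\<And>k::nat. \<eta> k \<in> CC" "(\<lambda>k. sq_norm \<mu> (\<lambda>g. h g - \<eta> k g)) \<longlonglongrightarrow> 0"
      "(\<lambda>k. q (\<lambda>l g. K' l g - U (\<eta> k) l g)) \<longlonglongrightarrow> 0" using K' unfolding limit_family_def by blast
  let ?A = "\<lambda>k. q (\<lambda>l g. K l g - U (\<xi> k) l g)" and ?B = "\<lambda>k. q (\<lambda>l g. K' l g - U (\<eta> k) l g)"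
  let ?a = "\<lambda>k. sq_norm \<mu> (\<lambda>g. f g - \<xi> k g)" and ?b = "\<lambda>k. sq_norm \<mu> (\<lambda>g. h g - \<eta> k g)"
  let ?s = "sq_norm \<mu> (\<lambda>g. f g - h g)"
  have bound: "q (\<lambda>l g. K l g - K' l g) \<le> 2 * ?A k + 2 * (2 * (2 * ?a k + 2 * (2 * ?s + 2 * ?b k)) + 2 * ?B k)" for k
  proof -
    note gU = covariant_family_U[OF \<xi>(1)[of k]] covariant_family_U[OF \<eta>(1)[of k]]
    have "q (\<lambda>l g. K l g - K' l g) = q (\<lambda>l g. (K l g - U (\<xi> k) l g) - (K' l g - U (\<xi> k) l g))" by simp
    also have "\<dots> \<le> 2 * ?A k + 2 * q (\<lambda>l g. K' l g - U (\<xi> k) l g)"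
      by (intro q_diff covariant_family_diff g g' gU)
    also have "q (\<lambda>l g. K' l g - U (\<xi> k) l g) = q (\<lambda>l g. (U (\<eta> k) l g - U (\<xi> k) l g) + (K' l g - U (\<eta> k) l g))" by simp
    also have "\<dots> \<le> 2 * q (\<lambda>l g. U (\<eta> k) l g - U (\<xi> k) l g) + 2 * ?B k"
      by (intro q_add covariant_family_diff g g' gU)
    also have "q (\<lambda>l g. U (\<eta> k) l g - U (\<xi> k) l g) = sq_norm \<mu> (\<lambda>g. \<xi> k g - \<eta> k g)"
      unfolding q_U_diff[OF \<eta>(1) \<xi>(1)] by (rule sq_norm_swap)
    also have "\<dots> \<le> 2 * sq_norm \<mu> (\<lambda>g. \<xi> k g - f g) + 2 * sq_norm \<mu> (\<lambda>g. f g - \<eta> k g)"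
      by (intro sq_norm_diff CC_L2 \<xi> \<eta> f)
    also have "sq_norm \<mu> (\<lambda>g. \<xi> k g - f g) = ?a k" by (rule sq_norm_swap)
    also have "sq_norm \<mu> (\<lambda>g. f g - \<eta> k g) \<le> 2 * ?s + 2 * ?b k"
      by (intro sq_norm_diff CC_L2 \<eta> f h)
    finally show ?thesis by (simp add: add_mono mult_left_mono)
  qed
  have "(\<lambda>k. 2 * ?A k + 2 * (2 * (2 * ?a k + 2 * (2 * ?s + 2 * ?b k)) + 2 * ?B k))
    \<longlonglongrightarrow> 2 * 0 + 2 * (2 * (2 * 0 + 2 * (2 * ?s + 2 * 0)) + 2 * 0)"
    by (intro tendsto_add ennreal_tendsto_cmult \<xi> \<eta> tendsto_const) simp_all
  then have "q (\<lambda>l g. K l g - K' l g) \<le> 2 * 0 + 2 * (2 * (2 * 0 + 2 * (2 * ?s + 2 * 0)) + 2 * 0)"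
    by (rule LIMSEQ_le_const) (use bound in blast)
  then show ?thesis by (simp add: mult.assoc[symmetric])
qed

lemma q_zero [simp]: "q (\<lambda>l g. 0) = 0"
  by (simp add: q_def rho_sq_norm_def sq_norm_def on_cosets_def)

lemma sq_norm_zero [simp]: "sq_norm \<mu> (\<lambda>g. 0) = 0"
  by (simp add: sq_norm_def on_cosets_def)

lemma limit_family_unique: "f \<in> L2 \<Longrightarrow> limit_family f K \<Longrightarrow> limit_family f K' \<Longrightarrow> q (\<lambda>l g. K l g - K' l g) = 0"
  using limit_family_compare[of f f K K'] by simp

lemma limit_family_U: "\<xi> \<in> CC \<Longrightarrow> limit_family \<xi> (U \<xi>)"
  unfolding limit_family_def by (intro conjI covariant_family_U exI[of _ "\<lambda>_. \<xi>"]) (simp_all only: diff_self simp_thms q_zero sq_norm_zero tendsto_const)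

lemma limit_family_bounded:
  assumes f: "f \<in> L2" and K: "limit_family f K"
  shows "q K \<le> 16 * sq_norm \<mu> f"
proof -
  have z: "(\<lambda>g. 0) \<in> CC" by (simp add: CC_iff GG.rinv_def)
  have U0: "U (\<lambda>g. 0) l g = 0" for l g by (simp add: U_def Uh_def Uv_def on_cosets_def)
  show ?thesis using limit_family_compare[OF f CC_L2[OF z] K limit_family_U[OF z]] by (simp add: U0)
qed

text \<open>The same combination of the approximating sequences works, because the operator is
  exactly linear on continuous functions.\<close>

lemma limit_family_combine:
  assumes f: "f \<in> L2" and h: "h \<in> L2" and K: "limit_family f K" and K': "limit_family h K'"
  shows "limit_family (\<lambda>x. a * f x + b * h x) (\<lambda>l g. a * K l g + b * K' l g)"
proof -
  obtain \<xi> where g: "covariant_family K" and \<xi>: "\<And>k::nat. \<xi> k \<in> CC" "(\<lambda>k. sq_norm \<mu> (\<lambda>g. f g - \<xi> k g)) \<longlonglongrightarrow> 0"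
      "(\<lambda>k. q (\<lambda>l g. K l g - U (\<xi> k) l g)) \<longlonglongrightarrow> 0" using K unfolding limit_family_def by blast
  obtain \<eta> where g': "covariant_family K'" and \<eta>: "\<And>k::nat. \<eta> k \<in> CC" "(\<lambda>k. sq_norm \<mu> (\<lambda>g. h g - \<eta> k g)) \<longlonglongrightarrow> 0"
      "(\<lambda>k. q (\<lambda>l g. K' l g - U (\<eta> k) l g)) \<longlonglongrightarrow> 0" using K' unfolding limit_family_def by blast
  define \<zeta> where "\<zeta> k x = a * \<xi> k x + b * \<eta> k x" for k x
  have \<zeta>: "\<zeta> k \<in> CC" for k unfolding \<zeta>_def by (intro CC_combine \<xi> \<eta>)
  let ?a = "ennreal ((cmod a)\<^sup>2)" and ?b = "ennreal ((cmod b)\<^sup>2)"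
  have lim: "(\<lambda>k. 2 * (?a * u k) + 2 * (?b * v k)) \<longlonglongrightarrow> 0" if "u \<longlonglongrightarrow> 0" "v \<longlonglongrightarrow> 0" for u v :: "nat \<Rightarrow> ennreal"
  proof -
    have "(\<lambda>k. 2 * (?a * u k) + 2 * (?b * v k)) \<longlonglongrightarrow> 2 * (?a * 0) + 2 * (?b * 0)"
      by (intro tendsto_add ennreal_tendsto_cmult that) simp_all
    then show ?thesis by simp
  qed
  have m: "on_cosets (\<lambda>g. f g - \<xi> k g) \<in> borel_measurable \<mu>" "on_cosets (\<lambda>g. h g - \<eta> k g) \<in> borel_measurable \<mu>" for k
    using L2_D(2)[OF L2_combine[OF f CC_L2[OF \<xi>(1)], of 1 "- 1"]] L2_D(2)[OF L2_combine[OF h CC_L2[OF \<eta>(1)], of 1 "- 1"]]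
    by simp_all
  have 1: "sq_norm \<mu> (\<lambda>x. a * f x + b * h x - \<zeta> k x)
      \<le> 2 * (?a * sq_norm \<mu> (\<lambda>g. f g - \<xi> k g)) + 2 * (?b * sq_norm \<mu> (\<lambda>g. h g - \<eta> k g))" for k
  proof -
    have "(\<lambda>x. a * f x + b * h x - \<zeta> k x) = (\<lambda>x. a * (f x - \<xi> k x) + b * (h x - \<eta> k x))"
      by (simp add: \<zeta>_def algebra_simps)
    then show ?thesis by (simp only: sq_norm_combine[OF m])
  qed
  have 2: "q (\<lambda>l g. a * K l g + b * K' l g - U (\<zeta> k) l g)
      \<le> 2 * (?a * q (\<lambda>l g. K l g - U (\<xi> k) l g)) + 2 * (?b * q (\<lambda>l g. K' l g - U (\<eta> k) l g))" for k
  proof -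
    have gd: "covariant_family (\<lambda>l g. K l g - U (\<xi> k) l g)" "covariant_family (\<lambda>l g. K' l g - U (\<eta> k) l g)"
      by (intro covariant_family_diff g g' covariant_family_U \<xi> \<eta>)+
    have "q (\<lambda>l g. a * K l g + b * K' l g - U (\<zeta> k) l g)
        = q (\<lambda>l g. a * (K l g - U (\<xi> k) l g) + b * (K' l g - U (\<eta> k) l g))"
      unfolding \<zeta>_def by (rule q_cong) (simp only: U_linear[OF \<xi>(1) \<eta>(1)], simp add: algebra_simps)
    also have "\<dots> \<le> 2 * q (\<lambda>l g. a * (K l g - U (\<xi> k) l g)) + 2 * q (\<lambda>l g. b * (K' l g - U (\<eta> k) l g))"
      by (intro q_add covariant_family_cmult gd)
    finally show ?thesis by (simp only: q_cmult[OF gd(1)] q_cmult[OF gd(2)])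
  qed
  have "(\<lambda>k. sq_norm \<mu> (\<lambda>x. a * f x + b * h x - \<zeta> k x)) \<longlonglongrightarrow> 0"
    by (rule tendsto_zero_le[OF 1 lim[OF \<xi>(2) \<eta>(2)]])
  moreover have "(\<lambda>k. q (\<lambda>l g. a * K l g + b * K' l g - U (\<zeta> k) l g)) \<longlonglongrightarrow> 0"
    by (rule tendsto_zero_le[OF 2 lim[OF \<xi>(3) \<eta>(3)]])
  ultimately show ?thesis by (rule limit_family_I[OF covariant_family_combine[OF g g'] \<zeta>])
qed

text \<open>Translating the approximating sequence preserves all distances involved, on G / \<Gamma>
  and on the target side; on continuous functions the operator commutes with translation
  exactly.\<close>

lemma limit_family_translate:
  assumes f: "f \<in> L2" and K: "limit_family f K"
  shows "limit_family (\<lambda>x. f (a \<otimes> x)) (\<lambda>l g. K l (a \<otimes> g))"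
proof -
  obtain \<xi> where g: "covariant_family K" and \<xi>: "\<And>k::nat. \<xi> k \<in> CC" "(\<lambda>k. sq_norm \<mu> (\<lambda>g. f g - \<xi> k g)) \<longlonglongrightarrow> 0"
      "(\<lambda>k. q (\<lambda>l g. K l g - U (\<xi> k) l g)) \<longlonglongrightarrow> 0" using K unfolding limit_family_def by blast
  have L: "(\<lambda>g. f g - \<xi> k g) \<in> L2" for k using L2_combine[OF f CC_L2[OF \<xi>(1)], of 1 "- 1" k] by simp
  have 1: "sq_norm \<mu> (\<lambda>x. f (a \<otimes> x) - \<xi> k (a \<otimes> x)) = sq_norm \<mu> (\<lambda>g. f g - \<xi> k g)" for k
    by (rule sq_norm_translate[OF L2_D(2,1)[OF L]])
  have 2: "q (\<lambda>l g. K l (a \<otimes> g) - U (\<lambda>x. \<xi> k (a \<otimes> x)) l g) = q (\<lambda>l g. K l g - U (\<xi> k) l g)" for k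
    unfolding U_translate by (rule q_translate[OF covariant_family_diff[OF g covariant_family_U[OF \<xi>(1)]]])
  show ?thesis
    by (rule limit_family_I[of _ "\<lambda>k x. \<xi> k (a \<otimes> x)", OF covariant_family_translate[OF g] CC_translate[OF \<xi>(1)]])
      (simp_all only: 1 2 \<xi>)
qed

lemma limit_family_exists:
  assumes f: "f \<in> L2"
  shows "\<exists>K. limit_family f K"
proof -
  \<comment> \<open>The rate 16^-k is the one demanded by the almost everywhere convergence of the
    images.\<close>
  have ex: "\<exists>\<xi>. \<xi> \<in> CC \<and> sq_norm \<mu> (\<lambda>g. f g - \<xi> g) < ennreal ((1 / 16) ^ k)" for k :: nat
    by (rule CC_dense[OF f, unfolded Bex_def]) simp
  from choice[OF allI[OF ex]] obtain \<xi>
    where "\<forall>k::nat. \<xi> k \<in> CC \<and> sq_norm \<mu> (\<lambda>g. f g - \<xi> k g) < ennreal ((1 / 16) ^ k)" by (rule exE)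
  then have \<xi>: "\<And>k. \<xi> k \<in> CC" and b: "\<And>k. sq_norm \<mu> (\<lambda>g. f g - \<xi> k g) < ennreal ((1 / 16) ^ k)"
    by simp_all
  have d: "q (\<lambda>l g. U (\<xi> j) l g - U (\<xi> k) l g) \<le> ennreal (4 * (1 / 16) ^ k)" if kj: "k \<le> j" for j k
  proof -
    have "q (\<lambda>l g. U (\<xi> j) l g - U (\<xi> k) l g) = sq_norm \<mu> (\<lambda>g. \<xi> j g - \<xi> k g)" by (rule q_U_diff[OF \<xi> \<xi>])
    also have "\<dots> \<le> 2 * sq_norm \<mu> (\<lambda>g. \<xi> j g - f g) + 2 * sq_norm \<mu> (\<lambda>g. f g - \<xi> k g)"
      by (intro sq_norm_diff CC_L2 \<xi> f)
    also have "sq_norm \<mu> (\<lambda>g. \<xi> j g - f g) = sq_norm \<mu> (\<lambda>g. f g - \<xi> j g)" by (rule sq_norm_swap)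
    also have "2 * sq_norm \<mu> (\<lambda>g. f g - \<xi> j g) + 2 * sq_norm \<mu> (\<lambda>g. f g - \<xi> k g)
       \<le> 2 * ennreal ((1 / 16) ^ k) + 2 * ennreal ((1 / 16) ^ k)"
    proof (intro add_mono mult_left_mono less_imp_le[OF b])
      have "sq_norm \<mu> (\<lambda>g. f g - \<xi> j g) \<le> ennreal ((1 / 16) ^ j)" by (rule less_imp_le[OF b])
      also have "\<dots> \<le> ennreal ((1 / 16) ^ k)" by (intro ennreal_leI power_decreasing kj) simp_all
      finally show "sq_norm \<mu> (\<lambda>g. f g - \<xi> j g) \<le> ennreal ((1 / 16) ^ k)" .
    qed simp_all
    also have "\<dots> = ennreal (4 * (1 / 16) ^ k)" using ennreal_half_sum[of "4 * (1 / 16) ^ k"] by simp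
    finally show ?thesis .
  qed
  define K where "K l g = limf (\<lambda>j. U (\<xi> j) l g)" for l g
  have gK: "covariant_family K" unfolding K_def by (intro covariant_family_limf covariant_family_U \<xi>)
  have gd: "covariant_family (\<lambda>l g. U (\<xi> j) l g - U (\<xi> k) l g)" for j k by (intro covariant_family_diff covariant_family_U \<xi>)
  \<comment> \<open>Each half of the norm is bounded by the whole, so the limit estimate is applied
    to both halves separately and the bound appears twice.\<close>
  have lim: "q (\<lambda>l g. K l g - U (\<xi> k) l g) \<le> ennreal (4 * (1 / 16) ^ k) + ennreal (4 * (1 / 16) ^ k)" for k
    unfolding q_eq[OF covariant_family_diff[OF gK covariant_family_U[OF \<xi>]]]
  proof (intro add_mono)
    show "(\<Sum>\<^sub>\<infinity>l\<in>\<Sigma>. \<integral>\<^sup>+t. ennreal ((cmod (K l (E (t *\<^sub>R X n)) - U (\<xi> k) l (E (t *\<^sub>R X n))))\<^sup>2) \<partial>lborel) \<le> ennreal (4 * (1 / 16) ^ k)"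
      unfolding K_def
    proof (rule L2_limit[OF countable_\<Sigma>])
      show "(\<Sum>\<^sub>\<infinity>l\<in>\<Sigma>. \<integral>\<^sup>+t. ennreal ((cmod (U (\<xi> j) l (E (t *\<^sub>R X n)) - U (\<xi> k) l (E (t *\<^sub>R X n))))\<^sup>2) \<partial>lborel) \<le> ennreal (4 * (1 / 16) ^ k)"
        if "k \<le> j" for j k
        using d[OF that] unfolding q_eq[OF gd] by (rule order_trans[rotated]) simp
    qed (auto intro: covariant_family_measurable[simplified] covariant_family_U \<xi>)
    show "(\<Sum>\<^sub>\<infinity>l\<in>V. \<integral>\<^sup>+x. ennreal ((cmod (K l \<one> - U (\<xi> k) l \<one>))\<^sup>2) \<partial>count_space {()}) \<le> ennreal (4 * (1 / 16) ^ k)"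
      unfolding K_def
    proof (rule L2_limit[OF countable_V])
      show "(\<Sum>\<^sub>\<infinity>l\<in>V. \<integral>\<^sup>+x. ennreal ((cmod (U (\<xi> j) l \<one> - U (\<xi> k) l \<one>))\<^sup>2) \<partial>count_space {()}) \<le> ennreal (4 * (1 / 16) ^ k)"
        if "k \<le> j" for j k
        using d[OF that] unfolding q_eq[OF gd] by (rule order_trans[rotated]) simp
    qed simp_all
  qed
  have p16: "(\<lambda>k. (1 / 16 :: real) ^ k) \<longlonglongrightarrow> 0" by (rule LIMSEQ_power_zero) simp
  have "(\<lambda>k. sq_norm \<mu> (\<lambda>g. f g - \<xi> k g)) \<longlonglongrightarrow> 0"
  proof (rule tendsto_zero_le[OF less_imp_le[OF b]])
    show "(\<lambda>k. ennreal ((1 / 16) ^ k)) \<longlonglongrightarrow> 0" using tendsto_ennrealI[OF p16] by (simp only: ennreal_0)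
  qed
  moreover have "(\<lambda>k. q (\<lambda>l g. K l g - U (\<xi> k) l g)) \<longlonglongrightarrow> 0"
  proof (rule tendsto_zero_le[OF lim])
    have 4: "(\<lambda>k. ennreal (4 * (1 / 16) ^ k)) \<longlonglongrightarrow> ennreal (4 * 0)" by (intro tendsto_ennrealI tendsto_mult_left p16)
    show "(\<lambda>k. ennreal (4 * (1 / 16) ^ k) + ennreal (4 * (1 / 16) ^ k)) \<longlonglongrightarrow> 0"
      using tendsto_add[OF 4 4] by (simp only: ennreal_0 mult_zero_right add_0)
  qed
  ultimately show ?thesis by (intro exI[of _ K] limit_family_I[OF gK \<xi>])
qed

text \<open>Each component over \<Sigma> is close to the image of a continuous function, which in
  turn is close to a function with compact support modulo M; the two errors of \<epsilon>/4 add up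
  to \<epsilon>.\<close>

lemma limit_family_rho_space:
  assumes f: "f \<in> L2" and K: "limit_family f K"
  shows "K \<in> rho_space G expo M \<nu> \<Sigma> V"
proof -
  obtain \<xi> where g: "covariant_family K" and \<xi>: "\<And>k::nat. \<xi> k \<in> CC" "(\<lambda>k. q (\<lambda>l g. K l g - U (\<xi> k) l g)) \<longlonglongrightarrow> 0"
    using K unfolding limit_family_def by blast
  have "K l \<in> ind_space G M (chm l) \<nu>" if l: "l \<in> \<Sigma>" for l
  proof (rule ind_space_I[OF covariant_family_D(1)[OF g l] covariant_family_D(2)[OF g l]])
    fix \<epsilon> :: real assume e: "\<epsilon> > 0"
    then have e4: "\<epsilon> / 4 > 0" by simp
    then have "\<forall>\<^sub>F k in sequentially. q (\<lambda>l g. K l g - U (\<xi> k) l g) < ennreal (\<epsilon> / 4)"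
      by (intro order_tendstoD(2)[OF \<xi>(2)]) (simp only: ennreal_less_zero_iff)
    from eventually_happens'[OF sequentially_bot this]
    obtain k where k: "q (\<lambda>l g. K l g - U (\<xi> k) l g) < ennreal (\<epsilon> / 4)" by (elim exE)
    from ind_core_dense[OF \<xi>(1)[of k] l e4] obtain \<Phi>
      where \<Phi>: "\<Phi> \<in> ind_core G M (chm l)" "sq_norm \<nu> (\<lambda>g. U (\<xi> k) l g - \<Phi> g) < ennreal (\<epsilon> / 4)"
      by (elim bexE)
    have \<Phi>D: "\<Phi> \<in> borel_measurable borel" "covariant G M (chm l) \<Phi>"
      using \<Phi>(1) unfolding ind_core_def by (simp_all add: borel_measurable_continuous_onI)
    note UD = covariant_family_D(1,2)[OF covariant_family_U[OF \<xi>(1)] l, of k]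
    note KD = covariant_family_D(1,2)[OF g l]
    have a: "(\<lambda>g. K l g - U (\<xi> k) l g) \<in> borel_measurable borel" "(\<lambda>g. U (\<xi> k) l g - \<Phi> g) \<in> borel_measurable borel"
      using UD(1) KD(1) \<Phi>D(1) by simp_all
    have cv: "covariant G M (chm l) (\<lambda>g. F g - F' g)" if "covariant G M (chm l) F" "covariant G M (chm l) F'" for F F'
      using covariant_combine[OF that, of 1 "- 1"] by simp
    have s: "sq_norm \<nu> (\<lambda>g. F g - F' g) = (\<integral>\<^sup>+t. ennreal ((cmod (F (E (t *\<^sub>R X n)) - F' (E (t *\<^sub>R X n))))\<^sup>2) \<partial>lborel)"
      if "F \<in> borel_measurable borel" "F' \<in> borel_measurable borel" "covariant G M (chm l) F" "covariant G M (chm l) F'" for F F'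
      by (rule sq_norm_line[OF borel_measurable_diff[OF that(1,2)] covariant_M_inv[OF cv[OF that(3,4)]]])
    have mE: "(\<lambda>t. F (E (t *\<^sub>R X n))) \<in> borel_measurable lborel" if "F \<in> borel_measurable borel" for F :: "'g \<Rightarrow> complex"
      using measurable_compose[OF measurable_EX that] by simp
    have "sq_norm \<nu> (\<lambda>g. K l g - \<Phi> g) \<le> 2 * sq_norm \<nu> (\<lambda>g. K l g - U (\<xi> k) l g) + 2 * sq_norm \<nu> (\<lambda>g. U (\<xi> k) l g - \<Phi> g)"
      using nn_integral_sq_add[OF mE[OF a(1)] mE[OF a(2)]]
      by (simp add: s UD KD \<Phi>D)
    also have "\<dots> \<le> 2 * q (\<lambda>l g. K l g - U (\<xi> k) l g) + 2 * sq_norm \<nu> (\<lambda>g. U (\<xi> k) l g - \<Phi> g)"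
      by (intro add_mono mult_left_mono q_component[OF l, of "\<lambda>l g. K l g - U (\<xi> k) l g"]) simp_all
    also have "\<dots> < 2 * ennreal (\<epsilon> / 4) + 2 * ennreal (\<epsilon> / 4)"
      using k \<Phi>(2) by (intro add_strict_mono ennreal_mult_strict_left_mono) simp_all
    also have "\<dots> = ennreal \<epsilon>" by (rule ennreal_half_sum[OF e])
    finally show "\<exists>\<Phi>\<in>ind_core G M (chm l). sq_norm \<nu> (\<lambda>g. K l g - \<Phi> g) < ennreal \<epsilon>" by (rule bexI[OF _ \<Phi>(1)])
  qed
  moreover have "q K < \<infinity>"
    using order_le_less_trans[OF limit_family_bounded[OF f K], of \<infinity>] L2_D(3)[OF f] by (simp add: ennreal_mult_less_top)
  ultimately show ?thesis
    unfolding rho_space_def q_def[symmetric] char_space_def using covariant_family_D(3)[OF g] by simp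
qed

lemma extension:
  "\<exists>T. intertwining_operator G expo \<Gamma> M \<mu> \<nu> \<Sigma> V T \<and> (\<forall>\<xi>\<in>CC. T \<xi> = U \<xi>)"
proof -
  \<comment> \<open>Using the integral formula itself on continuous functions makes \<open>T\<close>
    a literal extension. Elsewhere any representative will do, since two of them differ by a family
    of norm zero.\<close>
  define T where "T f = (if f \<in> CC then U f else SOME K. limit_family f K)" for f
  have T: "limit_family f (T f)" if "f \<in> L2" for f
    unfolding T_def using limit_family_U[of f] someI_ex[OF limit_family_exists[OF that]] by simp
  have "intertwining_operator G expo \<Gamma> M \<mu> \<nu> \<Sigma> V T"
    unfolding intertwining_operator_def q_def[symmetric]
  proof (intro conjI ballI allI)
    fix f assume f: "f \<in> L2"
    show "T f \<in> rho_space G expo M \<nu> \<Sigma> V" by (rule limit_family_rho_space[OF f T[OF f]])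
  next
    fix f h a b assume f: "f \<in> L2" and h: "h \<in> L2"
    show "q (\<lambda>l g. T (\<lambda>x. a * f x + b * h x) l g - (a * T f l g + b * T h l g)) = 0"
      using L2_combine[OF f h] by (intro limit_family_unique[OF _ T limit_family_combine[OF f h T[OF f] T[OF h]]])
  next
    show "\<exists>B::real. \<forall>f\<in>L2. q (T f) \<le> ennreal B * sq_norm \<mu> f"
      using limit_family_bounded[OF _ T] by (intro exI[of _ 16]) simp
  next
    fix a f assume f: "f \<in> L2"
    show "q (\<lambda>l g. T (left_translate G a f) l g - left_translate G a (T f l) g) = 0"
      unfolding left_translate_def
      using L2_translate[OF f] by (intro limit_family_unique[OF _ T limit_family_translate[OF f T[OF f]]])
  qed
  then show ?thesis by (intro exI[of _ T]) (simp add: T_def)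
qed

end

theorem theorem4:
  fixes G :: "'g::{t2_space,second_countable_topology} monoid"
    and \<A> :: "('g, 'a::euclidean_space) chart set"
    and \<kappa> :: "('g, 'a) chart"
    and expo :: "'a \<Rightarrow> 'g"
    and \<Gamma> M :: "'g set"
    and \<mm> :: "'a set"
    and X :: "nat \<Rightarrow> 'a"
    and n p :: nat
    and \<V> \<W> \<Sigma> :: "('a \<Rightarrow> real) set"
    and \<mu> \<mu>M \<nu> :: "'g set measure"
  assumes "one_parameter_metabelian_nilpotent G \<A> \<kappa>"
    and "n = DIM('a)"
    and "exponential_map G \<kappa> expo"
    and "uniform_subgroup G \<Gamma>"
    and "codim_one_abelian_ideal (lie_bracket G \<kappa>) \<mm>"
    and "rational_subspace expo \<Gamma> \<mm>"
    and "M = expo ` \<mm>"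
    and "strong_malcev_basis (lie_bracket G \<kappa>) X"
    and "strongly_based_on G expo X \<Gamma>"
    and "p \<le> n"
    and "derived_algebra (lie_bracket G \<kappa>) = span (X ` {1..p})"
    and "\<mm> = span (X ` {1..n - 1})"
    and "\<V> = V_lattice X p"
    and "\<W> = W_lattice (lie_bracket G \<kappa>) X"
    and "cross_section \<Gamma> (coAd0 G \<kappa> X) \<W> \<Sigma>"
    and "invariant_probability G \<Gamma> \<mu>"
    and "invariant_probability (G\<lparr>carrier := M\<rparr>) (M \<inter> \<Gamma>) \<mu>M"
    and "\<nu> = line_measure G expo M (X n)"
  shows "(\<forall>\<xi>\<in>cont_coset_functions G \<Gamma>. \<forall>\<eta>\<in>cont_coset_functions G \<Gamma>. \<forall>a b. \<forall>l\<in>\<Sigma> \<union> \<V>. \<forall>g.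
            U_op G expo \<mu>M \<mu> \<Sigma> \<V> (\<lambda>x. a * \<xi> x + b * \<eta> x) l g
              = a * U_op G expo \<mu>M \<mu> \<Sigma> \<V> \<xi> l g + b * U_op G expo \<mu>M \<mu> \<Sigma> \<V> \<eta> l g) \<and>
         (\<forall>\<xi>\<in>cont_coset_functions G \<Gamma>.
            U_op G expo \<mu>M \<mu> \<Sigma> \<V> \<xi> \<in> rho_space G expo M \<nu> \<Sigma> \<V> \<and>
            rho_sq_norm G \<nu> \<Sigma> \<V> (U_op G expo \<mu>M \<mu> \<Sigma> \<V> \<xi>) = sq_norm \<mu> \<xi>) \<and>
         (\<exists>T. intertwining_operator G expo \<Gamma> M \<mu> \<nu> \<Sigma> \<V> T \<and>
            (\<forall>\<xi>\<in>cont_coset_functions G \<Gamma>. \<forall>l\<in>\<Sigma> \<union> \<V>. T \<xi> l = U_op G expo \<mu>M \<mu> \<Sigma> \<V> \<xi> l))"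
  proof -
  note G = assms(1)[unfolded one_parameter_metabelian_nilpotent_def]
  interpret plancherel G \<A> \<kappa> expo \<mm> X n \<Gamma> M p \<mu> \<mu>M \<Sigma>
  proof unfold_locales
    show "lie_group G \<A>" "identity_chart G \<A> \<kappa>" "connected (UNIV :: 'g set)"
      "simply_connected (UNIV :: 'g set)" "nilpotent_algebra (lie_bracket G \<kappa>)"
      using G by blast+
    show "cross_section \<Gamma> (coAd0 G \<kappa> X) (W_lattice (lie_bracket G \<kappa>) X) \<Sigma>"
      using assms(15) unfolding assms(14) .
  qed (rule assms)+
  show ?thesis
    unfolding assms(13) U_op_eq
  proof (intro conjI ballI allI)
    show "U (\<lambda>x. a * \<xi> x + b * \<eta> x) l g = a * U \<xi> l g + b * U \<eta> l g"
      if "\<xi> \<in> CC" "\<eta> \<in> CC" "l \<in> \<Sigma> \<union> V" for \<xi> \<eta> a b l g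
      using that by (rule U_linear)
    show "U \<xi> \<in> rho_space G expo M \<nu> \<Sigma> V" if "\<xi> \<in> CC" for \<xi>
      unfolding assms(18) by (rule limit_family_rho_space[OF CC_L2[OF that] limit_family_U[OF that]])
    show "rho_sq_norm G \<nu> \<Sigma> V (U \<xi>) = sq_norm \<mu> \<xi>" if "\<xi> \<in> CC" for \<xi>
      using q_U[OF that] unfolding assms(18) q_def .
    show "\<exists>T. intertwining_operator G expo \<Gamma> M \<mu> \<nu> \<Sigma> V T \<and> (\<forall>\<xi>\<in>CC. \<forall>l\<in>\<Sigma> \<union> V. T \<xi> l = U \<xi> l)"
      unfolding assms(18)
    proof -
      obtain T where "intertwining_operator G expo \<Gamma> M \<mu> (line_measure G expo M (X n)) \<Sigma> V T" "\<forall>\<xi>\<in>CC. T \<xi> = U \<xi>"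
        using extension by (elim exE conjE)
      then show "\<exists>T. intertwining_operator G expo \<Gamma> M \<mu> (line_measure G expo M (X n)) \<Sigma> V T \<and>
          (\<forall>\<xi>\<in>CC. \<forall>l\<in>\<Sigma> \<union> V. T \<xi> l = U \<xi> l)"
        by (intro exI[of _ T] conjI) simp_all
    qed
  qed
qed


end
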